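(* Let $\Sigma^2$ be a convex region in the $(\varphi^1,\varphi^2)$-plane $\mathbb{R}^2$ with a Riemannian metric $g_\Sigma$ such that $(\Sigma^2,g_\Sigma)$ is a geodesically complete 2-manifold. Assume that $(\Sigma^2,g_\Sigma)$ satisfies conditions (B), (C), (D), (E) listed in the context ($\Sigma^2$ is not assumed to be a polygon or to be closed in the plane), and that $\triangle_\Sigma\sqrt{\mathcal{V}}\le 0$, where $\mathcal{V}=|\nabla\varphi^1|^2|\nabla\varphi^2|^2-\langle\nabla\varphi^1,\nabla\varphi^2\rangle^2$. Then the metric $g_\Sigma$ is flat.
   Context: $\varphi^1,\varphi^2$ denote the two standard coordinate functions of $\mathbb{R}^2$, restricted to $\Sigma^2$; $\nabla$, $\langle\cdot,\cdot\rangle$, $|\cdot|$ and $\triangle_\Sigma$ (the Laplace--Beltrami operator $\mathrm{div}\,\nabla$) are those of $g_\Sigma$. Geodesically complete means every geodesic extends for all time (so the 2-manifold has no boundary points and the conditions concerning boundary segments and corners are then vacuous). The conditions are: (B) The boundary $\partial\Sigma^2$ (the part of the boundary included in $\Sigma^2$) has one component or no components. (C) The metric $g_\Sigma$ is positive definite, $C^\infty$ up to boundary segments, and Lipschitz at corners. (D) The unit fields $\nabla\varphi^i/|\nabla\varphi^i|$ are smooth except at corner points, Lipschitz at corner points, and covariant-constant along boundary segments (in particular boundary segments are totally geodesic). (E) The distribution $\mathrm{span}\{\nabla\varphi^1,\nabla\varphi^2\}$ is 2-dimensional on the interior of $\Sigma^2$, 1-dimensional on boundary segments, and 0-dimensional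 on boundary vertices; also $[\nabla\varphi^1,\nabla\varphi^2]=0$. *)

theory Defs
  imports "HOL-Analysis.Analysis"
begin

text \<open>
  The surface is an open convex subset S of the plane with the coordinates of the plane as a
  global chart, and a metric is the matrix field of its components g_ij in this chart.
  All notions of differential geometry below are the usual coordinate expressions. They are
  meant for open S only, so derivatives are always taken at interior points.
\<close>

primrec C_k_on :: "nat \<Rightarrow> 'a::real_normed_vector set \<Rightarrow> ('a \<Rightarrow> 'b::real_normed_vector) \<Rightarrow> bool" where
  "C_k_on 0 S f \<longleftrightarrow> continuous_on S f"
| "C_k_on (Suc k) S f \<longleftrightarrow> (\<forall>x\<in>S. f differentiable (at x)) \<and>
     (\<forall>v. C_k_on k S (\<lambda>x. frechet_derivative f (at x) v))"

definition smooth_on :: "'a::real_normed_vector set \<Rightarrow> ('a \<Rightarrow> 'b::real_normed_vector) \<Rightarrow> bool" where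
  "smooth_on S f \<longleftrightarrow> (\<forall>k. C_k_on k S f)"

definition partial_deriv :: "'n::finite \<Rightarrow> (real^'n \<Rightarrow> real) \<Rightarrow> real^'n \<Rightarrow> real" where
  "partial_deriv i f x = frechet_derivative f (at x) (axis i 1)"

type_synonym 'n metric = "real^'n \<Rightarrow> real^'n^'n"

definition riemannian_metric_on :: "(real^'n) set \<Rightarrow> 'n::finite metric \<Rightarrow> bool" where
  "riemannian_metric_on S g \<longleftrightarrow>
     (\<forall>i j. smooth_on S (\<lambda>x. g x $ i $ j)) \<and>
     (\<forall>x\<in>S. transpose (g x) = g x) \<and>
     (\<forall>x\<in>S. \<forall>v. v \<noteq> 0 \<longrightarrow> v \<bullet> (g x *v v) > 0)"

definition metric_inner :: "'n::finite metric \<Rightarrow> real^'n \<Rightarrow> real^'n \<Rightarrow> real^'n \<Rightarrow> real" where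
  "metric_inner g x u v = u \<bullet> (g x *v v)"

definition metric_norm :: "'n::finite metric \<Rightarrow> real^'n \<Rightarrow> real^'n \<Rightarrow> real" where
  "metric_norm g x v = sqrt (metric_inner g x v v)"

definition grad :: "'n::finite metric \<Rightarrow> (real^'n \<Rightarrow> real) \<Rightarrow> real^'n \<Rightarrow> real^'n" where
  "grad g f x = matrix_inv (g x) *v (\<chi> j. partial_deriv j f x)"

definition divergence :: "'n::finite metric \<Rightarrow> (real^'n \<Rightarrow> real^'n) \<Rightarrow> real^'n \<Rightarrow> real" where
  "divergence g X x =
     (\<Sum>i\<in>UNIV. partial_deriv i (\<lambda>y. sqrt (det (g y)) * X y $ i) x) / sqrt (det (g x))"

definition laplace_beltrami :: "'n::finite metric \<Rightarrow> (real^'n \<Rightarrow> real) \<Rightarrow> real^'n \<Rightarrow> real" where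
  "laplace_beltrami g f = divergence g (grad g f)"

definition lie_bracket ::
    "(real^'n \<Rightarrow> real^'n) \<Rightarrow> (real^'n \<Rightarrow> real^'n) \<Rightarrow> real^'n \<Rightarrow> real^'n::finite" where
  "lie_bracket X Y x = frechet_derivative Y (at x) (X x) - frechet_derivative X (at x) (Y x)"

text \<open>\<open>christoffel g k i j\<close> is the symbol with upper index k and lower indices i, j.\<close>

definition christoffel :: "'n::finite metric \<Rightarrow> 'n \<Rightarrow> 'n \<Rightarrow> 'n \<Rightarrow> real^'n \<Rightarrow> real" where
  "christoffel g k i j x = (1/2) * (\<Sum>l\<in>UNIV. matrix_inv (g x) $ k $ l *
     (partial_deriv i (\<lambda>y. g y $ j $ l) x + partial_deriv j (\<lambda>y. g y $ i $ l) x
      - partial_deriv l (\<lambda>y. g y $ i $ j) x))"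

text \<open>
  The component R^l_kij of the Riemann tensor, that is, the l-th component of
  R(e_i, e_j) e_k for the coordinate fields e_i.
\<close>

definition riemann_curvature :: "'n::finite metric \<Rightarrow> 'n \<Rightarrow> 'n \<Rightarrow> 'n \<Rightarrow> 'n \<Rightarrow> real^'n \<Rightarrow> real" where
  "riemann_curvature g l k i j x =
     partial_deriv i (christoffel g l j k) x - partial_deriv j (christoffel g l i k) x
     + (\<Sum>m\<in>UNIV. christoffel g l i m x * christoffel g m j k x
                 - christoffel g l j m x * christoffel g m i k x)"

definition flat_on :: "(real^'n) set \<Rightarrow> 'n::finite metric \<Rightarrow> bool" where
  "flat_on S g \<longleftrightarrow> (\<forall>x\<in>S. \<forall>l k i j. riemann_curvature g l k i j x = 0)"

definition geodesic_on ::
    "(real^'n) set \<Rightarrow> 'n::finite metric \<Rightarrow> real set \<Rightarrow> (real \<Rightarrow> real^'n) \<Rightarrow> bool" where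
  "geodesic_on S g J c \<longleftrightarrow> (\<forall>t\<in>J. c t \<in> S) \<and>
     (\<exists>v. \<forall>t\<in>J. (c has_vector_derivative v t) (at t) \<and>
        (v has_vector_derivative
          (\<chi> k. - (\<Sum>i\<in>UNIV. \<Sum>j\<in>UNIV. christoffel g k i j (c t) * v t $ i * v t $ j))) (at t))"

definition geodesically_complete :: "(real^'n) set \<Rightarrow> 'n::finite metric \<Rightarrow> bool" where
  "geodesically_complete S g \<longleftrightarrow>
     (\<forall>J c. open J \<and> is_interval J \<and> J \<noteq> {} \<and> geodesic_on S g J c \<longrightarrow>
        (\<exists>d. geodesic_on S g UNIV d \<and> (\<forall>t\<in>J. d t = c t)))"

abbreviation grad_coord :: "'n::finite metric \<Rightarrow> 'n \<Rightarrow> real^'n \<Rightarrow> real^'n" where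
  "grad_coord g i \<equiv> grad g (\<lambda>x. x $ i)"

definition gram_det :: "2 metric \<Rightarrow> real^2 \<Rightarrow> real" where
  "gram_det g x =
     (metric_norm g x (grad_coord g 1 x))\<^sup>2 * (metric_norm g x (grad_coord g 2 x))\<^sup>2
     - (metric_inner g x (grad_coord g 1 x) (grad_coord g 2 x))\<^sup>2"

text \<open>
  A geodesically complete surface has no boundary points, so S is open wherever the following
  conditions are used: there are neither boundary segments nor corners, and the requirements on
  the metric and on the gradient fields along them are void. The part of the boundary that is
  included in S is the intersection of S with its frontier.
\<close>

definition boundary_at_most_one_component :: "(real^2) set \<Rightarrow> bool" where
  "boundary_at_most_one_component S \<longleftrightarrow> (\<exists>C. components (S \<inter> frontier S) \<subseteq> {C})"

definition unit_gradients_smooth :: "(real^2) set \<Rightarrow> 2 metric \<Rightarrow> bool" where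
  "unit_gradients_smooth S g \<longleftrightarrow>
     (\<forall>i. smooth_on S (\<lambda>x. grad_coord g i x /\<^sub>R metric_norm g x (grad_coord g i x)))"

definition gradients_span_and_commute :: "(real^2) set \<Rightarrow> 2 metric \<Rightarrow> bool" where
  "gradients_span_and_commute S g \<longleftrightarrow>
     (\<forall>x\<in>S. dim (span {grad_coord g 1 x, grad_coord g 2 x}) = 2) \<and>
     (\<forall>x\<in>S. lie_bracket (grad_coord g 1) (grad_coord g 2) x = 0)"

end

theory Submission
  imports Defs "HOL-Complex_Analysis.Great_Picard"
begin

text \<open>
  The gradients of the coordinates commute if and only if the first derivatives of g are totally
  symmetric, that is, g is a Hessian metric. Let w be the square root of the Gram determinant, which is
  the inverse square root of det g, and h = w g. Then det h = 1, and the Laplacian of g is w times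
  that of h. For a Hessian metric the hypothesis that w is superharmonic gives the curvature bound
  K(h) >= |d log w|^2 / 4 >= 0. As in the work of Fischer-Colbrie and Schoen on stable minimal surfaces,
  the second variation of h-minimizing geodesics in the direction \<open>sqrt w * \<psi> * N\<close> and this bound show
  that h is complete because g is. On a complete surface of nonnegative curvature positive superharmonic
  functions are constant, so w is constant. Now 1 / g11 and 1 / g22 are h-harmonic and hence
  constant as well, so all derivatives of g vanish.
\<close>

text \<open>The distance function of \<open>h\<close> need not be differentiable, the completeness
  of \<open>h\<close> is not known in advance, and its geodesics are not given as smooth families.
  The whole argument is therefore variational. Minimizing curves arise as limits of minimizing
  polygons, for a metric altered away from a compact set so that it has global bounds. Smooth
  variations of one minimizer bound the action from above with equality at its end point, and that
  is enough for second order comparison at a point where the action itself may fail to be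
  differentiable. Completeness is used and passed on in the form that frontiers of suitable compact
  sets cost much energy. The exponent in \<open>sqrt w\<close> is dictated by the constant 1/4: with
  W = sqrt w the bound reads K >= |d log W|^2, exactly what absorbs the square of the derivative of
  W in the index form. Determinant one makes the inverse metric a cofactor matrix, so that the
  normal of a geodesic is its rotated momentum and the curvature identities are polynomial.\<close>

no_notation fps_nth (infixl \<open>$\<close> 75)

section \<open>Limits of difference schemes\<close>

text \<open>Piecewise linear interpolation as a sum of ramps: the clamp is the fraction of the k-th
  increment already travelled at time \<open>t\<close>. In this form no subinterval has to be
  located, and the Lipschitz bound follows from the monotonicity of each ramp and
  \<open>sum_clamp\<close>.\<close>

definition interp :: "nat \<Rightarrow> (nat \<Rightarrow> 'a::real_normed_vector) \<Rightarrow> real \<Rightarrow> 'a" where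
  "interp N y t = y 0 + (\<Sum>k<N. max 0 (min 1 (real N * t - real k)) *\<^sub>R (y (Suc k) - y k))"

lemma sum_clamp: "(\<Sum>k<n. max 0 (min 1 (u - real k))) = max 0 (min (real n) u)"
  by (induction n) (auto simp: max_def min_def)

lemma interp_grid:
  assumes "N > 0" "m \<le> N"
  shows "interp N y (real m / real N) = y m"
proof -
  have 1: "max 0 (min 1 (real N * (real m / real N) - real k)) = (if k < m then 1 else 0)" for k
    using assms by (auto simp: max_def min_def)
  have "(\<Sum>k<N. (if k < m then 1 else 0) *\<^sub>R (y (Suc k) - y k)) = (\<Sum>k<m. y (Suc k) - y k)"
    using assms by (intro sum.mono_neutral_cong_right) auto
  also have "\<dots> = y m - y 0"
    by (rule sum_lessThan_telescope)
  finally show ?thesis unfolding interp_def 1 by simp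
qed

lemma interp_lipschitz:
  assumes "N > 0" and inc: "\<And>k. k < N \<Longrightarrow> norm (y (Suc k) - y k) \<le> M / real N"
    and "s \<in> {0..1}" "t \<in> {0..1}"
  shows "norm (interp N y t - interp N y s) \<le> M * \<bar>t - s\<bar>"
proof -
  have *: "norm (interp N y t - interp N y s) \<le> M * (t - s)"
    if st: "s \<in> {0..1}" "t \<in> {0..1}" "s \<le> t" for s t
  proof -
    let ?c = "\<lambda>u k. max 0 (min 1 (real N * u - real k))"
    have mono: "?c s k \<le> ?c t k" for k
    proof -
      have "real N * s \<le> real N * t" using st by (intro mult_left_mono) auto
      then show ?thesis by (auto simp: max_def min_def)
    qed
    have eq: "interp N y t - interp N y s = (\<Sum>k<N. (?c t k - ?c s k) *\<^sub>R (y (Suc k) - y k))"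
      by (simp add: interp_def scaleR_diff_left sum_subtractf)
    have "norm (interp N y t - interp N y s) \<le> (\<Sum>k<N. (?c t k - ?c s k) * (M / real N))"
      unfolding eq
    proof (intro sum_norm_le)
      fix k assume "k \<in> {..<N}"
      then have "norm (y (Suc k) - y k) \<le> M / real N" using inc by auto
      moreover have c0: "0 \<le> ?c t k - ?c s k" using mono[of k] by (simp only: diff_ge_0_iff_ge)
      ultimately show "norm ((?c t k - ?c s k) *\<^sub>R (y (Suc k) - y k)) \<le> (?c t k - ?c s k) * (M / real N)"
        unfolding norm_scaleR abs_of_nonneg[OF c0] by (intro mult_left_mono)
    qed
    also have "(\<Sum>k<N. (?c t k - ?c s k) * (M / real N)) = (\<Sum>k<N. ?c t k - ?c s k) * (M / real N)"
      by (rule sum_distrib_right[symmetric])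
    also have "(\<Sum>k<N. ?c t k - ?c s k) = (\<Sum>k<N. ?c t k) - (\<Sum>k<N. ?c s k)"
      by (rule sum_subtractf)
    also have "\<dots> = max 0 (min (real N) (real N * t)) - max 0 (min (real N) (real N * s))"
      unfolding sum_clamp by (rule refl)
    also have "\<dots> = real N * t - real N * s"
      using st by (simp add: mult_left_le)
    also have "\<dots> * (M / real N) = M * (t - s)"
      using \<open>N > 0\<close> by (simp add: field_simps)
    finally show ?thesis .
  qed
  show ?thesis
  proof (cases "s \<le> t")
    case True then show ?thesis using *[of s t] assms by simp
  next
    case False then show ?thesis using *[of t s] assms by (simp add: norm_minus_commute)
  qed
qed

lemma floor_grid_tendsto:
  assumes r: "strict_mono (r :: nat \<Rightarrow> nat)" and "0 \<le> s"
  shows "(\<lambda>n. real (nat \<lfloor>real (Suc (r n)) * s\<rfloor>) / real (Suc (r n))) \<longlonglongrightarrow> s"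
proof -
  have N: "filterlim (\<lambda>n. real (Suc (r n))) at_top sequentially"
    using filterlim_compose[OF filterlim_real_sequentially filterlim_compose[OF filterlim_Suc filterlim_subseq[OF r]]] .
  have lim0: "(\<lambda>n. 1 / real (Suc (r n))) \<longlonglongrightarrow> 0"
    using tendsto_divide_0[OF tendsto_const filterlim_at_top_imp_at_infinity[OF N]] .
  have b: "\<bar>real (nat \<lfloor>real (Suc (r n)) * s\<rfloor>) / real (Suc (r n)) - s\<bar> \<le> 1 / real (Suc (r n))" for n
  proof -
    let ?N = "real (Suc (r n))"
    have "?N > 0" by simp
    have "0 \<le> ?N * s" using \<open>0 \<le> s\<close> by simp
    then have "real (nat \<lfloor>?N * s\<rfloor>) = of_int \<lfloor>?N * s\<rfloor>" by (simp only: of_nat_nat zero_le_floor)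
    moreover have "\<bar>of_int \<lfloor>?N * s\<rfloor> - ?N * s\<bar> \<le> 1" by linarith
    ultimately have "\<bar>real (nat \<lfloor>?N * s\<rfloor>) - ?N * s\<bar> \<le> 1" by simp
    then have "\<bar>(real (nat \<lfloor>?N * s\<rfloor>) - ?N * s) / ?N\<bar> \<le> 1 / ?N"
      using \<open>?N > 0\<close> by (simp only: abs_divide abs_of_pos divide_right_mono less_imp_le)
    moreover have "(real (nat \<lfloor>?N * s\<rfloor>) - ?N * s) / ?N = real (nat \<lfloor>?N * s\<rfloor>) / ?N - s"
      using \<open>?N > 0\<close> by (simp only: diff_divide_distrib) (simp del: of_nat_Suc)
    ultimately show ?thesis by (simp only:)
  qed
  have "(\<lambda>n. real (nat \<lfloor>real (Suc (r n)) * s\<rfloor>) / real (Suc (r n)) - s) \<longlonglongrightarrow> 0"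
    by (rule Lim_null_comparison[OF _ lim0]) (use b in \<open>auto simp del: of_nat_Suc\<close>)
  then show ?thesis by (simp add: LIM_zero_iff)
qed

text \<open>The increments are bounded by a constant times the step size, so the interpolants are
  equi-Lipschitz and Arzela-Ascoli applies; without uniqueness for the limit equation only a
  subsequence converges. \<open>F\<close> sees both neighbouring values because the scheme of the
  minimizing polygons pairs the old position with the new momentum. The uniform closeness at grid
  points is what lets energies pass to the limit.\<close>

lemma discrete_limit:
  fixes F :: "'a::euclidean_space \<Rightarrow> 'a \<Rightarrow> 'a" and y :: "nat \<Rightarrow> nat \<Rightarrow> 'a"
  assumes contF: "continuous_on UNIV (\<lambda>(u, v). F u v)"
    and bnd: "\<And>n k. k \<le> Suc n \<Longrightarrow> norm (y n k) \<le> R"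
    and rec: "\<And>n k. k < Suc n \<Longrightarrow> y n (Suc k) - y n k = (1 / real (Suc n)) *\<^sub>R F (y n k) (y n (Suc k))"
  obtains Y and r :: "nat \<Rightarrow> nat" where "strict_mono r"
    "\<And>t. t \<in> {0..1} \<Longrightarrow> (Y has_vector_derivative F (Y t) (Y t)) (at t within {0..1})"
    "\<And>e. e > 0 \<Longrightarrow> \<exists>N. \<forall>n\<ge>N. \<forall>k\<le>Suc (r n). norm (y (r n) k - Y (real k / real (Suc (r n)))) < e"
proof -
  have "compact ((\<lambda>(u, v). F u v) ` (cball 0 R \<times> cball 0 R))"
    by (intro compact_continuous_image continuous_on_subset[OF contF] compact_Times compact_cball) auto
  then obtain M where M: "\<And>u v. norm u \<le> R \<Longrightarrow> norm v \<le> R \<Longrightarrow> norm (F u v) \<le> M"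
    by (fastforce dest!: compact_imp_bounded simp: bounded_iff)
  have "norm (y 0 0) \<le> R" using bnd by simp
  then have "M \<ge> 0" using M[of "y 0 0" "y 0 0"] norm_ge_zero order_trans by blast
  have inc: "norm (y n (Suc k) - y n k) \<le> M / real (Suc n)" if "k < Suc n" for n k
  proof -
    have "norm (F (y n k) (y n (Suc k))) \<le> M" using that by (intro M bnd) auto
    then show ?thesis unfolding rec[OF that] by (simp add: divide_right_mono del: of_nat_Suc)
  qed
  define f where "f n = interp (Suc n) (y n)" for n
  have lip: "norm (f n t - f n s) \<le> M * \<bar>t - s\<bar>" if "s \<in> {0..1}" "t \<in> {0..1}" for n s t
    unfolding f_def using inc that by (intro interp_lipschitz) auto
  have grid: "f n (real k / real (Suc n)) = y n k" if "k \<le> Suc n" for n k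
    unfolding f_def using that by (intro interp_grid) auto
  have f0: "f n 0 = y n 0" for n using grid[of 0 n] by simp
  have fb: "norm (f n t) \<le> R + M" if "t \<in> {0..1}" for n t
  proof -
    have "norm (f n t - f n 0) \<le> M * \<bar>t - 0\<bar>" using that by (intro lip) auto
    also have "\<dots> \<le> M * 1" using that \<open>M \<ge> 0\<close> by (intro mult_left_mono) auto
    finally have "norm (f n t - f n 0) \<le> M" by simp
    moreover have "norm (f n 0) \<le> R" using bnd f0 by simp
    ultimately show ?thesis using norm_triangle_sub[of "f n t" "f n 0"] by linarith
  qed
  have equi: "\<exists>d>0. \<forall>n y. y \<in> {0..1} \<and> norm (x - y) < d \<longrightarrow> norm (f n x - f n y) < e"
    if "x \<in> {0..1}" "e > 0" for x e :: real
  proof (intro exI[of _ "e / (M + 1)"] conjI allI impI)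
    show "e / (M + 1) > 0" using \<open>e > 0\<close> \<open>M \<ge> 0\<close> by simp
    fix n and z :: real assume z: "z \<in> {0..1} \<and> norm (x - z) < e / (M + 1)"
    have "norm (f n x - f n z) \<le> M * \<bar>x - z\<bar>" using z that by (intro lip) auto
    also have "\<dots> \<le> (M + 1) * \<bar>x - z\<bar>" by (intro mult_right_mono) auto
    also have "\<dots> < (M + 1) * (e / (M + 1))" using z \<open>M \<ge> 0\<close> by (intro mult_strict_left_mono) auto
    finally show "norm (f n x - f n z) < e" using \<open>M \<ge> 0\<close> by simp
  qed
  obtain Y and r :: "nat \<Rightarrow> nat" where contY: "continuous_on {0..1} Y" and r: "strict_mono r"
    and conv: "\<And>e. 0 < e \<Longrightarrow> \<exists>N. \<forall>n x. n \<ge> N \<and> x \<in> {0..1} \<longrightarrow> norm (f (r n) x - Y x) < e"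
    by (rule Arzela_Ascoli[of "{0..1::real}" f "R + M", OF compact_Icc fb equi]) blast+
  have unif: "\<exists>N. \<forall>n\<ge>N. \<forall>k\<le>Suc (r n). norm (y (r n) k - Y (real k / real (Suc (r n)))) < e"
    if e: "e > 0" for e
  proof -
    obtain N where N: "\<And>n x. n \<ge> N \<Longrightarrow> x \<in> {0..1} \<Longrightarrow> norm (f (r n) x - Y x) < e"
      using conv[OF e] by blast
    have "norm (y (r n) k - Y (real k / real (Suc (r n)))) < e" if "n \<ge> N" "k \<le> Suc (r n)" for n k
    proof -
      have "real k / real (Suc (r n)) \<in> {0..1}" using that by (simp add: divide_le_eq_1 del: of_nat_Suc)
      from N[OF \<open>n \<ge> N\<close> this] show ?thesis by (simp only: grid[OF \<open>k \<le> Suc (r n)\<close>])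
    qed
    then show ?thesis by blast
  qed
  have der: "(Y has_vector_derivative F (Y t) (Y t)) (at t within {0..1})" if t: "t \<in> {0..1}" for t
  proof -
    \<comment> \<open>A uniform form of differentiability at \<open>t\<close>, in which both
      \<open>a\<close> and \<open>b\<close> vary. The cases \<open>a = t\<close> and
      \<open>b = t\<close> are the two one-sided derivatives.\<close>
    have ex: "\<exists>d>0. \<forall>a b. 0 \<le> a \<and> a \<le> b \<and> b \<le> 1 \<and> \<bar>a - t\<bar> < d \<and> \<bar>b - t\<bar> < d \<longrightarrow>
        norm (Y b - Y a - (b - a) *\<^sub>R F (Y t) (Y t)) \<le> e * (b - a)" if e: "e > 0" for e
    proof -
      from contF have "isCont (\<lambda>(u, v). F u v) (Y t, Y t)"
        by (simp add: continuous_on_eq_continuous_at)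
      then obtain d1 where "d1 > 0" and
        d1: "\<And>z. dist z (Y t, Y t) < d1 \<Longrightarrow> dist ((\<lambda>(u, v). F u v) z) (F (Y t) (Y t)) < e"
        unfolding continuous_at_eps_delta using e by fastforce
      have d1': "norm (F u v - F (Y t) (Y t)) \<le> e" if "norm (u - Y t) < d1 / 2" "norm (v - Y t) < d1 / 2" for u v
      proof -
        have "dist (u, v) (Y t, Y t) \<le> dist u (Y t) + dist v (Y t)"
          unfolding dist_Pair_Pair by (rule sqrt_sum_squares_le_sum) auto
        also have "\<dots> < d1" using that by (simp add: dist_norm)
        finally show ?thesis using d1[of "(u, v)"] by (simp add: dist_norm less_imp_le)
      qed
      from contY t \<open>d1 > 0\<close> obtain d where "d > 0" and
        d: "\<And>x. x \<in> {0..1} \<Longrightarrow> \<bar>x - t\<bar> < d \<Longrightarrow> norm (Y x - Y t) < d1 / 4"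
        unfolding continuous_on_iff dist_norm real_norm_def by (metis zero_less_divide_iff zero_less_numeral)
      show ?thesis
      proof (intro exI[of _ d] conjI allI impI)
        show "d > 0" by fact
        fix a b assume ab: "0 \<le> a \<and> a \<le> b \<and> b \<le> 1 \<and> \<bar>a - t\<bar> < d \<and> \<bar>b - t\<bar> < d"
        define l where "l n = nat \<lfloor>real (Suc (r n)) * a\<rfloor>" for n
        define m where "m n = nat \<lfloor>real (Suc (r n)) * b\<rfloor>" for n
        have l_lim: "(\<lambda>n. real (l n) / real (Suc (r n))) \<longlonglongrightarrow> a"
          and m_lim: "(\<lambda>n. real (m n) / real (Suc (r n))) \<longlonglongrightarrow> b"
          unfolding l_def m_def 
          by (rule floor_grid_tendsto[OF r], use ab in linarith)+
        have lm: "l n \<le> m n" for n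
          unfolding l_def m_def using ab by (intro nat_mono floor_mono mult_left_mono) auto
        have mle: "m n \<le> Suc (r n)" for n
        proof -
          have "real (Suc (r n)) * b \<le> real (Suc (r n)) * 1" using ab by (intro mult_left_mono) auto
          then have "\<lfloor>real (Suc (r n)) * b\<rfloor> \<le> \<lfloor>real (Suc (r n))\<rfloor>" by (intro floor_mono) (simp only: mult_1_right)
          then have "\<lfloor>real (Suc (r n)) * b\<rfloor> \<le> int (Suc (r n))" by (simp only: floor_of_nat)
          then show ?thesis unfolding m_def by linarith
        qed
        have ylim: "(\<lambda>n. y (r n) (i n)) \<longlonglongrightarrow> Y c"
          if i: "\<And>n. i n \<le> Suc (r n)" and lim: "(\<lambda>n. real (i n) / real (Suc (r n))) \<longlonglongrightarrow> c" and c: "c \<in> {0..1}" for i c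
        proof -
          have in01: "real (i n) / real (Suc (r n)) \<in> {0..1}" for n
            using i[of n] by (simp add: divide_le_eq_1 del: of_nat_Suc)
          have A: "(\<lambda>n. Y (real (i n) / real (Suc (r n)))) \<longlonglongrightarrow> Y c"
            using continuous_on_tendsto_compose[OF contY lim c] in01 by (simp del: of_nat_Suc)
          have B: "(\<lambda>n. y (r n) (i n) - Y (real (i n) / real (Suc (r n)))) \<longlonglongrightarrow> 0"
          proof (rule LIMSEQ_I)
            fix e :: real assume "e > 0"
            then show "\<exists>N. \<forall>n\<ge>N. norm (y (r n) (i n) - Y (real (i n) / real (Suc (r n))) - 0) < e"
              using unif[of e] i unfolding diff_zero by blast
          qed
          from tendsto_add[OF B A] show ?thesis by simp
        qed
        have yl: "(\<lambda>n. y (r n) (l n)) \<longlonglongrightarrow> Y a" 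
          by (rule ylim[OF order_trans[OF lm mle] l_lim]) (use ab in auto)
        have ym: "(\<lambda>n. y (r n) (m n)) \<longlonglongrightarrow> Y b" 
          by (rule ylim[OF mle m_lim]) (use ab in auto)
        let ?F = "F (Y t) (Y t)"
        have lim1: "(\<lambda>n. norm (y (r n) (m n) - y (r n) (l n) - (real (m n) / real (Suc (r n)) - real (l n) / real (Suc (r n))) *\<^sub>R ?F))
            \<longlonglongrightarrow> norm (Y b - Y a - (b - a) *\<^sub>R ?F)"
          by (intro tendsto_intros yl ym l_lim m_lim)
        have lim2: "(\<lambda>n. e * (real (m n) / real (Suc (r n)) - real (l n) / real (Suc (r n)))) \<longlonglongrightarrow> e * (b - a)"
          by (intro tendsto_intros l_lim m_lim)
        from unif[of "d1 / 4"] \<open>d1 > 0\<close> obtain N1 where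
          N1: "\<And>n k. n \<ge> N1 \<Longrightarrow> k \<le> Suc (r n) \<Longrightarrow> norm (y (r n) k - Y (real k / real (Suc (r n)))) < d1 / 4"
          by fastforce
        have "eventually (\<lambda>n. \<bar>real (l n) / real (Suc (r n)) - t\<bar> < d) sequentially"
          using ab by (intro order_tendstoD[OF tendsto_rabs[OF tendsto_diff[OF l_lim tendsto_const]]]) auto
        moreover have "eventually (\<lambda>n. \<bar>real (m n) / real (Suc (r n)) - t\<bar> < d) sequentially"
          using ab by (intro order_tendstoD[OF tendsto_rabs[OF tendsto_diff[OF m_lim tendsto_const]]]) auto
        moreover have "eventually (\<lambda>n. n \<ge> N1) sequentially" by (rule eventually_ge_at_top)
        ultimately have ev: "eventually (\<lambda>n. norm (y (r n) (m n) - y (r n) (l n) - (real (m n) / real (Suc (r n)) - real (l n) / real (Suc (r n))) *\<^sub>R ?F)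
            \<le> e * (real (m n) / real (Suc (r n)) - real (l n) / real (Suc (r n)))) sequentially"
        proof eventually_elim
          case (elim n)
          let ?N = "real (Suc (r n))"
          have near: "norm (y (r n) k - Y t) < d1 / 2" if k: "l n \<le> k" "k \<le> m n" for k
          proof -
            have kN: "k \<le> Suc (r n)" using k mle[of n] by simp
            have "real (l n) / ?N \<le> real k / ?N" "real k / ?N \<le> real (m n) / ?N"
              using k by (auto intro!: divide_right_mono)
            then have "\<bar>real k / ?N - t\<bar> < d" using elim by linarith
            moreover have "real k / ?N \<in> {0..1}" using kN by (simp add: divide_le_eq_1 del: of_nat_Suc)
            ultimately have "norm (Y (real k / ?N) - Y t) < d1 / 4" by (rule d[rotated])
            moreover have "norm (y (r n) k - Y (real k / ?N)) < d1 / 4" using elim kN by (intro N1) auto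
            ultimately show ?thesis
              using norm_triangle_ineq[of "y (r n) k - Y (real k / ?N)" "Y (real k / ?N) - Y t"] by simp
          qed
          \<comment> \<open>Over the block from \<open>l n\<close> to \<open>m n\<close> the
            increments telescope, and every value of \<open>F\<close> in the block is within
            \<open>e\<close> of its value at \<open>Y t\<close>.\<close>
          have "y (r n) (m n) - y (r n) (l n) = (\<Sum>k=l n..<m n. y (r n) (Suc k) - y (r n) k)"
            using lm[of n] by (simp add: sum_Suc_diff')
          also have "\<dots> = (\<Sum>k=l n..<m n. (1 / ?N) *\<^sub>R F (y (r n) k) (y (r n) (Suc k)))"
            using mle[of n] by (intro sum.cong refl rec) auto
          finally have 1: "y (r n) (m n) - y (r n) (l n) = \<dots>" .
          have 2: "real (m n) / ?N - real (l n) / ?N = (\<Sum>k=l n..<m n. 1 / ?N)"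
            using lm[of n] by (simp add: of_nat_diff diff_divide_distrib del: of_nat_Suc)
          have "y (r n) (m n) - y (r n) (l n) - (real (m n) / ?N - real (l n) / ?N) *\<^sub>R ?F
             = (\<Sum>k=l n..<m n. (1 / ?N) *\<^sub>R (F (y (r n) k) (y (r n) (Suc k)) - ?F))"
            unfolding 1 2 scaleR_sum_left scaleR_diff_right sum_subtractf by (rule refl)
          also have "norm \<dots> \<le> (\<Sum>k=l n..<m n. (1 / ?N) * e)"
          proof (intro sum_norm_le)
            fix k assume k: "k \<in> {l n..<m n}"
            have "norm (F (y (r n) k) (y (r n) (Suc k)) - ?F) \<le> e"
              using k by (intro d1' near) auto
            then show "norm ((1 / ?N) *\<^sub>R (F (y (r n) k) (y (r n) (Suc k)) - ?F)) \<le> (1 / ?N) * e"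
              by (simp add: divide_right_mono del: of_nat_Suc)
          qed
          also have "\<dots> = e * (real (m n) / ?N - real (l n) / ?N)"
            unfolding 2 by (simp add: sum_distrib_left mult.commute del: of_nat_Suc)
          finally show ?case .
        qed
        show "norm (Y b - Y a - (b - a) *\<^sub>R ?F) \<le> e * (b - a)"
          by (rule tendsto_le[OF trivial_limit_sequentially lim2 lim1 ev])
      qed
    qed
    show ?thesis unfolding has_vector_derivative_def has_derivative_within_alt
    proof (intro conjI allI impI bounded_linear_scaleR_left)
      fix e :: real assume "e > 0"
      from ex[OF this] obtain d where "d > 0" and
        d: "\<And>a b. 0 \<le> a \<Longrightarrow> a \<le> b \<Longrightarrow> b \<le> 1 \<Longrightarrow> \<bar>a - t\<bar> < d \<Longrightarrow> \<bar>b - t\<bar> < d \<Longrightarrow>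
          norm (Y b - Y a - (b - a) *\<^sub>R F (Y t) (Y t)) \<le> e * (b - a)" by blast
      have "norm (Y z - Y t - (z - t) *\<^sub>R F (Y t) (Y t)) \<le> e * norm (z - t)" if z: "z \<in> {0..1}" "norm (z - t) < d" for z
      proof (cases "t \<le> z")
        case True
        then show ?thesis using d[of t z] z t \<open>d > 0\<close> by simp
      next
        case False
        then have "norm (Y t - Y z - (t - z) *\<^sub>R F (Y t) (Y t)) \<le> e * (t - z)"
          using d[of z t] z t \<open>d > 0\<close> by simp
        moreover have "Y z - Y t - (z - t) *\<^sub>R F (Y t) (Y t) = - (Y t - Y z - (t - z) *\<^sub>R F (Y t) (Y t))"
          by (simp add: algebra_simps)
        ultimately show ?thesis using False by (simp only: norm_minus_cancel) simp
      qed
      then show "\<exists>d>0. \<forall>z\<in>{0..1}. norm (z - t) < d \<longrightarrow> norm (Y z - Y t - (z - t) *\<^sub>R F (Y t) (Y t)) \<le> e * norm (z - t)"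
        using \<open>d > 0\<close> by blast
    qed
  qed
  show ?thesis using that[OF r der unif] .
qed

section \<open>Existence of energy minimizers\<close>

text \<open>The velocity is carried as a second argument, so that densities and variations are
  formed from data and not from a derivative operator; at the end points the derivative is
  one-sided.\<close>

definition C1_curve :: "(real \<Rightarrow> 'a::real_normed_vector) \<Rightarrow> (real \<Rightarrow> 'a) \<Rightarrow> bool" where
  "C1_curve c v \<longleftrightarrow> (\<forall>t\<in>{0..1}. (c has_vector_derivative v t) (at t within {0..1})) \<and> continuous_on {0..1} v"

definition energy :: "('a \<Rightarrow> 'a \<Rightarrow> real) \<Rightarrow> (real \<Rightarrow> 'a) \<Rightarrow> (real \<Rightarrow> 'a) \<Rightarrow> real" where
  "energy e c v = integral {0..1} (\<lambda>t. e (c t) (v t))"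

lemma C1_curve_continuous: "C1_curve c v \<Longrightarrow> continuous_on {0..1} c"
  unfolding C1_curve_def continuous_on_eq_continuous_within
  by (auto intro: has_vector_derivative_continuous)

section \<open>Riemann sums with perturbed sample values\<close>

lemma riemann_sum_error:
  fixes f :: "real \<Rightarrow> real"
  assumes f: "continuous_on {0..1} f"
    and a: "\<And>k t. k < Suc n \<Longrightarrow> real k / real (Suc n) \<le> t \<Longrightarrow> t \<le> real (Suc k) / real (Suc n) \<Longrightarrow> \<bar>f t - a k\<bar> \<le> B"
  shows "\<bar>integral {0..1} f - (1 / real (Suc n)) * (\<Sum>k<Suc n. a k)\<bar> \<le> B"
proof -
  let ?N = "real (Suc n)"
  have step: "\<bar>integral {0..real m / ?N} f - (1 / ?N) * (\<Sum>k<m. a k)\<bar> \<le> B * (real m / ?N)" if "m \<le> Suc n" for m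
    using that
  proof (induction m)
    case 0
    then show ?case by simp
  next
    case (Suc m)
    let ?l = "real m / ?N" and ?u = "real (Suc m) / ?N"
    have lu: "0 \<le> ?l" "?l \<le> ?u" "?u \<le> 1" using Suc.prems by (auto simp: divide_right_mono simp del: of_nat_Suc)
    have c0: "continuous_on {0..?u} f" "continuous_on {?l..?u} f"
      using lu by (meson continuous_on_subset[OF f] atLeastatMost_subset_iff order_trans order_refl)+
    have "integral {0..?l} f + integral {?l..?u} f = integral {0..?u} f"
      using lu c0 by (intro Henstock_Kurzweil_Integration.integral_combine integrable_continuous_interval)
    moreover have "\<bar>integral {?l..?u} f - (1 / ?N) * a m\<bar> \<le> B * (1 / ?N)"
    proof -
      have w: "?u - ?l = 1 / ?N" by (simp add: diff_divide_distrib[symmetric])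
      have "integral {?l..?u} (\<lambda>t. f t - a m) = integral {?l..?u} f - integral {?l..?u} (\<lambda>t. a m)"
        by (intro integral_diff integrable_continuous_interval c0 continuous_intros)
      also have "integral {?l..?u} (\<lambda>t. a m) = (?u - ?l) * a m"
        using lu(2) by (simp del: of_nat_Suc)
      finally have "integral {?l..?u} f - (1 / ?N) * a m = integral {?l..?u} (\<lambda>t. f t - a m)"
        unfolding w by simp
      moreover have "norm (integral {?l..?u} (\<lambda>t. f t - a m)) \<le> B * (?u - ?l)"
        using lu a[of m] Suc.prems by (intro integral_bound continuous_intros c0) (auto simp del: of_nat_Suc)
      ultimately show ?thesis unfolding w by simp
    qed
    moreover have "\<bar>integral {0..?l} f - (1 / ?N) * (\<Sum>k<m. a k)\<bar> \<le> B * ?l" using Suc by simp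
    moreover have "B * ?u = B * ?l + B * (1 / ?N)"
      by (simp only: distrib_left[symmetric] add_divide_distrib[symmetric] of_nat_Suc add.commute)
    moreover have "(1 / ?N) * (\<Sum>k<Suc m. a k) = (1 / ?N) * (\<Sum>k<m. a k) + (1 / ?N) * a m"
      by (simp add: distrib_left)
    ultimately show ?case by linarith
  qed
  from step[of "Suc n"] show ?thesis by (simp del: of_nat_Suc sum.lessThan_Suc)
qed

text \<open>The samples need only be uniformly close to \<open>f\<close> on the grid: the velocities
  of an inscribed polygon are difference quotients, and those of the minimizing polygons come from
  momenta shifted by one step.\<close>

lemma riemann_sum_limit:
  fixes f :: "real \<Rightarrow> real" and r :: "nat \<Rightarrow> nat"
  assumes f: "continuous_on {0..1} f" and r: "strict_mono r"
    and a: "\<And>\<epsilon>. \<epsilon> > 0 \<Longrightarrow> \<exists>N. \<forall>n\<ge>N. \<forall>k<Suc (r n). \<bar>a n k - f (real k / real (Suc (r n)))\<bar> < \<epsilon>"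
  shows "(\<lambda>n. (1 / real (Suc (r n))) * (\<Sum>k<Suc (r n). a n k)) \<longlonglongrightarrow> integral {0..1} f"
proof (rule LIMSEQ_I)
  fix \<epsilon> :: real assume "\<epsilon> > 0"
  have "uniformly_continuous_on {0..1} f"
    using f by (intro compact_uniformly_continuous) auto
  then obtain d where "d > 0" and d: "\<And>s t. s \<in> {0..1} \<Longrightarrow> t \<in> {0..1} \<Longrightarrow> \<bar>t - s\<bar> < d \<Longrightarrow> \<bar>f t - f s\<bar> < \<epsilon> / 3"
    using \<open>\<epsilon> > 0\<close> unfolding uniformly_continuous_on_def dist_real_def
    by (metis divide_pos_pos zero_less_numeral)
  obtain M where M: "real M > 1 / d" using reals_Archimedean2 by blast
  obtain N1 where N1: "\<And>n k. n \<ge> N1 \<Longrightarrow> k < Suc (r n) \<Longrightarrow> \<bar>a n k - f (real k / real (Suc (r n)))\<bar> < \<epsilon> / 3"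
    using a[of "\<epsilon> / 3"] \<open>\<epsilon> > 0\<close> by (metis divide_pos_pos zero_less_numeral)
  have "norm ((1 / real (Suc (r n))) * (\<Sum>k<Suc (r n). a n k) - integral {0..1} f) < \<epsilon>"
    if n: "n \<ge> max M N1" for n
  proof -
    let ?N = "real (Suc (r n))"
    have "n \<le> r n" using r by (rule strict_mono_imp_increasing)
    then have "real M \<le> ?N" using n by simp
    then have "1 / d < ?N" using M by linarith
    then have inv: "1 / ?N < d" using \<open>d > 0\<close> by (simp add: field_simps del: of_nat_Suc)
    have close: "\<bar>f t - a n k\<bar> \<le> 2 * \<epsilon> / 3"
      if k: "k < Suc (r n)" and t: "real k / ?N \<le> t" "t \<le> real (Suc k) / ?N" for k t
    proof -
      have *: "real (Suc k) / ?N = real k / ?N + 1 / ?N" by (simp add: add_divide_distrib[symmetric])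
      have "real (Suc k) / ?N \<le> 1" using k by (simp del: of_nat_Suc)
      moreover have "0 \<le> real k / ?N" by simp
      moreover have "0 < 1 / ?N" by simp
      ultimately have in01: "t \<in> {0..1}" "real k / ?N \<in> {0..1}"
        using t unfolding * atLeastAtMost_iff by linarith+
      have "\<bar>t - real k / ?N\<bar> < d" using t inv unfolding * by linarith
      from d[OF in01(2,1) this] N1[OF _ k] n show ?thesis by linarith
    qed
    have "\<bar>integral {0..1} f - (1 / ?N) * (\<Sum>k<Suc (r n). a n k)\<bar> \<le> 2 * \<epsilon> / 3"
      using close by (rule riemann_sum_error[OF f])
    then show ?thesis using \<open>\<epsilon> > 0\<close> by (simp add: abs_minus_commute del: of_nat_Suc sum.lessThan_Suc)
  qed
  then show "\<exists>N. \<forall>n\<ge>N. norm ((1 / real (Suc (r n))) * (\<Sum>k<Suc (r n). a n k) - integral {0..1} f) < \<epsilon>"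
    by blast
qed

text \<open>The bounds are global in the position: quadratic growth from below makes the polygon
  energies coercive, and the bounds on \<open>ex\<close> and \<open>ev\<close> keep the momenta
  under control. For a metric on an open set they are achieved by the modification in
  \<open>metric_extension\<close>. \<open>psi x\<close> recovers the velocity from the momentum, so
  solutions can be written in Hamiltonian form.\<close>

locale lagrangian =
  fixes e :: "'a::euclidean_space \<Rightarrow> 'a \<Rightarrow> real" and ex ev psi :: "'a \<Rightarrow> 'a \<Rightarrow> 'a" and lam C :: real
  assumes lam: "lam > 0"
    and deriv: "((\<lambda>z. e (fst z) (snd z)) has_derivative (\<lambda>d. ex x v \<bullet> fst d + ev x v \<bullet> snd d)) (at (x, v))"
    and cont_ex: "continuous_on UNIV (\<lambda>z. ex (fst z) (snd z))"
    and cont_psi: "continuous_on UNIV (\<lambda>z. psi (fst z) (snd z))"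
    and lower: "lam * (norm v)\<^sup>2 \<le> e x v"
    and ex_bound: "norm (ex x v) \<le> C * (norm v)\<^sup>2"
    and ev_bound: "norm (ev x v) \<le> C * norm v"
    and psi_ev: "psi x (ev x v) = v"
begin

lemma e_nonneg: "e x v \<ge> 0"
  using order_trans[OF mult_nonneg_nonneg[OF less_imp_le[OF lam] zero_le_power2] lower] .

lemma C_nonneg: "C \<ge> 0"
proof -
  obtain b :: 'a where "b \<in> Basis" using nonempty_Basis by blast
  then have "norm b = 1" by (rule norm_Basis)
  then show ?thesis using ex_bound[of undefined b] norm_ge_zero[of "ex undefined b"] by (simp del: norm_ge_zero)
qed

lemma cont_e: "continuous_on UNIV (\<lambda>z. e (fst z) (snd z))"
proof -
  have "isCont (\<lambda>z. e (fst z) (snd z)) z" for z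
    using has_derivative_continuous[OF deriv[of "fst z" "snd z"]] by simp
  then show ?thesis by (simp add: continuous_at_imp_continuous_on)
qed

lemma cont_energy_density:
  assumes "continuous_on S c" "continuous_on S v"
  shows "continuous_on S (\<lambda>t. e (c t) (v t))"
  using continuous_on_compose2[OF cont_e continuous_on_Pair[OF assms]] by (simp only: fst_conv snd_conv subset_UNIV)

definition polygon_energy :: "nat \<Rightarrow> (nat \<Rightarrow> 'a) \<Rightarrow> real" where
  "polygon_energy N x = (1 / real N) * (\<Sum>k<N. e (x k) (real N *\<^sub>R (x (Suc k) - x k)))"

text \<open>All terms of the sum are nonnegative, so the total energy controls every single segment.
  The bound grows with \<open>N\<close>; it only serves to confine the vertices for fixed
  \<open>N\<close>. The expression 1 + B / lam replaces the square root of B / lam.\<close>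

lemma polygon_bound:
  assumes "N > 0" "polygon_energy N x \<le> B" "m \<le> N"
  shows "norm (x m - x 0) \<le> real N * (1 + B / lam)"
proof -
  let ?d = "\<lambda>k. norm (x (Suc k) - x k)"
  have B: "B \<ge> 0"
    by (rule order_trans[OF _ assms(2)]) (auto simp: polygon_energy_def intro!: divide_nonneg_nonneg sum_nonneg e_nonneg)
  have le: "?d k \<le> 1 + B / lam" if "k < N" for k
  proof -
    have "lam * (norm (real N *\<^sub>R (x (Suc k) - x k)))\<^sup>2 \<le> e (x k) (real N *\<^sub>R (x (Suc k) - x k))"
      by (rule lower)
    also have "\<dots> \<le> (\<Sum>k<N. e (x k) (real N *\<^sub>R (x (Suc k) - x k)))"
      using that e_nonneg by (intro member_le_sum) auto
    also have "\<dots> = real N * polygon_energy N x" using assms(1) by (simp add: polygon_energy_def)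
    also have "\<dots> \<le> real N * B" using assms by (intro mult_left_mono) auto
    finally have "lam * (real N * (real N * (?d k)\<^sup>2)) \<le> real N * B" 
      unfolding norm_scaleR by (simp add: power_mult_distrib power2_eq_square mult.assoc mult.left_commute)
    then have "real N * (lam * (real N * (?d k)\<^sup>2)) \<le> real N * B" by (simp only: mult.left_commute)
    then have "lam * (real N * (?d k)\<^sup>2) \<le> B" using assms(1) by (simp only: mult_le_cancel_left_pos of_nat_0_less_iff)
    moreover have "lam * (1 * (?d k)\<^sup>2) \<le> lam * (real N * (?d k)\<^sup>2)"
      using lam assms(1) by (intro mult_left_mono mult_right_mono) auto
    ultimately have "lam * (?d k)\<^sup>2 \<le> B" by linarith
    then have "(?d k)\<^sup>2 \<le> B / lam" using lam by (simp add: field_simps)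
    also have "\<dots> \<le> (1 + B / lam)\<^sup>2"
    proof -
      have "0 \<le> B / lam" using B lam by simp
      then have "0 \<le> (B / lam)\<^sup>2 + B / lam + 1" by simp
      then show ?thesis by (simp add: power2_sum power_divide)
    qed
    finally show ?thesis by (rule power2_le_imp_le) (use B lam in auto)
  qed
  have "norm (x m - x 0) = norm (\<Sum>k<m. x (Suc k) - x k)" by (simp add: sum_lessThan_telescope)
  also have "\<dots> \<le> (\<Sum>k<m. 1 + B / lam)" using le assms by (intro sum_norm_le) auto
  also have "\<dots> = real m * (1 + B / lam)" by simp
  also have "\<dots> \<le> real N * (1 + B / lam)" using assms B lam by (intro mult_right_mono) auto
  finally show ?thesis .
qed

text \<open>For a fixed number of segments the direct method is finite dimensional: competitors of
  bounded energy have their vertices in one ball, and there a continuous function attains its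
  minimum. No weak convergence of curves is involved.\<close>

lemma polygon_minimizer:
  assumes "N > 0"
  obtains x where "x 0 = p" "x N = q"
    "\<And>z. z 0 = p \<Longrightarrow> z N = q \<Longrightarrow> polygon_energy N x \<le> polygon_energy N z"
proof -
  \<comment> \<open>\<open>ext\<close> forces the prescribed end points, so the minimum can be
    sought over a full product of balls, compact by Tychonoff's theorem; only the coordinates
    strictly between 0 and \<open>N\<close> influence the energy.\<close>
  define ext where "ext z k = (if k = 0 then p else if N \<le> k then q else z k)" for z :: "nat \<Rightarrow> 'a" and k
  define B where "B = polygon_energy N (ext (\<lambda>_. p))"
  define R where "R = real N * (1 + B / lam)"
  have "compactin (product_topology (\<lambda>_. euclidean) UNIV) (PiE UNIV (\<lambda>_::nat. cball p R))"
    unfolding compactin_PiE by (simp add: compactin_euclidean_iff)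
  then have comp: "compact (PiE UNIV (\<lambda>_::nat. cball p R))"
    by (simp add: euclidean_product_topology compactin_euclidean_iff)
  have R0: "R \<ge> 0"
  proof -
    have "norm (ext (\<lambda>_. p) 0 - ext (\<lambda>_. p) 0) \<le> R"
      unfolding R_def by (rule polygon_bound[OF assms]) (auto simp: B_def)
    then show ?thesis by simp
  qed
  have contc: "continuous_on UNIV (\<lambda>z::nat \<Rightarrow> 'a. ext z k)" for k
  proof (cases "k = 0 \<or> N \<le> k")
    case True
    then have "(\<lambda>z. ext z k) = (\<lambda>z. if k = 0 then p else q)" by (auto simp: ext_def)
    then show ?thesis by (simp only: continuous_on_const)
  next
    case False
    then have "(\<lambda>z. ext z k) = (\<lambda>z. z k)" by (auto simp: ext_def)
    then show ?thesis by (simp only: continuous_on_product_coordinates)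
  qed
  have cont: "continuous_on (PiE UNIV (\<lambda>_::nat. cball p R)) (\<lambda>z. polygon_energy N (ext z))"
    unfolding polygon_energy_def
    by (intro continuous_intros cont_energy_density continuous_on_subset[OF contc]) auto
  have "PiE UNIV (\<lambda>_::nat. cball p R) \<noteq> {}" using R0 by (auto simp: PiE_eq_empty_iff)
  from continuous_attains_inf[OF comp this cont] obtain x where
    x: "x \<in> PiE UNIV (\<lambda>_::nat. cball p R)"
    and xmin: "\<And>z. z \<in> PiE UNIV (\<lambda>_::nat. cball p R) \<Longrightarrow> polygon_energy N (ext x) \<le> polygon_energy N (ext z)"
    by blast
  have "polygon_energy N (ext x) \<le> polygon_energy N z" if z: "z 0 = p" "z N = q" for z
  proof (cases "polygon_energy N z \<le> B")
    case True
    \<comment> \<open>Vertices beyond \<open>N\<close> do not enter the energy and are reset, so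
      that the competitor lies in the product of balls.\<close>
    define z' where "z' k = (if k \<le> N then z k else p)" for k
    have "z' \<in> PiE UNIV (\<lambda>_::nat. cball p R)"
      using polygon_bound[OF assms True] R0 z
      by (auto simp: z'_def PiE_def R_def dist_norm norm_minus_commute)
    from xmin[OF this] have "polygon_energy N (ext x) \<le> polygon_energy N (ext z')" .
    also have "ext z' k = z k" if "k \<le> N" for k using that z assms by (auto simp: ext_def z'_def)
    then have "polygon_energy N (ext z') = polygon_energy N z" unfolding polygon_energy_def by simp
    finally show ?thesis .
  next
    case False
    have "(\<lambda>_. p) \<in> PiE UNIV (\<lambda>_::nat. cball p R)" using R0 by auto
    from xmin[OF this] False show ?thesis unfolding B_def by linarith
  qed
  then show ?thesis using that[of "ext x"] assms by (simp add: ext_def)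
qed

text \<open>Stationarity under moving the single vertex \<open>k\<close>, which only the segments
  \<open>k - 1\<close> and \<open>k\<close> feel.\<close>

lemma polygon_euler_lagrange:
  assumes "N > 0" and min: "\<And>z. z 0 = x 0 \<Longrightarrow> z N = x N \<Longrightarrow> polygon_energy N x \<le> polygon_energy N z"
    and k: "0 < k" "k < N"
  defines "v \<equiv> \<lambda>k. real N *\<^sub>R (x (Suc k) - x k)"
  shows "ev (x k) (v k) - ev (x (k - 1)) (v (k - 1)) = (1 / real N) *\<^sub>R ex (x k) (v k)"
proof -
  have "((1 / real N) *\<^sub>R ex (x k) (v k) - (ev (x k) (v k) - ev (x (k - 1)) (v (k - 1)))) \<bullet> d = 0" for d
  proof -
    define xt where "xt \<tau> j = (if j = k then x j + \<tau> *\<^sub>R d else x j)" for \<tau> j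
    let ?D = "\<lambda>j. ex (x j) (v j) \<bullet> (if j = k then d else 0) +
        ev (x j) (v j) \<bullet> (real N *\<^sub>R ((if Suc j = k then d else 0) - (if j = k then d else 0)))"
    have xt': "((\<lambda>\<tau>. xt \<tau> j) has_derivative (\<lambda>h. h *\<^sub>R (if j = k then d else 0))) (at 0)" for j
      unfolding xt_def by (cases "j = k") (auto intro!: derivative_eq_intros)
    have "((\<lambda>\<tau>. e (xt \<tau> j) (real N *\<^sub>R (xt \<tau> (Suc j) - xt \<tau> j))) has_derivative (\<lambda>h. h * ?D j)) (at 0)" for j
    proof -
      have A: "((\<lambda>\<tau>. (xt \<tau> j, real N *\<^sub>R (xt \<tau> (Suc j) - xt \<tau> j))) has_derivative
         (\<lambda>h. (h *\<^sub>R (if j = k then d else 0), real N *\<^sub>R (h *\<^sub>R (if Suc j = k then d else 0) - h *\<^sub>R (if j = k then d else 0))))) (at 0)"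
        by (intro has_derivative_Pair xt' has_derivative_scaleR_right has_derivative_diff)
      have x0: "xt 0 j = x j" for j by (simp add: xt_def)
      have "((\<lambda>z. e (fst z) (snd z)) has_derivative (\<lambda>d. ex (x j) (v j) \<bullet> fst d + ev (x j) (v j) \<bullet> snd d))
         (at (xt 0 j, real N *\<^sub>R (xt 0 (Suc j) - xt 0 j)))"
        unfolding x0 v_def by (rule deriv)
      from has_derivative_compose[OF A this] show ?thesis
        by (simp add: algebra_simps inner_diff_right)
    qed
    then have "((\<lambda>\<tau>. e (xt \<tau> j) (real N *\<^sub>R (xt \<tau> (Suc j) - xt \<tau> j))) has_real_derivative ?D j) (at 0)" for j
      unfolding has_field_derivative_def mult_commute_abs .
    then have D: "((\<lambda>\<tau>. polygon_energy N (xt \<tau>)) has_real_derivative (1 / real N) * (\<Sum>j<N. ?D j)) (at 0)"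
      unfolding polygon_energy_def
      by (intro DERIV_cmult DERIV_sum)
    have "polygon_energy N (xt 0) \<le> polygon_energy N (xt \<tau>)" for \<tau>
    proof -
      have "xt 0 = x" by (auto simp: xt_def)
      then show ?thesis using min[of "xt \<tau>"] k by (simp add: xt_def)
    qed
    then have "(1 / real N) * (\<Sum>j<N. ?D j) = 0"
      by (intro DERIV_local_min[OF D, of 1]) auto
    then have "(\<Sum>j<N. ?D j) = 0" using assms(1) by simp
    moreover have "(\<Sum>j<N. ?D j) = (\<Sum>j\<in>{k - 1, k}. ?D j)"
      using k by (intro sum.mono_neutral_right) auto
    moreover have "(\<Sum>j\<in>{k - 1, k}. ?D j) = ?D (k - 1) + ?D k" using k by simp
    moreover have "Suc (k - 1) = k" "k - 1 \<noteq> k" using k by auto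
    ultimately have "real N * (ev (x (k - 1)) (v (k - 1)) \<bullet> d) + (ex (x k) (v k) \<bullet> d - real N * (ev (x k) (v k) \<bullet> d)) = 0"
      using k by (auto simp: inner_diff_right)
    then show ?thesis using assms(1) by (simp add: inner_diff_left inner_add_left field_simps)
  qed
  from this[of "(1 / real N) *\<^sub>R ex (x k) (v k) - (ev (x k) (v k) - ev (x (k - 1)) (v (k - 1)))"]
  show ?thesis by (simp only: inner_eq_zero_iff) simp
qed

end

lemma norm_fst: "norm (fst z) \<le> norm z"
  by (metis norm_fst_le prod.collapse)

lemma norm_snd: "norm (snd z) \<le> norm z"
  by (metis norm_snd_le prod.collapse)

section \<open>Bounds uniform in the number of segments and passage from polygons to curves\<close>

context lagrangian
begin

text \<open>The bound must not depend on \<open>N\<close>. The energy bounds the mean square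
  velocity, so some segment has a velocity of that order and hence a bounded momentum. From there
  the momentum varies by at most \<open>C * (B / lam)\<close>, because \<open>ex\<close> grows
  quadratically in the velocity and is summed with weight 1 / N.\<close>

lemma momentum_bounds:
  assumes "0 < N" "polygon_energy N x \<le> B"
    and Pv: "\<And>k. k < N \<Longrightarrow> P (Suc k) = ev (x k) (real N *\<^sub>R (x (Suc k) - x k))"
    and Pd: "\<And>k. k < N \<Longrightarrow> P (Suc k) - P k = (1 / real N) *\<^sub>R ex (x k) (real N *\<^sub>R (x (Suc k) - x k))"
    and "k \<le> N"
  shows "norm (P k) \<le> C * (1 + B / lam) + C * (B / lam)"
proof -
  define w where "w k = (norm (real N *\<^sub>R (x (Suc k) - x k)))\<^sup>2" for k
  have "lam * (\<Sum>k<N. w k) \<le> (\<Sum>k<N. e (x k) (real N *\<^sub>R (x (Suc k) - x k)))"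
    unfolding w_def sum_distrib_left by (intro sum_mono lower)
  also have "\<dots> = real N * polygon_energy N x" using assms by (simp add: polygon_energy_def)
  also have "\<dots> \<le> real N * B" using assms by (intro mult_left_mono) auto
  finally have sumw: "(\<Sum>k<N. w k) \<le> real N * (B / lam)" using lam by (simp add: field_simps)
  have B: "B / lam \<ge> 0"
  proof -
    have "0 \<le> (\<Sum>k<N. w k)" unfolding w_def by (intro sum_nonneg) auto
    then have "0 \<le> real N * (B / lam)" using sumw by linarith
    then show ?thesis using assms(1) by (simp only: zero_le_mult_iff) auto
  qed
  obtain k0 where k0: "k0 < N" "w k0 \<le> B / lam"
  proof (rule ccontr)
    assume "\<not> thesis"
    then have "\<And>k. k < N \<Longrightarrow> B / lam < w k" using that by force
    then have "(\<Sum>k<N. B / lam) < (\<Sum>k<N. w k)" using assms(1) by (intro sum_strict_mono) auto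
    then show False using sumw by simp
  qed
  have "norm (P (Suc k0)) \<le> C * norm (real N *\<^sub>R (x (Suc k0) - x k0))"
    unfolding Pv[OF k0(1)] by (rule ev_bound)
  moreover have "norm (real N *\<^sub>R (x (Suc k0) - x k0)) \<le> 1 + B / lam"
  proof (rule power2_le_imp_le)
    have "B / lam \<le> (1 + B / lam)\<^sup>2"
      unfolding power2_sum using B zero_le_power2[of "B / lam"] by (simp only: power_one)
    then show "(norm (real N *\<^sub>R (x (Suc k0) - x k0)))\<^sup>2 \<le> (1 + B / lam)\<^sup>2"
      using k0(2) unfolding w_def by linarith
    show "0 \<le> 1 + B / lam" using B by linarith
  qed
  ultimately have P0: "norm (P (Suc k0)) \<le> C * (1 + B / lam)"
    using mult_left_mono[OF _ C_nonneg] order_trans by blast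
  have var: "norm (P j - P i) \<le> C * (B / lam)" if "i \<le> j" "j \<le> N" for i j
  proof -
    have eq: "P j - P i = (\<Sum>k=i..<j. P (Suc k) - P k)"
      by (rule sum_Suc_diff'[OF that(1), symmetric])
    have "norm (P j - P i) \<le> (\<Sum>k=i..<j. (1 / real N) * (C * w k))"
      unfolding eq
    proof (intro sum_norm_le)
      fix k assume "k \<in> {i..<j}"
      then have "k < N" using that by auto
      show "norm (P (Suc k) - P k) \<le> (1 / real N) * (C * w k)"
        unfolding Pd[OF \<open>k < N\<close>] norm_scaleR w_def
        using ex_bound[of "x k" "real N *\<^sub>R (x (Suc k) - x k)"] by (simp add: divide_right_mono)
    qed
    also have "\<dots> \<le> (\<Sum>k<N. (1 / real N) * (C * w k))"
      using that C_nonneg by (intro sum_mono2) (auto simp: w_def)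
    also have "\<dots> = (1 / real N) * (C * (\<Sum>k<N. w k))" by (simp add: sum_distrib_left)
    also have "\<dots> \<le> (1 / real N) * (C * (real N * (B / lam)))"
      using sumw C_nonneg by (intro mult_left_mono) auto
    also have "\<dots> = C * (B / lam)" using assms(1) by simp
    finally show ?thesis .
  qed
  have "norm (P k - P (Suc k0)) \<le> C * (B / lam)"
  proof (cases "k \<le> Suc k0")
    case True
    then show ?thesis using var[of k "Suc k0"] k0 by (simp add: norm_minus_commute)
  next
    case False
    then show ?thesis using var[of "Suc k0" k] assms by simp
  qed
  then show ?thesis using P0 norm_triangle_sub[of "P k" "P (Suc k0)"] by linarith
qed

lemma uniform_on_bounded:
  fixes g :: "'a \<times> 'a \<Rightarrow> real"
  assumes "continuous_on UNIV g" "\<epsilon> > 0"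
  obtains d where "d > 0" "\<And>x y v w :: 'a. norm x \<le> R \<Longrightarrow> norm y \<le> R \<Longrightarrow> norm v \<le> R \<Longrightarrow> norm w \<le> R \<Longrightarrow>
    norm (x - y) < d \<Longrightarrow> norm (v - w) < d \<Longrightarrow> \<bar>g (x, v) - g (y, w)\<bar> < \<epsilon>"
proof -
  have "uniformly_continuous_on (cball 0 R \<times> cball 0 R) g"
    by (intro compact_uniformly_continuous continuous_on_subset[OF assms(1)] compact_Times compact_cball) auto
  then obtain d where "d > 0" and
    d: "\<And>z z'. z \<in> cball 0 R \<times> cball 0 R \<Longrightarrow> z' \<in> cball 0 R \<times> cball 0 R \<Longrightarrow> dist z' z < d \<Longrightarrow> dist (g z') (g z) < \<epsilon>"
    unfolding uniformly_continuous_on_def using assms(2) by metis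
  show ?thesis
  proof (rule that[of "d / 2"])
    fix x y v w :: 'a assume *: "norm x \<le> R" "norm y \<le> R" "norm v \<le> R" "norm w \<le> R"
      "norm (x - y) < d / 2" "norm (v - w) < d / 2"
    have "dist (x, v) (y, w) \<le> dist x y + dist v w"
      unfolding dist_Pair_Pair by (rule sqrt_sum_squares_le_sum) auto
    also have "\<dots> < d" using * by (simp add: dist_norm)
    finally show "\<bar>g (x, v) - g (y, w)\<bar> < \<epsilon>"
      using d[of "(y, w)" "(x, v)"] * by (simp add: dist_real_def)
  qed (use \<open>d > 0\<close> in auto)
qed

text \<open>Difference quotients of a C1 curve are uniformly close to its velocity at the grid
  points. Through its inscribed polygons every curve thus competes with the minimizing
  polygons.\<close>

lemma sampled_energy_limit:
  assumes c: "C1_curve c v" and r: "strict_mono r"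
  shows "(\<lambda>n. polygon_energy (Suc (r n)) (\<lambda>k. c (real k / real (Suc (r n))))) \<longlonglongrightarrow> energy e c v"
proof -
  have contc: "continuous_on {0..1} c" and contv: "continuous_on {0..1} v"
    using c C1_curve_continuous by (auto simp: C1_curve_def)
  have "bounded (c ` {0..1})" "bounded (v ` {0..1})"
    using compact_continuous_image[OF contc] compact_continuous_image[OF contv] compact_imp_bounded compact_Icc by blast+
  then obtain R1 R2 where "\<forall>t\<in>{0..1}. norm (c t) \<le> R1" "\<forall>t\<in>{0..1}. norm (v t) \<le> R2"
    unfolding bounded_iff by blast
  then obtain R where Rc: "\<And>t. t \<in> {0..1} \<Longrightarrow> norm (c t) \<le> R" and Rv: "\<And>t. t \<in> {0..1} \<Longrightarrow> norm (v t) \<le> R"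
    using that[of "max R1 R2"] by (metis max.coboundedI1 max.coboundedI2)
  show ?thesis unfolding polygon_energy_def energy_def
  proof (rule riemann_sum_limit[OF cont_energy_density[OF contc contv] r])
    fix \<epsilon> :: real assume "\<epsilon> > 0"
    obtain d where "d > 0" and d: "\<And>x y v w :: 'a. norm x \<le> R + 1 \<Longrightarrow> norm y \<le> R + 1 \<Longrightarrow> norm v \<le> R + 1 \<Longrightarrow> norm w \<le> R + 1 \<Longrightarrow>
        norm (x - y) < d \<Longrightarrow> norm (v - w) < d \<Longrightarrow> \<bar>e x v - e y w\<bar> < \<epsilon>"
      using uniform_on_bounded[OF cont_e \<open>\<epsilon> > 0\<close>, of "R + 1"] by (metis fst_conv snd_conv)
    define d' where "d' = min d 1 / 2"
    have d': "d' > 0" "d' < d" "d' < 1" using \<open>d > 0\<close> by (auto simp: d'_def min_def)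
    have "uniformly_continuous_on {0..1} v" using contv by (intro compact_uniformly_continuous) auto
    then obtain s where "s > 0" and s: "\<And>x y. x \<in> {0..1} \<Longrightarrow> y \<in> {0..1} \<Longrightarrow> dist y x < s \<Longrightarrow> dist (v y) (v x) < d'"
      unfolding uniformly_continuous_on_def using d' by metis
    obtain M where M: "real M > 1 / s" using reals_Archimedean2 by blast
    have "\<bar>e (c (real k / real (Suc (r n)))) (real (Suc (r n)) *\<^sub>R (c (real (Suc k) / real (Suc (r n))) - c (real k / real (Suc (r n)))))
        - e (c (real k / real (Suc (r n)))) (v (real k / real (Suc (r n))))\<bar> < \<epsilon>" if n: "n \<ge> M" and k: "k < Suc (r n)" for n k
    proof -
      let ?N = "real (Suc (r n))" let ?a = "real k / ?N" let ?b = "real (Suc k) / ?N"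
      have "n \<le> r n" using r by (rule strict_mono_imp_increasing)
      then have "real M \<le> ?N" using n by simp
      then have "1 / s < ?N" using M by linarith
      then have inv: "1 / ?N < s" using \<open>s > 0\<close> by (simp add: field_simps del: of_nat_Suc)
      have ba: "?b - ?a = 1 / ?N" by (simp add: diff_divide_distrib[symmetric])
      have "0 < 1 / ?N" by simp
      then have ab: "?a \<le> ?b" using ba by linarith
      have ab01: "0 \<le> ?a" "?b \<le> 1" using k by (simp_all del: of_nat_Suc)
      have a01: "?a \<in> {0..1}" using ab ab01 by simp
      have "norm (c ?b - c ?a - (?b - ?a) *\<^sub>R v ?a) \<le> norm (?b - ?a) * d'"
      proof (rule vector_differentiable_bound_linearization[of "{?a..?b}"])
        show "(c has_vector_derivative v t) (at t within {?a..?b})" if "t \<in> {?a..?b}" for t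
        proof -
          have "t \<in> {0..1}" using that ab01 unfolding atLeastAtMost_iff by linarith
          then have "(c has_vector_derivative v t) (at t within {0..1})" using c by (simp add: C1_curve_def)
          then show ?thesis by (rule has_vector_derivative_within_subset) (use ab01 in auto)
        qed
        show "closed_segment ?a ?b \<subseteq> {?a..?b}" using ab by (simp add: closed_segment_eq_real_ivl)
        show "norm (v t - v ?a) \<le> d'" if "t \<in> {?a..?b}" for t
        proof -
          have "t \<in> {0..1}" using that ab01 unfolding atLeastAtMost_iff by linarith
          moreover have "dist t ?a < s" using that inv ba unfolding dist_real_def atLeastAtMost_iff by linarith
          ultimately show ?thesis using s[OF a01, of t] by (simp add: dist_norm)
        qed
        show "?a \<in> {?a..?b}" using ab by simp
      qed
      then have "?N * norm (c ?b - c ?a - (1 / ?N) *\<^sub>R v ?a) \<le> ?N * ((1 / ?N) * d')"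
        unfolding ba by (intro mult_left_mono) (auto simp del: of_nat_Suc)
      also have "?N * ((1 / ?N) * d') = d'" by (simp del: of_nat_Suc)
      also have "?N * norm (c ?b - c ?a - (1 / ?N) *\<^sub>R v ?a) = norm (?N *\<^sub>R (c ?b - c ?a) - v ?a)"
      proof -
        have "?N *\<^sub>R (c ?b - c ?a - (1 / ?N) *\<^sub>R v ?a) = ?N *\<^sub>R (c ?b - c ?a) - v ?a"
          by (simp add: scaleR_diff_right del: of_nat_Suc)
        then show ?thesis by (metis norm_scaleR abs_of_nat)
      qed
      finally have close: "norm (?N *\<^sub>R (c ?b - c ?a) - v ?a) \<le> d'" .
      then have "norm (?N *\<^sub>R (c ?b - c ?a)) \<le> R + 1"
        using norm_triangle_sub[of "?N *\<^sub>R (c ?b - c ?a)" "v ?a"] Rv[OF a01] d' by linarith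
      then show ?thesis
        using Rc[OF a01] Rv[OF a01] close d' by (intro d) (auto simp del: of_nat_Suc)
    qed
    then show "\<exists>N. \<forall>n\<ge>N. \<forall>k<Suc (r n). \<bar>e (c (real k / real (Suc (r n)))) (real (Suc (r n)) *\<^sub>R (c (real (Suc k) / real (Suc (r n))) - c (real k / real (Suc (r n)))))
        - e (c (real k / real (Suc (r n)))) (v (real k / real (Suc (r n))))\<bar> < \<epsilon>"
      by blast
  qed
qed

text \<open>Minimizing polygons satisfy a difference form of Hamilton's equations, with positions
  and momenta bounded independently of \<open>n\<close>. The limit solves these equations, so its
  regularity is automatic, and its energy is the limit of the minimal polygon energies, which are at
  most those of the polygons inscribed in any competitor.\<close>

theorem minimizer_exists:
  obtains c P where "c 0 = p" "c 1 = q" "C1_curve c (\<lambda>t. psi (c t) (P t))"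
    "C1_curve P (\<lambda>t. ex (c t) (psi (c t) (P t)))"
    "\<And>z w. C1_curve z w \<Longrightarrow> z 0 = p \<Longrightarrow> z 1 = q \<Longrightarrow> energy e c (\<lambda>t. psi (c t) (P t)) \<le> energy e z w"
proof -
  define line where "line t = p + t *\<^sub>R (q - p)" for t :: real
  have line: "C1_curve line (\<lambda>_. q - p)"
    unfolding C1_curve_def line_def by (auto intro!: derivative_eq_intros)
  obtain X where X: "\<And>n. X n 0 = p" "\<And>n. X n (Suc n) = q"
    and Xmin: "\<And>n z. z 0 = p \<Longrightarrow> z (Suc n) = q \<Longrightarrow> polygon_energy (Suc n) (X n) \<le> polygon_energy (Suc n) z"
  proof -
    have "\<exists>x. x 0 = p \<and> x (Suc n) = q \<and> (\<forall>z. z 0 = p \<longrightarrow> z (Suc n) = q \<longrightarrow> polygon_energy (Suc n) x \<le> polygon_energy (Suc n) z)" for n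
      using polygon_minimizer[of "Suc n" p q] by (metis zero_less_Suc)
    then show ?thesis using that by metis
  qed
  define V where "V n k = real (Suc n) *\<^sub>R (X n (Suc k) - X n k)" for n k
  \<comment> \<open>\<open>Q n (Suc k)\<close> is the momentum of segment \<open>k\<close>. The
    value \<open>Q n 0\<close> is chosen backwards so that the recursion \<open>Qd\<close> holds
    from the first step on.\<close>
  define Q where "Q n k = (case k of 0 \<Rightarrow> ev (X n 0) (V n 0) - (1 / real (Suc n)) *\<^sub>R ex (X n 0) (V n 0) | Suc j \<Rightarrow> ev (X n j) (V n j))" for n k
  have QS: "Q n (Suc k) = ev (X n k) (V n k)" for n k by (simp add: Q_def)
  have Qd: "Q n (Suc k) - Q n k = (1 / real (Suc n)) *\<^sub>R ex (X n k) (V n k)" if "k < Suc n" for n k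
  proof (cases k)
    case 0
    then show ?thesis by (simp add: Q_def)
  next
    case (Suc j)
    have "ev (X n k) (V n k) - ev (X n (k - 1)) (V n (k - 1)) = (1 / real (Suc n)) *\<^sub>R ex (X n k) (V n k)"
      unfolding V_def using that Suc X Xmin by (intro polygon_euler_lagrange) auto
    then show ?thesis using Suc by (simp add: Q_def)
  qed
  have VQ: "V n k = psi (X n k) (Q n (Suc k))" for n k by (simp add: QS psi_ev)
  have id: "strict_mono (\<lambda>n::nat. n)" by (simp add: strict_mono_def)
  \<comment> \<open>Polygons inscribed in the straight segment have convergent and hence bounded
    energies, which gives one energy bound for all \<open>n\<close>.\<close>
  have "convergent (\<lambda>n. polygon_energy (Suc n) (\<lambda>k. line (real k / real (Suc n))))"
    using sampled_energy_limit[OF line id] by (auto simp: convergent_def)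
  from convergent_imp_Bseq[OF this] obtain B where B: "\<And>n. \<bar>polygon_energy (Suc n) (\<lambda>k. line (real k / real (Suc n)))\<bar> \<le> B"
    unfolding Bseq_def real_norm_def by blast
  have EB: "polygon_energy (Suc n) (X n) \<le> B" for n
  proof -
    have "polygon_energy (Suc n) (X n) \<le> polygon_energy (Suc n) (\<lambda>k. line (real k / real (Suc n)))"
      by (rule Xmin) (auto simp: line_def simp del: of_nat_Suc)
    then show ?thesis using B[of n] by linarith
  qed
  have B0: "B \<ge> 0" using B[of 0] by linarith
  have QB: "norm (Q n k) \<le> C * (1 + B / lam) + C * (B / lam)" if "k \<le> Suc n" for n k
    by (rule momentum_bounds[where x = "X n" and N = "Suc n"]) (use EB that QS Qd V_def in \<open>auto simp del: of_nat_Suc\<close>)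
  \<comment> \<open>In contrast to \<open>polygon_bound\<close> this is uniform in \<open>n\<close>:
    the length of the polygon is the mean of the norms of its velocities, and |v| <= 1/2 + |v|^2 /
    2.\<close>
  have XB: "norm (X n k) \<le> norm p + (1 + B / lam)" if "k \<le> Suc n" for n k
  proof -
    let ?N = "real (Suc n)"
    have le: "norm (X n (Suc j) - X n j) \<le> (1 / ?N) * (1 / 2 + w / 2)" if "w = (norm (V n j))\<^sup>2" for j w
    proof -
      have "X n (Suc j) - X n j = (1 / ?N) *\<^sub>R V n j" by (simp add: V_def del: of_nat_Suc)
      then have "norm (X n (Suc j) - X n j) = (1 / ?N) * norm (V n j)" by (simp del: of_nat_Suc)
      also have "norm (V n j) \<le> 1 / 2 + w / 2"
        using sum_squares_bound[of "norm (V n j)" 1] that by (simp add: power2_eq_square)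
      finally show ?thesis by (simp add: mult_left_mono divide_right_mono del: of_nat_Suc)
    qed
    have "lam * (\<Sum>k<Suc n. (norm (V n k))\<^sup>2) \<le> (\<Sum>k<Suc n. e (X n k) (V n k))"
      unfolding sum_distrib_left by (intro sum_mono lower)
    also have "\<dots> = ?N * polygon_energy (Suc n) (X n)" by (simp add: polygon_energy_def V_def del: of_nat_Suc sum.lessThan_Suc)
    also have "\<dots> \<le> ?N * B" using EB by (intro mult_left_mono) auto
    finally have sumw: "(\<Sum>k<Suc n. (norm (V n k))\<^sup>2) \<le> ?N * (B / lam)" using lam by (simp add: field_simps del: of_nat_Suc sum.lessThan_Suc)
    have eq: "X n k - X n 0 = (\<Sum>j<k. X n (Suc j) - X n j)" by (rule sum_lessThan_telescope[symmetric])
    have "norm (X n k - X n 0) \<le> (\<Sum>j<k. (1 / ?N) * (1 / 2 + (norm (V n j))\<^sup>2 / 2))"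
      unfolding eq by (intro sum_norm_le le) auto
    also have "\<dots> \<le> (\<Sum>j<Suc n. (1 / ?N) * (1 / 2 + (norm (V n j))\<^sup>2 / 2))"
      using that by (intro sum_mono2) auto
    also have "\<dots> = (1 / ?N) * (\<Sum>j<Suc n. 1 / 2) + (1 / ?N) * ((\<Sum>j<Suc n. (norm (V n j))\<^sup>2) / 2)"
      by (simp only: sum_distrib_left[symmetric] sum.distrib sum_divide_distrib[symmetric] distrib_left)
    also have "\<dots> \<le> (1 / ?N) * (?N * (1 / 2)) + (1 / ?N) * (?N * (B / lam) / 2)"
      using sumw by (intro add_mono mult_left_mono divide_right_mono) (auto simp del: sum.lessThan_Suc)
    also have "\<dots> = 1 / 2 + B / lam / 2" by (simp del: of_nat_Suc)
    also have "1 / 2 + x / 2 \<le> 1 + x" if "0 \<le> x" for x :: real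
      using that by linarith
    from this[OF divide_nonneg_pos[OF B0 lam]] have "1 / 2 + B / lam / 2 \<le> 1 + B / lam" .
    finally have "norm (X n k - p) \<le> 1 + B / lam" unfolding X(1) .
    then show ?thesis using norm_triangle_sub[of "X n k" p] by linarith
  qed
  define R where "R = (norm p + (1 + B / lam)) + (C * (1 + B / lam) + C * (B / lam))"
  have BL: "B / lam \<ge> 0" using B0 lam by simp
  have R1: "norm (X n k) \<le> R" "norm (Q n k) \<le> R" if "k \<le> Suc n" for n k
  proof -
    have "0 \<le> C * (1 + B / lam) + C * (B / lam)"
      by (intro add_nonneg_nonneg mult_nonneg_nonneg C_nonneg BL zero_le_one)
    then show "norm (X n k) \<le> R" using XB[OF that] unfolding R_def by linarith
    have "0 \<le> norm p + (1 + B / lam)" by (intro add_nonneg_nonneg BL zero_le_one norm_ge_zero)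
    then show "norm (Q n k) \<le> R" using QB[OF that] unfolding R_def by linarith
  qed
  \<comment> \<open>Hamilton's equations with the old position taken from \<open>u\<close> and the
    new momentum from \<open>w\<close>; with this pairing the recursion is exact and not merely
    approximate.\<close>
  define F where "F u w = (psi (fst u) (snd w), ex (fst u) (psi (fst u) (snd w)))" for u w :: "'a \<times> 'a"
  have cpsi: "continuous_on UNIV (\<lambda>z. psi (fst (fst z)) (snd (snd z)))" for z :: "('a \<times> 'a) \<times> ('a \<times> 'a)"
    by (rule continuous_on_compose2[OF cont_psi, where f = "\<lambda>z. (fst (fst z), snd (snd z))", simplified]) (intro continuous_intros)
  have cex: "continuous_on UNIV (\<lambda>z. ex (fst (fst z)) (psi (fst (fst z)) (snd (snd z))))" for z :: "('a \<times> 'a) \<times> ('a \<times> 'a)"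
    by (rule continuous_on_compose2[OF cont_ex, where f = "\<lambda>z. (fst (fst z), psi (fst (fst z)) (snd (snd z)))", simplified])
      (intro continuous_intros cpsi)
  have contF: "continuous_on UNIV (\<lambda>(u, w). F u w)"
    unfolding F_def case_prod_beta by (intro continuous_on_Pair cpsi cex)
  obtain Y and r :: "nat \<Rightarrow> nat" where r: "strict_mono r"
    and Yd: "\<And>t. t \<in> {0..1} \<Longrightarrow> (Y has_vector_derivative F (Y t) (Y t)) (at t within {0..1})"
    and Yc: "\<And>\<epsilon>. \<epsilon> > 0 \<Longrightarrow> \<exists>N. \<forall>n\<ge>N. \<forall>k\<le>Suc (r n). norm ((X (r n) k, Q (r n) k) - Y (real k / real (Suc (r n)))) < \<epsilon>"
  proof (rule discrete_limit[OF contF, of "\<lambda>n k. (X n k, Q n k)" "R + R"])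
    show "norm (X n k, Q n k) \<le> R + R" if "k \<le> Suc n" for n k
      using R1[OF that] norm_Pair_le[of "X n k" "Q n k"] by linarith
    show "(X n (Suc k), Q n (Suc k)) - (X n k, Q n k) = (1 / real (Suc n)) *\<^sub>R F (X n k, Q n k) (X n (Suc k), Q n (Suc k))"
      if "k < Suc n" for n k
    proof -
      have "X n (Suc k) - X n k = (1 / real (Suc n)) *\<^sub>R V n k" by (simp add: V_def del: of_nat_Suc)
      then show ?thesis using Qd[OF that] unfolding F_def fst_conv snd_conv VQ[symmetric] by simp
    qed
  qed blast
  define c where "c t = fst (Y t)" for t
  define P where "P t = snd (Y t)" for t
  have cd: "(c has_vector_derivative psi (c t) (P t)) (at t within {0..1})"
    and Pd: "(P has_vector_derivative ex (c t) (psi (c t) (P t))) (at t within {0..1})" if "t \<in> {0..1}" for t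
    using bounded_linear.has_vector_derivative[OF bounded_linear_fst Yd[OF that]]
      bounded_linear.has_vector_derivative[OF bounded_linear_snd Yd[OF that]]
    by (simp_all only: F_def c_def[abs_def] P_def[abs_def] fst_conv snd_conv)
  have contc: "continuous_on {0..1} c" and contP: "continuous_on {0..1} P"
    using cd Pd has_vector_derivative_continuous unfolding continuous_on_eq_continuous_within by blast+
  have contv: "continuous_on {0..1} (\<lambda>t. psi (c t) (P t))"
    using continuous_on_compose2[OF cont_psi continuous_on_Pair[OF contc contP]] by simp
  have contw: "continuous_on {0..1} (\<lambda>t. ex (c t) (psi (c t) (P t)))"
    using continuous_on_compose2[OF cont_ex continuous_on_Pair[OF contc contv]] by simp
  have C1: "C1_curve c (\<lambda>t. psi (c t) (P t))" "C1_curve P (\<lambda>t. ex (c t) (psi (c t) (P t)))"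
    unfolding C1_curve_def using cd Pd contv contw by auto
  have Ylim: "fst (Y t) = a" if "t \<in> {0,1}" "\<And>n. X n (if t = 0 then 0 else Suc n) = a" for t a
  proof -
    have "norm (a - fst (Y t)) < \<epsilon>" if eps: "\<epsilon> > 0" for \<epsilon>
    proof -
      obtain N where N: "\<And>k. k \<le> Suc (r N) \<Longrightarrow> norm ((X (r N) k, Q (r N) k) - Y (real k / real (Suc (r N)))) < \<epsilon>"
        using Yc[OF eps] by blast
      let ?k = "if t = 0 then 0 else Suc (r N)"
      have "norm ((X (r N) ?k, Q (r N) ?k) - Y t) < \<epsilon>" using N[of ?k] \<open>t \<in> {0,1}\<close> by (auto simp del: of_nat_Suc)
      moreover have "norm (fst ((X (r N) ?k, Q (r N) ?k) - Y t)) \<le> norm ((X (r N) ?k, Q (r N) ?k) - Y t)"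
        by (rule norm_fst)
      ultimately show ?thesis using \<open>\<And>n. X n (if t = 0 then 0 else Suc n) = a\<close>[of "r N"] by (simp only: fst_diff fst_conv)
    qed
    then show ?thesis by (metis less_irrefl right_minus_eq zero_less_norm_iff)
  qed
  have c0: "c 0 = p" using Ylim[of 0 p] X by (simp add: c_def)
  have c1: "c 1 = q" using Ylim[of 1 q] X by (simp add: c_def)
  \<comment> \<open>The velocity of segment \<open>k\<close> belongs to the momentum at index
    \<open>Suc k\<close>; the shift by one grid step is absorbed by the uniform continuity of
    \<open>P\<close>.\<close>
  have E1: "(\<lambda>n. polygon_energy (Suc (r n)) (X (r n))) \<longlonglongrightarrow> energy e c (\<lambda>t. psi (c t) (P t))"
    unfolding polygon_energy_def energy_def
  proof (rule riemann_sum_limit[OF cont_energy_density[OF contc contv] r])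
    fix \<epsilon> :: real assume "\<epsilon> > 0"
    define g where "g z = e (fst z) (psi (fst z) (snd z))" for z
    have contg: "continuous_on UNIV g"
      unfolding g_def by (intro cont_energy_density continuous_intros cont_psi)
    have "bounded (Y ` {0..1})"
      by (intro compact_imp_bounded compact_continuous_image compact_Icc)
        (use Yd has_vector_derivative_continuous in \<open>unfold continuous_on_eq_continuous_within, blast\<close>)
    then obtain R2 where R2: "\<And>t. t \<in> {0..1} \<Longrightarrow> norm (Y t) \<le> R2" unfolding bounded_iff by blast
    have R2': "norm (c t) \<le> R2" "norm (P t) \<le> R2" if "t \<in> {0..1}" for t
      using R2[OF that] norm_fst[of "Y t"] norm_snd[of "Y t"] unfolding c_def P_def by linarith+
    obtain d where "d > 0" and d: "\<And>x y v w :: 'a. norm x \<le> max R R2 \<Longrightarrow> norm y \<le> max R R2 \<Longrightarrow> norm v \<le> max R R2 \<Longrightarrow> norm w \<le> max R R2 \<Longrightarrow>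
        norm (x - y) < d \<Longrightarrow> norm (v - w) < d \<Longrightarrow> \<bar>g (x, v) - g (y, w)\<bar> < \<epsilon>"
      using uniform_on_bounded[OF contg \<open>\<epsilon> > 0\<close>, of "max R R2"] by metis
    have "uniformly_continuous_on {0..1} P" using contP by (intro compact_uniformly_continuous) auto
    then obtain s where "s > 0" and s: "\<And>x y. x \<in> {0..1} \<Longrightarrow> y \<in> {0..1} \<Longrightarrow> dist y x < s \<Longrightarrow> dist (P y) (P x) < d / 2"
      unfolding uniformly_continuous_on_def using \<open>d > 0\<close> by (metis half_gt_zero)
    obtain M where M: "real M > 1 / s" using reals_Archimedean2 by blast
    obtain N1 where N1: "\<And>n k. n \<ge> N1 \<Longrightarrow> k \<le> Suc (r n) \<Longrightarrow> norm ((X (r n) k, Q (r n) k) - Y (real k / real (Suc (r n)))) < d / 2"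
      using Yc[of "d / 2"] \<open>d > 0\<close> by (metis half_gt_zero)
    have "\<bar>e (X (r n) k) (real (Suc (r n)) *\<^sub>R (X (r n) (Suc k) - X (r n) k))
        - e (c (real k / real (Suc (r n)))) (psi (c (real k / real (Suc (r n)))) (P (real k / real (Suc (r n)))))\<bar> < \<epsilon>"
      if n: "n \<ge> max M N1" and k: "k < Suc (r n)" for n k
    proof -
      let ?N = "real (Suc (r n))" let ?a = "real k / ?N" let ?b = "real (Suc k) / ?N"
      have "n \<le> r n" using r by (rule strict_mono_imp_increasing)
      then have "real M \<le> ?N" using n by simp
      then have "1 / s < ?N" using M by linarith
      then have inv: "1 / ?N < s" using \<open>s > 0\<close> by (simp add: field_simps del: of_nat_Suc)
      have ba: "?b - ?a = 1 / ?N" by (simp add: diff_divide_distrib[symmetric])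
      have "0 < 1 / ?N" by simp
      then have ab: "?a \<le> ?b" using ba by linarith
      have "0 \<le> ?a" "?b \<le> 1" using k by (simp_all del: of_nat_Suc)
      then have a01: "?a \<in> {0..1}" "?b \<in> {0..1}" using ab by auto
      have "dist ?b ?a < s" using inv ba ab by (simp add: dist_real_def)
      then have "norm (P ?b - P ?a) < d / 2" using s[OF a01] by (simp add: dist_norm)
      moreover have "norm (snd ((X (r n) (Suc k), Q (r n) (Suc k)) - Y ?b)) < d / 2"
        using N1[of n "Suc k"] n k norm_snd[of "(X (r n) (Suc k), Q (r n) (Suc k)) - Y ?b"] by linarith
      then have "norm (Q (r n) (Suc k) - P ?b) < d / 2" by (simp add: P_def del: of_nat_Suc)
      ultimately have dQ: "norm (Q (r n) (Suc k) - P ?a) < d"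
        using norm_triangle_ineq[of "Q (r n) (Suc k) - P ?b" "P ?b - P ?a"] by (simp del: of_nat_Suc)
      have "norm (fst ((X (r n) k, Q (r n) k) - Y ?a)) < d / 2"
        using N1[of n k] n k norm_fst[of "((X (r n) k, Q (r n) k) - Y ?a)"] by linarith
      then have dX: "norm (X (r n) k - c ?a) < d" using \<open>d > 0\<close> by (simp add: c_def del: of_nat_Suc)
      have "\<bar>g (X (r n) k, Q (r n) (Suc k)) - g (c ?a, P ?a)\<bar> < \<epsilon>"
        using dX dQ R2'[OF a01(1)] R1[of k "r n"] R1[of "Suc k" "r n"] k by (intro d) (auto simp del: of_nat_Suc)
      then show ?thesis by (simp add: g_def VQ[symmetric] V_def del: of_nat_Suc)
    qed
    then show "\<exists>N. \<forall>n\<ge>N. \<forall>k<Suc (r n). \<bar>e (X (r n) k) (real (Suc (r n)) *\<^sub>R (X (r n) (Suc k) - X (r n) k))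
        - e (c (real k / real (Suc (r n)))) (psi (c (real k / real (Suc (r n)))) (P (real k / real (Suc (r n)))))\<bar> < \<epsilon>"
      by blast
  qed
  have "energy e c (\<lambda>t. psi (c t) (P t)) \<le> energy e z w" if z: "C1_curve z w" "z 0 = p" "z 1 = q" for z w
  proof (rule LIMSEQ_le[OF E1 sampled_energy_limit[OF z(1) r]])
    show "\<exists>N. \<forall>n\<ge>N. polygon_energy (Suc (r n)) (X (r n)) \<le> polygon_energy (Suc (r n)) (\<lambda>k. z (real k / real (Suc (r n))))"
      using z by (intro exI[of _ 0] allI impI Xmin) (auto simp del: of_nat_Suc)
  qed
  then show ?thesis using that[OF c0 c1 C1] by blast
qed

end

text \<open>Cauchy-Schwarz in the form of a square: integrate (|v| - s)^2 >= 0, where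
  \<open>s\<close> is the distance of the end points.\<close>

lemma energy_lower_bound:
  fixes c :: "real \<Rightarrow> 'a::euclidean_space"
  assumes c: "C1_curve c v" and f: "f integrable_on {0..1}"
    and low: "\<And>t. t \<in> {0..1} \<Longrightarrow> l * (norm (v t))\<^sup>2 \<le> f t" and "l > 0"
  shows "l * (norm (c 1 - c 0))\<^sup>2 \<le> integral {0..1} f"
proof -
  define s where "s = norm (c 1 - c 0)"
  have cd: "(c has_vector_derivative v t) (at t within {0..1})" if "t \<in> {0..1}" for t
    using c that by (simp add: C1_curve_def)
  have cv: "continuous_on {0..1} v" using c by (simp add: C1_curve_def)
  have "(v has_integral (c 1 - c 0)) {0..1}"
    by (rule fundamental_theorem_of_calculus) (use cd in auto)
  then have "s = norm (integral {0..1} v)" by (simp add: s_def integral_unique)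
  also have "\<dots> \<le> integral {0..1} (\<lambda>t. norm (v t))"
    by (intro integral_norm_bound_integral integrable_continuous_interval continuous_intros cv) auto
  finally have 1: "s \<le> integral {0..1} (\<lambda>t. norm (v t))" .
  have "2 * l * s * integral {0..1} (\<lambda>t. norm (v t)) - l * s\<^sup>2 = integral {0..1} (\<lambda>t. 2 * l * s * norm (v t) - l * s\<^sup>2)"
    by (subst integral_diff) (auto intro!: integrable_continuous_interval continuous_intros cv)
  also have "\<dots> \<le> integral {0..1} f"
  proof (intro integral_le f integrable_continuous_interval continuous_intros cv)
    fix t :: real assume t: "t \<in> {0..1}"
    have "0 \<le> l * (norm (v t) - s)\<^sup>2" using \<open>l > 0\<close> by simp
    also have "\<dots> = l * (norm (v t))\<^sup>2 - (2 * l * s * norm (v t) - l * s\<^sup>2)"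
      by (simp add: power2_eq_square algebra_simps)
    finally show "2 * l * s * norm (v t) - l * s\<^sup>2 \<le> f t" using low[OF t] by linarith
  qed
  finally have 2: "2 * l * s * integral {0..1} (\<lambda>t. norm (v t)) - l * s\<^sup>2 \<le> integral {0..1} f" .
  have "2 * l * s * s \<le> 2 * l * s * integral {0..1} (\<lambda>t. norm (v t))"
    using 1 \<open>l > 0\<close> by (intro mult_left_mono) (auto simp: s_def)
  then show ?thesis using 2 unfolding s_def[symmetric] by (simp add: power2_eq_square)
qed

text \<open>The infimum of the closed set of times outside the interior. It is a limit of times at
  which the curve is still inside, hence a time on the frontier.\<close>

lemma exit_time:
  fixes c :: "real \<Rightarrow> 'a::euclidean_space"
  assumes c: "continuous_on {0..1} c" "c 0 \<in> interior K" "c 1 \<notin> interior K"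
  obtains t0 where "0 < t0" "t0 \<le> 1" "c t0 \<in> frontier K" "\<And>t. 0 \<le> t \<Longrightarrow> t < t0 \<Longrightarrow> c t \<in> interior K"
proof -
  define A where "A = {t \<in> {0..1}. c t \<in> - interior K}"
  have "closed A" unfolding A_def
    by (intro continuous_closed_preimage[OF c(1), unfolded vimage_def Int_def mem_Collect_eq]) auto
  moreover have "1 \<in> A" using c by (simp add: A_def)
  moreover have bb: "bdd_below A" unfolding A_def by (intro bdd_belowI[of _ 0]) auto
  ultimately have inA: "Inf A \<in> A" using closed_contains_Inf[of A] by blast
  define t0 where "t0 = Inf A"
  have t0: "t0 \<in> {0..1}" "c t0 \<notin> interior K" using inA by (auto simp: A_def t0_def)
  then have "t0 \<noteq> 0" using c by auto
  have less: "c t \<in> interior K" if "0 \<le> t" "t < t0" for t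
  proof (rule ccontr)
    assume "c t \<notin> interior K"
    then have "t \<in> A" using that t0 by (simp add: A_def)
    then have "t0 \<le> t" unfolding t0_def using bb by (rule cInf_lower)
    then show False using that by simp
  qed
  have "c t0 \<in> closure K"
  proof -
    define u where "u n = t0 * (1 - inverse (real (Suc n)))" for n
    have "u \<longlonglongrightarrow> t0 * (1 - 0)" unfolding u_def by (intro tendsto_intros LIMSEQ_inverse_real_of_nat)
    then have "u \<longlonglongrightarrow> t0" by simp
    moreover have u: "0 \<le> u n \<and> u n < t0" for n
    proof -
      have "inverse (real (Suc n)) \<le> 1" by (simp add: inverse_le_1_iff)
      moreover have "0 < inverse (real (Suc n))" by simp
      moreover have "0 < t0" using t0 \<open>t0 \<noteq> 0\<close> by simp
      ultimately show ?thesis unfolding u_def by (simp add: field_simps del: of_nat_Suc)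
    qed
    moreover have "u n \<in> {0..1}" for n using u[of n] t0 by auto
    ultimately have "(\<lambda>n. c (u n)) \<longlonglongrightarrow> c t0"
      using continuous_on_tendsto_compose[OF c(1) \<open>u \<longlonglongrightarrow> t0\<close> t0(1)] by simp
    moreover have "\<forall>n. c (u n) \<in> K" using less u interior_subset by blast
    ultimately show ?thesis unfolding closure_sequential by (intro exI[of _ "\<lambda>n. c (u n)"] conjI)
  qed
  then have "c t0 \<in> frontier K" using t0 by (simp add: frontier_def)
  then show ?thesis using that[of t0] t0 \<open>t0 \<noteq> 0\<close> less by auto
qed

lemma C1_curve_rescale:
  assumes c: "C1_curve c v" and s: "0 \<le> s" "s \<le> 1"
  shows "C1_curve (\<lambda>t. c (s * t)) (\<lambda>t. s *\<^sub>R v (s * t))"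
proof -
  have in01: "s * t \<in> {0..1}" if "t \<in> {0..1}" for t
    using that s by (auto intro: mult_le_one)
  show ?thesis unfolding C1_curve_def
  proof (intro conjI ballI)
    fix t :: real assume t: "t \<in> {0..1}"
    have "((\<lambda>t. s * t) has_vector_derivative s) (at t within {0..1})"
      by (auto intro!: derivative_eq_intros simp: has_real_derivative_iff_has_vector_derivative[symmetric])
    moreover have "(c has_vector_derivative v (s * t)) (at (s * t) within (\<lambda>t. s * t) ` {0..1})"
      using c in01[OF t] in01 unfolding C1_curve_def by (blast intro: has_vector_derivative_within_subset)
    ultimately show "((\<lambda>t. c (s * t)) has_vector_derivative s *\<^sub>R v (s * t)) (at t within {0..1})"
      using vector_diff_chain_within[of "\<lambda>t. s * t" s t "{0..1}" c] by (simp add: o_def)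
  next
    have "continuous_on {0..1} v" using c by (simp add: C1_curve_def)
    then have "continuous_on {0..1} (\<lambda>t. v (s * t))"
      by (rule continuous_on_compose2) (use in01 in \<open>auto intro!: continuous_intros\<close>)
    then show "continuous_on {0..1} (\<lambda>t. s *\<^sub>R v (s * t))"
      by (intro continuous_on_scaleR continuous_on_const)
  qed
qed

section \<open>The action of a quadratic Lagrangian as a function of the end point\<close>

locale quadratic_lagrangian = lagrangian +
  assumes scale: "e x (s *\<^sub>R v) = s\<^sup>2 * e x v"
begin

text \<open>For the kinetic energy of a metric this is half the squared distance. The action is
  preferred to the distance because minimizers of the energy solve Hamilton's equations and so come
  with constant speed.\<close>

definition action :: "'a \<Rightarrow> 'a \<Rightarrow> real" where
  "action p q = Inf {E. \<exists>c v. C1_curve c v \<and> c 0 = p \<and> c 1 = q \<and> E = energy e c v}"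

lemma integrable_density:
  assumes "C1_curve c v"
  shows "(\<lambda>t. e (c t) (v t)) integrable_on {0..1}"
proof (rule integrable_continuous_interval[OF cont_energy_density])
  show "continuous_on {0..1} c" using assms by (rule C1_curve_continuous)
  show "continuous_on {0..1} v" using assms by (simp add: C1_curve_def)
qed

lemma energy_nonneg: "C1_curve c v \<Longrightarrow> energy e c v \<ge> 0"
  unfolding energy_def by (rule integral_nonneg[OF integrable_density e_nonneg])

lemma action_le:
  assumes "C1_curve c v" "c 0 = p" "c 1 = q"
  shows "action p q \<le> energy e c v"
  unfolding action_def using assms energy_nonneg
  by (intro cInf_lower) (auto intro!: bdd_belowI[of _ 0])

lemma action_attained:
  obtains c P where "c 0 = p" "c 1 = q" "C1_curve c (\<lambda>t. psi (c t) (P t))"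
    "C1_curve P (\<lambda>t. ex (c t) (psi (c t) (P t)))" "energy e c (\<lambda>t. psi (c t) (P t)) = action p q"
proof -
  obtain c P where c: "c 0 = p" "c 1 = q" "C1_curve c (\<lambda>t. psi (c t) (P t))"
    "C1_curve P (\<lambda>t. ex (c t) (psi (c t) (P t)))"
    and min: "\<And>z w. C1_curve z w \<Longrightarrow> z 0 = p \<Longrightarrow> z 1 = q \<Longrightarrow> energy e c (\<lambda>t. psi (c t) (P t)) \<le> energy e z w"
    using minimizer_exists[of p q] by blast
  have "action p q = energy e c (\<lambda>t. psi (c t) (P t))"
    unfolding action_def using c min by (intro cInf_eq_minimum) blast+
  then show ?thesis using that c by simp
qed

lemma action_lower: "lam * (norm (q - p))\<^sup>2 \<le> action p q"
proof -
  obtain c P where c: "c 0 = p" "c 1 = q" "C1_curve c (\<lambda>t. psi (c t) (P t))"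
    "energy e c (\<lambda>t. psi (c t) (P t)) = action p q"
    using action_attained[of p q] by blast
  show ?thesis
    using energy_lower_bound[OF c(3) integrable_density[OF c(3)] lower lam] c by (simp add: energy_def)
qed

text \<open>Stretching the initial piece to unit time multiplies the density by s^2 and the time by
  1 / s.\<close>

lemma energy_rescale:
  assumes c: "C1_curve c v" and s: "0 < s" "s \<le> 1"
  shows "energy e (\<lambda>t. c (s * t)) (\<lambda>t. s *\<^sub>R v (s * t)) = s * integral {0..s} (\<lambda>t. e (c t) (v t))"
proof -
  have "(\<lambda>t. e (c t) (v t)) integrable_on {0..s}"
    by (rule integrable_on_subinterval[OF integrable_density[OF c]]) (use s in auto)
  then have "((\<lambda>t. e (c t) (v t)) has_integral integral {0..s} (\<lambda>t. e (c t) (v t))) (cbox 0 s)"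
    by (simp add: has_integral_integral)
  from has_integral_affinity[OF this, of s 0] s
  have "((\<lambda>t. e (c (s * t)) (v (s * t))) has_integral (1 / s) * integral {0..s} (\<lambda>t. e (c t) (v t))) {0..1}"
    by (simp add: image_affinity_atLeastAtMost_div_diff)
  from has_integral_mult_right[OF this, of "s\<^sup>2"] s
  have "((\<lambda>t. e (c (s * t)) (s *\<^sub>R v (s * t))) has_integral s * integral {0..s} (\<lambda>t. e (c t) (v t))) {0..1}"
    by (simp add: scale power2_eq_square)
  then show ?thesis unfolding energy_def by (rule integral_unique)
qed

lemma energy_rescale_le:
  assumes c: "C1_curve c v" and s: "0 < s" "s \<le> 1"
  shows "energy e (\<lambda>t. c (s * t)) (\<lambda>t. s *\<^sub>R v (s * t)) \<le> s * energy e c v"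
proof -
  have "integral {0..s} (\<lambda>t. e (c t) (v t)) \<le> energy e c v"
    unfolding energy_def
    by (intro integral_subset_le integrable_density[OF c] integrable_on_subinterval[OF integrable_density[OF c]])
      (use s e_nonneg in auto)
  then show ?thesis unfolding energy_rescale[OF assms] using s by (intro mult_left_mono) auto
qed

text \<open>Mean value theorem along the segment to (x + h, v + d). The polynomial
  \<open>3 * (norm v)\<^sup>2 + 4\<close> is the sum of 2 |v|^2 + 2, which bounds the squared
  velocity on the way, and |v|^2 + 2, which bounds the velocity itself.\<close>

lemma density_perturb:
  assumes "norm d \<le> 1" "norm h \<le> norm d"
  shows "e (x + h) (v + d) \<le> e x v + C * norm d * (3 * (norm v)\<^sup>2 + 4)"
proof -
  define \<phi> where "\<phi> s = e (x + s *\<^sub>R h) (v + s *\<^sub>R d)" for s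
  define \<phi>' where "\<phi>' s = ex (x + s *\<^sub>R h) (v + s *\<^sub>R d) \<bullet> h + ev (x + s *\<^sub>R h) (v + s *\<^sub>R d) \<bullet> d" for s
  have "(\<phi> has_real_derivative \<phi>' s) (at s)" for s
  proof -
    have A: "((\<lambda>s. (x + s *\<^sub>R h, v + s *\<^sub>R d)) has_derivative (\<lambda>t. (t *\<^sub>R h, t *\<^sub>R d))) (at s)"
      by (auto intro!: derivative_eq_intros)
    from has_derivative_compose[OF A deriv] have "(\<phi> has_derivative (\<lambda>t. t * \<phi>' s)) (at s)"
      unfolding \<phi>_def[abs_def] \<phi>'_def by (simp add: distrib_left)
    then show ?thesis unfolding has_field_derivative_def mult_commute_abs .
  qed
  then obtain s where s: "0 < s" "s < 1" "\<phi> 1 - \<phi> 0 = (1 - 0) * \<phi>' s"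
    using MVT2[of 0 1 \<phi> \<phi>'] by auto
  let ?v = "v + s *\<^sub>R d" and ?x = "x + s *\<^sub>R h"
  have nd: "norm (s *\<^sub>R d) \<le> 1" using s assms by (simp add: mult_le_one)
  then have nv: "norm ?v \<le> norm v + 1" using norm_triangle_ineq[of v "s *\<^sub>R d"] by linarith
  have nv2: "(norm ?v)\<^sup>2 \<le> 2 * (norm v)\<^sup>2 + 2"
  proof -
    have "(norm ?v)\<^sup>2 \<le> (norm v + 1)\<^sup>2" using nv by (intro power_mono) auto
    also have "\<dots> \<le> 2 * (norm v)\<^sup>2 + 2" using sum_squares_bound[of "norm v" 1] by (simp add: power2_eq_square algebra_simps)
    finally show ?thesis .
  qed
  have nv1: "norm ?v \<le> (norm v)\<^sup>2 + 2"
  proof -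
    have "2 * norm v \<le> (norm v)\<^sup>2 + 1" using sum_squares_bound[of "norm v" 1] by simp
    then show ?thesis using nv norm_ge_zero[of v] by linarith
  qed
  have "ex ?x ?v \<bullet> h \<le> norm (ex ?x ?v) * norm h" by (rule norm_cauchy_schwarz)
  also have "\<dots> \<le> (C * (2 * (norm v)\<^sup>2 + 2)) * norm d"
    using assms by (intro mult_mono order_trans[OF ex_bound] mult_left_mono C_nonneg nv2) (auto intro!: mult_nonneg_nonneg C_nonneg add_nonneg_nonneg)
  finally have 1: "ex ?x ?v \<bullet> h \<le> (C * (2 * (norm v)\<^sup>2 + 2)) * norm d" .
  have "ev ?x ?v \<bullet> d \<le> norm (ev ?x ?v) * norm d" by (rule norm_cauchy_schwarz)
  also have "\<dots> \<le> (C * ((norm v)\<^sup>2 + 2)) * norm d"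
    by (intro mult_right_mono order_trans[OF ev_bound] mult_left_mono C_nonneg nv1) auto
  finally have 2: "ev ?x ?v \<bullet> d \<le> (C * ((norm v)\<^sup>2 + 2)) * norm d" .
  have "\<phi> 1 - \<phi> 0 \<le> C * norm d * (3 * (norm v)\<^sup>2 + 4)"
    using 1 2 s unfolding \<phi>'_def by (simp add: algebra_simps)
  then show ?thesis by (simp add: \<phi>_def)
qed

text \<open>A minimizer to \<open>q\<close>, sheared by the drift t d, is a competitor for
  \<open>q + d\<close>. Only the action at \<open>q\<close> enters the error, since it bounds the
  mean square velocity of the minimizer.\<close>

lemma action_perturb:
  assumes d: "norm d \<le> 1"
  shows "action p (q + d) \<le> action p q + C * norm d * (3 * (action p q / lam) + 4)"
proof -
  obtain c P where c: "c 0 = p" "c 1 = q" "C1_curve c (\<lambda>t. psi (c t) (P t))"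
    and E: "energy e c (\<lambda>t. psi (c t) (P t)) = action p q"
    using action_attained[of p q] by blast
  let ?v = "\<lambda>t. psi (c t) (P t)"
  have cv: "continuous_on {0..1} ?v" using c by (simp add: C1_curve_def)
  have C1: "C1_curve (\<lambda>t. c t + t *\<^sub>R d) (\<lambda>t. ?v t + d)"
    using c(3) unfolding C1_curve_def by (auto intro!: derivative_eq_intros continuous_intros)
  have iv: "(\<lambda>t. (norm (?v t))\<^sup>2) integrable_on {0..1}"
    by (intro integrable_continuous_interval continuous_intros cv)
  have "lam * integral {0..1} (\<lambda>t. (norm (?v t))\<^sup>2) = integral {0..1} (\<lambda>t. lam * (norm (?v t))\<^sup>2)" by simp
  also have "\<dots> \<le> energy e c ?v" unfolding energy_def
    by (intro integral_le integrable_density c(3) lower integrable_on_mult_right iv)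
  finally have I: "integral {0..1} (\<lambda>t. (norm (?v t))\<^sup>2) \<le> action p q / lam"
    using lam E by (simp add: field_simps)
  have "action p (q + d) \<le> energy e (\<lambda>t. c t + t *\<^sub>R d) (\<lambda>t. ?v t + d)"
    by (rule action_le[OF C1]) (auto simp: c)
  also have "\<dots> \<le> integral {0..1} (\<lambda>t. e (c t) (?v t) + C * norm d * (3 * (norm (?v t))\<^sup>2 + 4))"
    unfolding energy_def
  proof (intro integral_le integrable_density[OF C1] density_perturb d)
    show "(\<lambda>t. e (c t) (?v t) + C * norm d * (3 * (norm (?v t))\<^sup>2 + 4)) integrable_on {0..1}"
      by (intro integrable_add integrable_density c(3) integrable_continuous_interval continuous_intros cv)
    show "norm (t *\<^sub>R d) \<le> norm d" if "t \<in> {0..1}" for t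
      using that by (simp add: mult_left_le_one_le)
  qed
  also have "\<dots> = action p q + C * norm d * (3 * integral {0..1} (\<lambda>t. (norm (?v t))\<^sup>2) + 4)"
  proof -
    have "((\<lambda>t. e (c t) (?v t) + C * norm d * (3 * (norm (?v t))\<^sup>2 + 4)) has_integral
        action p q + C * norm d * (3 * integral {0..1} (\<lambda>t. (norm (?v t))\<^sup>2) + 4)) {0..1}"
      unfolding E[symmetric] energy_def
      by (intro has_integral_add has_integral_mult_right integrable_integral integrable_density c(3) iv)
        (use has_integral_const_real[of "4::real" 0 1] in simp)
    then show ?thesis by (simp add: integral_unique)
  qed
  also have "\<dots> \<le> action p q + C * norm d * (3 * (action p q / lam) + 4)"
    using I C_nonneg by (intro add_left_mono mult_left_mono) auto
  finally show ?thesis .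
qed

lemma continuous_action: "continuous_on UNIV (action p)"
  unfolding continuous_on_eq_continuous_at[OF open_UNIV]
proof (intro ballI)
  fix q :: 'a
  \<comment> \<open>The error in \<open>action_perturb\<close> depends on the action at the base
    point. Going back from x to \<open>q\<close> therefore first needs a bound for the action near
    \<open>q\<close>: this is \<open>A\<close>, and \<open>B\<close> is the resulting Lipschitz
    constant.\<close>
  define A where "A = action p q + C * (3 * (action p q / lam) + 4)"
  define B where "B = C * (3 * (A / lam) + 4)"
  have a0: "action p q \<ge> 0" using order_trans[OF mult_nonneg_nonneg[OF less_imp_le[OF lam] zero_le_power2] action_lower] .
  have A0: "A \<ge> action p q" unfolding A_def using a0 lam C_nonneg by (simp add: add_nonneg_nonneg)
  have B0: "B \<ge> 0" unfolding B_def using a0 A0 lam C_nonneg by (intro mult_nonneg_nonneg add_nonneg_nonneg) auto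
  have up: "action p x \<le> A" if "norm (x - q) \<le> 1" for x
  proof -
    have "action p (q + (x - q)) \<le> action p q + C * norm (x - q) * (3 * (action p q / lam) + 4)"
      by (rule action_perturb[OF that])
    also have "\<dots> \<le> action p q + C * 1 * (3 * (action p q / lam) + 4)"
      using that a0 lam C_nonneg by (intro add_left_mono mult_right_mono mult_left_mono) auto
    finally show ?thesis by (simp add: A_def)
  qed
  have pert: "action p (y + d) - action p y \<le> B * norm d" if "action p y \<le> A" "norm d \<le> 1" for y d
  proof -
    have "action p (y + d) \<le> action p y + C * norm d * (3 * (action p y / lam) + 4)"
      by (rule action_perturb[OF that(2)])
    also have "\<dots> \<le> action p y + C * norm d * (3 * (A / lam) + 4)"
      using that lam C_nonneg by (intro add_left_mono mult_left_mono add_mono divide_right_mono) auto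
    finally show ?thesis by (simp add: B_def algebra_simps)
  qed
  have lip: "\<bar>action p x - action p q\<bar> \<le> B * norm (x - q)" if "norm (x - q) \<le> 1" for x
    using pert[of q "x - q"] pert[of x "q - x"] up[OF that] A0 that by (simp add: norm_minus_commute abs_le_iff)
  have ev: "eventually (\<lambda>x. norm (action p x - action p q) \<le> B * norm (x - q)) (at q)"
    unfolding eventually_at by (rule exI[of _ 1]) (auto simp: dist_norm intro!: lip)
  have "((\<lambda>x. B * norm (x - q)) \<longlongrightarrow> B * norm (q - q)) (at q)"
    by (intro tendsto_intros)
  then have "((\<lambda>x. B * norm (x - q)) \<longlongrightarrow> 0) (at q)" by simp
  from Lim_null_comparison[OF ev this] have "((\<lambda>x. action p x - action p q) \<longlongrightarrow> 0) (at q)" .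
  then show "isCont (action p) q" unfolding isCont_def by (simp add: LIM_zero_iff)
qed

lemma action_exit:
  assumes K: "p \<in> interior K" and c: "C1_curve c v" "c 0 = p" "c 1 \<notin> interior K"
  obtains t0 where "0 < t0" "t0 \<le> 1" "c t0 \<in> frontier K" "\<And>t. 0 \<le> t \<Longrightarrow> t < t0 \<Longrightarrow> c t \<in> interior K"
    "action p (c t0) \<le> t0 * energy e c v"
proof -
  obtain t0 where t0: "0 < t0" "t0 \<le> 1" "c t0 \<in> frontier K" "\<And>t. 0 \<le> t \<Longrightarrow> t < t0 \<Longrightarrow> c t \<in> interior K"
    using exit_time[of c K] C1_curve_continuous[OF c(1)] K c by blast
  have "action p (c t0) \<le> energy e (\<lambda>t. c (t0 * t)) (\<lambda>t. t0 *\<^sub>R v (t0 * t))"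
    using t0 c by (intro action_le C1_curve_rescale[OF c(1)]) auto
  also have "\<dots> \<le> t0 * energy e c v" using energy_rescale_le[OF c(1) t0(1,2)] .
  finally show ?thesis using that t0 by blast
qed

text \<open>The minimizer to a cheapest frontier point meets the frontier only at its end: at an
  earlier contact time t0 the action would be at most t0 times the minimum.\<close>

lemma frontier_minimizer:
  assumes K: "compact K" "p \<in> interior K"
  obtains c P where "c 0 = p" "c 1 \<in> frontier K" "\<And>t. 0 \<le> t \<Longrightarrow> t < 1 \<Longrightarrow> c t \<in> interior K"
    "C1_curve c (\<lambda>t. psi (c t) (P t))" "C1_curve P (\<lambda>t. ex (c t) (psi (c t) (P t)))"
    "energy e c (\<lambda>t. psi (c t) (P t)) = action p (c 1)"
    "\<And>x. x \<in> frontier K \<Longrightarrow> action p (c 1) \<le> action p x"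
proof -
  have "K \<noteq> {}" "K \<noteq> UNIV" using K interior_subset not_compact_UNIV by blast+
  then have "frontier K \<noteq> {}" by (rule frontier_not_empty)
  moreover have "compact (frontier K)" using K by (simp add: compact_frontier)
  ultimately obtain q where q: "q \<in> frontier K" "\<And>x. x \<in> frontier K \<Longrightarrow> action p q \<le> action p x"
    using continuous_attains_inf[of "frontier K" "action p"] continuous_on_subset[OF continuous_action] by blast
  obtain c P where c: "c 0 = p" "c 1 = q" "C1_curve c (\<lambda>t. psi (c t) (P t))"
    "C1_curve P (\<lambda>t. ex (c t) (psi (c t) (P t)))" "energy e c (\<lambda>t. psi (c t) (P t)) = action p q"
    using action_attained[of p q] by blast
  have qi: "q \<notin> interior K" using q by (simp add: frontier_def)
  obtain t0 where t0: "0 < t0" "t0 \<le> 1" "c t0 \<in> frontier K" "\<And>t. 0 \<le> t \<Longrightarrow> t < t0 \<Longrightarrow> c t \<in> interior K"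
    "action p (c t0) \<le> t0 * action p q"
    using action_exit[OF K(2) c(3,1)] qi c by metis
  have "p \<noteq> q" using qi K by blast
  then have "0 < lam * (norm (q - p))\<^sup>2" using lam by simp
  then have pos: "0 < action p q" using action_lower[of q p] by linarith
  have "action p q \<le> t0 * action p q" using q(2)[OF t0(3)] t0(5) by linarith
  then have "t0 \<ge> 1" using pos by simp
  then have "t0 = 1" using t0 by simp
  then show ?thesis using that[of c P] c q t0 by simp
qed

end

section \<open>Smooth functions\<close>

lemma frechet_derivative_cong_open:
  assumes "open S" "x \<in> S" "\<And>y. y \<in> S \<Longrightarrow> f y = g y"
  shows "f differentiable (at x) \<longleftrightarrow> g differentiable (at x)"
    and "frechet_derivative f (at x) = frechet_derivative g (at x)"
proof -
  have *: "(f has_derivative D) (at x) \<longleftrightarrow> (g has_derivative D) (at x)" for D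
    using has_derivative_transform_within_open[OF _ assms(1,2)] assms(3) by metis
  show "f differentiable (at x) \<longleftrightarrow> g differentiable (at x)"
    by (simp add: differentiable_def *)
  show "frechet_derivative f (at x) = frechet_derivative g (at x)"
    by (simp add: frechet_derivative_def *)
qed

lemma C_k_on_cong:
  assumes "open S" "\<And>y. y \<in> S \<Longrightarrow> f y = g y"
  shows "C_k_on k S f \<longleftrightarrow> C_k_on k S g"
  using assms(2)
proof (induction k arbitrary: f g)
  case 0
  then show ?case by (simp cong: continuous_on_cong)
next
  case (Suc k)
  have 1: "f differentiable (at x) \<longleftrightarrow> g differentiable (at x)"
    "frechet_derivative f (at x) = frechet_derivative g (at x)" if "x \<in> S" for x
    using frechet_derivative_cong_open[OF assms(1) that] Suc.prems by blast+
  have "C_k_on k S (\<lambda>x. frechet_derivative f (at x) v) \<longleftrightarrow> C_k_on k S (\<lambda>x. frechet_derivative g (at x) v)" for v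
    by (rule Suc.IH) (simp add: 1)
  then show ?case using 1 by simp
qed

text \<open>\<open>C_k_on\<close> speaks of \<open>frechet_derivative\<close>, which is a choice. On
  an open set any explicit derivative may take its place, and the closure properties below are
  proved through this rule.\<close>

lemma C_k_on_SucI:
  assumes "open S" "\<And>x. x \<in> S \<Longrightarrow> (f has_derivative f' x) (at x)" "\<And>v. C_k_on k S (\<lambda>x. f' x v)"
  shows "C_k_on (Suc k) S f"
proof -
  have "frechet_derivative f (at x) v = f' x v" if "x \<in> S" for x v
    using frechet_derivative_at[OF assms(2)[OF that]] by simp
  then have "C_k_on k S (\<lambda>x. frechet_derivative f (at x) v)" for v
    using C_k_on_cong[OF assms(1), of "\<lambda>x. frechet_derivative f (at x) v" "\<lambda>x. f' x v"] assms(3) by blast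
  then show ?thesis using assms(2) by (auto simp: differentiable_def)
qed

lemma C_k_on_SucD:
  assumes "C_k_on (Suc k) S f" "x \<in> S"
  shows "(f has_derivative frechet_derivative f (at x)) (at x)"
proof -
  have "f differentiable (at x)" using assms by simp
  then show ?thesis by (rule frechet_derivative_works[THEN iffD1])
qed

lemma C_k_on_mono: "C_k_on (Suc k) S f \<Longrightarrow> C_k_on k S f"
proof (induction k arbitrary: f)
  case 0
  then show ?case
    by (auto intro!: continuous_at_imp_continuous_on differentiable_imp_continuous_within)
next
  case (Suc k)
  show ?case using Suc.prems Suc.IH C_k_on.simps(2) by blast
qed

lemma C_k_on_const: "C_k_on k S (\<lambda>x. c)"
proof (induction k arbitrary: c)
  case (Suc k)
  have "frechet_derivative (\<lambda>x. c) (at x) = (\<lambda>h. 0)" for x :: 'a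
    by (rule frechet_derivative_at[symmetric]) simp
  then show ?case using Suc[of 0] by simp
qed simp

lemma C_k_on_add:
  assumes "open S" shows "C_k_on k S f \<Longrightarrow> C_k_on k S g \<Longrightarrow> C_k_on k S (\<lambda>x. f x + g x)"
proof (induction k arbitrary: f g)
  case 0 then show ?case by (auto intro: continuous_intros)
next
  case (Suc k)
  show ?case
  proof (rule C_k_on_SucI[OF assms])
    fix x assume "x \<in> S"
    with Suc.prems show "((\<lambda>x. f x + g x) has_derivative
        (\<lambda>v. frechet_derivative f (at x) v + frechet_derivative g (at x) v)) (at x)"
      by (intro has_derivative_add C_k_on_SucD)
  qed (use Suc in auto)
qed

lemma C_k_on_mult:
  fixes f g :: "'a::real_normed_vector \<Rightarrow> real"
  assumes "open S" shows "C_k_on k S f \<Longrightarrow> C_k_on k S g \<Longrightarrow> C_k_on k S (\<lambda>x. f x * g x)"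
proof (induction k arbitrary: f g)
  case 0 then show ?case by (auto intro: continuous_intros)
next
  case (Suc k)
  show ?case
  proof (rule C_k_on_SucI[OF assms])
    fix x assume "x \<in> S"
    with Suc.prems show "((\<lambda>x. f x * g x) has_derivative
        (\<lambda>v. f x * frechet_derivative g (at x) v + frechet_derivative f (at x) v * g x)) (at x)"
      by (intro has_derivative_mult C_k_on_SucD)
  next
    fix v
    show "C_k_on k S (\<lambda>x. f x * frechet_derivative g (at x) v + frechet_derivative f (at x) v * g x)"
      using Suc.prems C_k_on_mono[OF Suc.prems(1)] C_k_on_mono[OF Suc.prems(2)]
      by (intro C_k_on_add[OF assms] Suc.IH) auto
  qed
qed

lemma C_k_on_inverse:
  fixes f :: "'a::real_normed_vector \<Rightarrow> real"
  assumes "open S" "\<And>x. x \<in> S \<Longrightarrow> f x \<noteq> 0"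
  shows "C_k_on k S f \<Longrightarrow> C_k_on k S (\<lambda>x. inverse (f x))"
proof (induction k)
  case 0 then show ?case using assms by (auto intro: continuous_intros)
next
  case (Suc k)
  show ?case
  proof (rule C_k_on_SucI[OF assms(1)])
    fix x assume "x \<in> S"
    with Suc.prems have "(f has_derivative frechet_derivative f (at x)) (at x)" by (rule C_k_on_SucD)
    then show "((\<lambda>x. inverse (f x)) has_derivative
        (\<lambda>v. - (inverse (f x) * frechet_derivative f (at x) v * inverse (f x)))) (at x)"
      by (rule Deriv.has_derivative_inverse[where f = f and x = x, OF assms(2)[OF \<open>x \<in> S\<close>]])
  next
    fix v
    have I: "C_k_on k S (\<lambda>x. inverse (f x))" using Suc.IH C_k_on_mono[OF Suc.prems] by blast
    have D: "C_k_on k S (\<lambda>x. frechet_derivative f (at x) v)" using Suc.prems by simp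
    have "C_k_on k S (\<lambda>x. (-1) * (inverse (f x) * frechet_derivative f (at x) v * inverse (f x)))"
      by (rule C_k_on_mult[OF assms(1) C_k_on_const C_k_on_mult[OF assms(1) C_k_on_mult[OF assms(1) I D] I]])
    then show "C_k_on k S (\<lambda>x. - (inverse (f x) * frechet_derivative f (at x) v * inverse (f x)))" by simp
  qed
qed

lemma C_k_on_sqrt:
  fixes f :: "'a::real_normed_vector \<Rightarrow> real"
  assumes "open S" "\<And>x. x \<in> S \<Longrightarrow> f x > 0"
  shows "C_k_on k S f \<Longrightarrow> C_k_on k S (\<lambda>x. sqrt (f x))"
proof (induction k)
  case 0 then show ?case by (auto intro: continuous_intros)
next
  case (Suc k)
  show ?case
  proof (rule C_k_on_SucI[OF assms(1)])
    fix x assume x: "x \<in> S"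
    have "((\<lambda>x. sqrt (f x)) has_derivative (\<lambda>v. frechet_derivative f (at x) v * (inverse (sqrt (f x)) / 2))) (at x)"
      using has_derivative_compose[OF C_k_on_SucD[OF Suc.prems x]
          DERIV_real_sqrt[OF assms(2)[OF x], unfolded has_field_derivative_def]]
      by (simp add: mult.commute)
    then show "((\<lambda>x. sqrt (f x)) has_derivative (\<lambda>v. frechet_derivative f (at x) v * (inverse (sqrt (f x)) * (1 / 2)))) (at x)"
      by simp
  next
    fix v
    have "sqrt (f x) \<noteq> 0" if "x \<in> S" for x using assms(2)[OF that] by simp
    then have I: "C_k_on k S (\<lambda>x. inverse (sqrt (f x)))"
      using Suc.IH C_k_on_mono[OF Suc.prems] C_k_on_inverse[OF assms(1), of "\<lambda>x. sqrt (f x)"] by blast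
    have D: "C_k_on k S (\<lambda>x. frechet_derivative f (at x) v)" using Suc.prems by simp
    show "C_k_on k S (\<lambda>x. frechet_derivative f (at x) v * (inverse (sqrt (f x)) * (1 / 2)))"
      by (rule C_k_on_mult[OF assms(1) D C_k_on_mult[OF assms(1) I C_k_on_const]])
  qed
qed

lemma smooth_on_const: "smooth_on S (\<lambda>x. c)"
  by (simp add: smooth_on_def C_k_on_const)

lemma smooth_on_add: "open S \<Longrightarrow> smooth_on S f \<Longrightarrow> smooth_on S g \<Longrightarrow> smooth_on S (\<lambda>x. f x + g x)"
  by (simp add: smooth_on_def C_k_on_add)

lemma smooth_on_mult:
  fixes f g :: "'a::real_normed_vector \<Rightarrow> real"
  shows "open S \<Longrightarrow> smooth_on S f \<Longrightarrow> smooth_on S g \<Longrightarrow> smooth_on S (\<lambda>x. f x * g x)"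
  by (simp add: smooth_on_def C_k_on_mult)

lemma smooth_on_diff:
  fixes f g :: "'a::real_normed_vector \<Rightarrow> real"
  assumes "open S" "smooth_on S f" "smooth_on S g"
  shows "smooth_on S (\<lambda>x. f x - g x)"
  using smooth_on_add[OF assms(1,2) smooth_on_mult[OF assms(1) smooth_on_const[of S "-1"] assms(3)]] by simp

lemma smooth_on_power:
  fixes f :: "'a::real_normed_vector \<Rightarrow> real"
  assumes "open S" "smooth_on S f"
  shows "smooth_on S (\<lambda>x. f x ^ n)"
proof (induction n)
  case 0
  then show ?case by (simp add: smooth_on_const)
next
  case (Suc n)
  then show ?case using smooth_on_mult[OF assms] by simp
qed

lemma smooth_on_inverse:
  fixes f :: "'a::real_normed_vector \<Rightarrow> real"
  shows "open S \<Longrightarrow> smooth_on S f \<Longrightarrow> (\<And>x. x \<in> S \<Longrightarrow> f x \<noteq> 0) \<Longrightarrow> smooth_on S (\<lambda>x. inverse (f x))"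
  by (simp add: smooth_on_def C_k_on_inverse)

lemma smooth_on_divide:
  fixes f g :: "'a::real_normed_vector \<Rightarrow> real"
  shows "open S \<Longrightarrow> smooth_on S f \<Longrightarrow> smooth_on S g \<Longrightarrow> (\<And>x. x \<in> S \<Longrightarrow> g x \<noteq> 0) \<Longrightarrow> smooth_on S (\<lambda>x. f x / g x)"
  unfolding divide_inverse by (rule smooth_on_mult[OF _ _ smooth_on_inverse])

lemma smooth_on_sqrt:
  fixes f :: "'a::real_normed_vector \<Rightarrow> real"
  shows "open S \<Longrightarrow> smooth_on S f \<Longrightarrow> (\<And>x. x \<in> S \<Longrightarrow> f x > 0) \<Longrightarrow> smooth_on S (\<lambda>x. sqrt (f x))"
  by (simp add: smooth_on_def C_k_on_sqrt)

lemma smooth_on_cong: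
  "open S \<Longrightarrow> (\<And>x. x \<in> S \<Longrightarrow> f x = g x) \<Longrightarrow> smooth_on S f \<longleftrightarrow> smooth_on S g"
  unfolding smooth_on_def using C_k_on_cong[of S f g] by simp

lemma smooth_on_frechet: "smooth_on S f \<Longrightarrow> smooth_on S (\<lambda>x. frechet_derivative f (at x) v)"
  unfolding smooth_on_def
proof
  fix k assume "\<forall>k. C_k_on k S f"
  then have "C_k_on (Suc k) S f" by (rule spec)
  then show "C_k_on k S (\<lambda>x. frechet_derivative f (at x) v)" by simp
qed

lemma smooth_on_has_frechet:
  "smooth_on S f \<Longrightarrow> x \<in> S \<Longrightarrow> (f has_derivative frechet_derivative f (at x)) (at x)"
  unfolding smooth_on_def by (rule C_k_on_SucD[of 0], erule spec)

lemma smooth_on_continuous: "smooth_on S f \<Longrightarrow> continuous_on S f"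
  unfolding smooth_on_def by (drule spec[of _ 0]) simp

section \<open>Partial derivatives and their symmetry\<close>

lemma smooth_on_partial_deriv: "smooth_on S f \<Longrightarrow> smooth_on S (partial_deriv i f)"
  unfolding partial_deriv_def[abs_def] by (rule smooth_on_frechet)

lemma partial_deriv_cong_open:
  assumes "open S" "x \<in> S" "\<And>y. y \<in> S \<Longrightarrow> f y = g y"
  shows "partial_deriv i f x = partial_deriv i g x"
  unfolding partial_deriv_def using frechet_derivative_cong_open(2)[OF assms] by simp

lemma partial_deriv_at:
  "(f has_derivative D) (at x) \<Longrightarrow> partial_deriv i f x = D (axis i 1)"
  unfolding partial_deriv_def using frechet_derivative_at[of f D x] by simp

lemma vec2_expand: "(v :: real^2) = (v $ 1) *\<^sub>R axis 1 1 + (v $ 2) *\<^sub>R axis 2 1"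
  by (simp add: vec_eq_iff forall_2 axis_def)

lemma smooth_on_has_derivative:
  fixes f :: "real^2 \<Rightarrow> real"
  assumes "smooth_on S f" "x \<in> S"
  shows "(f has_derivative (\<lambda>v. partial_deriv 1 f x * v $ 1 + partial_deriv 2 f x * v $ 2)) (at x)"
proof -
  let ?D = "frechet_derivative f (at x)"
  have D: "(f has_derivative ?D) (at x)" using assms by (rule smooth_on_has_frechet)
  then have lin: "linear ?D" using has_derivative_linear by blast
  have "?D v = partial_deriv 1 f x * v $ 1 + partial_deriv 2 f x * v $ 2" for v :: "real^2"
  proof -
    have "?D v = ?D ((v $ 1) *\<^sub>R axis 1 1 + (v $ 2) *\<^sub>R axis 2 1)" using vec2_expand[of v] by simp
    also have "\<dots> = v $ 1 * ?D (axis 1 1) + v $ 2 * ?D (axis 2 1)"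
      using lin by (simp add: linear_add linear_cmul)
    finally show ?thesis by (simp add: partial_deriv_def mult.commute)
  qed
  then have "?D = (\<lambda>v. partial_deriv 1 f x * v $ 1 + partial_deriv 2 f x * v $ 2)" by (rule ext)
  then show ?thesis using D by simp
qed

lemma smooth_on_curve:
  fixes f :: "real^2 \<Rightarrow> real"
  assumes "smooth_on S f" "c t \<in> S" "(c has_vector_derivative v) (at t within A)"
  shows "((\<lambda>t. f (c t)) has_real_derivative partial_deriv 1 f (c t) * v $ 1 + partial_deriv 2 f (c t) * v $ 2) (at t within A)"
proof -
  have "(f has_derivative (\<lambda>v. partial_deriv 1 f (c t) * v $ 1 + partial_deriv 2 f (c t) * v $ 2)) (at (c t) within c ` A)"
    using smooth_on_has_derivative[OF assms(1,2)] has_derivative_at_withinI by blast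
  from diff_chain_within[OF assms(3)[unfolded has_vector_derivative_def] this]
  have D: "((\<lambda>t. f (c t)) has_derivative (\<lambda>h. h * (partial_deriv 1 f (c t) * v $ 1 + partial_deriv 2 f (c t) * v $ 2))) (at t within A)"
    by (simp add: o_def algebra_simps)
  then show ?thesis unfolding has_field_derivative_def mult_commute_abs .
qed

text \<open>Two applications of the mean value theorem, first in direction \<open>u\<close> and then
  in direction \<open>w\<close>. The second difference is symmetric in \<open>u\<close> and
  \<open>w\<close>, which is the source of the symmetry of second derivatives.\<close>

lemma second_difference_mvt:
  fixes f :: "'a::real_normed_vector \<Rightarrow> real"
  assumes f: "smooth_on S f" and h: "h > 0"
    and S: "\<And>s t. 0 \<le> s \<Longrightarrow> s \<le> h \<Longrightarrow> 0 \<le> t \<Longrightarrow> t \<le> h \<Longrightarrow> x + s *\<^sub>R u + t *\<^sub>R w \<in> S"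
  obtains s t where "0 < s" "s < h" "0 < t" "t < h"
    "f (x + h *\<^sub>R u + h *\<^sub>R w) - f (x + h *\<^sub>R u) - f (x + h *\<^sub>R w) + f x
      = h * h * frechet_derivative (\<lambda>y. frechet_derivative f (at y) u) (at (x + s *\<^sub>R u + t *\<^sub>R w)) w"
proof -
  let ?D = "\<lambda>y. frechet_derivative f (at y) u"
  have line: "((\<lambda>s. g (y + s *\<^sub>R z)) has_real_derivative frechet_derivative g (at (y + s *\<^sub>R z)) z) (at s)"
    if "smooth_on S g" "y + s *\<^sub>R z \<in> S" for g :: "'a \<Rightarrow> real" and y z s
  proof -
    have g: "(g has_derivative frechet_derivative g (at (y + s *\<^sub>R z))) (at (y + s *\<^sub>R z))"
      using that by (rule smooth_on_has_frechet)
    have "((\<lambda>s. y + s *\<^sub>R z) has_derivative (\<lambda>t. t *\<^sub>R z)) (at s)" by (auto intro!: derivative_eq_intros)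
    from has_derivative_compose[OF this g] show ?thesis
      unfolding has_field_derivative_def mult_commute_abs
      using linear_cmul[OF has_derivative_linear[OF g]] by (simp add: mult.commute[of _ "frechet_derivative g (at (y + s *\<^sub>R z)) z"])
  qed
  define \<phi> where "\<phi> s = f (x + h *\<^sub>R w + s *\<^sub>R u) - f (x + s *\<^sub>R u)" for s
  have in1: "x + h *\<^sub>R w + s *\<^sub>R u \<in> S" "x + s *\<^sub>R u \<in> S" if "0 \<le> s" "s \<le> h" for s
    using S[of s h] S[of s 0] that h by (auto simp: add_ac)
  have "\<exists>s>0. s < h \<and> \<phi> h - \<phi> 0 = (h - 0) * (?D (x + h *\<^sub>R w + s *\<^sub>R u) - ?D (x + s *\<^sub>R u))"
    by (rule MVT2[OF h]) (unfold \<phi>_def, intro DERIV_diff line f in1, auto)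
  then obtain s where s: "0 < s" "s < h" "\<phi> h - \<phi> 0 = h * (?D (x + h *\<^sub>R w + s *\<^sub>R u) - ?D (x + s *\<^sub>R u))"
    by auto
  have "\<exists>t>0. t < h \<and> ?D (x + s *\<^sub>R u + h *\<^sub>R w) - ?D (x + s *\<^sub>R u + 0 *\<^sub>R w)
      = (h - 0) * frechet_derivative ?D (at (x + s *\<^sub>R u + t *\<^sub>R w)) w"
    by (rule MVT2[OF h, of "\<lambda>t. ?D (x + s *\<^sub>R u + t *\<^sub>R w)"]) (intro line smooth_on_frechet f S, use s in auto)
  then obtain t where t: "0 < t" "t < h"
    "?D (x + s *\<^sub>R u + h *\<^sub>R w) - ?D (x + s *\<^sub>R u) = h * frechet_derivative ?D (at (x + s *\<^sub>R u + t *\<^sub>R w)) w"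
    by auto
  have "x + h *\<^sub>R w + s *\<^sub>R u = x + s *\<^sub>R u + h *\<^sub>R w" by (simp only: add_ac)
  then have "\<phi> h - \<phi> 0 = h * (h * frechet_derivative ?D (at (x + s *\<^sub>R u + t *\<^sub>R w)) w)"
    using s(3) t(3) by (simp only:)
  moreover have "\<phi> h - \<phi> 0 = f (x + h *\<^sub>R u + h *\<^sub>R w) - f (x + h *\<^sub>R u) - f (x + h *\<^sub>R w) + f x"
    unfolding \<phi>_def by (simp add: add_ac)
  ultimately show ?thesis using that[OF s(1,2) t(1,2)] by (simp only: mult.assoc)
qed

lemma frechet_derivative_commute:
  fixes f :: "'a::real_normed_vector \<Rightarrow> real"
  assumes S: "open S" "x \<in> S" and f: "smooth_on S f"
  shows "frechet_derivative (\<lambda>y. frechet_derivative f (at y) u) (at x) w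
       = frechet_derivative (\<lambda>y. frechet_derivative f (at y) w) (at x) u"
proof (rule ccontr)
  let ?A = "\<lambda>x. frechet_derivative (\<lambda>y. frechet_derivative f (at y) u) (at x) w"
  let ?B = "\<lambda>x. frechet_derivative (\<lambda>y. frechet_derivative f (at y) w) (at x) u"
  assume "?A x \<noteq> ?B x"
  define \<epsilon> where "\<epsilon> = \<bar>?A x - ?B x\<bar> / 2"
  have "\<epsilon> > 0" using \<open>?A x \<noteq> ?B x\<close> by (simp add: \<epsilon>_def)
  have "isCont ?A x" "isCont ?B x"
    using smooth_on_continuous[OF smooth_on_frechet[OF smooth_on_frechet[OF f]]] S
    by (auto simp: continuous_on_eq_continuous_at)
  then obtain d1 d2 where d: "d1 > 0" "d2 > 0"
    "\<And>y. dist y x < d1 \<Longrightarrow> dist (?A y) (?A x) < \<epsilon>" "\<And>y. dist y x < d2 \<Longrightarrow> dist (?B y) (?B x) < \<epsilon>"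
    unfolding continuous_at_eps_delta using \<open>\<epsilon> > 0\<close> by metis
  obtain r where r: "r > 0" "ball x r \<subseteq> S" using S open_contains_ball by blast
  define m where "m = min r (min d1 d2)"
  have m: "m > 0" "m \<le> r" "m \<le> d1" "m \<le> d2" using r d by (auto simp: m_def)
  \<comment> \<open>With this \<open>h\<close> the whole parallelogram spanned by h u and h w stays
    within m / 2 of \<open>x\<close>.\<close>
  define h where "h = m / (2 * (norm u + norm w + 1))"
  have N: "norm u + norm w + 1 > 0" by (smt (verit) norm_ge_zero)
  have h: "h > 0" using m N by (simp add: h_def)
  have near: "dist (x + s *\<^sub>R a + t *\<^sub>R b) x < m" if "0 \<le> s" "s \<le> h" "0 \<le> t" "t \<le> h" "{a, b} = {u, w}" for s t a b
  proof -
    have "dist (x + s *\<^sub>R a + t *\<^sub>R b) x \<le> s * norm a + t * norm b"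
      using norm_triangle_ineq[of "s *\<^sub>R a" "t *\<^sub>R b"] that by (simp add: dist_norm add.assoc)
    also have "\<dots> \<le> h * norm a + h * norm b" using that by (intro add_mono mult_right_mono) auto
    also have "\<dots> \<le> h * (norm u + norm w + 1)" using that h by (auto simp: doubleton_eq_iff algebra_simps)
    also have "\<dots> = m / 2" using N unfolding h_def by (simp add: divide_simps)
    also have "\<dots> < m" using m by simp
    finally show ?thesis .
  qed
  have inS: "x + s *\<^sub>R a + t *\<^sub>R b \<in> S" if "0 \<le> s" "s \<le> h" "0 \<le> t" "t \<le> h" "{a, b} = {u, w}" for s t a b
    using near[OF that] m r by (auto simp: dist_commute mem_ball subset_iff)
  have in1: "x + s *\<^sub>R u + t *\<^sub>R w \<in> S" "x + s *\<^sub>R w + t *\<^sub>R u \<in> S" if "0 \<le> s" "s \<le> h" "0 \<le> t" "t \<le> h" for s t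
    using inS[OF that, of u w] inS[OF that, of w u] by (auto simp: insert_commute)
  obtain s t where 1: "0 < s" "s < h" "0 < t" "t < h"
    "f (x + h *\<^sub>R u + h *\<^sub>R w) - f (x + h *\<^sub>R u) - f (x + h *\<^sub>R w) + f x = h * h * ?A (x + s *\<^sub>R u + t *\<^sub>R w)"
    by (rule second_difference_mvt[OF f h in1(1)])
  obtain s' t' where 2: "0 < s'" "s' < h" "0 < t'" "t' < h"
    "f (x + h *\<^sub>R w + h *\<^sub>R u) - f (x + h *\<^sub>R w) - f (x + h *\<^sub>R u) + f x = h * h * ?B (x + s' *\<^sub>R w + t' *\<^sub>R u)"
    by (rule second_difference_mvt[OF f h in1(2)])
  have "x + h *\<^sub>R w + h *\<^sub>R u = x + h *\<^sub>R u + h *\<^sub>R w" by (simp add: add_ac)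
  with 2(5) have "f (x + h *\<^sub>R u + h *\<^sub>R w) - f (x + h *\<^sub>R w) - f (x + h *\<^sub>R u) + f x
      = h * h * ?B (x + s' *\<^sub>R w + t' *\<^sub>R u)" by (simp only:)
  then have "h * h * ?A (x + s *\<^sub>R u + t *\<^sub>R w) = h * h * ?B (x + s' *\<^sub>R w + t' *\<^sub>R u)"
    unfolding 1(5)[symmetric] by simp
  then have eq: "?A (x + s *\<^sub>R u + t *\<^sub>R w) = ?B (x + s' *\<^sub>R w + t' *\<^sub>R u)" using h by simp
  have "dist (?A (x + s *\<^sub>R u + t *\<^sub>R w)) (?A x) < \<epsilon>"
    using near[of s t u w] 1 m by (intro d) auto
  moreover have "dist (?B (x + s' *\<^sub>R w + t' *\<^sub>R u)) (?B x) < \<epsilon>"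
    using near[of s' t' w u] 2 m by (intro d) (auto simp: insert_commute)
  ultimately have "dist (?A x) (?B x) < \<epsilon> + \<epsilon>"
    unfolding eq by (intro dist_triangle_less_add[of _ "?B (x + s' *\<^sub>R w + t' *\<^sub>R u)"]) (simp_all only: dist_commute)
  then show False by (simp add: \<epsilon>_def dist_real_def)
qed

lemma partial_deriv_commute:
  assumes "open S" "x \<in> S" "smooth_on S f"
  shows "partial_deriv i (partial_deriv j f) x = partial_deriv j (partial_deriv i f) x"
  using frechet_derivative_commute[OF assms] unfolding partial_deriv_def[abs_def] .

section \<open>Metrics on the plane\<close>

text \<open>The square of the positive part has a continuous derivative across 0 and is the building
  block of the cutoff functions. One continuous derivative suffices for them, because a Lagrangian
  is differentiated only once in the position.\<close>

lemma max_square_DERIV: "((\<lambda>u. (max 0 u)\<^sup>2) has_real_derivative 2 * max 0 u) (at (u::real))"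
proof -
  have b: "\<bar>(max 0 y)\<^sup>2 - (max 0 u)\<^sup>2 - (2 * max 0 u) * (y - u)\<bar> \<le> (y - u)\<^sup>2" for y
  proof -
    have pu: "max 0 u * u = max 0 u * max 0 u" by (simp add: max_def)
    have "(max 0 y)\<^sup>2 - (max 0 u)\<^sup>2 - (2 * max 0 u) * (y - u)
        = (max 0 y - max 0 u)\<^sup>2 + 2 * max 0 u * (max 0 y - y) + 2 * (max 0 u * u - max 0 u * max 0 u)"
      unfolding power2_eq_square by algebra
    then have eq: "(max 0 y)\<^sup>2 - (max 0 u)\<^sup>2 - (2 * max 0 u) * (y - u) = (max 0 y - max 0 u)\<^sup>2 + 2 * max 0 u * (max 0 y - y)"
      unfolding pu by simp
    show ?thesis
    proof (cases "u \<le> 0")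
      case True
      then have "(max 0 y - max 0 u)\<^sup>2 \<le> (y - u)\<^sup>2" by (cases "y \<le> 0") (auto simp: max_def intro: power_mono)
      then show ?thesis unfolding eq using True by (simp add: max_def)
    next
      case u: False
      show ?thesis
      proof (cases "y \<le> 0")
        case True
        have up: "(0 - u)\<^sup>2 + 2 * u * (0 - y) \<le> (y - u)\<^sup>2" by (simp add: power2_eq_square algebra_simps)
        moreover have "u * y \<le> 0" using True u by (simp add: mult_nonneg_nonpos)
        moreover have "2 * u * (0 - y) = - (2 * (u * y))" by (simp add: algebra_simps)
        ultimately have "0 \<le> (0 - u)\<^sup>2 + 2 * u * (0 - y)" using zero_le_power2[of "0 - u"] by linarith
        with up show ?thesis unfolding eq using True u by (simp add: max_def)
      next
        case False
        then show ?thesis unfolding eq using u by (simp add: max_def)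
      qed
    qed
  qed
  have "((\<lambda>u. (max 0 u)\<^sup>2) has_derivative (\<lambda>h. (2 * max 0 u) * h)) (at u)"
  proof (rule has_derivativeI_sandwich[of 1 _ _ _ _ "\<lambda>y. \<bar>y - u\<bar>"])
    fix y assume "y \<noteq> u"
    then show "norm ((max 0 y)\<^sup>2 - (max 0 u)\<^sup>2 - (2 * max 0 u) * (y - u)) / norm (y - u) \<le> \<bar>y - u\<bar>"
      using b[of y] by (simp add: divide_le_eq power2_eq_square)
  next
    show "((\<lambda>y. \<bar>y - u\<bar>) \<longlongrightarrow> 0) (at u)"
      by (auto intro!: tendsto_eq_intros)
  qed (auto intro: bounded_linear_mult_right)
  then show ?thesis unfolding has_field_derivative_def .
qed

text \<open>Besides the plateau \<open>U\<close> around \<open>K\<close> the compact set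
  \<open>T\<close> inside \<open>S\<close> is recorded: off \<open>T\<close> a function given only
  on \<open>S\<close> can be replaced by a constant.\<close>

lemma cutoff_exists:
  fixes K S :: "'a::euclidean_space set"
  assumes "compact K" "open S" "K \<subseteq> S"
  obtains \<theta> :: "'a \<Rightarrow> real" and \<theta>' U T where "open U" "K \<subseteq> U" "U \<subseteq> T" "compact T" "T \<subseteq> S"
    "\<And>x. (\<theta> has_derivative (\<lambda>v. \<theta>' x \<bullet> v)) (at x)" "continuous_on UNIV \<theta>'"
    "\<And>x. 0 \<le> \<theta> x" "\<And>x. \<theta> x \<le> 1" "\<And>x. x \<in> U \<Longrightarrow> \<theta> x = 1" "\<And>x. x \<in> U \<Longrightarrow> \<theta>' x = 0"
    "\<And>x. x \<notin> T \<Longrightarrow> \<theta> x = 0" "\<And>x. x \<notin> T \<Longrightarrow> \<theta>' x = 0"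
proof -
  have "\<exists>r>0. cball a (2 * r) \<subseteq> S" if "a \<in> K" for a
  proof -
    have "a \<in> S" using that assms(3) by blast
    then obtain e where "e > 0" "cball a e \<subseteq> S" using assms(2) open_contains_cball by blast
    then show ?thesis by (intro exI[of _ "e / 2"]) simp
  qed
  then obtain r where r: "\<And>a. a \<in> K \<Longrightarrow> r a > 0" "\<And>a. a \<in> K \<Longrightarrow> cball a (2 * r a) \<subseteq> S" by metis
  have "K \<subseteq> (\<Union>a\<in>K. ball a (r a))" using r by force
  then obtain D where D: "D \<subseteq> K" "finite D" "K \<subseteq> (\<Union>a\<in>D. ball a (r a))"
    using compactE_image[OF assms(1), of K "\<lambda>a. ball a (r a)"] by auto
  \<comment> \<open>The bump \<open>w a\<close> is nonpositive outside the ball of radius 2 r about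
    \<open>a\<close> and at least 3/4 on the ball of radius r. Hence \<sigma> is at least 9/16 on
    \<open>K\<close>, above the level 1/2 from which on \<theta> is identically 1.\<close>
  define w where "w a x = 1 - (norm (x - a))\<^sup>2 / (4 * (r a)\<^sup>2)" for a x
  define \<sigma> where "\<sigma> x = (\<Sum>a\<in>D. (max 0 (w a x))\<^sup>2)" for x
  define \<sigma>' where "\<sigma>' x = (\<Sum>a\<in>D. (2 * max 0 (w a x) * (- 1 / (2 * (r a)\<^sup>2))) *\<^sub>R (x - a))" for x
  define \<theta> where "\<theta> x = 1 - (max 0 (1 - 2 * \<sigma> x))\<^sup>2" for x
  define \<theta>' where "\<theta>' x = (4 * max 0 (1 - 2 * \<sigma> x)) *\<^sub>R \<sigma>' x" for x
  define T where "T = (\<Union>a\<in>D. cball a (2 * r a))"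
  define U where "U = {x. \<sigma> x > 1 / 2}"
  have w': "(w a has_derivative (\<lambda>v. ((- 1 / (2 * (r a)\<^sup>2)) *\<^sub>R (x - a)) \<bullet> v)) (at x)" for a x
  proof -
    define k where "k = 1 / (4 * (r a)\<^sup>2)"
    have "((\<lambda>x. (x - a) \<bullet> (x - a)) has_derivative (\<lambda>v. (x - a) \<bullet> v + v \<bullet> (x - a))) (at x)"
      by (intro has_derivative_inner) (auto intro!: derivative_eq_intros)
    from has_derivative_diff[OF has_derivative_const has_derivative_mult_left[OF this, of k], of 1]
    have "((\<lambda>x. 1 - (x - a) \<bullet> (x - a) * k) has_derivative (\<lambda>v. - (2 * k) * ((x - a) \<bullet> v))) (at x)"
      by (simp add: inner_commute algebra_simps)
    moreover have "(\<lambda>x. 1 - (x - a) \<bullet> (x - a) * k) = w a"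
      by (simp add: fun_eq_iff w_def k_def power2_norm_eq_inner)
    moreover have "- 1 / (2 * (r a)\<^sup>2) = - (2 * k)" by (simp add: k_def)
    ultimately show ?thesis by (simp only: inner_scaleR_left)
  qed
  have \<sigma>'d: "(\<sigma> has_derivative (\<lambda>v. \<sigma>' x \<bullet> v)) (at x)" for x
  proof -
    have "((\<lambda>x. (max 0 (w a x))\<^sup>2) has_derivative (\<lambda>v. ((2 * max 0 (w a x) * (- 1 / (2 * (r a)\<^sup>2))) *\<^sub>R (x - a)) \<bullet> v)) (at x)" for a
      using has_derivative_compose[OF w' max_square_DERIV[unfolded has_field_derivative_def]]
      by (simp only: inner_scaleR_left mult.assoc)
    then show ?thesis unfolding \<sigma>_def[abs_def] \<sigma>'_def inner_sum_left by (intro has_derivative_sum)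
  qed
  have \<theta>'d: "(\<theta> has_derivative (\<lambda>v. \<theta>' x \<bullet> v)) (at x)" for x
  proof -
    have "((\<lambda>x. 1 - 2 * \<sigma> x) has_derivative (\<lambda>v. - 2 * (\<sigma>' x \<bullet> v))) (at x)"
      using \<sigma>'d[of x] by (auto intro!: derivative_eq_intros)
    from has_derivative_compose[OF this max_square_DERIV[unfolded has_field_derivative_def]]
    have "((\<lambda>x. 1 - (max 0 (1 - 2 * \<sigma> x))\<^sup>2) has_derivative (\<lambda>v. 0 - 2 * max 0 (1 - 2 * \<sigma> x) * (- 2 * (\<sigma>' x \<bullet> v)))) (at x)"
      by (intro has_derivative_diff has_derivative_const)
    then show ?thesis unfolding \<theta>_def[abs_def] \<theta>'_def by (simp add: mult.assoc)
  qed
  have cw: "continuous_on UNIV (w a)" for a unfolding w_def[abs_def] by (cases "r a = 0") (auto intro!: continuous_intros)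
  have c\<sigma>: "continuous_on UNIV \<sigma>" "continuous_on UNIV \<sigma>'"
    unfolding \<sigma>_def[abs_def] \<sigma>'_def[abs_def] by (intro continuous_intros cw)+
  have c\<theta>: "continuous_on UNIV \<theta>'" unfolding \<theta>'_def[abs_def] by (intro continuous_intros c\<sigma>)
  have out: "\<sigma> x = 0" "\<sigma>' x = 0" if "x \<notin> T" for x
  proof -
    have "max 0 (w a x) = 0" if "a \<in> D" for a
    proof -
      have "r a > 0" using that D r by blast
      have "2 * r a \<le> norm (x - a)" using \<open>x \<notin> T\<close> that by (auto simp: T_def dist_norm norm_minus_commute)
      then have "(2 * r a)\<^sup>2 \<le> (norm (x - a))\<^sup>2" using \<open>r a > 0\<close> by (intro power_mono) auto
      then show ?thesis using \<open>r a > 0\<close> by (simp add: w_def power_mult_distrib)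
    qed
    then show "\<sigma> x = 0" "\<sigma>' x = 0" by (simp_all add: \<sigma>_def \<sigma>'_def)
  qed
  have \<sigma>0: "\<sigma> x \<ge> 0" for x unfolding \<sigma>_def by (intro sum_nonneg) auto
  show ?thesis
  proof (rule that[of U T \<theta> \<theta>'])
    show "open U" unfolding U_def using c\<sigma>(1) by (intro open_Collect_less) auto
    show "K \<subseteq> U"
    proof
      fix x assume "x \<in> K"
      then obtain a where a: "a \<in> D" "norm (x - a) < r a" using D by (auto simp: dist_norm norm_minus_commute)
      have "r a > 0" using a D r by blast
      have "(norm (x - a))\<^sup>2 \<le> (r a)\<^sup>2" using a by (intro power_mono) auto
      then have "(norm (x - a))\<^sup>2 / (4 * (r a)\<^sup>2) \<le> 1 / 4" using \<open>r a > 0\<close> by (simp add: field_simps)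
      then have "3 / 4 \<le> max 0 (w a x)" by (simp add: w_def)
      then have "(3 / 4)\<^sup>2 \<le> (max 0 (w a x))\<^sup>2" by (intro power_mono) auto
      also have "\<dots> \<le> \<sigma> x" unfolding \<sigma>_def using a D by (intro member_le_sum) auto
      finally show "x \<in> U" by (simp add: U_def power2_eq_square)
    qed
    show "U \<subseteq> T" using out by (force simp: U_def)
    show "compact T" unfolding T_def using D by (intro compact_UN) auto
    show "T \<subseteq> S" unfolding T_def using r D by blast
    show "\<theta> x \<ge> 0" for x
    proof -
      have "(max 0 (1 - 2 * \<sigma> x))\<^sup>2 \<le> 1\<^sup>2" using \<sigma>0[of x] by (intro power_mono) auto
      then show ?thesis by (simp add: \<theta>_def)
    qed
    show "\<theta> x \<le> 1" for x by (simp add: \<theta>_def)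
    show "x \<in> U \<Longrightarrow> \<theta> x = 1" "x \<in> U \<Longrightarrow> \<theta>' x = 0" for x by (auto simp: U_def \<theta>_def \<theta>'_def max_def)
    show "x \<notin> T \<Longrightarrow> \<theta> x = 0" "x \<notin> T \<Longrightarrow> \<theta>' x = 0" for x by (auto simp: \<theta>_def \<theta>'_def out)
  qed (use \<theta>'d c\<theta> in auto)
qed

lemma extend_by_cutoff:
  fixes f :: "'a::euclidean_space \<Rightarrow> real" and \<theta> :: "'a \<Rightarrow> real"
  assumes S: "open S" and T: "compact T" "T \<subseteq> S" and U: "U \<subseteq> T"
    and \<theta>: "\<And>x. (\<theta> has_derivative (\<lambda>v. \<theta>' x \<bullet> v)) (at x)" "continuous_on UNIV \<theta>'"
    "\<And>x. x \<in> U \<Longrightarrow> \<theta> x = 1" "\<And>x. x \<in> U \<Longrightarrow> \<theta>' x = 0"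
    "\<And>x. x \<notin> T \<Longrightarrow> \<theta> x = 0" "\<And>x. x \<notin> T \<Longrightarrow> \<theta>' x = 0"
    and f: "\<And>x. x \<in> S \<Longrightarrow> (f has_derivative (\<lambda>v. f' x \<bullet> v)) (at x)" "continuous_on S f'"
  shows "\<exists>F' M. (\<forall>x. ((\<lambda>x. if x \<in> S then \<theta> x * f x + (1 - \<theta> x) * k else k) has_derivative (\<lambda>v. F' x \<bullet> v)) (at x)) \<and>
    continuous_on UNIV F' \<and> (\<forall>x\<in>U. F' x = f' x) \<and> (\<forall>x. norm (F' x) \<le> M) \<and>
    (\<forall>x. \<bar>if x \<in> S then \<theta> x * f x + (1 - \<theta> x) * k else k\<bar> \<le> M)"
proof -
  define F where "F x = (if x \<in> S then \<theta> x * f x + (1 - \<theta> x) * k else k)" for x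
  define F' where "F' x = (if x \<in> S then \<theta> x *\<^sub>R f' x + (f x - k) *\<^sub>R \<theta>' x else 0)" for x
  have oT: "open (- T)" using T by (simp add: compact_imp_closed open_Compl)
  have offT: "F x = k" "F' x = 0" if "x \<in> - T" for x using that \<theta> by (auto simp: F_def F'_def)
  have Fd: "(F has_derivative (\<lambda>v. F' x \<bullet> v)) (at x)" for x
  proof (cases "x \<in> S")
    case True
    have "((\<lambda>x. \<theta> x * f x + (1 - \<theta> x) * k) has_derivative (\<lambda>v. F' x \<bullet> v)) (at x)"
      using True by (auto intro!: derivative_eq_intros \<theta>(1) f(1) simp: F'_def fun_eq_iff inner_add_left inner_left_distrib algebra_simps)
    then show ?thesis
      by (rule has_derivative_transform_within_open[OF _ S True]) (simp add: F_def)
  next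
    case False
    then have x: "x \<in> - T" using T by blast
    have "((\<lambda>x. k) has_derivative (\<lambda>v. F' x \<bullet> v)) (at x)" by (simp add: offT(2)[OF x])
    then show ?thesis
      by (rule has_derivative_transform_within_open[OF _ oT x]) (simp add: offT)
  qed
  have cf: "continuous_on S f" using f(1) by (auto intro!: continuous_at_imp_continuous_on has_derivative_continuous)
  have c\<theta>: "continuous_on UNIV \<theta>" using \<theta>(1) by (auto intro!: continuous_at_imp_continuous_on has_derivative_continuous)
  have "continuous_on S F'"
  proof -
    have "continuous_on S (\<lambda>x. \<theta> x *\<^sub>R f' x + (f x - k) *\<^sub>R \<theta>' x)"
      by (intro continuous_intros cf f(2) continuous_on_subset[OF c\<theta>] continuous_on_subset[OF \<theta>(2)]) auto
    then show ?thesis by (rule continuous_on_eq) (simp add: F'_def)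
  qed
  moreover have "continuous_on (- T) F'"
    by (rule continuous_on_eq[of _ "\<lambda>_. 0"]) (auto simp: offT)
  ultimately have "continuous_on (S \<union> - T) F'" using S oT by (intro continuous_on_open_Un)
  moreover have "S \<union> - T = UNIV" using T by blast
  ultimately have cF': "continuous_on UNIV F'" by simp
  have cF: "continuous_on UNIV F" using Fd by (auto intro!: continuous_at_imp_continuous_on has_derivative_continuous)
  have "bounded (F' ` T)" "bounded (F ` T)"
    by (intro compact_imp_bounded compact_continuous_image T continuous_on_subset[OF cF'] continuous_on_subset[OF cF]; simp)+
  then obtain M1 M2 where M: "\<And>x. x \<in> T \<Longrightarrow> norm (F' x) \<le> M1" "\<And>x. x \<in> T \<Longrightarrow> norm (F x) \<le> M2"
    unfolding bounded_iff by blast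
  define M where "M = max (max M1 M2) \<bar>k\<bar>"
  have M': "norm (F' x) \<le> M" "\<bar>F x\<bar> \<le> M" for x
    using M[of x] offT[of x] by (cases "x \<in> T"; force simp: M_def)+
  have "F' x = f' x" if "x \<in> U" for x using that U T \<theta>(3,4) by (auto simp: F'_def)
  then show ?thesis using Fd[unfolded F_def[abs_def]] cF' M'[unfolded F_def] by blast
qed

section \<open>Vectors, differentials and quadratic forms in the plane\<close>

definition V2 :: "real \<Rightarrow> real \<Rightarrow> real^2" where
  "V2 p q = p *\<^sub>R axis 1 1 + q *\<^sub>R axis 2 1"

lemma V2_nth [simp]: "V2 p q $ 1 = p" "V2 p q $ 2 = q"
  by (simp_all add: V2_def axis_def)

lemma vec2_eq_iff: "(x :: real^2) = y \<longleftrightarrow> x $ 1 = y $ 1 \<and> x $ 2 = y $ 2"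
  by (simp add: vec_eq_iff forall_2)

lemma V2_inner [simp]: "V2 p q \<bullet> v = p * v $ 1 + q * v $ 2"
  by (simp add: inner_vec_def sum_2)

lemma norm_V2_le: "norm (V2 p q) \<le> \<bar>p\<bar> + \<bar>q\<bar>"
  unfolding V2_def by (rule order_trans[OF norm_triangle_ineq]) simp

lemma norm2_sq: "(norm (v :: real^2))\<^sup>2 = (v $ 1)\<^sup>2 + (v $ 2)\<^sup>2"
  unfolding power2_norm_eq_inner by (simp add: inner_vec_def sum_2 power2_eq_square)

lemma continuous_on_V2 [continuous_intros]:
  "continuous_on S f \<Longrightarrow> continuous_on S g \<Longrightarrow> continuous_on S (\<lambda>x. V2 (f x) (g x))"
  unfolding V2_def by (intro continuous_intros)

text \<open>The differential of \<open>f\<close> in the chart, as a vector for the Euclidean inner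
  product. It does not involve a metric, unlike \<open>grad\<close>.\<close>

definition grd :: "(real^2 \<Rightarrow> real) \<Rightarrow> real^2 \<Rightarrow> real^2" where
  "grd f x = V2 (partial_deriv 1 f x) (partial_deriv 2 f x)"

lemma smooth_on_grd: "smooth_on S f \<Longrightarrow> x \<in> S \<Longrightarrow> (f has_derivative (\<lambda>v. grd f x \<bullet> v)) (at x)"
  unfolding grd_def V2_inner by (rule smooth_on_has_derivative)

lemma continuous_on_grd: "smooth_on S f \<Longrightarrow> continuous_on S (grd f)"
  unfolding grd_def[abs_def] by (intro continuous_on_V2 smooth_on_continuous smooth_on_partial_deriv)

text \<open>A metric is given by its components \<open>a\<close>, \<open>b\<close>, \<open>c\<close>; \<open>quad\<close> is the kinetic energy,
  \<open>mom\<close> the Legendre transform and \<open>vel\<close> its inverse.\<close>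

definition quad :: "(real^2 \<Rightarrow> real) \<Rightarrow> (real^2 \<Rightarrow> real) \<Rightarrow> (real^2 \<Rightarrow> real) \<Rightarrow> real^2 \<Rightarrow> real^2 \<Rightarrow> real" where
  "quad a b c x v = (a x * (v $ 1)\<^sup>2 + 2 * b x * (v $ 1 * v $ 2) + c x * (v $ 2)\<^sup>2) / 2"

definition quad_x :: "(real^2 \<Rightarrow> real^2) \<Rightarrow> (real^2 \<Rightarrow> real^2) \<Rightarrow> (real^2 \<Rightarrow> real^2) \<Rightarrow> real^2 \<Rightarrow> real^2 \<Rightarrow> real^2" where
  "quad_x a b c x v = ((v $ 1)\<^sup>2 / 2) *\<^sub>R a x + (v $ 1 * v $ 2) *\<^sub>R b x + ((v $ 2)\<^sup>2 / 2) *\<^sub>R c x"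

definition mom :: "(real^2 \<Rightarrow> real) \<Rightarrow> (real^2 \<Rightarrow> real) \<Rightarrow> (real^2 \<Rightarrow> real) \<Rightarrow> real^2 \<Rightarrow> real^2 \<Rightarrow> real^2" where
  "mom a b c x v = V2 (a x * v $ 1 + b x * v $ 2) (b x * v $ 1 + c x * v $ 2)"

definition vel :: "(real^2 \<Rightarrow> real) \<Rightarrow> (real^2 \<Rightarrow> real) \<Rightarrow> (real^2 \<Rightarrow> real) \<Rightarrow> real^2 \<Rightarrow> real^2 \<Rightarrow> real^2" where
  "vel a b c x P = V2 ((c x * P $ 1 - b x * P $ 2) / (a x * c x - (b x)\<^sup>2)) ((a x * P $ 2 - b x * P $ 1) / (a x * c x - (b x)\<^sup>2))"

lemma vel_mom: "a x * c x - (b x)\<^sup>2 \<noteq> 0 \<Longrightarrow> vel a b c x (mom a b c x v) = v"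
  unfolding vec2_eq_iff vel_def mom_def by (simp add: divide_eq_eq power2_eq_square algebra_simps)

lemma mom_vel: "a x * c x - (b x)\<^sup>2 \<noteq> 0 \<Longrightarrow> mom a b c x (vel a b c x P) = P"
  unfolding vec2_eq_iff vel_def mom_def
  by (simp add: add_divide_distrib[symmetric] divide_eq_eq power2_eq_square algebra_simps)

lemma quad_mom: "quad a b c x v = (mom a b c x v \<bullet> v) / 2"
  by (simp add: quad_def mom_def power2_eq_square algebra_simps)

text \<open>By Cayley-Hamilton, (a + c) G - det G = G^2 for the symmetric matrix G with entries a,
  b, c, and the quadratic form of G^2 is a sum of squares. So det G / (a + c) bounds the form of G
  from below; the additional factor 2 is that of \<open>quad\<close>.\<close>

lemma quad_lower:
  assumes "a x > 0" "a x * c x - (b x)\<^sup>2 > 0"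
  shows "c x > 0" "(a x * c x - (b x)\<^sup>2) / (2 * (a x + c x)) * (norm v)\<^sup>2 \<le> quad a b c x v"
proof -
  have "0 < a x * c x" using assms zero_le_power2[of "b x"] by linarith
  then show c: "c x > 0" using assms by (simp add: zero_less_mult_iff)
  have "(a x + c x) * (2 * quad a b c x v) - (a x * c x - (b x)\<^sup>2) * ((v $ 1)\<^sup>2 + (v $ 2)\<^sup>2)
      = (a x * v $ 1 + b x * v $ 2)\<^sup>2 + (b x * v $ 1 + c x * v $ 2)\<^sup>2"
    unfolding quad_def by (simp add: power2_eq_square algebra_simps)
  moreover have "0 \<le> (a x * v $ 1 + b x * v $ 2)\<^sup>2 + (b x * v $ 1 + c x * v $ 2)\<^sup>2" by simp
  ultimately have "(a x * c x - (b x)\<^sup>2) * (norm v)\<^sup>2 \<le> (a x + c x) * (2 * quad a b c x v)"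
    unfolding norm2_sq by linarith
  then show "(a x * c x - (b x)\<^sup>2) / (2 * (a x + c x)) * (norm v)\<^sup>2 \<le> quad a b c x v"
    using assms c by (simp add: field_simps)
qed

lemma quad_lagrangian:
  assumes da: "\<And>x. (a has_derivative (\<lambda>v. a' x \<bullet> v)) (at x)" and db: "\<And>x. (b has_derivative (\<lambda>v. b' x \<bullet> v)) (at x)"
    and dc: "\<And>x. (c has_derivative (\<lambda>v. c' x \<bullet> v)) (at x)"
    and ca: "continuous_on UNIV a'" and cb: "continuous_on UNIV b'" and cc: "continuous_on UNIV c'"
    and Ma: "\<And>x. norm (a' x) \<le> M" and Mb: "\<And>x. norm (b' x) \<le> M" and Mc: "\<And>x. norm (c' x) \<le> M"
    and Na: "\<And>x. \<bar>a x\<bar> \<le> M" and Nb: "\<And>x. \<bar>b x\<bar> \<le> M" and Nc: "\<And>x. \<bar>c x\<bar> \<le> M"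
    and lam: "lam > 0" and low: "\<And>x v. lam * (norm v)\<^sup>2 \<le> quad a b c x v"
  shows "quadratic_lagrangian (quad a b c) (quad_x a' b' c') (mom a b c) (vel a b c) lam (4 * M)"
proof
  have M0: "M \<ge> 0" using Na[of undefined] by linarith
  \<comment> \<open>The determinant is controlled by \<open>low\<close>: the form is tested on (1,
    0) and on (-b, a), where its value is half of a times the determinant.\<close>
  have det: "a x * c x - (b x)\<^sup>2 \<noteq> 0" for x
  proof -
    have "0 < lam * (norm (V2 1 0))\<^sup>2" using lam by (simp add: norm2_sq)
    also have "\<dots> \<le> quad a b c x (V2 1 0)" by (rule low)
    finally have apos: "a x > 0" by (simp add: quad_def)
    have "0 < lam * (norm (V2 (- b x) (a x)))\<^sup>2" using lam apos by (simp add: norm2_sq sum_power2_gt_zero_iff)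
    also have "\<dots> \<le> quad a b c x (V2 (- b x) (a x))" by (rule low)
    also have "\<dots> = a x * (a x * c x - (b x)\<^sup>2) / 2" by (simp add: quad_def power2_eq_square algebra_simps)
    finally show ?thesis using apos by auto
  qed
  show "0 < lam" by fact
  show "lam * (norm v)\<^sup>2 \<le> quad a b c x v" for x v by (rule low)
  show "vel a b c x (mom a b c x v) = v" for x v by (rule vel_mom[OF det])
  show "quad a b c x (s *\<^sub>R v) = s\<^sup>2 * quad a b c x v" for x s v
    by (simp add: quad_def power2_eq_square algebra_simps)
  have b1: "\<bar>v $ i\<bar> \<le> norm v" for v :: "real^2" and i by (rule component_le_norm_cart)
  have c0: "continuous_on UNIV a" "continuous_on UNIV b" "continuous_on UNIV c"
    using da db dc by (auto intro!: continuous_at_imp_continuous_on has_derivative_continuous)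
  have cf: "continuous_on UNIV (\<lambda>z :: (real^2) \<times> (real^2). f (fst z))" if "continuous_on UNIV f" for f :: "real^2 \<Rightarrow> 'b::real_normed_vector"
    by (rule continuous_on_compose2[OF that]) (auto intro!: continuous_intros)
  show "continuous_on UNIV (\<lambda>z. quad_x a' b' c' (fst z) (snd z))"
    unfolding quad_x_def by (intro continuous_intros cf ca cb cc) auto
  show "continuous_on UNIV (\<lambda>z. vel a b c (fst z) (snd z))"
    unfolding vel_def using det by (intro continuous_intros cf c0) auto
  show "norm (quad_x a' b' c' x v) \<le> 4 * M * (norm v)\<^sup>2" for x v
  proof -
    have s: "(v $ i)\<^sup>2 \<le> (norm v)\<^sup>2" for i using b1[of v i] power_mono[of "\<bar>v $ i\<bar>" "norm v" 2] by simp
    have p: "\<bar>v $ 1 * v $ 2\<bar> \<le> (norm v)\<^sup>2" unfolding abs_mult power2_eq_square by (intro mult_mono b1) auto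
    have "norm (quad_x a' b' c' x v) \<le> norm (((v $ 1)\<^sup>2 / 2) *\<^sub>R a' x) + norm ((v $ 1 * v $ 2) *\<^sub>R b' x) + norm (((v $ 2)\<^sup>2 / 2) *\<^sub>R c' x)"
      unfolding quad_x_def by (intro order_trans[OF norm_triangle_ineq] add_right_mono norm_triangle_ineq)
    also have "\<dots> = (v $ 1)\<^sup>2 / 2 * norm (a' x) + \<bar>v $ 1 * v $ 2\<bar> * norm (b' x) + (v $ 2)\<^sup>2 / 2 * norm (c' x)" by simp
    also have "\<dots> \<le> (norm v)\<^sup>2 / 2 * M + (norm v)\<^sup>2 * M + (norm v)\<^sup>2 / 2 * M"
      by (intro add_mono mult_mono divide_right_mono s p Ma Mb Mc) auto
    also have "\<dots> \<le> 4 * M * (norm v)\<^sup>2" using M0 by (simp add: mult.commute mult_nonneg_nonneg)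
    finally show ?thesis .
  qed
  show "norm (mom a b c x v) \<le> 4 * M * norm v" for x v
  proof -
    have "norm (mom a b c x v) \<le> \<bar>a x * v $ 1 + b x * v $ 2\<bar> + \<bar>b x * v $ 1 + c x * v $ 2\<bar>"
      unfolding mom_def by (rule norm_V2_le)
    also have "\<dots> \<le> (\<bar>a x\<bar> * \<bar>v $ 1\<bar> + \<bar>b x\<bar> * \<bar>v $ 2\<bar>) + (\<bar>b x\<bar> * \<bar>v $ 1\<bar> + \<bar>c x\<bar> * \<bar>v $ 2\<bar>)"
      unfolding abs_mult[symmetric] by (intro add_mono abs_triangle_ineq)
    also have "\<dots> \<le> (M * norm v + M * norm v) + (M * norm v + M * norm v)"
      using M0 by (intro add_mono mult_mono b1 Na Nb Nc) auto
    finally show ?thesis by simp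
  qed
  show "((\<lambda>z. quad a b c (fst z) (snd z)) has_derivative (\<lambda>d. quad_x a' b' c' x v \<bullet> fst d + mom a b c x v \<bullet> snd d)) (at (x, v))" for x v
  proof -
    have F: "((\<lambda>z. f (fst z)) has_derivative (\<lambda>d. f' x \<bullet> fst d)) (at (x, v))"
      if "\<And>x. (f has_derivative (\<lambda>v. f' x \<bullet> v)) (at x)" for f :: "real^2 \<Rightarrow> real" and f'
      using has_derivative_compose[OF has_derivative_fst[OF has_derivative_ident], of f "\<lambda>v. f' x \<bullet> v" "(x, v)" UNIV] that by simp
    have G: "((\<lambda>z :: (real^2) \<times> (real^2). snd z $ i) has_derivative (\<lambda>d. snd d $ i)) (at (x, v))" for i
      by (rule bounded_linear.has_derivative[OF bounded_linear_vec_nth has_derivative_snd[OF has_derivative_ident]])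
    note D = has_derivative_mult[OF F[OF da] has_derivative_mult[OF G[of 1] G[of 1]]]
      has_derivative_mult[OF F[OF db] has_derivative_mult[OF G[of 1] G[of 2]]]
      has_derivative_mult[OF F[OF dc] has_derivative_mult[OF G[of 2] G[of 2]]]
    have "((\<lambda>z. (1 / 2) * (a (fst z) * (snd z $ 1 * snd z $ 1)) + b (fst z) * (snd z $ 1 * snd z $ 2) + (1 / 2) * (c (fst z) * (snd z $ 2 * snd z $ 2)))
      has_derivative (\<lambda>d. quad_x a' b' c' x v \<bullet> fst d + mom a b c x v \<bullet> snd d)) (at (x, v))"
      by (rule has_derivative_eq_rhs[OF has_derivative_add[OF has_derivative_add[OF has_derivative_mult_right[OF D(1)] D(2)] has_derivative_mult_right[OF D(3)]]])
        (simp add: fun_eq_iff quad_x_def mom_def inner_add_left power2_eq_square algebra_simps)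
    then show ?thesis by (simp add: quad_def power2_eq_square algebra_simps add_divide_distrib)
  qed
qed

section \<open>Modifying a metric outside a compact set\<close>

definition posdef_on :: "(real^2) set \<Rightarrow> (real^2 \<Rightarrow> real) \<Rightarrow> (real^2 \<Rightarrow> real) \<Rightarrow> (real^2 \<Rightarrow> real) \<Rightarrow> bool" where
  "posdef_on S a b c \<longleftrightarrow> (\<forall>x\<in>S. a x > 0 \<and> a x * c x - (b x)\<^sup>2 > 0)"

lemma quad_lower_compact:
  assumes T: "compact T" and pd: "posdef_on T a b c"
    and cont: "continuous_on T a" "continuous_on T b" "continuous_on T c"
  obtains l where "l > 0" "\<And>x v. x \<in> T \<Longrightarrow> l * (norm v)\<^sup>2 \<le> quad a b c x v"
proof (cases "T = {}")
  case True
  then show ?thesis using that[of 1] by simp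
next
  case False
  define f where "f x = (a x * c x - (b x)\<^sup>2) / (2 * (a x + c x))" for x
  have pos: "a x > 0" "a x * c x - (b x)\<^sup>2 > 0" "c x > 0" if "x \<in> T" for x
    using pd quad_lower(1)[of a x c b] that by (auto simp: posdef_on_def)
  have "2 * (a x + c x) \<noteq> 0" if "x \<in> T" for x
    using add_pos_pos[OF pos(1,3)[OF that]] by (simp only: mult_eq_0_iff) simp
  then have "continuous_on T f" unfolding f_def[abs_def] by (intro continuous_intros cont) blast
  then obtain x0 where x0: "x0 \<in> T" "\<And>x. x \<in> T \<Longrightarrow> f x0 \<le> f x"
    using continuous_attains_inf[OF T False] by blast
  show ?thesis
  proof (rule that[of "f x0"])
    show "f x0 > 0" unfolding f_def using pos[OF x0(1)] by (intro divide_pos_pos) auto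
    show "f x0 * (norm v)\<^sup>2 \<le> quad a b c x v" if "x \<in> T" for x v
    proof -
      have "f x0 * (norm v)\<^sup>2 \<le> f x * (norm v)\<^sup>2" using x0(2)[OF that] by (intro mult_right_mono) auto
      also have "\<dots> \<le> quad a b c x v" unfolding f_def using pos[OF that] by (intro quad_lower(2))
      finally show ?thesis .
    qed
  qed
qed

text \<open>A metric on \<open>S\<close> may degenerate near the frontier of \<open>S\<close> and
  has no meaning outside. It is blended with the Euclidean metric; the forms are combined convexly,
  which preserves positivity. On the neighbourhood \<open>U\<close> of \<open>K\<close> the first
  derivatives agree as well, so there both metrics have the same Hamilton equations.\<close>

lemma metric_extension:
  assumes S: "open S" and K: "compact K" "K \<subseteq> S"
    and sm: "smooth_on S a" "smooth_on S b" "smooth_on S c" and pd: "posdef_on S a b c"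
  obtains A B Cc A' B' C' lam M U where
    "quadratic_lagrangian (quad A B Cc) (quad_x A' B' C') (mom A B Cc) (vel A B Cc) lam M"
    "open U" "K \<subseteq> U" "U \<subseteq> S" "\<And>x. x \<in> U \<Longrightarrow> A x = a x" "\<And>x. x \<in> U \<Longrightarrow> B x = b x" "\<And>x. x \<in> U \<Longrightarrow> Cc x = c x"
    "\<And>x. x \<in> U \<Longrightarrow> A' x = grd a x" "\<And>x. x \<in> U \<Longrightarrow> B' x = grd b x" "\<And>x. x \<in> U \<Longrightarrow> C' x = grd c x"
proof -
  obtain \<theta> :: "real^2 \<Rightarrow> real" and \<theta>' U T where UT: "open U" "K \<subseteq> U" "U \<subseteq> T" "compact T" "T \<subseteq> S"
    and \<theta>: "\<And>x. (\<theta> has_derivative (\<lambda>v. \<theta>' x \<bullet> v)) (at x)" "continuous_on UNIV \<theta>'"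
    "\<And>x. x \<in> U \<Longrightarrow> \<theta> x = 1" "\<And>x. x \<in> U \<Longrightarrow> \<theta>' x = 0"
    "\<And>x. x \<notin> T \<Longrightarrow> \<theta> x = 0" "\<And>x. x \<notin> T \<Longrightarrow> \<theta>' x = 0"
    and \<theta>01: "\<And>x. 0 \<le> \<theta> x" "\<And>x. \<theta> x \<le> 1"
    using cutoff_exists[OF K(1) S K(2)] by metis
  define A where "A = (\<lambda>x. if x \<in> S then \<theta> x * a x + (1 - \<theta> x) * 1 else 1)"
  define B where "B = (\<lambda>x. if x \<in> S then \<theta> x * b x + (1 - \<theta> x) * 0 else 0)"
  define Cc where "Cc = (\<lambda>x. if x \<in> S then \<theta> x * c x + (1 - \<theta> x) * 1 else 1)"
  have "\<exists>F' M. (\<forall>x. (A has_derivative (\<lambda>v. F' x \<bullet> v)) (at x)) \<and> continuous_on UNIV F' \<and>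
      (\<forall>x\<in>U. F' x = grd a x) \<and> (\<forall>x. norm (F' x) \<le> M) \<and> (\<forall>x. \<bar>A x\<bar> \<le> M)"
    unfolding A_def by (rule extend_by_cutoff[OF S UT(4,5,3) \<theta> smooth_on_grd[OF sm(1)] continuous_on_grd[OF sm(1)]])
  then obtain A' Ma where A: "\<And>x. (A has_derivative (\<lambda>v. A' x \<bullet> v)) (at x)" "continuous_on UNIV A'"
    "\<And>x. x \<in> U \<Longrightarrow> A' x = grd a x" "\<And>x. norm (A' x) \<le> Ma" "\<And>x. \<bar>A x\<bar> \<le> Ma"
    by metis
  have "\<exists>F' M. (\<forall>x. (B has_derivative (\<lambda>v. F' x \<bullet> v)) (at x)) \<and> continuous_on UNIV F' \<and>
      (\<forall>x\<in>U. F' x = grd b x) \<and> (\<forall>x. norm (F' x) \<le> M) \<and> (\<forall>x. \<bar>B x\<bar> \<le> M)"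
    unfolding B_def by (rule extend_by_cutoff[OF S UT(4,5,3) \<theta> smooth_on_grd[OF sm(2)] continuous_on_grd[OF sm(2)]])
  then obtain B' Mb where B: "\<And>x. (B has_derivative (\<lambda>v. B' x \<bullet> v)) (at x)" "continuous_on UNIV B'"
    "\<And>x. x \<in> U \<Longrightarrow> B' x = grd b x" "\<And>x. norm (B' x) \<le> Mb" "\<And>x. \<bar>B x\<bar> \<le> Mb"
    by metis
  have "\<exists>F' M. (\<forall>x. (Cc has_derivative (\<lambda>v. F' x \<bullet> v)) (at x)) \<and> continuous_on UNIV F' \<and>
      (\<forall>x\<in>U. F' x = grd c x) \<and> (\<forall>x. norm (F' x) \<le> M) \<and> (\<forall>x. \<bar>Cc x\<bar> \<le> M)"
    unfolding Cc_def by (rule extend_by_cutoff[OF S UT(4,5,3) \<theta> smooth_on_grd[OF sm(3)] continuous_on_grd[OF sm(3)]])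
  then obtain C' Mc where C: "\<And>x. (Cc has_derivative (\<lambda>v. C' x \<bullet> v)) (at x)" "continuous_on UNIV C'"
    "\<And>x. x \<in> U \<Longrightarrow> C' x = grd c x" "\<And>x. norm (C' x) \<le> Mc" "\<And>x. \<bar>Cc x\<bar> \<le> Mc"
    by metis
  define M where "M = max Ma (max Mb Mc)"
  have bounds: "norm (A' x) \<le> M" "norm (B' x) \<le> M" "norm (C' x) \<le> M" "\<bar>A x\<bar> \<le> M" "\<bar>B x\<bar> \<le> M" "\<bar>Cc x\<bar> \<le> M" for x
    using A(4,5)[of x] B(4,5)[of x] C(4,5)[of x] by (auto simp: M_def)
  have "posdef_on T a b c" using pd UT(5) by (auto simp: posdef_on_def)
  then obtain l where l: "l > 0" "\<And>x v. x \<in> T \<Longrightarrow> l * (norm v)\<^sup>2 \<le> quad a b c x v"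
    using quad_lower_compact[OF UT(4)] sm UT(5) smooth_on_continuous continuous_on_subset by metis
  \<comment> \<open>The Euclidean energy density is half the squared norm, whence the 1/2.\<close>
  define lam where "lam = min l (1 / 2)"
  have lam: "lam > 0" "lam \<le> l" "lam \<le> 1 / 2" using l by (auto simp: lam_def)
  have low: "lam * (norm v)\<^sup>2 \<le> quad A B Cc x v" for x v
  proof (cases "x \<in> T")
    case True
    then have "x \<in> S" using UT by blast
    then have "quad A B Cc x v = \<theta> x * quad a b c x v + (1 - \<theta> x) * ((norm v)\<^sup>2 / 2)"
      unfolding quad_def norm2_sq by (simp add: A_def B_def Cc_def field_simps)
    moreover have "lam * (norm v)\<^sup>2 \<le> quad a b c x v"
      using l(2)[OF True, of v] mult_right_mono[OF lam(2), of "(norm v)\<^sup>2"] by simp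
    then have "\<theta> x * (lam * (norm v)\<^sup>2) \<le> \<theta> x * quad a b c x v" using \<theta>01 by (intro mult_left_mono)
    moreover have "lam * (norm v)\<^sup>2 \<le> (norm v)\<^sup>2 / 2" using mult_right_mono[OF lam(3), of "(norm v)\<^sup>2"] by simp
    then have "(1 - \<theta> x) * (lam * (norm v)\<^sup>2) \<le> (1 - \<theta> x) * ((norm v)\<^sup>2 / 2)"
      using \<theta>01[of x] by (intro mult_left_mono) auto
    moreover have "lam * (norm v)\<^sup>2 = \<theta> x * (lam * (norm v)\<^sup>2) + (1 - \<theta> x) * (lam * (norm v)\<^sup>2)"
      by (simp add: left_diff_distrib)
    ultimately show ?thesis by linarith
  next
    case False
    then have "A x = 1" "B x = 0" "Cc x = 1" using \<theta>(5) by (auto simp: A_def B_def Cc_def)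
    then have "quad A B Cc x v = (norm v)\<^sup>2 / 2" by (simp add: quad_def norm2_sq)
    then show ?thesis using mult_right_mono[OF lam(3), of "(norm v)\<^sup>2"] by simp
  qed
  have "quadratic_lagrangian (quad A B Cc) (quad_x A' B' C') (mom A B Cc) (vel A B Cc) lam (4 * M)"
    using A(1,2) B(1,2) C(1,2) bounds lam(1) low by (intro quad_lagrangian) blast+
  moreover have "A x = a x" "B x = b x" "Cc x = c x" if "x \<in> U" for x
    using that UT \<theta>(3) by (auto simp: A_def B_def Cc_def)
  ultimately show ?thesis using that[of A B Cc A' B' C' lam "4 * M" U] UT A(3) B(3) C(3) by blast
qed

section \<open>First and second variation of energy\<close>

definition bil :: "real \<Rightarrow> real \<Rightarrow> real \<Rightarrow> real^2 \<Rightarrow> real^2 \<Rightarrow> real" where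
  "bil a b c u v = a * (u $ 1 * v $ 1) + b * (u $ 1 * v $ 2 + u $ 2 * v $ 1) + c * (u $ 2 * v $ 2)"

definition dir2 :: "(real^2 \<Rightarrow> real) \<Rightarrow> real^2 \<Rightarrow> real^2 \<Rightarrow> real^2 \<Rightarrow> real" where
  "dir2 f x u v = u $ 1 * (grd (partial_deriv 1 f) x \<bullet> v) + u $ 2 * (grd (partial_deriv 2 f) x \<bullet> v)"

lemma quad_bil: "quad a b c x v = bil (a x) (b x) (c x) v v / 2"
  by (simp add: quad_def bil_def power2_eq_square algebra_simps)

text \<open>\<open>E1\<close> is differentiable at 0 only, so instead of Taylor's formula the sign
  of \<open>E1\<close> to the right of 0 is combined with the mean value theorem.\<close>

lemma second_derivative_nonneg_at_min:
  fixes E :: "real \<Rightarrow> real"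
  assumes "d > 0" and E: "\<And>s. \<bar>s\<bar> < d \<Longrightarrow> (E has_real_derivative E1 s) (at s)"
    and E1: "(E1 has_real_derivative E2) (at 0)"
    and min: "\<And>s. \<bar>s\<bar> < d \<Longrightarrow> E 0 \<le> E s"
  shows "E1 0 = 0" "E2 \<ge> 0"
proof -
  show z: "E1 0 = 0"
    using E[of 0] \<open>d > 0\<close> min by (intro DERIV_local_min[of E _ 0 d]) auto
  show "E2 \<ge> 0"
  proof (rule ccontr)
    assume "\<not> E2 \<ge> 0"
    then obtain s where s: "s > 0" "\<And>h. h > 0 \<Longrightarrow> h < s \<Longrightarrow> E1 (0 + h) < E1 0"
      using DERIV_neg_dec_right[OF E1] by auto
    define h where "h = min s d / 2"
    have h: "0 < h" "h < s" "h < d" using s(1) \<open>d > 0\<close> by (auto simp: h_def)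
    have "\<exists>z>0. z < h \<and> E h - E 0 = (h - 0) * E1 z"
      using h by (intro MVT2 E) auto
    then obtain y where y: "0 < y" "y < h" "E h - E 0 = h * E1 y" by auto
    have "E1 y < 0" using s(2)[of y] y h z by simp
    then have "E h < E 0" using y h mult_pos_neg[of h "E1 y"] by simp
    then show False using min[of h] h by simp
  qed
qed

lemma leibniz_second:
  fixes k k1 k2 :: "real \<Rightarrow> real \<Rightarrow> real"
  assumes d: "d > 0"
    and k1: "\<And>s t. \<bar>s\<bar> < d \<Longrightarrow> t \<in> {0..1} \<Longrightarrow> ((\<lambda>s. k s t) has_real_derivative k1 s t) (at s)"
    and k2: "\<And>s t. \<bar>s\<bar> < d \<Longrightarrow> t \<in> {0..1} \<Longrightarrow> ((\<lambda>s. k1 s t) has_real_derivative k2 s t) (at s)"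
    and c0: "\<And>s. \<bar>s\<bar> < d \<Longrightarrow> continuous_on {0..1} (k s)"
    and c1: "continuous_on ({-d<..<d} \<times> {0..1}) (\<lambda>(s, t). k1 s t)"
    and c2: "continuous_on ({-d<..<d} \<times> {0..1}) (\<lambda>(s, t). k2 s t)"
  shows "\<And>s. \<bar>s\<bar> < d \<Longrightarrow> ((\<lambda>s. integral {0..1} (k s)) has_real_derivative integral {0..1} (k1 s)) (at s)"
    and "((\<lambda>s. integral {0..1} (k1 s)) has_real_derivative integral {0..1} (k2 0)) (at 0)"
proof -
  have in_iff: "\<bar>s\<bar> < d \<longleftrightarrow> s \<in> {-d<..<d}" for s by auto
  have at: "at s within {-d<..<d} = at s" if "s \<in> {-d<..<d}" for s
    using that by (intro at_within_open) auto
  show "((\<lambda>s. integral {0..1} (k s)) has_real_derivative integral {0..1} (k1 s)) (at s)" if s: "\<bar>s\<bar> < d" for s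
  proof -
    have "((\<lambda>s. integral (cbox 0 1) (k s)) has_field_derivative integral (cbox 0 1) (k1 s)) (at s within {-d<..<d})"
    proof (rule leibniz_rule_field_derivative)
      show "((\<lambda>x. k x t) has_field_derivative k1 x t) (at x within {-d<..<d})" if "x \<in> {-d<..<d}" "t \<in> cbox 0 1" for x t
        using k1[of x t] that by (intro has_field_derivative_at_within[where s = "{-d<..<d}"]) (simp_all add: abs_less_iff)
      show "k x integrable_on cbox 0 1" if "x \<in> {-d<..<d}" for x
        using c0[of x] that by (intro integrable_continuous) auto
    qed (use c1 s in auto)
    then show ?thesis using at s by (simp add: in_iff)
  qed
  have c1': "continuous_on {0..1} (k1 s)" if "s \<in> {-d<..<d}" for s
  proof -
    have "continuous_on {0..1} (\<lambda>t. case (s, t) of (s, t) \<Rightarrow> k1 s t)"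
      by (rule continuous_on_compose2[OF c1 continuous_on_Pair[OF continuous_on_const continuous_on_id]]) (use that in auto)
    then show ?thesis by simp
  qed
  have "((\<lambda>s. integral (cbox 0 1) (k1 s)) has_field_derivative integral (cbox 0 1) (k2 0)) (at 0 within {-d<..<d})"
  proof (rule leibniz_rule_field_derivative)
    show "((\<lambda>x. k1 x t) has_field_derivative k2 x t) (at x within {-d<..<d})" if "x \<in> {-d<..<d}" "t \<in> cbox 0 1" for x t
      using k2[of x t] that by (intro has_field_derivative_at_within[where s = "{-d<..<d}"]) (simp_all add: abs_less_iff)
    show "k1 x integrable_on cbox 0 1" if "x \<in> {-d<..<d}" for x
      using c1'[OF that] by (intro integrable_continuous) auto
  qed (use c2 d in auto)
  then show "((\<lambda>s. integral {0..1} (k1 s)) has_real_derivative integral {0..1} (k2 0)) (at 0)"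
    using at[of 0] d by simp
qed

lemma smooth_on_subset: "smooth_on S f \<Longrightarrow> T \<subseteq> S \<Longrightarrow> smooth_on T f"
proof -
  have "C_k_on k S f \<Longrightarrow> T \<subseteq> S \<Longrightarrow> C_k_on k T f" for k
    by (induction k arbitrary: f) (auto intro: continuous_on_subset)
  then show "smooth_on S f \<Longrightarrow> T \<subseteq> S \<Longrightarrow> smooth_on T f" by (auto simp: smooth_on_def)
qed

lemma curve_nbhd:
  fixes \<gamma> :: "real \<Rightarrow> 'a::euclidean_space"
  assumes "open S" and \<gamma>: "continuous_on {0..1} \<gamma>" and V: "continuous_on {0..1} V"
    and in_S: "\<And>t. t \<in> {0..1} \<Longrightarrow> \<gamma> t \<in> S"
  obtains d where "d > 0" "\<And>s t. \<bar>s\<bar> < d \<Longrightarrow> t \<in> {0..1} \<Longrightarrow> \<gamma> t + s *\<^sub>R V t \<in> S"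
proof -
  have "compact (\<gamma> ` {0..1})" "\<gamma> ` {0..1} \<subseteq> S" using in_S by (auto intro: compact_continuous_image[OF \<gamma>])
  then obtain e where e: "e > 0" "(\<Union>x\<in>\<gamma> ` {0..1}. ball x e) \<subseteq> S"
    using compact_subset_open_imp_ball_epsilon_subset[of "\<gamma> ` {0..1}" S] \<open>open S\<close> by auto
  have "bounded (V ` {0..1})" using compact_continuous_image[OF V compact_Icc] by (rule compact_imp_bounded)
  then obtain M where M: "\<And>t. t \<in> {0..1} \<Longrightarrow> norm (V t) \<le> M" unfolding bounded_iff by blast
  have M0: "M \<ge> 0" by (rule order_trans[OF norm_ge_zero M[of 0]]) simp
  show ?thesis
  proof (rule that[of "e / (M + 1)"])
    show "e / (M + 1) > 0" using e M0 by simp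
    fix s t :: real assume s: "\<bar>s\<bar> < e / (M + 1)" and t: "t \<in> {0..1}"
    have "norm (s *\<^sub>R V t) \<le> \<bar>s\<bar> * (M + 1)" using M[OF t] by (simp add: mult_left_mono)
    also have "\<dots> < e" using s M0 by (simp add: field_simps)
    finally have "\<gamma> t + s *\<^sub>R V t \<in> ball (\<gamma> t) e" by (simp add: dist_norm)
    then show "\<gamma> t + s *\<^sub>R V t \<in> S" using e(2) t by blast
  qed
qed

text \<open>Integrands of the first and second derivative of the energy along \<gamma> + s V, where
  \<open>T\<close> and \<open>W\<close> are the velocities of \<gamma> and \<open>V\<close>. The
  variation is by straight lines of the chart and hence not covariant; for normal fields along a
  geodesic \<open>var2\<close> differs from the index form by an exact derivative, see
  \<open>index_form\<close>.\<close>

definition var1 where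
  "var1 a b c x T V W = bil (grd a x \<bullet> V) (grd b x \<bullet> V) (grd c x \<bullet> V) T T / 2 + bil (a x) (b x) (c x) T W"

definition var2 where
  "var2 a b c x T V W = bil (dir2 a x V V) (dir2 b x V V) (dir2 c x V V) T T / 2
    + 2 * bil (grd a x \<bullet> V) (grd b x \<bullet> V) (grd c x \<bullet> V) T W + bil (a x) (b x) (c x) W W"

lemma line_DERIV:
  assumes "smooth_on S f" "x + s *\<^sub>R V \<in> S"
  shows "((\<lambda>s. f (x + s *\<^sub>R V)) has_real_derivative grd f (x + s *\<^sub>R V) \<bullet> V) (at s)"
proof -
  have "((\<lambda>s. x + s *\<^sub>R V) has_vector_derivative V) (at s)" by (auto intro!: derivative_eq_intros)
  from smooth_on_curve[OF assms this] show ?thesis by (simp add: grd_def)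
qed

lemma line_DERIV2:
  assumes "smooth_on S f" "x + s *\<^sub>R V \<in> S"
  shows "((\<lambda>s. grd f (x + s *\<^sub>R V) \<bullet> V) has_real_derivative dir2 f (x + s *\<^sub>R V) V V) (at s)"
  unfolding grd_def[of f] V2_inner dir2_def
  by (rule DERIV_cong[OF DERIV_add[OF DERIV_cmult_right[OF line_DERIV[OF smooth_on_partial_deriv[OF assms(1)] assms(2)]]
        DERIV_cmult_right[OF line_DERIV[OF smooth_on_partial_deriv[OF assms(1)] assms(2)]]]]) (simp add: mult.commute)

lemma bil_DERIV:
  assumes "(a has_real_derivative a') (at s)" "(b has_real_derivative b') (at s)" "(c has_real_derivative c') (at s)"
    and "(u has_vector_derivative u') (at s)" "(v has_vector_derivative v') (at s)"
  shows "((\<lambda>s. bil (a s) (b s) (c s) (u s) (v s)) has_real_derivative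
    bil a' b' c' (u s) (v s) + bil (a s) (b s) (c s) u' (v s) + bil (a s) (b s) (c s) (u s) v') (at s)"
proof -
  have n: "((\<lambda>s. f s $ i) has_real_derivative f' $ i) (at s)" if "(f has_vector_derivative f') (at s)" for f :: "real \<Rightarrow> real^2" and f' i
    using bounded_linear.has_vector_derivative[OF bounded_linear_vec_nth that] by (simp add: has_real_derivative_iff_has_vector_derivative)
  show ?thesis unfolding bil_def
    by (auto intro!: derivative_eq_intros assms(1-3) n[OF assms(4)] n[OF assms(5)] simp: algebra_simps)
qed

theorem energy_variation:
  fixes a b c :: "real^2 \<Rightarrow> real"
  assumes S: "open S" and sm: "smooth_on S a" "smooth_on S b" "smooth_on S c"
    and \<gamma>: "C1_curve \<gamma> T" "\<And>t. t \<in> {0..1} \<Longrightarrow> \<gamma> t \<in> S" and V: "C1_curve V W"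
  obtains d E1 where "d > 0" "\<And>s t. \<bar>s\<bar> < d \<Longrightarrow> t \<in> {0..1} \<Longrightarrow> \<gamma> t + s *\<^sub>R V t \<in> S"
    "\<And>s. C1_curve (\<lambda>t. \<gamma> t + s *\<^sub>R V t) (\<lambda>t. T t + s *\<^sub>R W t)"
    "\<And>s. \<bar>s\<bar> < d \<Longrightarrow> ((\<lambda>s. energy (quad a b c) (\<lambda>t. \<gamma> t + s *\<^sub>R V t) (\<lambda>t. T t + s *\<^sub>R W t)) has_real_derivative E1 s) (at s)"
    "E1 0 = integral {0..1} (\<lambda>t. var1 a b c (\<gamma> t) (T t) (V t) (W t))"
    "(E1 has_real_derivative integral {0..1} (\<lambda>t. var2 a b c (\<gamma> t) (T t) (V t) (W t))) (at 0)"
proof -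
  have cT: "continuous_on {0..1} T" and cW: "continuous_on {0..1} W" using \<gamma>(1) V by (auto simp: C1_curve_def)
  have c\<gamma>: "continuous_on {0..1} \<gamma>" and cV: "continuous_on {0..1} V" using \<gamma>(1) V by (auto intro: C1_curve_continuous)
  obtain d where d: "d > 0" and inS: "\<And>s t. \<bar>s\<bar> < d \<Longrightarrow> t \<in> {0..1} \<Longrightarrow> \<gamma> t + s *\<^sub>R V t \<in> S"
    using curve_nbhd[OF S c\<gamma> cV \<gamma>(2)] by blast
  define x where "x s t = \<gamma> t + s *\<^sub>R V t" for s t
  define u where "u s t = T t + s *\<^sub>R W t" for s t
  define k where "k s t = quad a b c (x s t) (u s t)" for s t
  define k1 where "k1 s t = var1 a b c (x s t) (u s t) (V t) (W t)" for s t
  define k2 where "k2 s t = var2 a b c (x s t) (u s t) (V t) (W t)" for s t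
  have u': "((\<lambda>s. u s t) has_vector_derivative W t) (at s)" for s t unfolding u_def by (auto intro!: derivative_eq_intros)
  have bil_commute: "bil p q r y z = bil p q r z y" for p q r y z by (simp add: bil_def algebra_simps)
  have k1d: "((\<lambda>s. k s t) has_real_derivative k1 s t) (at s)" if "\<bar>s\<bar> < d" "t \<in> {0..1}" for s t
  proof -
    note D = line_DERIV[OF _ inS[OF that]]
    have "((\<lambda>s. bil (a (x s t)) (b (x s t)) (c (x s t)) (u s t) (u s t) / 2) has_real_derivative
       (bil (grd a (x s t) \<bullet> V t) (grd b (x s t) \<bullet> V t) (grd c (x s t) \<bullet> V t) (u s t) (u s t)
        + bil (a (x s t)) (b (x s t)) (c (x s t)) (W t) (u s t) + bil (a (x s t)) (b (x s t)) (c (x s t)) (u s t) (W t)) / 2) (at s)"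
      unfolding x_def by (intro DERIV_cdivide bil_DERIV D sm u')
    then show ?thesis unfolding k_def quad_bil k1_def var1_def bil_commute[of _ _ _ "W t"] by (simp add: add_divide_distrib add.commute)
  qed
  have k2d: "((\<lambda>s. k1 s t) has_real_derivative k2 s t) (at s)" if "\<bar>s\<bar> < d" "t \<in> {0..1}" for s t
  proof -
    note D = line_DERIV[OF _ inS[OF that]] and D2 = line_DERIV2[OF _ inS[OF that]]
    have "((\<lambda>s. bil (grd a (x s t) \<bullet> V t) (grd b (x s t) \<bullet> V t) (grd c (x s t) \<bullet> V t) (u s t) (u s t) / 2
        + bil (a (x s t)) (b (x s t)) (c (x s t)) (u s t) (W t)) has_real_derivative
       (bil (dir2 a (x s t) (V t) (V t)) (dir2 b (x s t) (V t) (V t)) (dir2 c (x s t) (V t) (V t)) (u s t) (u s t)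
        + bil (grd a (x s t) \<bullet> V t) (grd b (x s t) \<bullet> V t) (grd c (x s t) \<bullet> V t) (W t) (u s t)
        + bil (grd a (x s t) \<bullet> V t) (grd b (x s t) \<bullet> V t) (grd c (x s t) \<bullet> V t) (u s t) (W t)) / 2
       + (bil (grd a (x s t) \<bullet> V t) (grd b (x s t) \<bullet> V t) (grd c (x s t) \<bullet> V t) (u s t) (W t)
        + bil (a (x s t)) (b (x s t)) (c (x s t)) (W t) (W t) + bil (a (x s t)) (b (x s t)) (c (x s t)) (u s t) 0)) (at s)"
      unfolding x_def by (intro DERIV_add DERIV_cdivide bil_DERIV D D2 sm u' has_vector_derivative_const)
    moreover have "bil p q r y 0 = 0" for p q r y by (simp add: bil_def)
    ultimately show ?thesis unfolding k1_def var1_def k2_def var2_def bil_commute[of _ _ _ "W t" "u s t"]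
      by (simp add: add_divide_distrib add_ac)
  qed
  let ?D = "{-d<..<d} \<times> {0..1::real}"
  have pr: "continuous_on ?D (\<lambda>z. f (snd z))" if "continuous_on {0..1} f" for f :: "real \<Rightarrow> real^2"
    by (rule continuous_on_compose2[OF that]) (auto intro!: continuous_intros)
  have cx: "continuous_on ?D (\<lambda>z. x (fst z) (snd z))" and cu: "continuous_on ?D (\<lambda>z. u (fst z) (snd z))"
    unfolding x_def u_def by (intro continuous_intros pr c\<gamma> cV cT cW)+
  have xS: "(\<lambda>z. x (fst z) (snd z)) ` ?D \<subseteq> S" unfolding x_def using inS by auto
  have cf: "continuous_on ?D (\<lambda>z. f (x (fst z) (snd z)))" if "continuous_on S f" for f :: "real^2 \<Rightarrow> 'b::topological_space"
    by (rule continuous_on_compose2[OF that cx xS])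
  note sc = cf[OF smooth_on_continuous[OF sm(1)]] cf[OF smooth_on_continuous[OF sm(2)]] cf[OF smooth_on_continuous[OF sm(3)]]
  note gc = cf[OF continuous_on_grd[OF sm(1)]] cf[OF continuous_on_grd[OF sm(2)]] cf[OF continuous_on_grd[OF sm(3)]]
  note g2 = cf[OF continuous_on_grd[OF smooth_on_partial_deriv[OF sm(1)]]] cf[OF continuous_on_grd[OF smooth_on_partial_deriv[OF sm(2)]]]
    cf[OF continuous_on_grd[OF smooth_on_partial_deriv[OF sm(3)]]]
  have c1: "continuous_on ?D (\<lambda>(s, t). k1 s t)"
    unfolding k1_def var1_def bil_def case_prod_beta
    by (intro continuous_intros sc gc pr cu cV cW) auto
  have c2: "continuous_on ?D (\<lambda>(s, t). k2 s t)"
    unfolding k2_def var2_def bil_def dir2_def case_prod_beta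
    by (intro continuous_intros sc gc g2 pr cu cV cW) auto
  have c0: "continuous_on {0..1} (k s)" if "\<bar>s\<bar> < d" for s
  proof -
    have xs: "continuous_on {0..1} (x s)" "continuous_on {0..1} (u s)"
      unfolding x_def[abs_def] u_def[abs_def] by (intro continuous_intros c\<gamma> cV cT cW)+
    have "x s ` {0..1} \<subseteq> S" unfolding x_def using inS[OF that] by auto
    then have cs: "continuous_on {0..1} (\<lambda>t. f (x s t))" if "smooth_on S f" for f
      using continuous_on_compose2[OF smooth_on_continuous[OF that] xs(1)] by blast
    show ?thesis unfolding k_def[abs_def] quad_def
      by (intro continuous_intros xs cs[OF sm(1)] cs[OF sm(2)] cs[OF sm(3)]) auto
  qed
  have L1: "((\<lambda>s. integral {0..1} (k s)) has_real_derivative integral {0..1} (k1 s)) (at s)" if "\<bar>s\<bar> < d" for s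
    by (rule leibniz_second(1)[OF d k1d k2d c0 c1 c2 that])
  have L2: "((\<lambda>s. integral {0..1} (k1 s)) has_real_derivative integral {0..1} (k2 0)) (at 0)"
    by (rule leibniz_second(2)[OF d k1d k2d c0 c1 c2])
  show ?thesis
  proof (rule that[OF d inS])
    show "C1_curve (\<lambda>t. \<gamma> t + s *\<^sub>R V t) (\<lambda>t. T t + s *\<^sub>R W t)" for s
      using \<gamma>(1) V unfolding C1_curve_def by (auto intro!: derivative_eq_intros continuous_intros)
    show "((\<lambda>s. energy (quad a b c) (\<lambda>t. \<gamma> t + s *\<^sub>R V t) (\<lambda>t. T t + s *\<^sub>R W t)) has_real_derivative integral {0..1} (k1 s)) (at s)"
      if "\<bar>s\<bar> < d" for s using L1[OF that] unfolding energy_def k_def[abs_def] x_def u_def .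
    show "integral {0..1} (k1 0) = integral {0..1} (\<lambda>t. var1 a b c (\<gamma> t) (T t) (V t) (W t))"
      by (simp add: k1_def[abs_def] x_def u_def)
    show "((\<lambda>s. integral {0..1} (k1 s)) has_real_derivative integral {0..1} (\<lambda>t. var2 a b c (\<gamma> t) (T t) (V t) (W t))) (at 0)"
      using L2 by (simp add: k2_def[abs_def] x_def u_def)
  qed
qed

text \<open>With determinant one the cofactors of the metric form its inverse, so \<open>cofq\<close> is the inner product
  of covectors. \<open>gcurv\<close> is the curvature component R1212, here also the Gauss curvature.\<close>

definition cofq :: "real \<Rightarrow> real \<Rightarrow> real \<Rightarrow> real \<Rightarrow> real \<Rightarrow> real \<Rightarrow> real \<Rightarrow> real" where
  "cofq a b c x1 x2 y1 y2 = c * (x1 * y1) - b * (x1 * y2 + x2 * y1) + a * (x2 * y2)"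

text \<open>\<open>G1\<close> and \<open>G2\<close> are the Christoffel symbols of the first kind;
  \<open>s1\<close>, \<open>s2\<close> and \<open>m1\<close>, \<open>m2\<close> are the derivatives
  of the tangent T of a geodesic and of a parallel field N. The left side is the derivative of T
  paired with Gamma(N, N); it equals the density of the second variation plus curvature times the
  squared wedge product of N and T. As in the Gauss equation, the terms quadratic in Gamma reduce to
  |Gamma(N, T)|^2 - <Gamma(T, T), Gamma(N, N)>.\<close>

lemma index_algebra:
  fixes a b c a1 a2 b1 b2 c1 c2 a11 a12 a22 b11 b12 b22 c11 c12 c22 t1 t2 n1 n2 s1 s2 m1 m2 :: real
  assumes det: "a * c - b\<^sup>2 = 1"
    and G1: "\<And>u1 u2 v1 v2. G1 u1 u2 v1 v2 = (a1 / 2) * (u1 * v1) + (a2 / 2) * (u1 * v2 + u2 * v1) + (b2 - c1 / 2) * (u2 * v2)"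
    and G2: "\<And>u1 u2 v1 v2. G2 u1 u2 v1 v2 = (b1 - a2 / 2) * (u1 * v1) + (c1 / 2) * (u1 * v2 + u2 * v1) + (c2 / 2) * (u2 * v2)"
    and s: "a * s1 + b * s2 = - G1 t1 t2 t1 t2" "b * s1 + c * s2 = - G2 t1 t2 t1 t2"
    and m: "a * m1 + b * m2 = - G1 n1 n2 t1 t2" "b * m1 + c * m2 = - G2 n1 n2 t1 t2"
  shows "(s1 * G1 n1 n2 n1 n2 + s2 * G2 n1 n2 n1 n2) + 2 * (t1 * G1 n1 n2 m1 m2 + t2 * G2 n1 n2 m1 m2)
      + (t1 * (((a11 * t1 + a12 * t2) / 2) * (n1 * n1) + ((a12 * t1 + a22 * t2) / 2) * (2 * (n1 * n2)) + ((b12 * t1 + b22 * t2) - (c11 * t1 + c12 * t2) / 2) * (n2 * n2))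
        + t2 * (((b11 * t1 + b12 * t2) - (a12 * t1 + a22 * t2) / 2) * (n1 * n1) + ((c11 * t1 + c12 * t2) / 2) * (2 * (n1 * n2)) + ((c12 * t1 + c22 * t2) / 2) * (n2 * n2)))
    = ((a11 * (n1 * n1) + 2 * a12 * (n1 * n2) + a22 * (n2 * n2)) * (t1 * t1)
        + 2 * (b11 * (n1 * n1) + 2 * b12 * (n1 * n2) + b22 * (n2 * n2)) * (t1 * t2)
        + (c11 * (n1 * n1) + 2 * c12 * (n1 * n2) + c22 * (n2 * n2)) * (t2 * t2)) / 2
      + 2 * ((a1 * n1 + a2 * n2) * (t1 * m1) + (b1 * n1 + b2 * n2) * (t1 * m2 + t2 * m1) + (c1 * n1 + c2 * n2) * (t2 * m2))
      + (a * (m1 * m1) + 2 * b * (m1 * m2) + c * (m2 * m2))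
      + ((2 * b12 - c11 - a22) / 2 + cofq a b c (a2 / 2) (c1 / 2) (a2 / 2) (c1 / 2)
          - cofq a b c (a1 / 2) (b1 - a2 / 2) (b2 - c1 / 2) (c2 / 2)) * (n1 * t2 - n2 * t1)\<^sup>2"
    (is "?S + ?M + ?D = ?D2 + ?HN + ?NN + (?R2 + ?C1 - ?C2) * _")
proof -
  have cof: "x1 = c * y1 - b * y2" "x2 = a * y2 - b * y1" if "a * x1 + b * x2 = y1" "b * x1 + c * x2 = y2" for x1 x2 y1 y2
  proof -
    have "c * y1 - b * y2 = (a * c - b\<^sup>2) * x1" "a * y2 - b * y1 = (a * c - b\<^sup>2) * x2"
      unfolding that[symmetric] by (simp_all add: power2_eq_square algebra_simps)
    then show "x1 = c * y1 - b * y2" "x2 = a * y2 - b * y1" by (simp_all add: det)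
  qed
  note sm = cof[OF s] cof[OF m]
  have 1: "?D - ?D2 = ?R2 * (n1 * t2 - n2 * t1)\<^sup>2"
    by (simp add: power2_eq_square field_simps)
  have 2: "?HN = 2 * (m1 * G1 n1 n2 t1 t2 + m2 * G2 n1 n2 t1 t2) + ?M"
    unfolding G1 G2 by (simp add: field_simps)
  have "?NN = m1 * (a * m1 + b * m2) + m2 * (b * m1 + c * m2)" by (simp add: algebra_simps)
  then have 3: "?NN = - (m1 * G1 n1 n2 t1 t2 + m2 * G2 n1 n2 t1 t2)" unfolding m by simp
  have 4: "?S = - cofq a b c (G1 t1 t2 t1 t2) (G2 t1 t2 t1 t2) (G1 n1 n2 n1 n2) (G2 n1 n2 n1 n2)"
    unfolding sm(1,2) cofq_def by (simp add: algebra_simps)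
  have 5: "m1 * G1 n1 n2 t1 t2 + m2 * G2 n1 n2 t1 t2 = - cofq a b c (G1 n1 n2 t1 t2) (G2 n1 n2 t1 t2) (G1 n1 n2 t1 t2) (G2 n1 n2 t1 t2)"
    unfolding sm(3,4) cofq_def by (simp add: algebra_simps)
  \<comment> \<open>For symmetric bilinear forms in two variables this difference of products
    depends on the two vectors only through their wedge product.\<close>
  have 6: "cofq a b c (p1 * (n1 * t1) + q1 * (n1 * t2 + n2 * t1) + r1 * (n2 * t2)) (p2 * (n1 * t1) + q2 * (n1 * t2 + n2 * t1) + r2 * (n2 * t2))
        (p1 * (n1 * t1) + q1 * (n1 * t2 + n2 * t1) + r1 * (n2 * t2)) (p2 * (n1 * t1) + q2 * (n1 * t2 + n2 * t1) + r2 * (n2 * t2))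
      - cofq a b c (p1 * (t1 * t1) + q1 * (t1 * t2 + t2 * t1) + r1 * (t2 * t2)) (p2 * (t1 * t1) + q2 * (t1 * t2 + t2 * t1) + r2 * (t2 * t2))
          (p1 * (n1 * n1) + q1 * (n1 * n2 + n2 * n1) + r1 * (n2 * n2)) (p2 * (n1 * n1) + q2 * (n1 * n2 + n2 * n1) + r2 * (n2 * n2))
      = (cofq a b c q1 q2 q1 q2 - cofq a b c p1 p2 r1 r2) * (n1 * t2 - n2 * t1)\<^sup>2" for p1 q1 r1 p2 q2 r2
    unfolding cofq_def by algebra
  have 7: "cofq a b c (G1 n1 n2 t1 t2) (G2 n1 n2 t1 t2) (G1 n1 n2 t1 t2) (G2 n1 n2 t1 t2)
      - cofq a b c (G1 t1 t2 t1 t2) (G2 t1 t2 t1 t2) (G1 n1 n2 n1 n2) (G2 n1 n2 n1 n2) = (?C1 - ?C2) * (n1 * t2 - n2 * t1)\<^sup>2"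
    unfolding G1 G2 by (rule 6)
  have key: "S + M + D = D2 + HN + NN + (R2 + C1 - C2) * W"
    if "D - D2 = R2 * W" "HN = 2 * X + M" "NN = - X" "S = - K2" "X = - K1" "K1 - K2 = (C1 - C2) * W"
    for S M D D2 HN NN R2 C1 C2 W X K1 K2 :: real
    using that by (simp add: algebra_simps)
  show ?thesis by (rule key[OF 1 2 3 4 5 7])
qed

definition gcurv :: "(real^2 \<Rightarrow> real) \<Rightarrow> (real^2 \<Rightarrow> real) \<Rightarrow> (real^2 \<Rightarrow> real) \<Rightarrow> real^2 \<Rightarrow> real" where
  "gcurv a b c x =
    (2 * partial_deriv 1 (partial_deriv 2 b) x - partial_deriv 1 (partial_deriv 1 c) x - partial_deriv 2 (partial_deriv 2 a) x) / 2
    + cofq (a x) (b x) (c x) (partial_deriv 2 a x / 2) (partial_deriv 1 c x / 2) (partial_deriv 2 a x / 2) (partial_deriv 1 c x / 2)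
    - cofq (a x) (b x) (c x) (partial_deriv 1 a x / 2) (partial_deriv 1 b x - partial_deriv 2 a x / 2)
        (partial_deriv 2 b x - partial_deriv 1 c x / 2) (partial_deriv 2 c x / 2)"

section \<open>Geodesics in Hamiltonian form, their normal field and the index form\<close>

locale unimodular_curve =
  fixes S :: "(real^2) set" and a b c :: "real^2 \<Rightarrow> real" and \<gamma> P :: "real \<Rightarrow> real^2"
  assumes S: "open S" and sa: "smooth_on S a" and sb: "smooth_on S b" and sc: "smooth_on S c"
    and det: "\<And>x. x \<in> S \<Longrightarrow> a x * c x - (b x)\<^sup>2 = 1"
    and in_S: "\<And>t. t \<in> {0..1} \<Longrightarrow> \<gamma> t \<in> S"
    and \<gamma>_C1: "C1_curve \<gamma> (\<lambda>t. vel a b c (\<gamma> t) (P t))"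
    and P_C1: "C1_curve P (\<lambda>t. quad_x (grd a) (grd b) (grd c) (\<gamma> t) (vel a b c (\<gamma> t) (P t)))"
begin

definition T where "T t = vel a b c (\<gamma> t) (P t)"
definition P' where "P' t = quad_x (grd a) (grd b) (grd c) (\<gamma> t) (T t)"

lemma \<gamma>_deriv: "t \<in> {0..1} \<Longrightarrow> (\<gamma> has_vector_derivative T t) (at t within {0..1})"
  using \<gamma>_C1 by (simp add: C1_curve_def T_def)

lemma P_deriv: "t \<in> {0..1} \<Longrightarrow> (P has_vector_derivative P' t) (at t within {0..1})"
  using P_C1 by (simp add: C1_curve_def T_def P'_def)

lemma nth_deriv:
  "(f has_vector_derivative f') F \<Longrightarrow> ((\<lambda>s. f s $ i :: real) has_real_derivative f' $ i) F"
  using bounded_linear.has_vector_derivative[OF bounded_linear_vec_nth]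
  by (auto simp: has_real_derivative_iff_has_vector_derivative)

lemma coeff_deriv:
  assumes "smooth_on S f" "t \<in> {0..1}"
  shows "((\<lambda>t. f (\<gamma> t)) has_real_derivative grd f (\<gamma> t) \<bullet> T t) (at t within {0..1})"
  using smooth_on_curve[OF assms(1) in_S[OF assms(2)] \<gamma>_deriv[OF assms(2)]] by (simp add: grd_def)

lemma T_nth: "t \<in> {0..1} \<Longrightarrow> T t $ 1 = c (\<gamma> t) * P t $ 1 - b (\<gamma> t) * P t $ 2"
  "t \<in> {0..1} \<Longrightarrow> T t $ 2 = a (\<gamma> t) * P t $ 2 - b (\<gamma> t) * P t $ 1"
  using det[OF in_S] by (simp_all add: T_def vel_def)

lemma P_nth:
  assumes "t \<in> {0..1}"
  shows "P t $ 1 = a (\<gamma> t) * T t $ 1 + b (\<gamma> t) * T t $ 2" "P t $ 2 = b (\<gamma> t) * T t $ 1 + c (\<gamma> t) * T t $ 2"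
proof -
  have "mom a b c (\<gamma> t) (T t) = P t" unfolding T_def using det[OF in_S[OF assms]] by (intro mom_vel) simp
  then show "P t $ 1 = a (\<gamma> t) * T t $ 1 + b (\<gamma> t) * T t $ 2" "P t $ 2 = b (\<gamma> t) * T t $ 1 + c (\<gamma> t) * T t $ 2"
    unfolding vec2_eq_iff mom_def by simp_all
qed

lemma deriv_unique:
  assumes "(f has_real_derivative x) (at t within {0..1})" "(g has_real_derivative y) (at t within {0..1})"
    "t \<in> {0..1}" "\<And>s. s \<in> {0..1} \<Longrightarrow> f s = g s"
  shows "x = y"
proof -
  have "(f has_vector_derivative x) (at t within cbox 0 1)" "(g has_vector_derivative y) (at t within cbox 0 1)"
    using assms(1,2) by (simp_all add: has_real_derivative_iff_has_vector_derivative)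
  moreover have "(f has_vector_derivative y) (at t within cbox 0 1)"
    using calculation(2) assms(3,4) by (intro has_vector_derivative_transform[of t "cbox 0 1" f g y]) auto
  ultimately show ?thesis
    using vector_derivative_unique_within_closed_interval[of 0 1 t f x y] assms(3) by simp
qed

definition T' where
  "T' t = V2 ((grd c (\<gamma> t) \<bullet> T t) * P t $ 1 + c (\<gamma> t) * P' t $ 1 - ((grd b (\<gamma> t) \<bullet> T t) * P t $ 2 + b (\<gamma> t) * P' t $ 2))
    ((grd a (\<gamma> t) \<bullet> T t) * P t $ 2 + a (\<gamma> t) * P' t $ 2 - ((grd b (\<gamma> t) \<bullet> T t) * P t $ 1 + b (\<gamma> t) * P' t $ 1))"

lemma V2_has_vector_derivative:
  assumes "(f has_real_derivative f') (at x within A)" "(g has_real_derivative g') (at x within A)"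
  shows "((\<lambda>t. V2 (f t) (g t)) has_vector_derivative V2 f' g') (at x within A)"
  unfolding V2_def
  by (rule has_vector_derivative_eq_rhs[OF has_vector_derivative_add[OF has_vector_derivative_scaleR[OF assms(1) has_vector_derivative_const]
        has_vector_derivative_scaleR[OF assms(2) has_vector_derivative_const]]]) simp

lemma T_deriv:
  assumes t: "t \<in> {0..1}"
  shows "(T has_vector_derivative T' t) (at t within {0..1})"
proof -
  note P = nth_deriv[OF P_deriv[OF t]]
  have "((\<lambda>t. V2 (c (\<gamma> t) * P t $ 1 - b (\<gamma> t) * P t $ 2) (a (\<gamma> t) * P t $ 2 - b (\<gamma> t) * P t $ 1)) has_vector_derivative T' t) (at t within {0..1})"
    unfolding T'_def
    by (intro V2_has_vector_derivative)
      (auto intro!: derivative_eq_intros coeff_deriv[OF sa t] coeff_deriv[OF sb t] coeff_deriv[OF sc t] P simp: algebra_simps)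
  then show ?thesis
    by (rule has_vector_derivative_transform[OF t, rotated]) (simp add: vec2_eq_iff T_nth)
qed

text \<open>Christoffel symbols of the first kind as bilinear forms, with lowered index 1 here and 2
  in \<open>G2\<close>.\<close>

definition G1 where "G1 x u v = bil (partial_deriv 1 a x / 2) (partial_deriv 2 a x / 2) (partial_deriv 2 b x - partial_deriv 1 c x / 2) u v"
definition G2 where "G2 x u v = bil (partial_deriv 1 b x - partial_deriv 2 a x / 2) (partial_deriv 1 c x / 2) (partial_deriv 2 c x / 2) u v"

lemma P'_nth: "P' t $ i = ((T t $ 1)\<^sup>2 / 2) * grd a (\<gamma> t) $ i + (T t $ 1 * T t $ 2) * grd b (\<gamma> t) $ i + ((T t $ 2)\<^sup>2 / 2) * grd c (\<gamma> t) $ i"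
  by (simp add: P'_def quad_x_def)

text \<open>The geodesic equation with lowered index, found by differentiating P = h T and comparing
  with Hamilton's equation for \<open>P\<close>.\<close>

lemma T'_eq:
  assumes t: "t \<in> {0..1}"
  shows "a (\<gamma> t) * T' t $ 1 + b (\<gamma> t) * T' t $ 2 = - G1 (\<gamma> t) (T t) (T t)"
    "b (\<gamma> t) * T' t $ 1 + c (\<gamma> t) * T' t $ 2 = - G2 (\<gamma> t) (T t) (T t)"
proof -
  note C = coeff_deriv[OF sa t] coeff_deriv[OF sb t] coeff_deriv[OF sc t]
  note D = nth_deriv[OF T_deriv[OF t]]
  have 1: "P' t $ 1 = (grd a (\<gamma> t) \<bullet> T t) * T t $ 1 + T' t $ 1 * a (\<gamma> t) + ((grd b (\<gamma> t) \<bullet> T t) * T t $ 2 + T' t $ 2 * b (\<gamma> t))"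
    by (rule deriv_unique[OF nth_deriv[OF P_deriv[OF t]] DERIV_add[OF DERIV_mult[OF C(1) D] DERIV_mult[OF C(2) D]] t P_nth(1)])
  have 2: "P' t $ 2 = (grd b (\<gamma> t) \<bullet> T t) * T t $ 1 + T' t $ 1 * b (\<gamma> t) + ((grd c (\<gamma> t) \<bullet> T t) * T t $ 2 + T' t $ 2 * c (\<gamma> t))"
    by (rule deriv_unique[OF nth_deriv[OF P_deriv[OF t]] DERIV_add[OF DERIV_mult[OF C(2) D] DERIV_mult[OF C(3) D]] t P_nth(2)])
  show "a (\<gamma> t) * T' t $ 1 + b (\<gamma> t) * T' t $ 2 = - G1 (\<gamma> t) (T t) (T t)"
    using 1 unfolding P'_nth G1_def bil_def by (simp add: grd_def power2_eq_square field_simps)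
  show "b (\<gamma> t) * T' t $ 1 + c (\<gamma> t) * T' t $ 2 = - G2 (\<gamma> t) (T t) (T t)"
    using 2 unfolding P'_nth G2_def bil_def by (simp add: grd_def power2_eq_square field_simps)
qed

lemma P_inner_T_const: "\<exists>k. \<forall>t\<in>{0..1}. P t \<bullet> T t = k"
proof -
  have "((\<lambda>t. P t \<bullet> T t) has_real_derivative 0) (at s within {0..1})" if s: "s \<in> {0..1}" for s
  proof -
    have "((\<lambda>t. P t $ 1 * T t $ 1 + P t $ 2 * T t $ 2) has_real_derivative
      P' s $ 1 * T s $ 1 + T' s $ 1 * P s $ 1 + (P' s $ 2 * T s $ 2 + T' s $ 2 * P s $ 2)) (at s within {0..1})"
      by (intro DERIV_add DERIV_mult nth_deriv P_deriv T_deriv s)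
    moreover have "P' s $ 1 * T s $ 1 + T' s $ 1 * P s $ 1 + (P' s $ 2 * T s $ 2 + T' s $ 2 * P s $ 2) = 0"
    proof -
      have "T' s $ 1 * P s $ 1 + T' s $ 2 * P s $ 2 = T s $ 1 * (a (\<gamma> s) * T' s $ 1 + b (\<gamma> s) * T' s $ 2) + T s $ 2 * (b (\<gamma> s) * T' s $ 1 + c (\<gamma> s) * T' s $ 2)"
        unfolding P_nth[OF s] by (simp add: algebra_simps)
      also have "\<dots> = - (T s $ 1 * G1 (\<gamma> s) (T s) (T s) + T s $ 2 * G2 (\<gamma> s) (T s) (T s))" unfolding T'_eq[OF s] by simp
      finally show ?thesis unfolding P'_nth G1_def G2_def bil_def
        by (simp add: grd_def power2_eq_square field_simps)
    qed
    ultimately show ?thesis by (simp add: inner_vec_def sum_2)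
  qed
  then show ?thesis by (intro has_field_derivative_zero_constant) auto
qed

end

locale unimodular_geodesic = unimodular_curve +
  fixes r :: real
  assumes r: "r > 0" and r_def: "P 0 \<bullet> vel a b c (\<gamma> 0) (P 0) = r\<^sup>2"
begin

text \<open>The momentum rotated by a right angle and divided by the speed. It is annihilated by
  \<open>P\<close>, and since the determinant is one the rotation from covectors to vectors is an
  isometry, so \<open>N\<close> is the unit normal.\<close>

definition N where "N t = V2 (- (P t $ 2) / r) (P t $ 1 / r)"
definition N' where "N' t = V2 (- (P' t $ 2) / r) (P' t $ 1 / r)"

lemma P_inner_T: "t \<in> {0..1} \<Longrightarrow> P t \<bullet> T t = r\<^sup>2"
  using P_inner_T_const r_def unfolding T_def[symmetric] by force

lemma N_deriv: "t \<in> {0..1} \<Longrightarrow> (N has_vector_derivative N' t) (at t within {0..1})"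
  unfolding N_def[abs_def] N'_def
  by (intro V2_has_vector_derivative DERIV_cdivide DERIV_minus nth_deriv P_deriv)

lemma P_inner_N: "P t \<bullet> N t = 0"
  using r by (simp add: N_def inner_vec_def sum_2)

lemma bil_N_N:
  assumes t: "t \<in> {0..1}"
  shows "bil (a (\<gamma> t)) (b (\<gamma> t)) (c (\<gamma> t)) (N t) (N t) = 1"
proof -
  have "bil (a (\<gamma> t)) (b (\<gamma> t)) (c (\<gamma> t)) (N t) (N t) = (P t \<bullet> T t) / r\<^sup>2"
    using r by (simp add: bil_def N_def inner_vec_def sum_2 T_nth[OF t] power2_eq_square field_simps)
  then show ?thesis using r unfolding P_inner_T[OF t] by simp
qed

lemma N_wedge_T: "t \<in> {0..1} \<Longrightarrow> N t $ 1 * T t $ 2 - N t $ 2 * T t $ 1 = - r"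
  using P_inner_T[of t] r by (simp add: N_def inner_vec_def sum_2 power2_eq_square field_simps)

text \<open>\<open>N\<close> is parallel along the geodesic. \<open>X1\<close>, \<open>X2\<close>
  are the lowered components of its covariant derivative. This is orthogonal to \<open>N\<close>
  because \<open>N\<close> has constant length, and to \<open>T\<close> because \<open>P\<close> is
  parallel and annihilates \<open>N\<close>; by \<open>N_wedge_T\<close> the two vectors are
  independent.\<close>

lemma N'_eq:
  assumes t: "t \<in> {0..1}"
  shows "a (\<gamma> t) * N' t $ 1 + b (\<gamma> t) * N' t $ 2 = - G1 (\<gamma> t) (N t) (T t)"
    "b (\<gamma> t) * N' t $ 1 + c (\<gamma> t) * N' t $ 2 = - G2 (\<gamma> t) (N t) (T t)"
proof -
  define X1 where "X1 = a (\<gamma> t) * N' t $ 1 + b (\<gamma> t) * N' t $ 2 + G1 (\<gamma> t) (N t) (T t)"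
  define X2 where "X2 = b (\<gamma> t) * N' t $ 1 + c (\<gamma> t) * N' t $ 2 + G2 (\<gamma> t) (N t) (T t)"
  note C = coeff_deriv[OF sa t] coeff_deriv[OF sb t] coeff_deriv[OF sc t]
  note D = nth_deriv[OF N_deriv[OF t]]
  have "((\<lambda>t. a (\<gamma> t) * (N t $ 1 * N t $ 1) + b (\<gamma> t) * (N t $ 1 * N t $ 2 + N t $ 2 * N t $ 1) + c (\<gamma> t) * (N t $ 2 * N t $ 2)) has_real_derivative
    ((grd a (\<gamma> t) \<bullet> T t) * (N t $ 1 * N t $ 1) + (N' t $ 1 * N t $ 1 + N' t $ 1 * N t $ 1) * a (\<gamma> t))
    + ((grd b (\<gamma> t) \<bullet> T t) * (N t $ 1 * N t $ 2 + N t $ 2 * N t $ 1) + ((N' t $ 1 * N t $ 2 + N' t $ 2 * N t $ 1) + (N' t $ 2 * N t $ 1 + N' t $ 1 * N t $ 2)) * b (\<gamma> t))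
    + ((grd c (\<gamma> t) \<bullet> T t) * (N t $ 2 * N t $ 2) + (N' t $ 2 * N t $ 2 + N' t $ 2 * N t $ 2) * c (\<gamma> t))) (at t within {0..1})"
    by (intro DERIV_add DERIV_mult C D)
  from deriv_unique[OF this DERIV_const[of 1] t bil_N_N[unfolded bil_def]]
  have XN: "X1 * N t $ 1 + X2 * N t $ 2 = 0"
    unfolding X1_def X2_def G1_def G2_def bil_def by (simp add: grd_def field_simps)
  have "((\<lambda>t. P t $ 1 * N t $ 1 + P t $ 2 * N t $ 2) has_real_derivative
      (P' t $ 1 * N t $ 1 + N' t $ 1 * P t $ 1) + (P' t $ 2 * N t $ 2 + N' t $ 2 * P t $ 2)) (at t within {0..1})"
    by (intro DERIV_add DERIV_mult nth_deriv P_deriv D t)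
  then have "(P' t $ 1 * N t $ 1 + N' t $ 1 * P t $ 1) + (P' t $ 2 * N t $ 2 + N' t $ 2 * P t $ 2) = 0"
    by (rule deriv_unique[OF _ DERIV_const[of 0] t]) (use P_inner_N in \<open>simp add: inner_vec_def sum_2\<close>)
  then have XT: "X1 * T t $ 1 + X2 * T t $ 2 = 0"
    unfolding X1_def X2_def G1_def G2_def bil_def P'_nth P_nth[OF t] by (simp add: grd_def power2_eq_square field_simps)
  have "X1 * (N t $ 1 * T t $ 2 - N t $ 2 * T t $ 1) = (X1 * N t $ 1 + X2 * N t $ 2) * T t $ 2 - (X1 * T t $ 1 + X2 * T t $ 2) * N t $ 2"
    by (simp add: algebra_simps)
  then have "X1 = 0" unfolding XN XT N_wedge_T[OF t] using r by simp
  have "X2 * (N t $ 1 * T t $ 2 - N t $ 2 * T t $ 1) = (X1 * T t $ 1 + X2 * T t $ 2) * N t $ 1 - (X1 * N t $ 1 + X2 * N t $ 2) * T t $ 1"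
    by (simp add: algebra_simps)
  then have "X2 = 0" unfolding XN XT N_wedge_T[OF t] using r by simp
  show "a (\<gamma> t) * N' t $ 1 + b (\<gamma> t) * N' t $ 2 = - G1 (\<gamma> t) (N t) (T t)" using \<open>X1 = 0\<close> by (simp add: X1_def)
  show "b (\<gamma> t) * N' t $ 1 + c (\<gamma> t) * N' t $ 2 = - G2 (\<gamma> t) (N t) (T t)" using \<open>X2 = 0\<close> by (simp add: X2_def)
qed

text \<open>\<open>T\<close> paired with Gamma(N, N), the covariant acceleration of the straight
  line in direction \<open>N\<close>. It is the boundary term caused by varying along straight
  lines.\<close>

definition \<beta> where "\<beta> t = T t $ 1 * G1 (\<gamma> t) (N t) (N t) + T t $ 2 * G2 (\<gamma> t) (N t) (N t)"

end

context unimodular_geodesic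
begin

lemma partial_commute:
  "smooth_on S f \<Longrightarrow> t \<in> {0..1} \<Longrightarrow> partial_deriv 2 (partial_deriv 1 f) (\<gamma> t) = partial_deriv 1 (partial_deriv 2 f) (\<gamma> t)"
  by (rule partial_deriv_commute[OF S in_S])

text \<open>Arranged as the left side of \<open>index_algebra\<close>, with the mixed second
  derivatives in one fixed order.\<close>

definition \<beta>' where "\<beta>' t = (let x = \<gamma> t; t1 = T t $ 1; t2 = T t $ 2; n1 = N t $ 1; n2 = N t $ 2;
    a11 = partial_deriv 1 (partial_deriv 1 a) x; a12 = partial_deriv 1 (partial_deriv 2 a) x; a22 = partial_deriv 2 (partial_deriv 2 a) x;
    b11 = partial_deriv 1 (partial_deriv 1 b) x; b12 = partial_deriv 1 (partial_deriv 2 b) x; b22 = partial_deriv 2 (partial_deriv 2 b) x;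
    c11 = partial_deriv 1 (partial_deriv 1 c) x; c12 = partial_deriv 1 (partial_deriv 2 c) x; c22 = partial_deriv 2 (partial_deriv 2 c) x in
  (T' t $ 1 * G1 x (N t) (N t) + T' t $ 2 * G2 x (N t) (N t)) + 2 * (t1 * G1 x (N t) (N' t) + t2 * G2 x (N t) (N' t))
      + (t1 * (((a11 * t1 + a12 * t2) / 2) * (n1 * n1) + ((a12 * t1 + a22 * t2) / 2) * (2 * (n1 * n2)) + ((b12 * t1 + b22 * t2) - (c11 * t1 + c12 * t2) / 2) * (n2 * n2))
        + t2 * (((b11 * t1 + b12 * t2) - (a12 * t1 + a22 * t2) / 2) * (n1 * n1) + ((c11 * t1 + c12 * t2) / 2) * (2 * (n1 * n2)) + ((c12 * t1 + c22 * t2) / 2) * (n2 * n2))))"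

lemma \<beta>_deriv:
  assumes t: "t \<in> {0..1}"
  shows "(\<beta> has_real_derivative \<beta>' t) (at t within {0..1})"
proof -
  note NN = nth_deriv[OF N_deriv[OF t]] and TT = nth_deriv[OF T_deriv[OF t]]
  have p: "((\<lambda>t. partial_deriv i f (\<gamma> t)) has_real_derivative grd (partial_deriv i f) (\<gamma> t) \<bullet> T t) (at t within {0..1})"
    if "smooth_on S f" for f i
    by (rule coeff_deriv[OF smooth_on_partial_deriv[OF that] t])
  have bd: "((\<lambda>t. bil (u t) (v t) (w t) (N t) (N t)) has_real_derivative
      bil u' v' w' (N t) (N t) + 2 * bil (u t) (v t) (w t) (N t) (N' t)) (at t within {0..1})"
    if "(u has_real_derivative u') (at t within {0..1})" "(v has_real_derivative v') (at t within {0..1})"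
      "(w has_real_derivative w') (at t within {0..1})" for u v w u' v' w'
    unfolding bil_def
    by (rule DERIV_cong[OF DERIV_add[OF DERIV_add[OF DERIV_mult[OF that(1) DERIV_mult[OF NN NN]]
        DERIV_mult[OF that(2) DERIV_add[OF DERIV_mult[OF NN NN] DERIV_mult[OF NN NN]]]] DERIV_mult[OF that(3) DERIV_mult[OF NN NN]]]])
      (simp add: algebra_simps)
  note g1 = bd[OF DERIV_cdivide[OF p[OF sa, of 1], of 2] DERIV_cdivide[OF p[OF sa, of 2], of 2]
      DERIV_diff[OF p[OF sb, of 2] DERIV_cdivide[OF p[OF sc, of 1], of 2]]]
  note g2 = bd[OF DERIV_diff[OF p[OF sb, of 1] DERIV_cdivide[OF p[OF sa, of 2], of 2]]
      DERIV_cdivide[OF p[OF sc, of 1], of 2] DERIV_cdivide[OF p[OF sc, of 2], of 2]]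
  show ?thesis
    unfolding \<beta>_def[abs_def] G1_def[abs_def] G2_def[abs_def]
    by (rule DERIV_cong[OF DERIV_add[OF DERIV_mult[OF TT g1] DERIV_mult[OF TT g2]]])
      (simp add: \<beta>'_def Let_def G1_def G2_def grd_def partial_commute[OF sa t] partial_commute[OF sb t] partial_commute[OF sc t] bil_def[of _ _ _ "N t" "N t"] field_simps)
qed

text \<open>First comes the classical index form of the field x N, with \<open>y\<close> in the role
  of the derivative of \<open>x\<close>. The rest is the derivative of x^2 \<beta>, so after
  integration it contributes only at the end points.\<close>

lemma index_form:
  assumes t: "t \<in> {0..1}"
  shows "var2 a b c (\<gamma> t) (T t) (x *\<^sub>R N t) (y *\<^sub>R N t + x *\<^sub>R N' t) =
    (y\<^sup>2 - gcurv a b c (\<gamma> t) * r\<^sup>2 * x\<^sup>2) + (2 * x * y * \<beta> t + x\<^sup>2 * \<beta>' t)"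
proof -
  let ?a = "a (\<gamma> t)" and ?b = "b (\<gamma> t)" and ?c = "c (\<gamma> t)"
  let ?ga = "grd a (\<gamma> t) \<bullet> N t" and ?gb = "grd b (\<gamma> t) \<bullet> N t" and ?gc = "grd c (\<gamma> t) \<bullet> N t"
  have bil2: "bil p q w u v = p * (u $ 1 * v $ 1) + q * (u $ 1 * v $ 2 + u $ 2 * v $ 1) + w * (u $ 2 * v $ 2)" for p q w u v
    by (simp add: bil_def)
  have cross: "bil ?ga ?gb ?gc (T t) (N t) + bil ?a ?b ?c (N t) (N' t) = \<beta> t"
  proof -
    have "bil ?a ?b ?c (N t) (N' t) = N t $ 1 * (?a * N' t $ 1 + ?b * N' t $ 2) + N t $ 2 * (?b * N' t $ 1 + ?c * N' t $ 2)"
      by (simp add: bil_def algebra_simps)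
    then show ?thesis unfolding N'_eq[OF t] \<beta>_def G1_def G2_def by (simp add: bil_def grd_def field_simps)
  qed
  have main: "\<beta>' t = bil (dir2 a (\<gamma> t) (N t) (N t)) (dir2 b (\<gamma> t) (N t) (N t)) (dir2 c (\<gamma> t) (N t) (N t)) (T t) (T t) / 2
      + 2 * bil ?ga ?gb ?gc (T t) (N' t) + bil ?a ?b ?c (N' t) (N' t) + gcurv a b c (\<gamma> t) * r\<^sup>2"
  proof -
    have det': "?a * ?c - ?b\<^sup>2 = 1" using det[OF in_S[OF t]] .
    note A = index_algebra[where ?G1.0 = "\<lambda>u1 u2 v1 v2. G1 (\<gamma> t) (V2 u1 u2) (V2 v1 v2)" and ?G2.0 = "\<lambda>u1 u2 v1 v2. G2 (\<gamma> t) (V2 u1 u2) (V2 v1 v2)"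
        and ?s1.0 = "T' t $ 1" and ?s2.0 = "T' t $ 2" and ?m1.0 = "N' t $ 1" and ?m2.0 = "N' t $ 2"
        and ?t1.0 = "T t $ 1" and ?t2.0 = "T t $ 2" and ?n1.0 = "N t $ 1" and ?n2.0 = "N t $ 2"
        and ?a1.0 = "partial_deriv 1 a (\<gamma> t)" and ?a2.0 = "partial_deriv 2 a (\<gamma> t)" and ?b1.0 = "partial_deriv 1 b (\<gamma> t)"
        and ?b2.0 = "partial_deriv 2 b (\<gamma> t)" and ?c1.0 = "partial_deriv 1 c (\<gamma> t)" and ?c2.0 = "partial_deriv 2 c (\<gamma> t)"
        and ?a11.0 = "partial_deriv 1 (partial_deriv 1 a) (\<gamma> t)" and ?a12.0 = "partial_deriv 1 (partial_deriv 2 a) (\<gamma> t)" and ?a22.0 = "partial_deriv 2 (partial_deriv 2 a) (\<gamma> t)"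
        and ?b11.0 = "partial_deriv 1 (partial_deriv 1 b) (\<gamma> t)" and ?b12.0 = "partial_deriv 1 (partial_deriv 2 b) (\<gamma> t)" and ?b22.0 = "partial_deriv 2 (partial_deriv 2 b) (\<gamma> t)"
        and ?c11.0 = "partial_deriv 1 (partial_deriv 1 c) (\<gamma> t)" and ?c12.0 = "partial_deriv 1 (partial_deriv 2 c) (\<gamma> t)" and ?c22.0 = "partial_deriv 2 (partial_deriv 2 c) (\<gamma> t)",
        OF det']
    have V: "V2 (v $ 1) (v $ 2) = v" for v by (simp add: vec2_eq_iff)
    have W: "(N t $ 1 * T t $ 2 - N t $ 2 * T t $ 1)\<^sup>2 = r\<^sup>2" unfolding N_wedge_T[OF t] by simp
    have D2: "dir2 f (\<gamma> t) (N t) (N t) = partial_deriv 1 (partial_deriv 1 f) (\<gamma> t) * (N t $ 1 * N t $ 1)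
       + 2 * partial_deriv 1 (partial_deriv 2 f) (\<gamma> t) * (N t $ 1 * N t $ 2) + partial_deriv 2 (partial_deriv 2 f) (\<gamma> t) * (N t $ 2 * N t $ 2)"
      if "smooth_on S f" for f
      using partial_commute[OF that t] by (simp add: dir2_def grd_def algebra_simps)
    have R: "(2 * p - q - s) / 2 + u - v = gcurv a b c (\<gamma> t)"
      if "p = partial_deriv 1 (partial_deriv 2 b) (\<gamma> t)" "q = partial_deriv 1 (partial_deriv 1 c) (\<gamma> t)" "s = partial_deriv 2 (partial_deriv 2 a) (\<gamma> t)"
       "u = cofq ?a ?b ?c (partial_deriv 2 a (\<gamma> t) / 2) (partial_deriv 1 c (\<gamma> t) / 2) (partial_deriv 2 a (\<gamma> t) / 2) (partial_deriv 1 c (\<gamma> t) / 2)"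
       "v = cofq ?a ?b ?c (partial_deriv 1 a (\<gamma> t) / 2) (partial_deriv 1 b (\<gamma> t) - partial_deriv 2 a (\<gamma> t) / 2)
        (partial_deriv 2 b (\<gamma> t) - partial_deriv 1 c (\<gamma> t) / 2) (partial_deriv 2 c (\<gamma> t) / 2)" for p q s u v
      unfolding that gcurv_def by simp
    note B = A[unfolded V W R[OF refl refl refl refl refl], OF _ _ T'_eq[OF t] N'_eq[OF t]]
    have C: "\<beta>' t = (dir2 a (\<gamma> t) (N t) (N t) * (T t $ 1 * T t $ 1) + 2 * dir2 b (\<gamma> t) (N t) (N t) * (T t $ 1 * T t $ 2)
        + dir2 c (\<gamma> t) (N t) (N t) * (T t $ 2 * T t $ 2)) / 2
      + 2 * (?ga * (T t $ 1 * N' t $ 1) + ?gb * (T t $ 1 * N' t $ 2 + T t $ 2 * N' t $ 1) + ?gc * (T t $ 2 * N' t $ 2))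
      + (?a * (N' t $ 1 * N' t $ 1) + 2 * ?b * (N' t $ 1 * N' t $ 2) + ?c * (N' t $ 2 * N' t $ 2)) + gcurv a b c (\<gamma> t) * r\<^sup>2"
      unfolding \<beta>'_def Let_def D2[OF sa] D2[OF sb] D2[OF sc] grd_def V2_inner
      by (rule B) (simp_all add: G1_def G2_def bil_def)
    then show ?thesis by (simp add: bil_def algebra_simps)
  qed
  have d2: "dir2 f y (x *\<^sub>R u) (x *\<^sub>R u) = x\<^sup>2 * dir2 f y u u" for f y u
    by (simp add: dir2_def power2_eq_square algebra_simps)
  have "var2 a b c (\<gamma> t) (T t) (x *\<^sub>R N t) (y *\<^sub>R N t + x *\<^sub>R N' t) =
     x\<^sup>2 * (bil (dir2 a (\<gamma> t) (N t) (N t)) (dir2 b (\<gamma> t) (N t) (N t)) (dir2 c (\<gamma> t) (N t) (N t)) (T t) (T t) / 2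
      + 2 * bil ?ga ?gb ?gc (T t) (N' t) + bil ?a ?b ?c (N' t) (N' t))
     + 2 * x * y * (bil ?ga ?gb ?gc (T t) (N t) + bil ?a ?b ?c (N t) (N' t)) + y\<^sup>2 * bil ?a ?b ?c (N t) (N t)"
    unfolding var2_def d2 by (simp add: bil2 power2_eq_square field_simps)
  also have "\<dots> = x\<^sup>2 * (\<beta>' t - gcurv a b c (\<gamma> t) * r\<^sup>2) + 2 * x * y * \<beta> t + y\<^sup>2"
    unfolding cross bil_N_N[OF t] main by simp
  finally show ?thesis by (simp add: algebra_simps)
qed

lemma N_field_C1:
  assumes \<eta>: "\<And>t. t \<in> {0..1} \<Longrightarrow> (\<eta> has_real_derivative \<eta>' t) (at t within {0..1})" "continuous_on {0..1} \<eta>'"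
  shows "C1_curve (\<lambda>t. \<eta> t *\<^sub>R N t) (\<lambda>t. \<eta>' t *\<^sub>R N t + \<eta> t *\<^sub>R N' t)"
proof -
  have cN: "continuous_on {0..1} N" unfolding continuous_on_eq_continuous_within
    by (auto intro: has_vector_derivative_continuous N_deriv)
  have c\<eta>: "continuous_on {0..1} \<eta>" unfolding continuous_on_eq_continuous_within
    by (auto intro: DERIV_continuous \<eta>(1))
  have "continuous_on {0..1} P'" using P_C1 by (simp add: C1_curve_def P'_def[abs_def] T_def)
  then have cN': "continuous_on {0..1} N'" unfolding N'_def[abs_def] by (intro continuous_intros) (use r in auto)
  show ?thesis unfolding C1_curve_def
  proof (intro conjI ballI)
    fix t :: real assume t: "t \<in> {0..1}"
    show "((\<lambda>t. \<eta> t *\<^sub>R N t) has_vector_derivative \<eta>' t *\<^sub>R N t + \<eta> t *\<^sub>R N' t) (at t within {0..1})"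
      by (rule has_vector_derivative_eq_rhs[OF has_vector_derivative_scaleR[OF \<eta>(1)[OF t] N_deriv[OF t]]]) (simp add: add.commute)
  qed (intro continuous_intros cN c\<eta> \<eta>(2) cN')
qed

lemma continuous_gcurv_curve: "continuous_on {0..1} (\<lambda>t. gcurv a b c (\<gamma> t))"
proof -
  have c\<gamma>: "continuous_on {0..1} \<gamma>" using \<gamma>_C1 by (rule C1_curve_continuous)
  have cs: "continuous_on {0..1} (\<lambda>t. f (\<gamma> t))" if "smooth_on S f" for f
    by (rule continuous_on_compose2[OF smooth_on_continuous[OF that] c\<gamma>]) (use in_S in auto)
  note p1 = cs[OF smooth_on_partial_deriv[OF sa]] cs[OF smooth_on_partial_deriv[OF sb]] cs[OF smooth_on_partial_deriv[OF sc]]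
  note p2 = cs[OF smooth_on_partial_deriv[OF smooth_on_partial_deriv[OF sa]]] cs[OF smooth_on_partial_deriv[OF smooth_on_partial_deriv[OF sb]]]
     cs[OF smooth_on_partial_deriv[OF smooth_on_partial_deriv[OF sc]]]
  show ?thesis unfolding gcurv_def cofq_def
    by (intro continuous_intros cs[OF sa] cs[OF sb] cs[OF sc] p1 p2) auto
qed

lemma integral_var2:
  assumes \<eta>: "\<And>t. t \<in> {0..1} \<Longrightarrow> (\<eta> has_real_derivative \<eta>' t) (at t within {0..1})" "continuous_on {0..1} \<eta>'"
  shows "integral {0..1} (\<lambda>t. var2 a b c (\<gamma> t) (T t) (\<eta> t *\<^sub>R N t) (\<eta>' t *\<^sub>R N t + \<eta> t *\<^sub>R N' t))
    = integral {0..1} (\<lambda>t. (\<eta>' t)\<^sup>2 - gcurv a b c (\<gamma> t) * r\<^sup>2 * (\<eta> t)\<^sup>2) + ((\<eta> 1)\<^sup>2 * \<beta> 1 - (\<eta> 0)\<^sup>2 * \<beta> 0)"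
proof -
  have c\<eta>: "continuous_on {0..1} \<eta>" unfolding continuous_on_eq_continuous_within
    by (auto intro: DERIV_continuous \<eta>(1))
  have "((\<lambda>t. 2 * \<eta> t * \<eta>' t * \<beta> t + (\<eta> t)\<^sup>2 * \<beta>' t) has_integral ((\<eta> 1)\<^sup>2 * \<beta> 1 - (\<eta> 0)\<^sup>2 * \<beta> 0)) {0..1}"
  proof (rule fundamental_theorem_of_calculus)
    fix t :: real assume t: "t \<in> {0..1}"
    have "((\<lambda>t. (\<eta> t)\<^sup>2 * \<beta> t) has_real_derivative 2 * \<eta> t * \<eta>' t * \<beta> t + (\<eta> t)\<^sup>2 * \<beta>' t) (at t within {0..1})"
      by (auto intro!: derivative_eq_intros \<eta>(1)[OF t] \<beta>_deriv[OF t])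
    then show "((\<lambda>t. (\<eta> t)\<^sup>2 * \<beta> t) has_vector_derivative 2 * \<eta> t * \<eta>' t * \<beta> t + (\<eta> t)\<^sup>2 * \<beta>' t) (at t within {0..1})"
      by (simp add: has_real_derivative_iff_has_vector_derivative)
  qed simp
  moreover have "((\<lambda>t. (\<eta>' t)\<^sup>2 - gcurv a b c (\<gamma> t) * r\<^sup>2 * (\<eta> t)\<^sup>2) has_integral
      integral {0..1} (\<lambda>t. (\<eta>' t)\<^sup>2 - gcurv a b c (\<gamma> t) * r\<^sup>2 * (\<eta> t)\<^sup>2)) {0..1}"
    by (intro integrable_integral integrable_continuous_interval continuous_intros continuous_gcurv_curve c\<eta> \<eta>(2))
  ultimately have "((\<lambda>t. ((\<eta>' t)\<^sup>2 - gcurv a b c (\<gamma> t) * r\<^sup>2 * (\<eta> t)\<^sup>2) + (2 * \<eta> t * \<eta>' t * \<beta> t + (\<eta> t)\<^sup>2 * \<beta>' t)) has_integral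
      integral {0..1} (\<lambda>t. (\<eta>' t)\<^sup>2 - gcurv a b c (\<gamma> t) * r\<^sup>2 * (\<eta> t)\<^sup>2) + ((\<eta> 1)\<^sup>2 * \<beta> 1 - (\<eta> 0)\<^sup>2 * \<beta> 0)) {0..1}"
    by (intro has_integral_add)
  then have "((\<lambda>t. var2 a b c (\<gamma> t) (T t) (\<eta> t *\<^sub>R N t) (\<eta>' t *\<^sub>R N t + \<eta> t *\<^sub>R N' t)) has_integral
      integral {0..1} (\<lambda>t. (\<eta>' t)\<^sup>2 - gcurv a b c (\<gamma> t) * r\<^sup>2 * (\<eta> t)\<^sup>2) + ((\<eta> 1)\<^sup>2 * \<beta> 1 - (\<eta> 0)\<^sup>2 * \<beta> 0)) {0..1}"
    by (rule has_integral_eq[rotated]) (simp add: index_form)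
  then show ?thesis by (rule integral_unique)
qed

lemma integral_var1:
  assumes V: "C1_curve V W"
  shows "integral {0..1} (\<lambda>t. var1 a b c (\<gamma> t) (T t) (V t) (W t)) = P 1 \<bullet> V 1 - P 0 \<bullet> V 0"
proof -
  have "((\<lambda>t. var1 a b c (\<gamma> t) (T t) (V t) (W t)) has_integral P 1 \<bullet> V 1 - P 0 \<bullet> V 0) {0..1}"
  proof (rule fundamental_theorem_of_calculus)
    fix t :: real assume t: "t \<in> {0..1}"
    have Vd: "(V has_vector_derivative W t) (at t within {0..1})" using V t by (simp add: C1_curve_def)
    have "((\<lambda>t. P t $ 1 * V t $ 1 + P t $ 2 * V t $ 2) has_real_derivative
       (P' t $ 1 * V t $ 1 + W t $ 1 * P t $ 1) + (P' t $ 2 * V t $ 2 + W t $ 2 * P t $ 2)) (at t within {0..1})"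
      by (intro DERIV_add DERIV_mult nth_deriv P_deriv t Vd)
    moreover have "(P' t $ 1 * V t $ 1 + W t $ 1 * P t $ 1) + (P' t $ 2 * V t $ 2 + W t $ 2 * P t $ 2) = var1 a b c (\<gamma> t) (T t) (V t) (W t)"
      unfolding var1_def bil_def P'_nth P_nth[OF t] by (simp add: grd_def power2_eq_square field_simps)
    ultimately show "((\<lambda>t. P t \<bullet> V t) has_vector_derivative var1 a b c (\<gamma> t) (T t) (V t) (W t)) (at t within {0..1})"
      by (simp add: inner_vec_def sum_2 has_real_derivative_iff_has_vector_derivative)
  qed simp
  then show ?thesis by (rule integral_unique)
qed

end

section \<open>Superharmonic functions on complete surfaces\<close>

text \<open>At the end point of a minimizer the tangential competitors are its initial pieces, so
  minimality is known from one side only; the condition on \<open>F1 1\<close> makes up for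
  this.\<close>

lemma second_derivative_nonneg_at_left_min:
  fixes F :: "real \<Rightarrow> real"
  assumes "d > 0" "d \<le> 1" and F: "\<And>u. 1 - d < u \<Longrightarrow> u \<le> 1 \<Longrightarrow> (F has_real_derivative F1 u) (at u within {0..1})"
    and F1: "(F1 has_real_derivative F2) (at 1 within {0..1})" "F1 1 = 0"
    and min: "\<And>u. 1 - d < u \<Longrightarrow> u \<le> 1 \<Longrightarrow> F 1 \<le> F u"
  shows "F2 \<ge> 0"
proof (rule ccontr)
  assume "\<not> F2 \<ge> 0"
  then obtain s where s: "s > 0" "\<And>h. h > 0 \<Longrightarrow> 1 - h \<in> {0..1} \<Longrightarrow> h < s \<Longrightarrow> F1 (1 - h) > F1 1"
    using has_real_derivative_neg_dec_left[OF F1(1)] by auto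
  define h where "h = min s d / 2"
  have h: "0 < h" "h < s" "h < d" using s(1) \<open>d > 0\<close> by (auto simp: h_def)
  have cont: "continuous_on {1 - h..1} F" unfolding continuous_on_eq_continuous_within
  proof
    fix x assume "x \<in> {1 - h..1}"
    then have "(F has_real_derivative F1 x) (at x within {0..1})" using F h by simp
    then have "(F has_real_derivative F1 x) (at x within {1 - h..1})"
      by (rule has_field_derivative_subset) (use h \<open>d \<le> 1\<close> in auto)
    then show "continuous (at x within {1 - h..1}) F" by (rule DERIV_continuous)
  qed
  have der: "(F has_derivative (*) (F1 x)) (at x)" if "1 - h < x" "x < 1" for x
  proof -
    have "(F has_real_derivative F1 x) (at x within {0..1})" using F that h by simp
    moreover have "at x within {0..1} = at x" using that h \<open>d \<le> 1\<close> by (intro at_within_interior) auto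
    ultimately show ?thesis by (simp add: has_field_derivative_def)
  qed
  obtain z where z: "1 - h < z" "z < 1" "F 1 - F (1 - h) = F1 z * (1 - (1 - h))"
    by (rule mvt[OF _ cont der]) (use h in auto)
  have "F1 (1 - (1 - z)) > F1 1" by (rule s(2)) (use z h \<open>d \<le> 1\<close> in auto)
  then have "F1 z > 0" using F1(2) by simp
  then have "F1 z * (1 - (1 - h)) > 0" using h by simp
  then have "F (1 - h) < F 1" using z by linarith
  then show False using min[of "1 - h"] h by simp
qed

text \<open>The Laplace--Beltrami operator of a metric of determinant one.\<close>

definition lap :: "(real^2 \<Rightarrow> real) \<Rightarrow> (real^2 \<Rightarrow> real) \<Rightarrow> (real^2 \<Rightarrow> real) \<Rightarrow> (real^2 \<Rightarrow> real) \<Rightarrow> real^2 \<Rightarrow> real" where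
  "lap a b c f x = c x * partial_deriv 1 (partial_deriv 1 f) x - 2 * b x * partial_deriv 1 (partial_deriv 2 f) x
    + a x * partial_deriv 2 (partial_deriv 2 f) x
    + (partial_deriv 1 c x - partial_deriv 2 b x) * partial_deriv 1 f x
    + (partial_deriv 2 a x - partial_deriv 1 b x) * partial_deriv 2 f x"

section \<open>Second order comparison at a touching point\<close>

context unimodular_geodesic
begin

lemma quad_T: "t \<in> {0..1} \<Longrightarrow> quad a b c (\<gamma> t) (T t) = r\<^sup>2 / 2"
proof -
  assume t: "t \<in> {0..1}"
  have "mom a b c (\<gamma> t) (T t) = P t" unfolding T_def using det[OF in_S[OF t]] by (intro mom_vel) simp
  then show ?thesis using P_inner_T[OF t] by (simp add: quad_mom)
qed

lemma energy_\<gamma>: "energy (quad a b c) \<gamma> T = r\<^sup>2 / 2"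
proof -
  have "energy (quad a b c) \<gamma> T = integral {0..1} (\<lambda>t::real. r\<^sup>2 / 2)"
    unfolding energy_def using quad_T by (intro Henstock_Kurzweil_Integration.integral_cong) auto
  then show ?thesis by simp
qed

lemma det_deriv:
  assumes "x \<in> S"
  shows "partial_deriv i a x * c x + a x * partial_deriv i c x = 2 * b x * partial_deriv i b x"
proof -
  note F = smooth_on_has_frechet[OF sa assms] smooth_on_has_frechet[OF sb assms] smooth_on_has_frechet[OF sc assms]
  have "((\<lambda>x. a x * c x - b x * b x) has_derivative (\<lambda>v. (a x * frechet_derivative c (at x) v + frechet_derivative a (at x) v * c x)
      - (b x * frechet_derivative b (at x) v + frechet_derivative b (at x) v * b x))) (at x)"
    by (intro has_derivative_diff has_derivative_mult F)
  moreover have "((\<lambda>x. a x * c x - b x * b x) has_derivative (\<lambda>v. 0)) (at x)"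
  proof (rule has_derivative_transform_within_open[OF _ S assms])
    show "((\<lambda>x. 1) has_derivative (\<lambda>v. 0)) (at x)" by simp
    show "1 = a y * c y - b y * b y" if "y \<in> S" for y using det[OF that] by (simp add: power2_eq_square)
  qed
  ultimately have "(\<lambda>v. (a x * frechet_derivative c (at x) v + frechet_derivative a (at x) v * c x)
      - (b x * frechet_derivative b (at x) v + frechet_derivative b (at x) v * b x)) = (\<lambda>v. 0)"
    by (rule has_derivative_unique)
  from fun_cong[OF this, of "axis i 1"] show ?thesis by (simp add: partial_deriv_def algebra_simps)
qed

text \<open>The Laplacian as trace of the Hessian of \<open>f\<close> in the frame T / r, N. Since
  \<open>grd f\<close> is proportional to \<open>P\<close>, the Christoffel terms appear as the
  pairing with \<open>T'\<close> and as \<beta>, exactly the corrections that the variations in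
  \<open>touching_contradiction\<close> produce.\<close>

lemma lap_decomposition:
  assumes t: "t \<in> {0..1}" and f: "smooth_on S f" and k: "grd f (\<gamma> t) = - k *\<^sub>R P t"
  shows "r\<^sup>2 * lap a b c f (\<gamma> t) = (dir2 f (\<gamma> t) (T t) (T t) + grd f (\<gamma> t) \<bullet> T' t) + r\<^sup>2 * (dir2 f (\<gamma> t) (N t) (N t) + k * \<beta> t)"
proof -
  let ?x = "\<gamma> t"
  have x: "?x \<in> S" by (rule in_S[OF t])
  let ?f11 = "partial_deriv 1 (partial_deriv 1 f) ?x" and ?f12 = "partial_deriv 1 (partial_deriv 2 f) ?x" and ?f22 = "partial_deriv 2 (partial_deriv 2 f) ?x"
  let ?a = "a ?x" and ?b = "b ?x" and ?c = "c ?x"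
  let ?p = "P t $ 1" and ?q = "P t $ 2" and ?t1 = "T t $ 1" and ?t2 = "T t $ 2" and ?n1 = "N t $ 1" and ?n2 = "N t $ 2"
  have D2: "dir2 f ?x u u = ?f11 * (u $ 1 * u $ 1) + 2 * ?f12 * (u $ 1 * u $ 2) + ?f22 * (u $ 2 * u $ 2)" for u
    using partial_commute[OF f t] by (simp add: dir2_def grd_def algebra_simps)
  have d1: "?a * ?c - ?b\<^sup>2 = 1" using det[OF x] .
  have rr: "r\<^sup>2 = ?c * (?p * ?p) - 2 * ?b * (?p * ?q) + ?a * (?q * ?q)"
    using P_inner_T[OF t] by (simp add: inner_vec_def sum_2 T_nth[OF t] algebra_simps)
  have rn: "r * ?n1 = - ?q" "r * ?n2 = ?p" using r by (simp_all add: N_def)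
  have rn2: "r\<^sup>2 * (?n1 * ?n1) = ?q * ?q" "r\<^sup>2 * (?n1 * ?n2) = - (?p * ?q)" "r\<^sup>2 * (?n2 * ?n2) = ?p * ?p"
    unfolding power2_eq_square using rn by (algebra, algebra, algebra)
  have h: "?t1 * ?t1 + r\<^sup>2 * (?n1 * ?n1) = r\<^sup>2 * ?c" "?t1 * ?t2 + r\<^sup>2 * (?n1 * ?n2) = - (r\<^sup>2 * ?b)"
    "?t2 * ?t2 + r\<^sup>2 * (?n2 * ?n2) = r\<^sup>2 * ?a"
    unfolding rn2 unfolding T_nth[OF t] rr using d1 by (algebra, algebra, algebra)
  have "dir2 f ?x (T t) (T t) + r\<^sup>2 * dir2 f ?x (N t) (N t) = ?f11 * (?t1 * ?t1 + r\<^sup>2 * (?n1 * ?n1))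
      + 2 * ?f12 * (?t1 * ?t2 + r\<^sup>2 * (?n1 * ?n2)) + ?f22 * (?t2 * ?t2 + r\<^sup>2 * (?n2 * ?n2))"
    unfolding D2 by (simp add: algebra_simps)
  also have "\<dots> = r\<^sup>2 * (?c * ?f11 - 2 * ?b * ?f12 + ?a * ?f22)" unfolding h by (simp add: algebra_simps)
  finally have second: "dir2 f ?x (T t) (T t) + r\<^sup>2 * dir2 f ?x (N t) (N t) = r\<^sup>2 * (?c * ?f11 - 2 * ?b * ?f12 + ?a * ?f22)" .
  let ?a1 = "partial_deriv 1 a ?x" and ?a2 = "partial_deriv 2 a ?x" and ?b1 = "partial_deriv 1 b ?x"
    and ?b2 = "partial_deriv 2 b ?x" and ?c1 = "partial_deriv 1 c ?x" and ?c2 = "partial_deriv 2 c ?x"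
  have dd: "?a1 * ?c + ?a * ?c1 = 2 * ?b * ?b1" "?a2 * ?c + ?a * ?c2 = 2 * ?b * ?b2"
    using det_deriv[OF x] by blast+
  have PT': "P t \<bullet> T' t = - (?t1 * G1 ?x (T t) (T t) + ?t2 * G2 ?x (T t) (T t))"
  proof -
    have "P t \<bullet> T' t = ?t1 * (?a * T' t $ 1 + ?b * T' t $ 2) + ?t2 * (?b * T' t $ 1 + ?c * T' t $ 2)"
      by (simp add: inner_vec_def sum_2 P_nth[OF t] algebra_simps)
    then show ?thesis unfolding T'_eq[OF t] by simp
  qed
  have G1N: "r\<^sup>2 * G1 ?x (N t) (N t) = (?a1 / 2) * (?q * ?q) - ?a2 * (?p * ?q) + (?b2 - ?c1 / 2) * (?p * ?p)"
    and G2N: "r\<^sup>2 * G2 ?x (N t) (N t) = (?b1 - ?a2 / 2) * (?q * ?q) - ?c1 * (?p * ?q) + (?c2 / 2) * (?p * ?p)"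
  proof -
    have "r\<^sup>2 * bil x y z (N t) (N t) = x * (r\<^sup>2 * (?n1 * ?n1)) + 2 * y * (r\<^sup>2 * (?n1 * ?n2)) + z * (r\<^sup>2 * (?n2 * ?n2))" for x y z
      by (simp add: bil_def algebra_simps)
    then show "r\<^sup>2 * G1 ?x (N t) (N t) = (?a1 / 2) * (?q * ?q) - ?a2 * (?p * ?q) + (?b2 - ?c1 / 2) * (?p * ?p)"
      "r\<^sup>2 * G2 ?x (N t) (N t) = (?b1 - ?a2 / 2) * (?q * ?q) - ?c1 * (?p * ?q) + (?c2 / 2) * (?p * ?p)"
      unfolding G1_def G2_def rn2 by simp_all
  qed
  \<comment> \<open>The trace of the Christoffel symbols. As the determinant is constant, the
    relations \<open>dd\<close> reduce it to the divergence of the cofactor matrix, which gives the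
    first order terms of \<open>lap\<close>.\<close>
  have key: "(?t1 * G1 ?x (T t) (T t) + ?t2 * G2 ?x (T t) (T t)) + r\<^sup>2 * \<beta> t
      = - (r\<^sup>2 * ((?c1 - ?b2) * ?p + (?a2 - ?b1) * ?q))"
  proof -
    have "r\<^sup>2 * \<beta> t = ?t1 * (r\<^sup>2 * G1 ?x (N t) (N t)) + ?t2 * (r\<^sup>2 * G2 ?x (N t) (N t))"
      by (simp add: \<beta>_def algebra_simps)
    then have e: "r\<^sup>2 * \<beta> t = ?t1 * ((?a1 / 2) * (?q * ?q) - ?a2 * (?p * ?q) + (?b2 - ?c1 / 2) * (?p * ?p))
       + ?t2 * ((?b1 - ?a2 / 2) * (?q * ?q) - ?c1 * (?p * ?q) + (?c2 / 2) * (?p * ?p))" unfolding G1N G2N .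
    have g: "G1 ?x (T t) (T t) = (?a1 / 2) * (?t1 * ?t1) + ?a2 * (?t1 * ?t2) + (?b2 - ?c1 / 2) * (?t2 * ?t2)"
      "G2 ?x (T t) (T t) = (?b1 - ?a2 / 2) * (?t1 * ?t1) + ?c1 * (?t1 * ?t2) + (?c2 / 2) * (?t2 * ?t2)"
      by (simp_all add: G1_def G2_def bil_def)
    have tp: "?t1 = ?c * ?p - ?b * ?q" "?t2 = ?a * ?q - ?b * ?p" by (rule T_nth[OF t])+
    have "2 * ((?t1 * G1 ?x (T t) (T t) + ?t2 * G2 ?x (T t) (T t)) + r\<^sup>2 * \<beta> t + r\<^sup>2 * ((?c1 - ?b2) * ?p + (?a2 - ?b1) * ?q)) = 0"
      unfolding e g unfolding rr unfolding tp using d1 dd by algebra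
    then show ?thesis by simp
  qed
  have gf: "partial_deriv 1 f ?x = - k * ?p" "partial_deriv 2 f ?x = - k * ?q"
    using k by (simp_all add: vec2_eq_iff grd_def)
  have "grd f ?x \<bullet> T' t + r\<^sup>2 * (k * \<beta> t) = k * ((?t1 * G1 ?x (T t) (T t) + ?t2 * G2 ?x (T t) (T t)) + r\<^sup>2 * \<beta> t)"
    unfolding k inner_scaleR_left PT' by (simp add: algebra_simps)
  also have "\<dots> = r\<^sup>2 * ((?c1 - ?b2) * partial_deriv 1 f ?x + (?a2 - ?b1) * partial_deriv 2 f ?x)"
    unfolding key gf by (simp add: algebra_simps)
  finally show ?thesis using second unfolding lap_def by (simp add: algebra_simps)
qed

text \<open>The last condition on \<open>G\<close> says that G of half the squared radius is
  strictly superharmonic in the Euclidean plane. By nonnegative curvature this persists for the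
  distance of h, as in Laplacian comparison, so f + k G(action) cannot have a minimum. The action is
  never differentiated: the energies of variations of the minimizer lie above it and touch it at the
  end point.\<close>

lemma touching_contradiction:
  assumes f: "smooth_on S f" "lap a b c f (\<gamma> 1) \<le> 0" and curv: "\<And>t. t \<in> {0..1} \<Longrightarrow> gcurv a b c (\<gamma> t) \<ge> 0"
    and k: "k > 0" and Y: "open Y" "r\<^sup>2 / 2 \<in> Y"
    and G: "\<And>y. y \<in> Y \<Longrightarrow> (G has_real_derivative G1' y) (at y)" "(G1' has_real_derivative G2') (at (r\<^sup>2 / 2))"
    "G1' (r\<^sup>2 / 2) > 0" "G1' (r\<^sup>2 / 2) + r\<^sup>2 / 2 * G2' < 0"
    and \<delta>: "\<delta> > 0"
    and min: "\<And>z w. C1_curve z w \<Longrightarrow> z 0 = \<gamma> 0 \<Longrightarrow> (\<And>t. t \<in> {0..1} \<Longrightarrow> z t \<in> S) \<Longrightarrow> dist (z 1) (\<gamma> 1) < \<delta> \<Longrightarrow>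
       energy (quad a b c) z w \<in> Y \<Longrightarrow> f (\<gamma> 1) + k * G (r\<^sup>2 / 2) \<le> f (z 1) + k * G (energy (quad a b c) z w)"
  shows False
proof -
  let ?\<epsilon> = "r\<^sup>2 / 2"
  have one: "(1::real) \<in> {0..1}" by simp
  have \<gamma>C: "C1_curve \<gamma> T" using \<gamma>_C1 by (simp add: T_def[abs_def])
  \<comment> \<open>One-parameter families of competitors with fixed starting point;
    \<open>d\<close> is so small that the energies stay in \<open>Y\<close> and the end points
    within \<delta>.\<close>
  have vary: "\<exists>d>0. \<exists>E E1. E 0 = ?\<epsilon> \<and> E1 0 = P 1 \<bullet> V 1 \<and> (\<forall>s. \<bar>s\<bar> < d \<longrightarrow> (E has_real_derivative E1 s) (at s) \<and> E s \<in> Y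
      \<and> \<gamma> 1 + s *\<^sub>R V 1 \<in> S \<and> f (\<gamma> 1) + k * G ?\<epsilon> \<le> f (\<gamma> 1 + s *\<^sub>R V 1) + k * G (E s))
      \<and> (E1 has_real_derivative integral {0..1} (\<lambda>t. var2 a b c (\<gamma> t) (T t) (V t) (W t))) (at 0)"
    if V: "C1_curve V W" "V 0 = 0" for V W
  proof -
    obtain d E1 where d: "d > 0" and inS: "\<And>s t. \<bar>s\<bar> < d \<Longrightarrow> t \<in> {0..1} \<Longrightarrow> \<gamma> t + s *\<^sub>R V t \<in> S"
      and C1: "\<And>s. C1_curve (\<lambda>t. \<gamma> t + s *\<^sub>R V t) (\<lambda>t. T t + s *\<^sub>R W t)"
      and E: "\<And>s. \<bar>s\<bar> < d \<Longrightarrow> ((\<lambda>s. energy (quad a b c) (\<lambda>t. \<gamma> t + s *\<^sub>R V t) (\<lambda>t. T t + s *\<^sub>R W t)) has_real_derivative E1 s) (at s)"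
      and E10: "E1 0 = integral {0..1} (\<lambda>t. var1 a b c (\<gamma> t) (T t) (V t) (W t))"
      and E2: "(E1 has_real_derivative integral {0..1} (\<lambda>t. var2 a b c (\<gamma> t) (T t) (V t) (W t))) (at 0)"
      using energy_variation[OF S sa sb sc \<gamma>C in_S V(1)] by blast
    define Ef where "Ef s = energy (quad a b c) (\<lambda>t. \<gamma> t + s *\<^sub>R V t) (\<lambda>t. T t + s *\<^sub>R W t)" for s
    have E0: "Ef 0 = ?\<epsilon>" using energy_\<gamma> by (simp add: Ef_def)
    have "isCont Ef 0" using E[of 0] d DERIV_isCont unfolding Ef_def[abs_def] by auto
    then have "eventually (\<lambda>s. Ef s \<in> Y) (at 0)"
      using topological_tendstoD[of Ef "Ef 0" "at 0" Y] Y E0 by (simp add: isCont_def)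
    then obtain d1 where d1: "d1 > 0" "\<And>s. s \<noteq> 0 \<Longrightarrow> \<bar>s\<bar> < d1 \<Longrightarrow> Ef s \<in> Y"
      unfolding eventually_at by (auto simp: dist_real_def)
    define d2 where "d2 = \<delta> / (norm (V 1) + 1)"
    have d2: "d2 > 0" unfolding d2_def using \<delta> by (intro divide_pos_pos) (auto intro: add_nonneg_pos)
    define m where "m = min d (min d1 d2)"
    have m: "m > 0" "m \<le> d" "m \<le> d1" "m \<le> d2" using d d1 d2 by (auto simp: m_def)
    have "(Ef has_real_derivative E1 s) (at s) \<and> Ef s \<in> Y \<and> \<gamma> 1 + s *\<^sub>R V 1 \<in> S \<and> f (\<gamma> 1) + k * G ?\<epsilon> \<le> f (\<gamma> 1 + s *\<^sub>R V 1) + k * G (Ef s)"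
      if s: "\<bar>s\<bar> < m" for s
    proof -
      have sd: "\<bar>s\<bar> < d" "\<bar>s\<bar> < d1" "\<bar>s\<bar> < d2" using s m by auto
      have EY: "Ef s \<in> Y" 
      proof (cases "s = 0")
        case True
        show ?thesis unfolding True E0 using Y(2) .
      next
        case False
        then show ?thesis using d1(2) sd by blast
      qed
      have "norm (s *\<^sub>R V 1) \<le> \<bar>s\<bar> * (norm (V 1) + 1)" by (simp add: mult_left_mono)
      also have "\<dots> < d2 * (norm (V 1) + 1)" using sd by (intro mult_strict_right_mono) (auto intro: add_nonneg_pos)
      also have "\<dots> = \<delta>" unfolding d2_def using norm_ge_zero[of "V 1"] by (simp add: add_nonneg_eq_0_iff)
      finally have "dist (\<gamma> 1 + s *\<^sub>R V 1) (\<gamma> 1) < \<delta>" by (simp add: dist_norm)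
      then have "f (\<gamma> 1) + k * G ?\<epsilon> \<le> f (\<gamma> 1 + s *\<^sub>R V 1) + k * G (Ef s)"
        using EY inS[OF sd(1)] V(2) unfolding Ef_def by (intro min[OF C1[of s]]) auto
      then show ?thesis using E[OF sd(1)] EY inS[OF sd(1) one] unfolding Ef_def[abs_def] by simp
    qed
    moreover have "E1 0 = P 1 \<bullet> V 1" unfolding E10 integral_var1[OF V(1)] V(2) by simp
    ultimately show ?thesis using m(1) E0 E2 by blast
  qed
  \<comment> \<open>First order condition; it makes the gradient of \<open>f\<close> a negative
    multiple of the final momentum, as \<open>lap_decomposition\<close> requires.\<close>
  have first: "grd f (\<gamma> 1) \<bullet> e + k * (G1' ?\<epsilon> * (P 1 \<bullet> e)) = 0" for e
  proof -
    have "C1_curve (\<lambda>t. t *\<^sub>R e) (\<lambda>_. e)" unfolding C1_curve_def by (auto intro!: derivative_eq_intros)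
    from vary[OF this] obtain d E E1 where d: "d > 0" "E 0 = ?\<epsilon>" "E1 0 = P 1 \<bullet> e"
      "\<And>s. \<bar>s\<bar> < d \<Longrightarrow> (E has_real_derivative E1 s) (at s)"
      "\<And>s. \<bar>s\<bar> < d \<Longrightarrow> f (\<gamma> 1) + k * G ?\<epsilon> \<le> f (\<gamma> 1 + s *\<^sub>R e) + k * G (E s)" by auto
    have "((\<lambda>s. f (\<gamma> 1 + s *\<^sub>R e) + k * G (E s)) has_real_derivative grd f (\<gamma> 1 + 0 *\<^sub>R e) \<bullet> e + k * (G1' (E 0) * E1 0)) (at 0)"
    proof -
      have GE: "(G has_real_derivative G1' (E 0)) (at (E 0))" unfolding d(2) using Y(2) by (rule G(1))
      have EE: "(E has_real_derivative E1 0) (at 0)" using d(1,4) by simp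
      have fS: "\<gamma> 1 + 0 *\<^sub>R e \<in> S" using in_S[OF one] by simp
      show ?thesis by (intro DERIV_add DERIV_cmult line_DERIV[OF f(1) fS] DERIV_chain2[OF GE EE])
    qed
    from DERIV_local_min[OF this d(1)] show ?thesis using d(2,3,5) by simp
  qed
  define \<kappa> where "\<kappa> = k * G1' ?\<epsilon>"
  have gf: "grd f (\<gamma> 1) = - \<kappa> *\<^sub>R P 1"
  proof -
    have "(grd f (\<gamma> 1) + \<kappa> *\<^sub>R P 1) \<bullet> e = 0" for e using first[of e] by (simp add: \<kappa>_def inner_add_left)
    from this[of "grd f (\<gamma> 1) + \<kappa> *\<^sub>R P 1"] have "grd f (\<gamma> 1) + \<kappa> *\<^sub>R P 1 = 0" by simp
    then show ?thesis by (simp add: add_eq_0_iff2)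
  qed
  have \<kappa>: "\<kappa> > 0" using k G(3) by (simp add: \<kappa>_def)
  \<comment> \<open>The field t N is the Jacobi field of the flat case. Its index form is at most 1
    because the curvature is nonnegative; the correction \<open>\<beta> 1\<close> is kept, since it
    also occurs in the Laplacian.\<close>
  have normal: "dir2 f (\<gamma> 1) (N 1) (N 1) + \<kappa> * (1 + \<beta> 1) \<ge> 0"
  proof -
    have \<eta>: "((\<lambda>t. t) has_real_derivative 1) (at t within {0..1})" for t :: real by (rule DERIV_ident)
    have c\<eta>: "continuous_on {0..1} (\<lambda>t::real. 1::real)" by (rule continuous_on_const)
    note V = N_field_C1[OF \<eta> c\<eta>]
    obtain d E E1 where d: "d > 0" "E 0 = ?\<epsilon>" "E1 0 = P 1 \<bullet> (1 *\<^sub>R N 1)"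
      "\<And>s. \<bar>s\<bar> < d \<Longrightarrow> (E has_real_derivative E1 s) (at s)" "\<And>s. \<bar>s\<bar> < d \<Longrightarrow> E s \<in> Y"
      "\<And>s. \<bar>s\<bar> < d \<Longrightarrow> \<gamma> 1 + s *\<^sub>R N 1 \<in> S"
      "\<And>s. \<bar>s\<bar> < d \<Longrightarrow> f (\<gamma> 1) + k * G ?\<epsilon> \<le> f (\<gamma> 1 + s *\<^sub>R N 1) + k * G (E s)"
      "(E1 has_real_derivative integral {0..1} (\<lambda>t. var2 a b c (\<gamma> t) (T t) (t *\<^sub>R N t) (1 *\<^sub>R N t + t *\<^sub>R N' t))) (at 0)"
      using vary[OF V] by auto
    let ?E2 = "integral {0..1} (\<lambda>t. var2 a b c (\<gamma> t) (T t) (t *\<^sub>R N t) (1 *\<^sub>R N t + t *\<^sub>R N' t))"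
    have E10: "E1 0 = 0" unfolding d(3) using P_inner_N[of 1] by simp
    let ?F = "\<lambda>s. f (\<gamma> 1 + s *\<^sub>R N 1) + k * G (E s)" let ?F1 = "\<lambda>s. grd f (\<gamma> 1 + s *\<^sub>R N 1) \<bullet> N 1 + k * (G1' (E s) * E1 s)"
    have F: "(?F has_real_derivative ?F1 s) (at s)" if "\<bar>s\<bar> < d" for s
      by (intro DERIV_add DERIV_cmult line_DERIV[OF f(1) d(6)[OF that]] DERIV_chain2[OF G(1)[OF d(5)[OF that]] d(4)[OF that]])
    have F1: "(?F1 has_real_derivative dir2 f (\<gamma> 1 + 0 *\<^sub>R N 1) (N 1) (N 1) + k * (G2' * E1 0 * E1 0 + ?E2 * G1' (E 0))) (at 0)"
    proof -
      have GE: "(G1' has_real_derivative G2') (at (E 0))" unfolding d(2) by (rule G(2))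
      have EE: "(E has_real_derivative E1 0) (at 0)" using d(1,4) by simp
      have fS: "\<gamma> 1 + 0 *\<^sub>R N 1 \<in> S" using in_S[OF one] by simp
      show ?thesis by (intro DERIV_add DERIV_cmult line_DERIV2[OF f(1) fS] DERIV_mult DERIV_chain2[OF GE EE] d(8))
    qed
    have "0 \<le> dir2 f (\<gamma> 1 + 0 *\<^sub>R N 1) (N 1) (N 1) + k * (G2' * E1 0 * E1 0 + ?E2 * G1' (E 0))"
    proof (rule second_derivative_nonneg_at_min(2)[OF d(1) F F1])
      fix s assume "\<bar>s\<bar> < d"
      then show "f (\<gamma> 1 + 0 *\<^sub>R N 1) + k * G (E 0) \<le> f (\<gamma> 1 + s *\<^sub>R N 1) + k * G (E s)"
        unfolding d(2) scaleR_zero_left add_0_right by (rule d(7))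
    qed
    then have 1: "0 \<le> dir2 f (\<gamma> 1) (N 1) (N 1) + \<kappa> * ?E2" by (simp add: E10 d(2) \<kappa>_def mult.commute mult.left_commute)
    have "?E2 = integral {0..1} (\<lambda>t. 1\<^sup>2 - gcurv a b c (\<gamma> t) * r\<^sup>2 * t\<^sup>2) + (1\<^sup>2 * \<beta> 1 - 0\<^sup>2 * \<beta> 0)"
      by (rule integral_var2[OF \<eta> c\<eta>])
    moreover have "integral {0..1} (\<lambda>t. 1\<^sup>2 - gcurv a b c (\<gamma> t) * r\<^sup>2 * t\<^sup>2) \<le> 1"
    \<comment> \<open>A function that is not integrable has integral 0, which satisfies the bound
      too.\<close>
    proof (cases "(\<lambda>t. 1\<^sup>2 - gcurv a b c (\<gamma> t) * r\<^sup>2 * t\<^sup>2) integrable_on {0..1}")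
      case True
      have "integral {0..1} (\<lambda>t. 1\<^sup>2 - gcurv a b c (\<gamma> t) * r\<^sup>2 * t\<^sup>2) \<le> integral {0..1} (\<lambda>t::real. 1::real)"
        using True curv by (intro integral_le) auto
      then show ?thesis by simp
    qed (simp add: not_integrable_integral)
    ultimately have "?E2 \<le> 1 + \<beta> 1" by simp
    then have "\<kappa> * ?E2 \<le> \<kappa> * (1 + \<beta> 1)" using \<kappa> by (intro mult_left_mono) auto
    then show ?thesis using 1 by linarith
  qed
  \<comment> \<open>The competitors are the initial pieces of \<gamma> itself, run in unit time;
    their energy is exactly \<open>u\<^sup>2 * ?\<epsilon>\<close>.\<close>
  have tangential: "dir2 f (\<gamma> 1) (T 1) (T 1) + grd f (\<gamma> 1) \<bullet> T' 1 + k * (G2' * r\<^sup>2 * r\<^sup>2 + G1' ?\<epsilon> * r\<^sup>2) \<ge> 0"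
  proof -
    have "isCont (\<lambda>u::real. u\<^sup>2 * ?\<epsilon>) 1" by (intro continuous_intros)
    then have "eventually (\<lambda>u. u\<^sup>2 * ?\<epsilon> \<in> Y) (at 1)"
      using topological_tendstoD[of "\<lambda>u. u\<^sup>2 * ?\<epsilon>" "1\<^sup>2 * ?\<epsilon>" "at 1" Y] Y by (simp add: isCont_def)
    then obtain d1 where d1: "d1 > 0" "\<And>u. u \<noteq> 1 \<Longrightarrow> dist u 1 < d1 \<Longrightarrow> u\<^sup>2 * ?\<epsilon> \<in> Y"
      unfolding eventually_at by auto
    have "continuous (at 1 within {0..1}) \<gamma>" using \<gamma>_deriv[OF one] has_vector_derivative_continuous by blast
    then obtain d2 where d2: "d2 > 0" "\<And>u. u \<in> {0..1} \<Longrightarrow> dist u 1 < d2 \<Longrightarrow> dist (\<gamma> u) (\<gamma> 1) < \<delta>"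
      unfolding continuous_within_eps_delta using \<delta> by blast
    define d where "d = min 1 (min d1 d2)"
    have d: "d > 0" "d \<le> 1" "d \<le> d1" "d \<le> d2" using d1 d2 by (auto simp: d_def)
    have YY: "u\<^sup>2 * ?\<epsilon> \<in> Y" if "1 - d < u" "u \<le> 1" for u
      using d1(2)[of u] that d Y by (cases "u = 1") (auto simp: dist_real_def)
    let ?F = "\<lambda>u. f (\<gamma> u) + k * G (u\<^sup>2 * ?\<epsilon>)"
    let ?F1 = "\<lambda>u. grd f (\<gamma> u) \<bullet> T u + k * (G1' (u\<^sup>2 * ?\<epsilon>) * (u * r\<^sup>2))"
    have sq: "((\<lambda>u. u\<^sup>2 * ?\<epsilon>) has_real_derivative u * r\<^sup>2) (at u within {0..1})" for u
      by (auto intro!: derivative_eq_intros)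
    have F: "(?F has_real_derivative ?F1 u) (at u within {0..1})" if u: "1 - d < u" "u \<le> 1" for u
    proof -
      have "u \<in> {0..1}" using u d by auto
      then show ?thesis
        by (intro DERIV_add DERIV_cmult coeff_deriv[OF f(1)] DERIV_chain2[where g = "\<lambda>u. u\<^sup>2 * ?\<epsilon>" and x = u, OF G(1)[OF YY[OF u]]] sq)
    qed
    have F1: "(?F1 has_real_derivative (dir2 f (\<gamma> 1) (T 1) (T 1) + grd f (\<gamma> 1) \<bullet> T' 1) + k * (G2' * (1 * r\<^sup>2) * (1 * r\<^sup>2) + r\<^sup>2 * G1' (1\<^sup>2 * ?\<epsilon>))) (at 1 within {0..1})"
    proof (intro DERIV_add DERIV_cmult DERIV_mult)
      have "((\<lambda>u. partial_deriv 1 f (\<gamma> u) * T u $ 1 + partial_deriv 2 f (\<gamma> u) * T u $ 2) has_real_derivative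
        ((grd (partial_deriv 1 f) (\<gamma> 1) \<bullet> T 1) * T 1 $ 1 + T' 1 $ 1 * partial_deriv 1 f (\<gamma> 1))
        + ((grd (partial_deriv 2 f) (\<gamma> 1) \<bullet> T 1) * T 1 $ 2 + T' 1 $ 2 * partial_deriv 2 f (\<gamma> 1))) (at 1 within {0..1})"
        by (intro DERIV_add DERIV_mult coeff_deriv smooth_on_partial_deriv f(1) one nth_deriv T_deriv)
      then show "((\<lambda>u. grd f (\<gamma> u) \<bullet> T u) has_real_derivative dir2 f (\<gamma> 1) (T 1) (T 1) + grd f (\<gamma> 1) \<bullet> T' 1) (at 1 within {0..1})"
        by (simp add: grd_def[of f] dir2_def algebra_simps)
      have "(G1' has_real_derivative G2') (at (1\<^sup>2 * ?\<epsilon>))" using G(2) by simp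
      then show "((\<lambda>u. G1' (u\<^sup>2 * ?\<epsilon>)) has_real_derivative G2' * (1 * r\<^sup>2)) (at 1 within {0..1})"
        by (rule DERIV_chain2[where g = "\<lambda>u. u\<^sup>2 * ?\<epsilon>" and x = 1, OF _ sq])
      show "((\<lambda>u. u * r\<^sup>2) has_real_derivative r\<^sup>2) (at 1 within {0..1})" by (auto intro!: derivative_eq_intros)
    qed
    have "0 \<le> (dir2 f (\<gamma> 1) (T 1) (T 1) + grd f (\<gamma> 1) \<bullet> T' 1) + k * (G2' * (1 * r\<^sup>2) * (1 * r\<^sup>2) + r\<^sup>2 * G1' (1\<^sup>2 * ?\<epsilon>))"
    proof (rule second_derivative_nonneg_at_left_min[OF d(1,2) F F1])
      show "grd f (\<gamma> 1) \<bullet> T 1 + k * (G1' (1\<^sup>2 * ?\<epsilon>) * (1 * r\<^sup>2)) = 0"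
        using first[of "T 1"] P_inner_T[OF one] by simp
      fix u assume u: "1 - d < u" "u \<le> 1"
      have u01: "0 < u" "u \<in> {0..1}" using u d by auto
      have C: "C1_curve (\<lambda>t. \<gamma> (u * t)) (\<lambda>t. u *\<^sub>R T (u * t))"
        using C1_curve_rescale[OF \<gamma>C] u01 by simp
      have ut: "u * t \<in> {0..1}" if "t \<in> {0..1}" for t using that u01 by (auto intro: mult_le_one)
      have "quad a b c (\<gamma> (u * t)) (u *\<^sub>R T (u * t)) = u\<^sup>2 * ?\<epsilon>" if t: "t \<in> {0..1}" for t
      proof -
        have "mom a b c (\<gamma> (u * t)) (T (u * t)) = P (u * t)" unfolding T_def using det[OF in_S[OF ut[OF t]]] by (intro mom_vel) simp
        then have "quad a b c (\<gamma> (u * t)) (T (u * t)) = ?\<epsilon>" using P_inner_T[OF ut[OF t]] by (simp add: quad_mom)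
        moreover have "quad a b c (\<gamma> (u * t)) (u *\<^sub>R T (u * t)) = u\<^sup>2 * quad a b c (\<gamma> (u * t)) (T (u * t))"
          by (simp add: quad_def power2_eq_square algebra_simps)
        ultimately show ?thesis by simp
      qed
      then have "energy (quad a b c) (\<lambda>t. \<gamma> (u * t)) (\<lambda>t. u *\<^sub>R T (u * t)) = integral {0..1} (\<lambda>t::real. u\<^sup>2 * ?\<epsilon>)"
        unfolding energy_def by (intro Henstock_Kurzweil_Integration.integral_cong) auto
      then have en: "energy (quad a b c) (\<lambda>t. \<gamma> (u * t)) (\<lambda>t. u *\<^sub>R T (u * t)) = u\<^sup>2 * ?\<epsilon>" by simp
      have "f (\<gamma> 1) + k * G ?\<epsilon> \<le> f (\<gamma> (u * 1)) + k * G (energy (quad a b c) (\<lambda>t. \<gamma> (u * t)) (\<lambda>t. u *\<^sub>R T (u * t)))"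
      proof (rule min[OF C])
        show "dist (\<gamma> (u * 1)) (\<gamma> 1) < \<delta>" using d2(2)[of u] u01 u d by (simp add: dist_real_def)
        show "energy (quad a b c) (\<lambda>t. \<gamma> (u * t)) (\<lambda>t. u *\<^sub>R T (u * t)) \<in> Y" unfolding en by (rule YY[OF u])
      qed (use in_S ut in auto)
      then show "f (\<gamma> 1) + k * G (1\<^sup>2 * ?\<epsilon>) \<le> f (\<gamma> u) + k * G (u\<^sup>2 * ?\<epsilon>)" unfolding en by simp
    qed
    then show ?thesis by (simp add: algebra_simps)
  qed
  \<comment> \<open>Add r^2 times the normal inequality and the tangential one. The terms with
    \<open>f\<close> assemble to its Laplacian, which is at most 0, and what remains is 2 k r^2
    times the number that the condition on \<open>G\<close> makes negative.\<close>
  have "r\<^sup>2 * lap a b c f (\<gamma> 1) = (dir2 f (\<gamma> 1) (T 1) (T 1) + grd f (\<gamma> 1) \<bullet> T' 1) + r\<^sup>2 * (dir2 f (\<gamma> 1) (N 1) (N 1) + \<kappa> * \<beta> 1)"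
    by (rule lap_decomposition[OF one f(1) gf])
  moreover have "r\<^sup>2 * (dir2 f (\<gamma> 1) (N 1) (N 1) + \<kappa> * (1 + \<beta> 1)) \<ge> 0" using normal by simp
  moreover have "r\<^sup>2 * lap a b c f (\<gamma> 1) \<le> 0" using f(2) by (simp add: mult_nonneg_nonpos)
  ultimately have "0 \<le> r\<^sup>2 * \<kappa> + k * (G2' * r\<^sup>2 * r\<^sup>2 + G1' ?\<epsilon> * r\<^sup>2)" using tangential by (simp add: algebra_simps)
  also have "\<dots> = 2 * k * r\<^sup>2 * (G1' ?\<epsilon> + ?\<epsilon> * G2')" by (simp add: \<kappa>_def algebra_simps)
  also have "\<dots> < 0" using k r G(4) by (intro mult_pos_neg) auto
  finally show False by simp
qed

end

section \<open>Transfer between a metric and its extension\<close>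

lemma C1_curve_cong:
  assumes "C1_curve c v" "\<And>t. t \<in> {0..1} \<Longrightarrow> v t = v' t"
  shows "C1_curve c v'"
proof -
  have "continuous_on {0..1} v'" using assms by (auto simp: C1_curve_def intro: continuous_on_eq)
  then show ?thesis using assms by (auto simp: C1_curve_def)
qed

lemma energy_cong: "(\<And>t. t \<in> {0..1} \<Longrightarrow> e (c t) (v t) = e' (c' t) (v' t)) \<Longrightarrow> energy e c v = energy e' c' v'"
  unfolding energy_def by (rule Henstock_Kurzweil_Integration.integral_cong)

text \<open>By the Hopf--Rinow theorem \<open>proper_from\<close> expresses completeness. In this variational form it
  can be compared for conformal metrics.\<close>

definition confines :: "(real^2) set \<Rightarrow> (real^2 \<Rightarrow> real) \<Rightarrow> (real^2 \<Rightarrow> real) \<Rightarrow> (real^2 \<Rightarrow> real) \<Rightarrow> real^2 \<Rightarrow> real \<Rightarrow> bool" where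
  "confines K a b c p m \<longleftrightarrow> (\<forall>z w. C1_curve z w \<longrightarrow> z 0 = p \<longrightarrow> (\<forall>t\<in>{0..1}. z t \<in> K) \<longrightarrow> z 1 \<in> frontier K \<longrightarrow>
     energy (quad a b c) z w > m)"

definition proper_from :: "(real^2) set \<Rightarrow> (real^2 \<Rightarrow> real) \<Rightarrow> (real^2 \<Rightarrow> real) \<Rightarrow> (real^2 \<Rightarrow> real) \<Rightarrow> real^2 \<Rightarrow> bool" where
  "proper_from S a b c p \<longleftrightarrow> (\<forall>m. \<exists>K. compact K \<and> K \<subseteq> S \<and> p \<in> interior K \<and> confines K a b c p m)"

text \<open>Minimizers exist for the global metric, while smoothness and curvature are known for the
  original one; on \<open>U\<close> the two may be exchanged.\<close>

locale extended_metric = quadratic_lagrangian "quad A B Cc" "quad_x A' B' C'" "mom A B Cc" "vel A B Cc" lam M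
  for A B Cc A' B' C' lam M +
  fixes a b c :: "real^2 \<Rightarrow> real" and U :: "(real^2) set"
  assumes open_U: "open U"
    and agree: "\<And>x. x \<in> U \<Longrightarrow> A x = a x" "\<And>x. x \<in> U \<Longrightarrow> B x = b x" "\<And>x. x \<in> U \<Longrightarrow> Cc x = c x"
      "\<And>x. x \<in> U \<Longrightarrow> A' x = grd a x" "\<And>x. x \<in> U \<Longrightarrow> B' x = grd b x" "\<And>x. x \<in> U \<Longrightarrow> C' x = grd c x"
begin

lemma quad_agree: "x \<in> U \<Longrightarrow> quad A B Cc x v = quad a b c x v"
  by (simp add: quad_def agree)

lemma energy_agree: "(\<And>t. t \<in> {0..1} \<Longrightarrow> z t \<in> U) \<Longrightarrow> energy (quad A B Cc) z w = energy (quad a b c) z w"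
  by (rule energy_cong) (simp add: quad_agree)

lemma hamilton_agree:
  assumes "C1_curve \<gamma> (\<lambda>t. vel A B Cc (\<gamma> t) (P t))" "C1_curve P (\<lambda>t. quad_x A' B' C' (\<gamma> t) (vel A B Cc (\<gamma> t) (P t)))"
    and "\<And>t. t \<in> {0..1} \<Longrightarrow> \<gamma> t \<in> U"
  shows "C1_curve \<gamma> (\<lambda>t. vel a b c (\<gamma> t) (P t))" "C1_curve P (\<lambda>t. quad_x (grd a) (grd b) (grd c) (\<gamma> t) (vel a b c (\<gamma> t) (P t)))"
proof -
  have v: "vel A B Cc (\<gamma> t) (P t) = vel a b c (\<gamma> t) (P t)" if "t \<in> {0..1}" for t
    using assms(3)[OF that] by (simp add: vel_def agree)
  show "C1_curve \<gamma> (\<lambda>t. vel a b c (\<gamma> t) (P t))" by (rule C1_curve_cong[OF assms(1) v])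
  show "C1_curve P (\<lambda>t. quad_x (grd a) (grd b) (grd c) (\<gamma> t) (vel a b c (\<gamma> t) (P t)))"
    by (rule C1_curve_cong[OF assms(2)]) (use v assms(3) in \<open>simp add: quad_x_def agree\<close>)
qed

text \<open>Up to its first exit the curve lies in \<open>K\<close>, where both metrics agree, and
  by \<open>energy_rescale_le\<close> the initial piece is not more expensive than the whole. So
  confinement also holds against curves that wander outside \<open>U\<close>.\<close>

lemma exit_energy:
  assumes K: "closed K" "K \<subseteq> U" "p \<in> interior K" "confines K a b c p m"
    and z: "C1_curve z w" "z 0 = p" "z 1 \<notin> interior K"
  shows "energy (quad A B Cc) z w > m"
proof -
  obtain t0 where t0: "0 < t0" "t0 \<le> 1" "z t0 \<in> frontier K" "\<And>t. 0 \<le> t \<Longrightarrow> t < t0 \<Longrightarrow> z t \<in> interior K"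
    using exit_time[of z K] C1_curve_continuous[OF z(1)] K(3) z by blast
  let ?z = "\<lambda>t. z (t0 * t)" and ?w = "\<lambda>t. t0 *\<^sub>R w (t0 * t)"
  have C: "C1_curve ?z ?w" using C1_curve_rescale[OF z(1)] t0 by simp
  have inK: "?z t \<in> K" if "t \<in> {0..1}" for t
  proof (cases "t = 1")
    case True
    then show ?thesis using t0(3) K(1) frontier_subset_closed by auto
  next
    case False
    then have "t0 * t < t0" using that t0 by auto
    then show ?thesis using t0(4)[of "t0 * t"] that t0(1) interior_subset by auto
  qed
  have "m < energy (quad a b c) ?z ?w" using K(4) C inK z t0 unfolding confines_def by simp
  also have "\<dots> = energy (quad A B Cc) ?z ?w" using inK K(2) by (intro energy_agree[symmetric]) auto
  also have "\<dots> \<le> t0 * energy (quad A B Cc) z w" by (rule energy_rescale_le[OF z(1) t0(1,2)])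
  also have "\<dots> \<le> 1 * energy (quad A B Cc) z w" using t0 energy_nonneg[OF z(1)] by (intro mult_right_mono) auto
  finally show ?thesis by simp
qed

text \<open>By conservation of speed the energy is half the squared speed, whence
  \<open>sqrt (2 * E)\<close>.\<close>

lemma minimizer_unimodular_geodesic:
  assumes S: "open S" "S \<subseteq> U" and sm: "smooth_on S a" "smooth_on S b" "smooth_on S c"
    and det: "\<And>x. x \<in> S \<Longrightarrow> a x * c x - (b x)\<^sup>2 = 1"
    and \<gamma>S: "\<And>t. t \<in> {0..1} \<Longrightarrow> \<gamma> t \<in> S"
    and \<gamma>: "C1_curve \<gamma> (\<lambda>t. vel A B Cc (\<gamma> t) (P t))" "C1_curve P (\<lambda>t. quad_x A' B' C' (\<gamma> t) (vel A B Cc (\<gamma> t) (P t)))"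
    and E: "energy (quad A B Cc) \<gamma> (\<lambda>t. vel A B Cc (\<gamma> t) (P t)) = E" "E > 0"
  shows "unimodular_geodesic S a b c \<gamma> P (sqrt (2 * E))"
proof -
  have \<gamma>U: "\<gamma> t \<in> U" if "t \<in> {0..1}" for t using \<gamma>S[OF that] S(2) by blast
  interpret uc: unimodular_curve S a b c \<gamma> P
    by unfold_locales (use hamilton_agree[OF \<gamma> \<gamma>U] S sm det \<gamma>S in auto)
  obtain k where k: "\<And>t. t \<in> {0..1} \<Longrightarrow> P t \<bullet> uc.T t = k" using uc.P_inner_T_const by blast
  have "quad A B Cc (\<gamma> t) (vel A B Cc (\<gamma> t) (P t)) = k / 2" if t: "t \<in> {0..1}" for t
  proof -
    have "vel A B Cc (\<gamma> t) (P t) = uc.T t" using \<gamma>U[OF t] by (simp add: uc.T_def vel_def agree)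
    moreover have "mom a b c (\<gamma> t) (uc.T t) = P t" unfolding uc.T_def using det[OF \<gamma>S[OF t]] by (intro mom_vel) simp
    ultimately show ?thesis using k[OF t] quad_agree[OF \<gamma>U[OF t]] by (simp add: quad_mom)
  qed
  then have "energy (quad A B Cc) \<gamma> (\<lambda>t. vel A B Cc (\<gamma> t) (P t)) = integral {0..1} (\<lambda>t::real. k / 2)"
    unfolding energy_def by (intro Henstock_Kurzweil_Integration.integral_cong) auto
  then have "k = 2 * E" using E by simp
  then have "P 0 \<bullet> vel a b c (\<gamma> 0) (P 0) = (sqrt (2 * E))\<^sup>2" using k[of 0] E by (simp add: uc.T_def)
  then show ?thesis by unfold_locales (use E in auto)
qed

end

lemma extended_metric_exists:
  assumes S: "open S" and K: "compact K" "K \<subseteq> S"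
    and sm: "smooth_on S a" "smooth_on S b" "smooth_on S c" and pd: "posdef_on S a b c"
  obtains A B Cc A' B' C' lam M U where "extended_metric A B Cc A' B' C' lam M a b c U" "K \<subseteq> U" "U \<subseteq> S"
proof (rule metric_extension[OF S K sm pd])
  fix A B Cc A' B' C' lam M U
  assume 1: "quadratic_lagrangian (quad A B Cc) (quad_x A' B' C') (mom A B Cc) (vel A B Cc) lam M"
    and 2: "open U" "K \<subseteq> U" "U \<subseteq> S" "\<And>x. x \<in> U \<Longrightarrow> A x = a x" "\<And>x. x \<in> U \<Longrightarrow> B x = b x" "\<And>x. x \<in> U \<Longrightarrow> Cc x = c x"
    "\<And>x. x \<in> U \<Longrightarrow> A' x = grd a x" "\<And>x. x \<in> U \<Longrightarrow> B' x = grd b x" "\<And>x. x \<in> U \<Longrightarrow> C' x = grd c x"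
  interpret quadratic_lagrangian "quad A B Cc" "quad_x A' B' C'" "mom A B Cc" "vel A B Cc" lam M by (rule 1)
  have "extended_metric A B Cc A' B' C' lam M a b c U" by unfold_locales (use 2 in auto)
  then show thesis using that 2 by blast
qed

text \<open>A positive superharmonic \<open>f\<close> is compared with \<open>G D\<close>, where \<open>D\<close> is the least energy of a curve
  from \<open>p\<close> and \<open>G = ln (1 + ln)\<close> grows slowly and without bound. At an interior minimum of
  \<open>f + \<kappa> G D\<close> the second variation of a minimizing geodesic contradicts superharmonicity.\<close>

theorem superharmonic_le:
  assumes S: "open S" "convex S" and sm: "smooth_on S a" "smooth_on S b" "smooth_on S c"
    and apos: "\<And>x. x \<in> S \<Longrightarrow> a x > 0" and det: "\<And>x. x \<in> S \<Longrightarrow> a x * c x - (b x)\<^sup>2 = 1"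
    and proper: "proper_from S a b c p" and curv: "\<And>x. x \<in> S \<Longrightarrow> gcurv a b c x \<ge> 0"
    and f: "smooth_on S f" "\<And>x. x \<in> S \<Longrightarrow> f x > 0" "\<And>x. x \<in> S \<Longrightarrow> lap a b c f x \<le> 0"
    and p: "p \<in> S" and q: "q \<in> S"
  shows "f p \<le> f q"
proof (rule ccontr)
  assume "\<not> f p \<le> f q"
  \<comment> \<open>A level strictly between the two values; \<open>f\<close> exceeds it near
    \<open>p\<close> and stays below it at \<open>q\<close>.\<close>
  define m where "m = (f p + f q) / 2"
  have m: "f q < m" "m < f p" "m > 0" using \<open>\<not> f p \<le> f q\<close> f(2)[OF p] f(2)[OF q] by (auto simp: m_def)
  have "isCont f p" using smooth_on_continuous[OF f(1)] S(1) p by (simp add: continuous_on_eq_continuous_at)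
  then obtain d0 where d0: "d0 > 0" "\<And>x. dist x p < d0 \<Longrightarrow> dist (f x) (f p) < f p - m"
    unfolding continuous_at_eps_delta using m by (metis diff_gt_0_iff_gt)
  obtain d1 where d1: "d1 > 0" "cball p d1 \<subseteq> S" using S(1) p open_contains_cball by blast
  define s where "s = min d0 d1 / 2"
  have s: "s > 0" "s < d0" "s \<le> d1" using d0 d1 by (auto simp: s_def)
  have sS: "cball p s \<subseteq> S" using s d1 by auto
  have fm: "f x > m" if "x \<in> cball p s" for x
    using d0(2)[of x] that s by (auto simp: dist_commute dist_real_def abs_less_iff)
  have pd: "posdef_on S a b c" using apos det by (simp add: posdef_on_def)
  then have "posdef_on (cball p s) a b c" using sS by (auto simp: posdef_on_def)
  then obtain l where l: "l > 0" "\<And>x v. x \<in> cball p s \<Longrightarrow> l * (norm v)\<^sup>2 \<le> quad a b c x v"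
    using quad_lower_compact[OF compact_cball] sm smooth_on_continuous continuous_on_subset[OF _ sS] by metis
  \<comment> \<open>Half of the lower bound for the energy of a curve to the sphere of radius
    \<open>s\<close>. Points of action at most \<rho> therefore lie in the ball on which f >
    m.\<close>
  define \<rho> where "\<rho> = l * s\<^sup>2 / 2"
  have \<rho>: "\<rho> > 0" using l s by (simp add: \<rho>_def)
  define line where "line t = p + t *\<^sub>R (q - p)" for t :: real
  have line: "C1_curve line (\<lambda>_. q - p)" unfolding C1_curve_def line_def by (auto intro!: derivative_eq_intros)
  have lineS: "line ` {0..1} \<subseteq> S"
  proof
    fix x assume "x \<in> line ` {0..1}"
    then obtain t where t: "0 \<le> t" "t \<le> 1" "x = (1 - t) *\<^sub>R p + t *\<^sub>R q"
      by (auto simp: line_def algebra_simps)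
    then show "x \<in> S" using convexD[OF S(2) p q, of "1 - t" t] by simp
  qed
  define E0 where "E0 = max (energy (quad a b c) line (\<lambda>_. q - p)) (2 * \<rho>)"
  have E0: "E0 > \<rho>" "energy (quad a b c) line (\<lambda>_. q - p) \<le> E0" using \<rho> by (auto simp: E0_def)
  \<comment> \<open>\<open>ln\<close> alone is the borderline, harmonic case of the condition in
    \<open>touching_contradiction\<close>; the outer logarithm makes the inequality strict. The
    shift by 1 and the division by \<rho> let \<open>G\<close> vanish at the inner level
    \<rho>.\<close>
  define G where "G y = ln (1 + ln (y / \<rho>))" for y
  have lnpos: "ln (y / \<rho>) > 0" if "y > \<rho>" for y using that \<rho> by (intro ln_gt_zero) (simp add: field_simps)
  have lnmono: "ln (x / \<rho>) \<le> ln (y / \<rho>)" if "\<rho> \<le> x" "x \<le> y" for x y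
    using that \<rho> by (intro ln_mono divide_right_mono) auto
  have Gmono: "G x \<le> G y" if "\<rho> \<le> x" "x \<le> y" for x y
  proof -
    have "0 \<le> ln (x / \<rho>)" using that \<rho> by (intro ln_ge_zero) (simp add: field_simps)
    then show ?thesis unfolding G_def using lnmono[OF that] by (intro ln_mono) auto
  qed
  have Gnn: "G x \<ge> 0" if "\<rho> \<le> x" for x using Gmono[OF order_refl that] \<rho> by (simp add: G_def)
  \<comment> \<open>So large that the weight \<kappa>, which raises \<kappa> G to m on the outer
    level, is still too small to lift f + \<kappa> G up to m at \<open>q\<close>.\<close>
  define X where "X = m * G E0 / (m - f q) + 1"
  have "G E0 \<ge> 0" using Gnn E0 by simp
  have Xpos: "X > 0" unfolding X_def using m \<open>G E0 \<ge> 0\<close> by (intro add_nonneg_pos divide_nonneg_pos mult_nonneg_nonneg) auto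
  define Mx where "Mx = max E0 (\<rho> * exp (exp X - 1))"
  have Mx: "Mx \<ge> E0" "Mx > \<rho>" using E0 by (auto simp: Mx_def)
  have GM: "G Mx \<ge> X"
  proof -
    have e1: "1 \<le> exp (exp X - 1)" using Xpos by simp
    have "G (\<rho> * exp (exp X - 1)) \<le> G Mx" using \<rho> e1 by (intro Gmono) (auto simp: Mx_def)
    moreover have "G (\<rho> * exp (exp X - 1)) = X" using \<rho> by (simp add: G_def)
    ultimately show ?thesis by simp
  qed
  define \<kappa> where "\<kappa> = m / G Mx"
  have \<kappa>: "\<kappa> > 0" "\<kappa> * G Mx = m" using GM Xpos m by (auto simp: \<kappa>_def)
  have small: "f q + \<kappa> * G E0 < m"
  proof -
    have "m * G E0 / (m - f q) < G Mx" using GM by (simp add: X_def)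
    then have "m * G E0 < (m - f q) * G Mx" using m by (simp add: field_simps)
    then have "\<kappa> * G E0 < m - f q" unfolding \<kappa>_def using GM Xpos by (simp add: field_simps)
    then show ?thesis by simp
  qed
  obtain K where K: "compact K" "K \<subseteq> S" "p \<in> interior K" "confines K a b c p Mx"
    using proper unfolding proper_from_def by blast
  \<comment> \<open>The ball and the segment are included so that the extended metric agrees with
    the original one where the action is estimated from below and from above.\<close>
  define K' where "K' = K \<union> cball p s \<union> line ` {0..1}"
  have "compact (line ` {0..1})" by (intro compact_continuous_image C1_curve_continuous[OF line] compact_Icc)
  then have K': "compact K'" "K' \<subseteq> S" using K(1,2) sS lineS unfolding K'_def by (simp_all add: compact_Un)
  obtain A B Cc A' B' C' lam M U where ext: "extended_metric A B Cc A' B' C' lam M a b c U" and U: "K' \<subseteq> U" "U \<subseteq> S"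
    by (rule extended_metric_exists[OF S(1) K' sm pd])
  interpret extended_metric A B Cc A' B' C' lam M a b c U by (rule ext)
  let ?D = "action p"
  have outK: "?D x > Mx" if x: "x \<notin> interior K" for x
  proof -
    obtain z P where z: "z 0 = p" "z 1 = x" "C1_curve z (\<lambda>t. vel A B Cc (z t) (P t))" "energy (quad A B Cc) z (\<lambda>t. vel A B Cc (z t) (P t)) = ?D x"
      using action_attained[of p x] by blast
    show ?thesis unfolding z(4)[symmetric]
      by (rule exit_energy[OF compact_imp_closed[OF K(1)] _ K(3,4) z(3,1)]) (use U(1) x z in \<open>auto simp: K'_def\<close>)
  qed
  have ballD: "x \<in> cball p s" if x: "?D x \<le> \<rho>" for x
  proof (rule ccontr)
    assume "x \<notin> cball p s"
    then have xi: "x \<notin> interior (cball p s)" using interior_subset by blast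
    have conf: "confines (cball p s) a b c p \<rho>"
      unfolding confines_def
    proof (intro allI impI)
      fix z w assume z: "C1_curve z w" "z 0 = p" "\<forall>t\<in>{0..1}. z t \<in> cball p s" "z 1 \<in> frontier (cball p s)"
      have "norm (z 1 - z 0) = s" using z s by (simp add: dist_norm norm_minus_commute)
      have zU: "z t \<in> U" if "t \<in> {0..1}" for t using z(3) that U(1) by (auto simp: K'_def)
      have "l * (norm (z 1 - z 0))\<^sup>2 \<le> integral {0..1} (\<lambda>t. quad A B Cc (z t) (w t))"
        by (rule energy_lower_bound[OF z(1) integrable_density[OF z(1)] _ l(1)]) (use z zU l in \<open>auto simp: quad_agree\<close>)
      also have "\<dots> = energy (quad a b c) z w" using energy_agree[OF zU] by (simp add: energy_def)
      finally show "\<rho> < energy (quad a b c) z w" unfolding \<open>norm (z 1 - z 0) = s\<close> using \<rho> by (simp add: \<rho>_def)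
    qed
    obtain z P where z: "z 0 = p" "z 1 = x" "C1_curve z (\<lambda>t. vel A B Cc (z t) (P t))" "energy (quad A B Cc) z (\<lambda>t. vel A B Cc (z t) (P t)) = ?D x"
      using action_attained[of p x] by blast
    have "\<rho> < ?D x" unfolding z(4)[symmetric]
      by (rule exit_energy[OF closed_cball _ _ conf z(3,1)]) (use U(1) s xi z in \<open>auto simp: K'_def\<close>)
    then show False using x by simp
  qed
  \<comment> \<open>The region between two levels of the action. It is bounded because points
    outside the interior of \<open>K\<close> have action above \<open>Mx\<close>.\<close>
  define Ann where "Ann = {x. \<rho> \<le> ?D x \<and> ?D x \<le> Mx}"
  have AnnK: "Ann \<subseteq> interior K" using outK by (force simp: Ann_def)
  have "closed Ann" unfolding Ann_def by (intro closed_Collect_conj closed_Collect_le continuous_on_const continuous_action)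
  moreover have "bounded Ann" using AnnK interior_subset compact_imp_bounded[OF K(1)] bounded_subset by (metis order_trans)
  ultimately have compA: "compact Ann" by (simp add: compact_eq_bounded_closed)
  have AnnS: "Ann \<subseteq> S" using AnnK interior_subset K(2) by blast
  have Dq: "?D q \<le> E0"
  proof -
    have "?D q \<le> energy (quad A B Cc) line (\<lambda>_. q - p)" by (rule action_le[OF line]) (auto simp: line_def)
    also have "\<dots> = energy (quad a b c) line (\<lambda>_. q - p)" using U(1) by (intro energy_agree) (auto simp: K'_def)
    finally show ?thesis using E0 by simp
  qed
  have "q \<notin> cball p s" using fm m by fastforce
  then have qD: "?D q > \<rho>" using ballD by force
  have qA: "q \<in> Ann" using qD Dq Mx by (simp add: Ann_def)
  define u where "u x = f x + \<kappa> * G (?D x)" for x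
  have "continuous_on Ann u"
  proof -
    have cD: "continuous_on Ann ?D" by (rule continuous_on_subset[OF continuous_action]) simp
    have pos: "1 + ln (?D x / \<rho>) > 0" "?D x / \<rho> > 0" if "x \<in> Ann" for x
    proof -
      show "?D x / \<rho> > 0" using that \<rho> by (auto simp: Ann_def)
      have "0 \<le> ln (?D x / \<rho>)" using that \<rho> by (intro ln_ge_zero) (auto simp: Ann_def field_simps)
      then show "1 + ln (?D x / \<rho>) > 0" by simp
    qed
    have nz: "\<forall>x\<in>Ann. 1 + ln (?D x / \<rho>) \<noteq> 0" "\<forall>x\<in>Ann. ?D x / \<rho> \<noteq> 0" using pos by (metis less_irrefl)+
    have cln: "continuous_on Ann (\<lambda>x. ln (?D x / \<rho>))"
      by (rule continuous_on_ln[OF continuous_on_divide[OF cD continuous_on_const] nz(2)]) (use \<rho> in simp)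
    have "continuous_on Ann (\<lambda>x. ln (1 + ln (?D x / \<rho>)))"
      by (rule continuous_on_ln[OF continuous_on_add[OF continuous_on_const cln] nz(1)])
    then show ?thesis unfolding u_def G_def
      by (intro continuous_on_add continuous_on_mult continuous_on_const continuous_on_subset[OF smooth_on_continuous[OF f(1)] AnnS])
  qed
  then obtain x0 where x0: "x0 \<in> Ann" "\<And>x. x \<in> Ann \<Longrightarrow> u x0 \<le> u x"
    using continuous_attains_inf[OF compA] qA by blast
  have "u q \<le> f q + \<kappa> * G E0"
    unfolding u_def using Gmono[of "?D q" E0] qD Dq \<kappa> by (intro add_left_mono mult_left_mono) auto
  then have ux0: "u x0 < m" using small x0(2)[OF qA] by linarith
  have x0S: "x0 \<in> S" using x0(1) AnnS by blast
  \<comment> \<open>The minimum is attained strictly between the levels: on the outer one \<kappa> G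
    alone equals m and \<open>f\<close> is positive, on the inner one \<open>G\<close> vanishes but
    f > m.\<close>
  have "?D x0 \<noteq> Mx" using ux0 \<kappa> f(2)[OF x0S] by (auto simp: u_def)
  moreover have "?D x0 \<noteq> \<rho>"
  proof
    assume e: "?D x0 = \<rho>"
    then have "f x0 > m" using ballD[of x0] fm by simp
    then show False using ux0 \<rho> by (simp add: u_def e G_def)
  qed
  ultimately have Dx0: "\<rho> < ?D x0" "?D x0 < Mx" using x0(1) by (auto simp: Ann_def)
  obtain \<gamma> P where \<gamma>: "\<gamma> 0 = p" "\<gamma> 1 = x0" "C1_curve \<gamma> (\<lambda>t. vel A B Cc (\<gamma> t) (P t))"
    "C1_curve P (\<lambda>t. quad_x A' B' C' (\<gamma> t) (vel A B Cc (\<gamma> t) (P t)))" "energy (quad A B Cc) \<gamma> (\<lambda>t. vel A B Cc (\<gamma> t) (P t)) = ?D x0"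
    using action_attained[of p x0] by blast
  \<comment> \<open>Leaving the interior of \<open>K\<close> at some time would already cost more
    than \<open>Mx\<close>, which exceeds the action of \<open>x0\<close>.\<close>
  have \<gamma>K: "\<gamma> t \<in> interior K" if t: "t \<in> {0..1}" for t
  proof (rule ccontr)
    assume out: "\<gamma> t \<notin> interior K"
    then have "t \<noteq> 0" using \<gamma> K by auto
    then have t': "0 < t" "t \<le> 1" using t by auto
    have "energy (quad A B Cc) (\<lambda>s. \<gamma> (t * s)) (\<lambda>s. t *\<^sub>R vel A B Cc (\<gamma> (t * s)) (P (t * s))) > Mx"
      using \<gamma> out t' U(1) by (intro exit_energy[OF compact_imp_closed[OF K(1)] _ K(3,4)] C1_curve_rescale[OF \<gamma>(3)]) (auto simp: K'_def)
    moreover have "energy (quad A B Cc) (\<lambda>s. \<gamma> (t * s)) (\<lambda>s. t *\<^sub>R vel A B Cc (\<gamma> (t * s)) (P (t * s))) \<le> t * ?D x0"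
      using energy_rescale_le[OF \<gamma>(3) t'] \<gamma>(5) by simp
    moreover have "t * ?D x0 \<le> 1 * ?D x0" using t' Dx0 \<rho> by (intro mult_right_mono) auto
    ultimately show False using Dx0 by simp
  qed
  let ?I = "interior K"
  have IU: "?I \<subseteq> U" "?I \<subseteq> S" using U(1) K(2) interior_subset[of K] by (auto simp: K'_def)
  define r where "r = sqrt (2 * ?D x0)"
  have r: "r > 0" "r\<^sup>2 = 2 * ?D x0" using Dx0 \<rho> by (auto simp: r_def)
  interpret ug: unimodular_geodesic ?I a b c \<gamma> P r
    unfolding r_def
  proof (rule minimizer_unimodular_geodesic[OF _ IU(1) _ _ _ _ \<gamma>K \<gamma>(3,4,5)])
    show "smooth_on ?I a" "smooth_on ?I b" "smooth_on ?I c" using sm smooth_on_subset IU(2) by blast+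
  qed (use det IU(2) Dx0 \<rho> in auto)
  define G1 where "G1 y = 1 / (y * (1 + ln (y / \<rho>)))" for y
  define L where "L = 1 + ln (?D x0 / \<rho>)"
  have L: "L > 1" using lnpos[OF Dx0(1)] by (simp add: L_def)
  have D0: "?D x0 > 0" using Dx0 \<rho> by simp
  have lnd: "((\<lambda>y. 1 + ln (y / \<rho>)) has_real_derivative 1 / y) (at y)" if "y > 0" for y
  proof -
    have "y / \<rho> > 0" using that \<rho> by simp
    from DERIV_add[OF DERIV_const[of 1] DERIV_chain2[OF DERIV_ln_divide[OF this] DERIV_cdivide[OF DERIV_ident]]]
    show ?thesis using that \<rho> by simp
  qed
  have Gd: "(G has_real_derivative G1 y) (at y)" if "y \<in> {\<rho><..<Mx}" for y
  proof -
    have "y > \<rho>" using that by simp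
    then have y: "1 + ln (y / \<rho>) > 0" "y > 0" using lnpos[of y] \<rho> by linarith+
    from DERIV_chain2[OF DERIV_ln_divide[OF y(1)] lnd[OF y(2)]] show ?thesis
      unfolding G_def[abs_def] G1_def by (simp add: mult.commute)
  qed
  have G1d: "(G1 has_real_derivative - (L + 1) / (?D x0 * L)\<^sup>2) (at (?D x0))"
  proof -
    have "?D x0 * (1 + ln (?D x0 / \<rho>)) \<noteq> 0" using D0 L unfolding L_def[symmetric] by simp
    from DERIV_divide[OF DERIV_const[of 1] DERIV_mult[OF DERIV_ident lnd[OF D0]] this]
    show ?thesis unfolding G1_def[abs_def] L_def[symmetric] using D0 by (simp add: power2_eq_square algebra_simps)
  qed
  have "isCont ?D x0" using continuous_action by (simp add: continuous_on_eq_continuous_at)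
  then obtain \<delta> where \<delta>: "\<delta> > 0" "\<And>x. dist x x0 < \<delta> \<Longrightarrow> dist (?D x) (?D x0) < min (?D x0 - \<rho>) (Mx - ?D x0)"
    unfolding continuous_at_eps_delta using Dx0 by (metis diff_gt_0_iff_gt min_less_iff_conj)
  show False
  proof (rule ug.touching_contradiction[where f = f and k = \<kappa> and Y = "{\<rho><..<Mx}" and G = G and G1' = G1
        and G2' = "- (L + 1) / (?D x0 * L)\<^sup>2" and \<delta> = \<delta>])
    show "smooth_on ?I f" by (rule smooth_on_subset[OF f(1) IU(2)])
    show "lap a b c f (\<gamma> 1) \<le> 0" using f(3) x0S \<gamma> by simp
    show "0 \<le> gcurv a b c (\<gamma> t)" if "t \<in> {0..1}" for t using curv \<gamma>K[OF that] IU by blast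
    show "\<kappa> > 0" by fact
    show "open {\<rho><..<Mx}" by simp
    show "r\<^sup>2 / 2 \<in> {\<rho><..<Mx}" using r Dx0 by simp
    show "(G has_real_derivative G1 y) (at y)" if "y \<in> {\<rho><..<Mx}" for y using Gd[OF that] .
    show "(G1 has_real_derivative - (L + 1) / (?D x0 * L)\<^sup>2) (at (r\<^sup>2 / 2))" using G1d r by simp
    show "0 < G1 (r\<^sup>2 / 2)" using r D0 L by (simp add: G1_def L_def[symmetric])
    show "G1 (r\<^sup>2 / 2) + r\<^sup>2 / 2 * (- (L + 1) / (?D x0 * L)\<^sup>2) < 0"
    proof -
      \<comment> \<open>The contributions of the inner logarithm cancel; the concavity of the outer
        one leaves a negative term.\<close>
      have "G1 (?D x0) + ?D x0 * (- (L + 1) / (?D x0 * L)\<^sup>2) = - 1 / (?D x0 * L\<^sup>2)"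
        unfolding G1_def L_def[symmetric] using D0 L by (simp add: power2_eq_square divide_simps)
      also have "\<dots> < 0" using D0 L by (simp add: divide_neg_pos)
      finally show ?thesis using r by simp
    qed
    show "\<delta> > 0" by fact
    show "f (\<gamma> 1) + \<kappa> * G (r\<^sup>2 / 2) \<le> f (z 1) + \<kappa> * G (energy (quad a b c) z w)"
      if z: "C1_curve z w" "z 0 = \<gamma> 0" "\<And>t. t \<in> {0..1} \<Longrightarrow> z t \<in> ?I" "dist (z 1) (\<gamma> 1) < \<delta>" for z w
    proof -
      have "dist (?D (z 1)) (?D x0) < min (?D x0 - \<rho>) (Mx - ?D x0)" using \<delta>(2) z(4) \<gamma> by simp
      then have Dz: "\<rho> < ?D (z 1)" "?D (z 1) < Mx" by (auto simp: dist_real_def)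
      \<comment> \<open>The action lies below the energy of every competitor and equals it for
        \<gamma>. As \<open>G\<close> is increasing, minimality in terms of the action gives
        minimality among curves.\<close>
      have "?D (z 1) \<le> energy (quad A B Cc) z w" using z \<gamma> by (intro action_le) auto
      also have "\<dots> = energy (quad a b c) z w" using z(3) IU by (intro energy_agree) auto
      finally have "G (?D (z 1)) \<le> G (energy (quad a b c) z w)" using Dz by (intro Gmono) auto
      then have "u (z 1) \<le> f (z 1) + \<kappa> * G (energy (quad a b c) z w)"
        unfolding u_def using \<kappa> by (intro add_left_mono mult_left_mono) auto
      moreover have "u x0 \<le> u (z 1)" using Dz by (intro x0(2)) (simp add: Ann_def)
      ultimately show ?thesis using r \<gamma> by (simp add: u_def)
    qed
  qed
qed

section \<open>Completeness of a conformal metric\<close>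

text \<open>\<open>s\<close> is arc length for the speed \<kappa>, and \<tau> is its inverse scaled
  to the unit interval; composition with \<tau> makes the speed constant.\<close>

lemma arclength_reparam:
  fixes \<kappa> :: "real \<Rightarrow> real"
  assumes cont: "continuous_on {0..1} \<kappa>" and pos: "\<And>t. t \<in> {0..1} \<Longrightarrow> \<kappa> t > 0"
  obtains s \<tau> where "s 0 = 0" "\<And>t. t \<in> {0..1} \<Longrightarrow> (s has_real_derivative \<kappa> t) (at t within {0..1})"
    "\<And>x y. x \<in> {0..1} \<Longrightarrow> y \<in> {0..1} \<Longrightarrow> x < y \<Longrightarrow> s x < s y"
    "\<tau> 0 = 0" "\<tau> 1 = 1" "\<And>u. u \<in> {0..1} \<Longrightarrow> \<tau> u \<in> {0..1}"
    "\<And>u. u \<in> {0..1} \<Longrightarrow> (\<tau> has_real_derivative s 1 / \<kappa> (\<tau> u)) (at u within {0..1})"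
proof -
  \<comment> \<open>Continuing \<kappa> by its end values makes 0 and 1 interior points, so that the
    inverse function is differentiable there as well.\<close>
  define \<kappa>' where "\<kappa>' t = \<kappa> (max 0 (min 1 t))" for t
  have c': "continuous_on UNIV \<kappa>'" unfolding \<kappa>'_def
    by (rule continuous_on_compose2[OF cont]) (auto intro!: continuous_intros)
  have pos': "\<kappa>' t > 0" for t unfolding \<kappa>'_def by (rule pos) auto
  have \<kappa>'_eq: "\<kappa>' t = \<kappa> t" if "t \<in> {0..1}" for t using that by (simp add: \<kappa>'_def)
  define s where "s t = integral {-2..t} \<kappa>' - integral {-2..0} \<kappa>'" for t
  have sd: "(s has_real_derivative \<kappa>' t) (at t)" if t: "-2 < t" "t < 3" for t
  proof -
    have "((\<lambda>u. integral {-2..u} \<kappa>') has_real_derivative \<kappa>' t) (at t within {-2..3})"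
      using t by (intro integral_has_real_derivative continuous_on_subset[OF c']) auto
    moreover have "at t within {-2..3} = at t" using t by (intro at_within_interior) auto
    ultimately show ?thesis unfolding s_def[abs_def] by (auto intro!: derivative_eq_intros)
  qed
  have smono: "s x < s y" if "-2 < x" "x < y" "y < 3" for x y
    using that by (intro DERIV_pos_imp_increasing[OF that(2)]) (meson sd pos' less_le_trans le_less_trans)
  have s0: "s 0 = 0" by (simp add: s_def)
  have s1: "s 1 > 0" using smono[of 0 1] s0 by simp
  have contS: "isCont s z" if "-2 < z" "z < 3" for z using sd[OF that] DERIV_isCont by blast
  define g where "g y = (THE z. -1 \<le> z \<and> z \<le> 2 \<and> s z = y)" for y
  have gs: "g (s z) = z" if "-1 \<le> z" "z \<le> 2" for z
    unfolding g_def
  proof (rule the_equality)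
    fix x assume x: "-1 \<le> x \<and> x \<le> 2 \<and> s x = s z"
    show "x = z"
    proof (rule ccontr)
      assume "x \<noteq> z"
      then consider "x < z" | "z < x" by linarith
      then show False using smono[of x z] smono[of z x] x that by cases auto
    qed
  qed (use that in auto)
  have sg: "s (g y) = y \<and> -1 \<le> g y \<and> g y \<le> 2" if y: "s (-1) < y" "y < s 2" for y
  proof -
    have "\<exists>z\<ge>-1. z \<le> 2 \<and> s z = y" by (rule IVT) (use y contS in auto)
    then obtain z where "-1 \<le> z" "z \<le> 2" "s z = y" by blast
    then show ?thesis using gs[of z] by auto
  qed
  have gd: "(g has_real_derivative inverse (\<kappa>' x)) (at (s x))" if x: "0 \<le> x" "x \<le> 1" for x
  proof (rule DERIV_inverse_function[where f = s and a = "s (-1)" and b = "s 2"])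
    have "g (s x) = x" using gs x by simp
    then show "(s has_real_derivative \<kappa>' x) (at (g (s x)))" using sd[of x] x by simp
    show "\<kappa>' x \<noteq> 0" using pos'[of x] by simp
    show "s (-1) < s x" "s x < s 2" using smono[of "-1" x] smono[of x 2] x by auto
    show "s (g y) = y" if "s (-1) < y" "y < s 2" for y using sg that by blast
    show "isCont g (s x)"
      by (rule isCont_inverse_function2[where a = "-1" and b = 2]) (use x gs contS in auto)
  qed
  have sle: "s x \<le> s y" if "-2 < x" "x \<le> y" "y < 3" for x y using smono[of x y] that by (cases "x = y") auto
  define \<tau> where "\<tau> u = g (u * s 1)" for u
  have g01: "g y \<in> {0..1}" "s (g y) = y" if "0 \<le> y" "y \<le> s 1" for y
  proof -
    have "\<exists>z\<ge>0. z \<le> 1 \<and> s z = y" by (rule IVT) (use that s0 contS in auto)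
    then obtain z where z: "0 \<le> z" "z \<le> 1" "s z = y" by blast
    then show "g y \<in> {0..1}" "s (g y) = y" using gs[of z] by auto
  qed
  have us: "0 \<le> u * s 1" "u * s 1 \<le> s 1" if "u \<in> {0..1}" for u
    using that s1 by (auto simp: mult_le_cancel_right1)
  show ?thesis
  proof (rule that[of s \<tau>])
    show "s 0 = 0" by (rule s0)
    show "(s has_real_derivative \<kappa> t) (at t within {0..1})" if "t \<in> {0..1}" for t
      using has_field_derivative_at_within[OF sd[of t]] that \<kappa>'_eq[OF that] by simp
    show "s x < s y" if "x \<in> {0..1}" "y \<in> {0..1}" "x < y" for x y using smono[of x y] that by auto
    show "\<tau> 0 = 0" using gs[of 0] s0 by (simp add: \<tau>_def)
    show "\<tau> 1 = 1" using gs[of 1] by (simp add: \<tau>_def)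
    show \<tau>01: "\<tau> u \<in> {0..1}" if "u \<in> {0..1}" for u unfolding \<tau>_def by (rule g01(1)[OF us[OF that]])
    show "(\<tau> has_real_derivative s 1 / \<kappa> (\<tau> u)) (at u within {0..1})" if u: "u \<in> {0..1}" for u
    proof -
      have "s (\<tau> u) = u * s 1" unfolding \<tau>_def by (rule g01(2)[OF us[OF u]])
      then have "(g has_real_derivative inverse (\<kappa>' (\<tau> u))) (at (u * s 1))" using gd[of "\<tau> u"] \<tau>01[OF u] by simp
      moreover have "((\<lambda>u. u * s 1) has_real_derivative s 1) (at u within {0..1})" by (auto intro!: derivative_eq_intros)
      ultimately have "((\<lambda>u. g (u * s 1)) has_real_derivative inverse (\<kappa>' (\<tau> u)) * s 1) (at u within {0..1})"
        by (rule DERIV_chain2)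
      then show ?thesis unfolding \<tau>_def[abs_def, symmetric] using \<kappa>'_eq[OF \<tau>01[OF u]] by (simp add: divide_inverse mult.commute)
    qed
  qed
qed

text \<open>With \<open>q = gcurv * r\<^sup>2\<close> along a geodesic of speed \<open>r\<close> and \<open>W = sqrt w\<close>, the variation field
  \<open>W \<psi> N\<close> bounds the second variation by an integral that depends only on \<open>x = s / l\<close>:
  \<open>- r\<^sup>2\<close> times that of \<open>f = (1 - x)\<^sup>2 (1 - 14 x + 21 x\<^sup>2)\<close> over \<open>x \<le> 1\<close>. Here \<open>f\<close> is positive near 0 and
  at least \<open>- 4 / 3\<close>, so the time in which \<open>x\<close> grows from 1 / 40 to 1 cannot be short.\<close>

lemma stability_integral:
  fixes W Wt s :: "real \<Rightarrow> real"
  assumes W: "\<And>t. t \<in> {0..1} \<Longrightarrow> (W has_real_derivative Wt t) (at t within {0..1})" "continuous_on {0..1} Wt"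
    "\<And>t. t \<in> {0..1} \<Longrightarrow> W t > 0"
    and s: "s 0 = 0" "\<And>t. t \<in> {0..1} \<Longrightarrow> (s has_real_derivative r / W t) (at t within {0..1})"
      "\<And>x y. x \<in> {0..1} \<Longrightarrow> y \<in> {0..1} \<Longrightarrow> x < y \<Longrightarrow> s x < s y"
    and r: "r > 0" and t2: "0 < t2" "t2 \<le> 1"
    and stable: "\<And>\<eta> \<eta>'. (\<And>t. t \<in> {0..1} \<Longrightarrow> (\<eta> has_real_derivative \<eta>' t) (at t within {0..1})) \<Longrightarrow> continuous_on {0..1} \<eta>' \<Longrightarrow>
        \<eta> 0 = 0 \<Longrightarrow> \<eta> 1 = 0 \<Longrightarrow> 0 \<le> integral {0..1} (\<lambda>t. (\<eta>' t)\<^sup>2 - q t * (\<eta> t)\<^sup>2)"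
    and q: "continuous_on {0..1} q" "\<And>t. t \<in> {0..1} \<Longrightarrow> (Wt t / W t)\<^sup>2 \<le> q t"
  obtains t1 where "0 < t1" "t1 < t2" "s t1 = s t2 / 40" "t2 \<ge> 11 / 8 * t1"
proof -
  define l where "l = s t2"
  have l: "l > 0" using s(3)[of 0 t2] t2 s(1) by (auto simp: l_def)
  define x where "x t = s t / l" for t
  define M where "M t = (max 0 (1 - x t))\<^sup>2" for t
  define f where "f t = M t * (1 - 14 * x t + 21 * (x t)\<^sup>2)" for t
  have cs: "continuous_on {0..1} s" unfolding continuous_on_eq_continuous_within
    by (auto intro: DERIV_continuous s(2))
  have cW: "continuous_on {0..1} W" unfolding continuous_on_eq_continuous_within
    by (auto intro: DERIV_continuous W(1))
  have W0: "\<forall>t\<in>{0..1}. W t \<noteq> 0" using W(3) by force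
  have cx: "continuous_on {0..1} x" unfolding x_def[abs_def] using l by (intro continuous_intros cs) auto
  have cM: "continuous_on {0..1} M" unfolding M_def[abs_def] by (intro continuous_intros cx)
  have cf: "continuous_on {0..1} f" unfolding f_def[abs_def] by (intro continuous_intros cM cx)
  have xd: "(x has_real_derivative r / (W t * l)) (at t within {0..1})" if "t \<in> {0..1}" for t
    unfolding x_def[abs_def] using DERIV_cdivide[OF s(2)[OF that], of l] by simp
  have Md: "(M has_real_derivative - (2 * max 0 (1 - x t)) * (r / (W t * l))) (at t within {0..1})" if "t \<in> {0..1}" for t
  proof -
    have "((\<lambda>t. 1 - x t) has_real_derivative 0 - r / (W t * l)) (at t within {0..1})"
      by (intro DERIV_diff DERIV_const xd that)
    from DERIV_chain2[OF max_square_DERIV this] show ?thesis unfolding M_def[abs_def] by simp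
  qed
  have mM: "max 0 (1 - x t) * (1 - x t) = M t" "max 0 (1 - x t) * max 0 (1 - x t) = M t" for t
    by (auto simp: M_def power2_eq_square max_def)
  \<comment> \<open>\<open>\<psi>\<close> is \<open>s * (1 - s / l)\<^sup>2\<close> up to arc length \<open>l\<close> and zero afterwards; \<open>\<psi>1\<close> is its derivative in \<open>s\<close>.\<close>
  define \<psi> where "\<psi> t = s t * M t" for t
  define \<psi>1 where "\<psi>1 t = M t - 2 * max 0 (1 - x t) * x t" for t
  have \<psi>d: "(\<psi> has_real_derivative \<psi>1 t * (r / W t)) (at t within {0..1})" if t: "t \<in> {0..1}" for t
    unfolding \<psi>_def[abs_def]
    by (rule DERIV_cong[OF DERIV_mult[OF s(2)[OF t] Md[OF t]]])
      (use l W(3)[OF t] in \<open>simp add: \<psi>1_def x_def field_simps\<close>)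
  define \<eta> where "\<eta> t = W t * \<psi> t" for t
  define \<eta>' where "\<eta>' t = Wt t * \<psi> t + r * \<psi>1 t" for t
  have \<eta>d: "(\<eta> has_real_derivative \<eta>' t) (at t within {0..1})" if t: "t \<in> {0..1}" for t
    unfolding \<eta>_def[abs_def]
    by (rule DERIV_cong[OF DERIV_mult[OF W(1)[OF t] \<psi>d[OF t]]]) (use W(3)[OF t] in \<open>simp add: \<eta>'_def field_simps\<close>)
  have c\<psi>: "continuous_on {0..1} \<psi>" "continuous_on {0..1} \<psi>1"
    unfolding \<psi>_def[abs_def] \<psi>1_def[abs_def] by (intro continuous_intros cs cM cx)+
  have c\<eta>': "continuous_on {0..1} \<eta>'" unfolding \<eta>'_def[abs_def] by (intro continuous_intros W(2) c\<psi>)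
  have s1: "x 1 \<ge> 1" using s(3)[of t2 1] t2 l by (cases "t2 = 1") (auto simp: x_def l_def)
  have "0 \<le> integral {0..1} (\<lambda>t. (\<eta>' t)\<^sup>2 - q t * (\<eta> t)\<^sup>2)"
    by (rule stable[OF \<eta>d c\<eta>']) (use s(1) s1 in \<open>auto simp: \<eta>_def \<psi>_def M_def\<close>)
  \<comment> \<open>The bound on \<open>q\<close> removes exactly the square of
    \<open>Wt t * \<psi> t\<close>, leaving only terms at most linear in \<open>Wt\<close>.\<close>
  also have "\<dots> \<le> integral {0..1} (\<lambda>t. 2 * r * Wt t * \<psi> t * \<psi>1 t + r\<^sup>2 * (\<psi>1 t)\<^sup>2)"
  proof (intro integral_le integrable_continuous_interval continuous_intros c\<eta>' q(1) c\<psi> W(2))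
    show "continuous_on {0..1} \<eta>" unfolding \<eta>_def[abs_def] by (intro continuous_intros cW c\<psi>)
    fix t :: real assume t: "t \<in> {0..1}"
    have "(Wt t * \<psi> t)\<^sup>2 = (Wt t / W t)\<^sup>2 * (\<eta> t)\<^sup>2" using W(3)[OF t] by (simp add: \<eta>_def field_simps)
    also have "\<dots> \<le> q t * (\<eta> t)\<^sup>2" using q(2)[OF t] by (intro mult_right_mono) auto
    finally have "(Wt t * \<psi> t)\<^sup>2 \<le> q t * (\<eta> t)\<^sup>2" .
    moreover have "(\<eta>' t)\<^sup>2 = (Wt t * \<psi> t)\<^sup>2 + (2 * r * Wt t * \<psi> t * \<psi>1 t + r\<^sup>2 * (\<psi>1 t)\<^sup>2)"
      by (simp add: \<eta>'_def power2_eq_square algebra_simps)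
    ultimately show "(\<eta>' t)\<^sup>2 - q t * (\<eta> t)\<^sup>2 \<le> 2 * r * Wt t * \<psi> t * \<psi>1 t + r\<^sup>2 * (\<psi>1 t)\<^sup>2" by linarith
  qed
  finally have nonneg: "0 \<le> integral {0..1} (\<lambda>t. 2 * r * Wt t * \<psi> t * \<psi>1 t + r\<^sup>2 * (\<psi>1 t)\<^sup>2)" .
  \<comment> \<open>Integration by parts removes \<open>Wt\<close>.\<close>
  have \<psi>\<psi>1: "\<psi> t * \<psi>1 t = s t * (M t * ((1 - x t) * (1 - 3 * x t)))" for t
  proof -
    have "M t * \<psi>1 t = M t * M t - 2 * (max 0 (1 - x t) * M t) * x t" by (simp add: \<psi>1_def algebra_simps)
    also have "M t * M t = M t * (1 - x t)\<^sup>2" by (auto simp: M_def max_def power2_eq_square)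
    also have "max 0 (1 - x t) * M t = M t * (1 - x t)" by (auto simp: M_def max_def power2_eq_square)
    finally have "M t * \<psi>1 t = M t * ((1 - x t) * (1 - 3 * x t))" by (simp add: power2_eq_square algebra_simps)
    then show ?thesis by (simp add: \<psi>_def)
  qed
  have \<psi>1sq: "(\<psi>1 t)\<^sup>2 = M t * (1 - 3 * x t)\<^sup>2" for t
    unfolding \<psi>1_def M_def by (auto simp: max_def power2_eq_square algebra_simps)
  define Z where "Z t = M t * ((1 - x t) * (1 - 3 * x t))" for t
  have Zd: "(Z has_real_derivative (M t * (- 2 * (1 - 3 * x t) - (1 - 3 * x t) - 3 * (1 - x t))) * (r / (W t * l))) (at t within {0..1})" if t: "t \<in> {0..1}" for t
  proof -
    have "(Z has_real_derivative - (2 * max 0 (1 - x t)) * (r / (W t * l)) * ((1 - x t) * (1 - 3 * x t))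
        + ((0 - r / (W t * l)) * (1 - 3 * x t) + (0 - 3 * (r / (W t * l))) * (1 - x t)) * M t) (at t within {0..1})"
      unfolding Z_def[abs_def] by (intro DERIV_mult DERIV_diff DERIV_const DERIV_cmult xd Md t)
    moreover have "- (2 * X) * k * (u * v) + ((0 - k) * v + (0 - 3 * k) * u) * m = (X * u * (- 2 * v) + m * (- v - 3 * u)) * k" for X u v m k :: real
      by (simp add: algebra_simps)
    moreover have "(M t * (- 2 * v) + M t * (- v - 3 * u)) * k = (M t * (- 2 * v - v - 3 * u)) * k" for u v k :: real
      by (simp add: algebra_simps)
    ultimately show ?thesis by (simp only: mM)
  qed
  have Bd: "((\<lambda>t. W t * (s t * Z t)) has_real_derivative Wt t * (\<psi> t * \<psi>1 t) + r * (M t * (1 - 10 * x t + 15 * (x t)\<^sup>2))) (at t within {0..1})"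
    if t: "t \<in> {0..1}" for t
  proof -
    have "((\<lambda>t. W t * (s t * Z t)) has_real_derivative Wt t * (s t * Z t)
      + (r / W t * Z t + (M t * (- 2 * (1 - 3 * x t) - (1 - 3 * x t) - 3 * (1 - x t))) * (r / (W t * l)) * s t) * W t) (at t within {0..1})"
      by (intro DERIV_mult W(1) s(2) Zd t)
    moreover have "(r / W t * Z t + (M t * (- 2 * (1 - 3 * x t) - (1 - 3 * x t) - 3 * (1 - x t))) * (r / (W t * l)) * s t) * W t
      = r * (M t * ((1 - x t) * (1 - 3 * x t) + (- 2 * (1 - 3 * x t) - (1 - 3 * x t) - 3 * (1 - x t)) * x t))"
      using W(3)[OF t] l by (simp add: Z_def x_def divide_simps) (simp add: algebra_simps)
    moreover have "(1 - x t) * (1 - 3 * x t) + (- 2 * (1 - 3 * x t) - (1 - 3 * x t) - 3 * (1 - x t)) * x t = 1 - 10 * x t + 15 * (x t)\<^sup>2"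
      by (simp add: power2_eq_square algebra_simps)
    ultimately show ?thesis unfolding \<psi>\<psi>1 Z_def[symmetric] by simp
  qed
  have "((\<lambda>t. Wt t * (\<psi> t * \<psi>1 t) + r * (M t * (1 - 10 * x t + 15 * (x t)\<^sup>2))) has_integral (W 1 * (s 1 * Z 1) - W 0 * (s 0 * Z 0))) {0..1}"
    by (rule fundamental_theorem_of_calculus) (use Bd in \<open>auto simp: has_real_derivative_iff_has_vector_derivative\<close>)
  moreover have "Z 1 = 0" using s1 by (simp add: Z_def M_def)
  ultimately have parts: "((\<lambda>t. Wt t * (\<psi> t * \<psi>1 t) + r * (M t * (1 - 10 * x t + 15 * (x t)\<^sup>2))) has_integral 0) {0..1}"
    using s(1) by simp
  have "((\<lambda>t. 2 * r * Wt t * \<psi> t * \<psi>1 t + r\<^sup>2 * (\<psi>1 t)\<^sup>2) has_integral integral {0..1} (\<lambda>t. 2 * r * Wt t * \<psi> t * \<psi>1 t + r\<^sup>2 * (\<psi>1 t)\<^sup>2)) {0..1}"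
    by (intro integrable_integral integrable_continuous_interval continuous_intros c\<psi> W(2))
  \<comment> \<open>Subtracting 2 r times the integrated identity: (1 - 3 x)^2 - 2 (1 - 10 x + 15
    x^2) = -(1 - 14 x + 21 x^2).\<close>
  moreover have "2 * r * Wt t * \<psi> t * \<psi>1 t + r\<^sup>2 * (\<psi>1 t)\<^sup>2 - 2 * r * (Wt t * (\<psi> t * \<psi>1 t) + r * (M t * (1 - 10 * x t + 15 * (x t)\<^sup>2)))
      = - r\<^sup>2 * f t" for t
    unfolding \<psi>1sq f_def by (simp add: power2_eq_square algebra_simps)
  ultimately have "((\<lambda>t. - r\<^sup>2 * f t) has_integral integral {0..1} (\<lambda>t. 2 * r * Wt t * \<psi> t * \<psi>1 t + r\<^sup>2 * (\<psi>1 t)\<^sup>2)) {0..1}"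
    using has_integral_diff[OF _ has_integral_mult_right[OF parts, of "2 * r"]] by fastforce
  then have "integral {0..1} (\<lambda>t. - r\<^sup>2 * f t) = integral {0..1} (\<lambda>t. 2 * r * Wt t * \<psi> t * \<psi>1 t + r\<^sup>2 * (\<psi>1 t)\<^sup>2)"
    by (rule integral_unique)
  then have "0 \<le> - r\<^sup>2 * integral {0..1} f" using nonneg by (simp only: integral_mult_right)
  then have If: "integral {0..1} f \<le> 0" using r by (simp add: mult_le_0_iff zero_less_power2)
  have "\<exists>t1\<ge>0. t1 \<le> t2 \<and> s t1 = l / 40"
    using IVT'[of s 0 "l / 40" t2] s(1) l t2 continuous_on_subset[OF cs, of "{0..t2}"] by (auto simp: l_def)
  then obtain t1 where t1: "0 \<le> t1" "t1 \<le> t2" "s t1 = l / 40" by blast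
  have "t1 \<noteq> 0" "t1 \<noteq> t2" using t1 s(1) l by (auto simp: l_def)
  then have t1': "0 < t1" "t1 < t2" using t1 by auto
  have sle: "s u \<le> s v" if "0 \<le> u" "u \<le> v" "v \<le> 1" for u v using s(3)[of u v] that by (cases "u = v") auto
  have int: "f integrable_on {u..v}" if "0 \<le> u" "v \<le> 1" for u v
    by (rule integrable_continuous_interval[OF continuous_on_subset[OF cf]]) (use that in auto)
  \<comment> \<open>For x at most 1/40 the two factors of \<open>f\<close> are at least (39/40)^2
    and 1 - 14/40 = 26/40, with product above 1/2.\<close>
  have I1: "integral {0..t1} f \<ge> t1 / 2"
  proof -
    have "integral {0..t1} (\<lambda>t. 1 / 2) \<le> integral {0..t1} f"
    proof (rule integral_le)
      fix t assume t: "t \<in> {0..t1}"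
      then have "s t \<le> l / 40" "0 \<le> s t" using sle[of t t1] sle[of 0 t] t1 t2 s(1) by auto
      then have x: "0 \<le> x t" "x t \<le> 1 / 40" using l by (auto simp: x_def field_simps)
      have "(39 / 40)\<^sup>2 \<le> (1 - x t)\<^sup>2" using x by (intro power_mono) auto
      then have M: "(39 / 40)\<^sup>2 \<le> M t" using x by (simp add: M_def)
      have N: "26 / 40 \<le> 1 - 14 * x t + 21 * (x t)\<^sup>2" using x zero_le_power2[of "x t"] by linarith
      have "(39 / 40)\<^sup>2 * (26 / 40) \<le> f t" unfolding f_def by (rule mult_mono[OF M N]) (simp_all add: M_def)
      moreover have "1 / 2 \<le> (39 / 40)\<^sup>2 * (26 / 40 :: real)" by (simp add: power2_eq_square)
      ultimately show "1 / 2 \<le> f t" by linarith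
    qed (use int t1' t2 in auto)
    then show ?thesis using t1' by simp
  qed
  \<comment> \<open>The quadratic factor of \<open>f\<close> has its minimum -4/3 at x = 1/3, and
    \<open>M\<close> lies between 0 and 1.\<close>
  have I2: "integral {t1..t2} f \<ge> - (4 / 3) * (t2 - t1)"
  proof -
    have "integral {t1..t2} (\<lambda>t. - 4 / 3) \<le> integral {t1..t2} f"
    proof (rule integral_le)
      fix t assume t: "t \<in> {t1..t2}"
      then have "0 \<le> s t" using sle[of 0 t] t1 t2 s(1) by auto
      then have x: "0 \<le> x t" using l by (auto simp: x_def)
      have M01: "0 \<le> M t" "M t \<le> 1" unfolding M_def using x by (auto intro!: power_le_one)
      have "1 - 14 * x t + 21 * (x t)\<^sup>2 = 21 * (x t - 1 / 3)\<^sup>2 - 4 / 3" by (simp add: power2_eq_square algebra_simps)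
      then have "- 4 / 3 \<le> 1 - 14 * x t + 21 * (x t)\<^sup>2" by simp
      then have "M t * (- 4 / 3) \<le> f t" unfolding f_def using M01 by (intro mult_left_mono) auto
      then show "- 4 / 3 \<le> f t" using M01 by linarith
    qed (use int t1' t2 in auto)
    then show ?thesis using t1' by (simp add: algebra_simps)
  qed
  have I3: "integral {t2..1} f = 0"
  proof -
    have "f t = 0" if "t \<in> {t2..1}" for t
    proof -
      have "l \<le> s t" using sle[of t2 t] that t2 by (auto simp: l_def)
      then show ?thesis using l by (simp add: f_def M_def x_def)
    qed
    then have "integral {t2..1} f = integral {t2..1} (\<lambda>t::real. 0)" by (intro Henstock_Kurzweil_Integration.integral_cong)
    then show ?thesis by simp
  qed
  have "integral {0..t1} f + integral {t1..t2} f = integral {0..t2} f"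
    using t1' t2 by (intro Henstock_Kurzweil_Integration.integral_combine int) auto
  moreover have "integral {0..t2} f + integral {t2..1} f = integral {0..1} f"
    using t2 by (intro Henstock_Kurzweil_Integration.integral_combine int) auto
  \<comment> \<open>From t1 / 2 <= (4/3) (t2 - t1) comes the factor 1 + 3/8 = 11/8.\<close>
  ultimately have "t1 / 2 - (4 / 3) * (t2 - t1) \<le> 0" using I1 I2 I3 If by linarith
  then have "11 / 8 * t1 \<le> t2" by (simp add: field_simps)
  then show ?thesis using that t1' t1 by (simp add: l_def)
qed

lemma quad_scaleR: "quad a b c x (k *\<^sub>R v) = k\<^sup>2 * quad a b c x v"
  by (simp add: quad_def power2_eq_square algebra_simps)

section \<open>Conformal length along minimizing geodesics\<close>

context unimodular_geodesic
begin

text \<open>The competitors have both end points fixed; \<eta> vanishes there, which removes the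
  boundary terms with \<beta>.\<close>

lemma index_form_nonneg:
  assumes min: "\<And>z v. C1_curve z v \<Longrightarrow> z 0 = \<gamma> 0 \<Longrightarrow> z 1 = \<gamma> 1 \<Longrightarrow> (\<And>t. t \<in> {0..1} \<Longrightarrow> z t \<in> S) \<Longrightarrow>
      r\<^sup>2 / 2 \<le> energy (quad a b c) z v"
    and \<eta>: "\<And>t. t \<in> {0..1} \<Longrightarrow> (\<eta> has_real_derivative \<eta>' t) (at t within {0..1})" "continuous_on {0..1} \<eta>'"
      "\<eta> 0 = 0" "\<eta> 1 = 0"
  shows "0 \<le> integral {0..1} (\<lambda>t. (\<eta>' t)\<^sup>2 - gcurv a b c (\<gamma> t) * r\<^sup>2 * (\<eta> t)\<^sup>2)"
proof -
  have TC: "C1_curve \<gamma> T" using \<gamma>_C1 by (simp add: T_def[abs_def])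
  let ?V = "\<lambda>t. \<eta> t *\<^sub>R N t" and ?W = "\<lambda>t. \<eta>' t *\<^sub>R N t + \<eta> t *\<^sub>R N' t"
  obtain d E1 where d: "d > 0" and inS: "\<And>s t. \<bar>s\<bar> < d \<Longrightarrow> t \<in> {0..1} \<Longrightarrow> \<gamma> t + s *\<^sub>R ?V t \<in> S"
    and C1: "\<And>s. C1_curve (\<lambda>t. \<gamma> t + s *\<^sub>R ?V t) (\<lambda>t. T t + s *\<^sub>R ?W t)"
    and E: "\<And>s. \<bar>s\<bar> < d \<Longrightarrow> ((\<lambda>s. energy (quad a b c) (\<lambda>t. \<gamma> t + s *\<^sub>R ?V t) (\<lambda>t. T t + s *\<^sub>R ?W t)) has_real_derivative E1 s) (at s)"
    and "E1 0 = integral {0..1} (\<lambda>t. var1 a b c (\<gamma> t) (T t) (?V t) (?W t))"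
    and E2: "(E1 has_real_derivative integral {0..1} (\<lambda>t. var2 a b c (\<gamma> t) (T t) (?V t) (?W t))) (at 0)"
    using energy_variation[OF S sa sb sc TC in_S N_field_C1[OF \<eta>(1,2)]] by blast
  have "0 \<le> integral {0..1} (\<lambda>t. var2 a b c (\<gamma> t) (T t) (?V t) (?W t))"
  proof (rule second_derivative_nonneg_at_min(2)[OF d E E2])
    fix s :: real assume s: "\<bar>s\<bar> < d"
    show "energy (quad a b c) (\<lambda>t. \<gamma> t + 0 *\<^sub>R ?V t) (\<lambda>t. T t + 0 *\<^sub>R ?W t) \<le> energy (quad a b c) (\<lambda>t. \<gamma> t + s *\<^sub>R ?V t) (\<lambda>t. T t + s *\<^sub>R ?W t)"
      using min[OF C1[of s]] inS[OF s] \<eta>(3,4) energy_\<gamma> by simp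
  qed
  then show ?thesis using integral_var2[OF \<eta>(1,2)] \<eta>(3,4) by simp
qed

text \<open>The length \<open>s\<close> of a minimizing geodesic in the conformal metric \<open>h / w\<close> grows at most
  polynomially in its own length \<open>r * t\<close>: each factor 40 in \<open>s\<close> costs a factor 11/8 in \<open>t\<close>.\<close>

lemma conformal_length_growth:
  assumes min: "\<And>z v. C1_curve z v \<Longrightarrow> z 0 = \<gamma> 0 \<Longrightarrow> z 1 = \<gamma> 1 \<Longrightarrow> (\<And>t. t \<in> {0..1} \<Longrightarrow> z t \<in> S) \<Longrightarrow>
      r\<^sup>2 / 2 \<le> energy (quad a b c) z v"
    and w: "smooth_on S w" "\<And>x. x \<in> S \<Longrightarrow> w x > 0"
    and curv: "\<And>x v. x \<in> S \<Longrightarrow> (grd w x \<bullet> v)\<^sup>2 / (4 * (w x)\<^sup>2) \<le> gcurv a b c x * (2 * quad a b c x v)"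
    and l: "l > 0" "\<And>x v. x \<in> cball (\<gamma> 0) \<delta> \<Longrightarrow> l * (norm v)\<^sup>2 \<le> quad a b c x v"
    and w0: "w0 > 0" "\<And>x. x \<in> cball (\<gamma> 0) \<delta> \<Longrightarrow> w0 \<le> w x" and \<delta>: "\<delta> > 0"
    and far: "\<And>z v. C1_curve z v \<Longrightarrow> z 0 = \<gamma> 0 \<Longrightarrow> z 1 = \<gamma> 1 \<Longrightarrow> (\<And>t. t \<in> {0..1} \<Longrightarrow> z t \<in> \<gamma> ` {0..1}) \<Longrightarrow>
      (40 ^ J)\<^sup>2 / 2 < energy (quad (\<lambda>x. a x / w x) (\<lambda>x. b x / w x) (\<lambda>x. c x / w x)) z v"
  shows "(11 / 8) ^ J * min (sqrt (2 * l) * \<delta>) (sqrt w0) \<le> r"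
proof -
  have TC: "C1_curve \<gamma> T" using \<gamma>_C1 by (simp add: T_def[abs_def])
  have c\<gamma>: "continuous_on {0..1} \<gamma>" by (rule C1_curve_continuous[OF TC])
  have cT: "continuous_on {0..1} T" using TC by (simp add: C1_curve_def)
  have cc: "continuous_on {0..1} (\<lambda>t. f (\<gamma> t))" if "continuous_on S f" for f :: "real^2 \<Rightarrow> 'z::topological_space"
    by (rule continuous_on_compose2[OF that c\<gamma>]) (use in_S in auto)
  define W where "W t = sqrt (w (\<gamma> t))" for t
  define Wt where "Wt t = (grd w (\<gamma> t) \<bullet> T t) / (2 * W t)" for t
  have Wpos: "W t > 0" "(W t)\<^sup>2 = w (\<gamma> t)" if "t \<in> {0..1}" for t using w(2)[OF in_S[OF that]] by (auto simp: W_def)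
  have Wd: "(W has_real_derivative Wt t) (at t within {0..1})" if t: "t \<in> {0..1}" for t
  proof -
    have "((\<lambda>t. sqrt (w (\<gamma> t))) has_real_derivative (inverse (sqrt (w (\<gamma> t))) / 2) * (grd w (\<gamma> t) \<bullet> T t)) (at t within {0..1})"
      by (rule DERIV_chain2[OF DERIV_real_sqrt coeff_deriv[OF w(1) t]]) (use w(2)[OF in_S[OF t]] in auto)
    moreover have "inverse x / 2 * y = y / (2 * x)" for x y :: real by (cases "x = 0") (simp_all add: field_simps)
    ultimately show ?thesis by (simp only: W_def[abs_def] Wt_def)
  qed
  have cW: "continuous_on {0..1} W" unfolding W_def[abs_def]
    by (intro continuous_intros cc smooth_on_continuous[OF w(1)])
  have cWt: "continuous_on {0..1} Wt" unfolding Wt_def[abs_def]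
    by (intro continuous_on_divide continuous_on_inner continuous_on_mult continuous_on_const cc[OF continuous_on_grd[OF w(1)]] cT cW)
      (use Wpos in force)
  \<comment> \<open>The speed of \<gamma> in the metric h / w, so that \<open>s\<close> becomes its
    length in that metric.\<close>
  define \<kappa> where "\<kappa> t = r / W t" for t
  have c\<kappa>: "continuous_on {0..1} \<kappa>" unfolding \<kappa>_def[abs_def]
    by (intro continuous_on_divide continuous_on_const cW) (use Wpos in force)
  have \<kappa>pos: "\<kappa> t > 0" if "t \<in> {0..1}" for t using Wpos[OF that] r by (simp add: \<kappa>_def)
  show ?thesis
  proof (rule arclength_reparam[OF c\<kappa> \<kappa>pos])
    fix s \<tau> :: "real \<Rightarrow> real"
    assume s: "s 0 = 0" "\<And>t. t \<in> {0..1} \<Longrightarrow> (s has_real_derivative \<kappa> t) (at t within {0..1})"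
      "\<And>x y. x \<in> {0..1} \<Longrightarrow> y \<in> {0..1} \<Longrightarrow> x < y \<Longrightarrow> s x < s y"
      and \<tau>: "\<tau> 0 = 0" "\<tau> 1 = 1" "\<And>u. u \<in> {0..1} \<Longrightarrow> \<tau> u \<in> {0..1}"
      "\<And>u. u \<in> {0..1} \<Longrightarrow> (\<tau> has_real_derivative s 1 / \<kappa> (\<tau> u)) (at u within {0..1})"
    have s1: "s 1 > 0" using s(1) s(3)[of 0 1] by simp
    have step: "\<exists>t1. 0 < t1 \<and> t1 < t2 \<and> s t1 = s t2 / 40 \<and> 11 / 8 * t1 \<le> t2" if t2: "0 < t2" "t2 \<le> 1" for t2
    proof (rule stability_integral[where W = W and Wt = Wt and s = s and r = r and q = "\<lambda>t. gcurv a b c (\<gamma> t) * r\<^sup>2", OF Wd cWt Wpos(1) s(1) _ s(3) r t2])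
      show "(s has_real_derivative r / W t) (at t within {0..1})" if "t \<in> {0..1}" for t using s(2)[OF that] by (simp add: \<kappa>_def)
      show "continuous_on {0..1} (\<lambda>t. gcurv a b c (\<gamma> t) * r\<^sup>2)" by (intro continuous_intros continuous_gcurv_curve)
      show "(Wt t / W t)\<^sup>2 \<le> gcurv a b c (\<gamma> t) * r\<^sup>2" if t: "t \<in> {0..1}" for t
      proof -
        have "(Wt t / W t)\<^sup>2 = (grd w (\<gamma> t) \<bullet> T t)\<^sup>2 / (4 * ((W t)\<^sup>2)\<^sup>2)"
          unfolding Wt_def by (simp add: power_divide power_mult_distrib)
        then show ?thesis using curv[OF in_S[OF t], of "T t"] quad_T[OF t] by (simp add: Wpos(2)[OF t])
      qed
      show "0 \<le> integral {0..1} (\<lambda>t. (\<eta>' t)\<^sup>2 - gcurv a b c (\<gamma> t) * r\<^sup>2 * (\<eta> t)\<^sup>2)"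
        if "\<And>t. t \<in> {0..1} \<Longrightarrow> (\<eta> has_real_derivative \<eta>' t) (at t within {0..1})" "continuous_on {0..1} \<eta>'" "\<eta> 0 = 0" "\<eta> 1 = 0" for \<eta> \<eta>'
        by (rule index_form_nonneg[OF min that])
    qed blast+
    \<comment> \<open>While the curve stays in the ball, passing from h to h / w stretches lengths
      by at most the factor 1 / sqrt w0.\<close>
    have sr: "s t \<le> r * t / sqrt w0" if t: "0 < t" "t \<le> 1" and inball: "\<And>u. 0 < u \<Longrightarrow> u < t \<Longrightarrow> \<gamma> u \<in> cball (\<gamma> 0) \<delta>" for t
    proof -
      have "continuous_on {0..1} s" unfolding continuous_on_eq_continuous_within by (auto intro: DERIV_continuous s(2))
      then have cs: "continuous_on {0..t} s" using t by (auto intro: continuous_on_subset)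
      have der: "(s has_derivative (*) (\<kappa> x)) (at x)" if "0 < x" "x < t" for x
      proof -
        have "(s has_real_derivative \<kappa> x) (at x within {0..1})" using s(2) that t by simp
        moreover have "at x within {0..1} = at x" using that t by (intro at_within_interior) auto
        ultimately show ?thesis by (simp add: has_field_derivative_def)
      qed
      obtain z where z: "0 < z" "z < t" "s t - s 0 = \<kappa> z * (t - 0)" by (rule mvt[OF t(1) cs der])
      have "sqrt w0 \<le> W z" using w0(2)[OF inball[OF z(1,2)]] by (simp add: W_def)
      moreover have "W z > 0" using Wpos[of z] z t by simp
      ultimately have "\<kappa> z \<le> r / sqrt w0" unfolding \<kappa>_def using r w0 by (intro divide_left_mono mult_pos_pos) auto
      then have "\<kappa> z * t \<le> r / sqrt w0 * t" using t by (intro mult_right_mono) auto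
      then show ?thesis using z(3) s(1) by simp
    qed
    define k where "k = min (sqrt (2 * l) * \<delta>) (sqrt w0)"
    \<comment> \<open>Start of the induction: when the conformal length has reached 1, the length r
      t is at least \<open>k\<close>. If the curve is still in the ball this follows from
      \<open>sr\<close>; otherwise it has crossed the distance \<delta> in the region where
      \<open>l\<close> bounds the metric from below.\<close>
    have base: "k \<le> r * t" if t: "0 < t" "t \<le> 1" and st: "s t \<ge> 1" for t
    proof (cases "\<forall>u\<in>{0..1}. \<gamma> (t * u) \<in> interior (cball (\<gamma> 0) \<delta>)")
      case True
      have "\<gamma> u \<in> cball (\<gamma> 0) \<delta>" if "0 < u" "u < t" for u
        using True[rule_format, of "u / t"] that interior_subset by fastforce
      then have "s t \<le> r * t / sqrt w0" using sr[OF t] by blast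
      then have "1 \<le> r * t / sqrt w0" using st by linarith
      then have "sqrt w0 \<le> r * t" using w0 by (simp add: field_simps)
      then show ?thesis by (simp add: k_def)
    next
      case False
      then obtain u where u: "u \<in> {0..1}" "\<gamma> (t * u) \<notin> interior (cball (\<gamma> 0) \<delta>)" by blast
      then have "u \<noteq> 0" using \<delta> by auto
      then have tu: "0 < t * u" "t * u \<le> t" "t * u \<le> 1" using u t by (auto simp: mult_le_one)
      have "continuous_on {0..1} (\<lambda>x. \<gamma> (t * u * x))"
        by (rule continuous_on_compose2[OF c\<gamma>]) (use tu in \<open>auto intro!: continuous_intros mult_le_one\<close>)
      then obtain t0 where t0: "0 < t0" "t0 \<le> 1" "\<gamma> (t * u * t0) \<in> frontier (cball (\<gamma> 0) \<delta>)"
          "\<And>x. 0 \<le> x \<Longrightarrow> x < t0 \<Longrightarrow> \<gamma> (t * u * x) \<in> interior (cball (\<gamma> 0) \<delta>)"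
        using exit_time[of "\<lambda>x. \<gamma> (t * u * x)" "cball (\<gamma> 0) \<delta>"] u \<delta> by auto
      define q where "q = t * u * t0"
      have "0 < q" "q \<le> t * u" unfolding q_def using tu(1) t0(1,2) by (simp_all only: mult_pos_pos mult_left_le less_imp_le)
      then have q: "0 < q" "q \<le> t" "q \<le> 1" using tu(2,3) by linarith+
      have inb: "\<gamma> (q * x) \<in> cball (\<gamma> 0) \<delta>" if "x \<in> {0..1}" for x
      proof (cases "x = 1")
        case True
        then show ?thesis using t0(3) \<delta> unfolding q_def by simp
      next
        case False
        then have "t0 * x < t0" using that t0 by auto
        then have "\<gamma> (t * u * (t0 * x)) \<in> interior (cball (\<gamma> 0) \<delta>)" using t0(1,4) that by auto
        then show ?thesis using interior_subset by (fastforce simp: q_def mult.assoc)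
      qed
      have "l * (norm (\<gamma> (q * 1) - \<gamma> (q * 0)))\<^sup>2 \<le> integral {0..1} (\<lambda>x::real. q\<^sup>2 * (r\<^sup>2 / 2))"
      proof (rule energy_lower_bound[OF C1_curve_rescale[OF TC] _ _ l(1)])
        fix x :: real assume x: "x \<in> {0..1}"
        have "q * x \<in> {0..1}" using q x by (auto simp: mult_le_one)
        then have "quad a b c (\<gamma> (q * x)) (q *\<^sub>R T (q * x)) = q\<^sup>2 * (r\<^sup>2 / 2)"
          using quad_T[of "q * x"] by (simp add: quad_scaleR)
        then show "l * (norm (q *\<^sub>R T (q * x)))\<^sup>2 \<le> q\<^sup>2 * (r\<^sup>2 / 2)" using l(2)[OF inb[OF x], of "q *\<^sub>R T (q * x)"] by simp
      qed (use q in auto)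
      moreover have "norm (\<gamma> (q * 1) - \<gamma> (q * 0)) = \<delta>" using t0(3) \<delta> by (simp add: q_def dist_norm norm_minus_commute)
      ultimately have "2 * l * \<delta>\<^sup>2 \<le> (r * q)\<^sup>2" by (simp add: power_mult_distrib algebra_simps)
      then have "sqrt (2 * l * \<delta>\<^sup>2) \<le> r * q" using r q by (intro real_le_lsqrt) auto
      moreover have "sqrt (2 * l * \<delta>\<^sup>2) = sqrt (2 * l) * \<delta>" using \<delta> l by (simp add: real_sqrt_mult)
      moreover have "r * q \<le> r * t" using r q by (intro mult_left_mono) auto
      ultimately show ?thesis by (simp add: k_def)
    qed
    have grow: "(11 / 8) ^ j * k \<le> r * t" if "0 < t" "t \<le> 1" "s t \<ge> 40 ^ j" for j t
      using that
    proof (induction j arbitrary: t)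
      case 0
      then show ?case using base by simp
    next
      case (Suc j)
      obtain t1 where t1: "0 < t1" "t1 < t" "s t1 = s t / 40" "11 / 8 * t1 \<le> t" using step[OF Suc.prems(1,2)] by blast
      then have "(11 / 8) ^ j * k \<le> r * t1" using Suc by (intro Suc.IH) auto
      moreover have "r * (11 / 8 * t1) \<le> r * t" using r t1 by (intro mult_left_mono) auto
      ultimately show ?case by simp
    qed
    \<comment> \<open>\<gamma> run at constant speed for h / w. Its energy is then half the squared
      conformal length, so \<open>far\<close> bounds this length from below by 40^J.\<close>
    let ?z = "\<lambda>u. \<gamma> (\<tau> u)" and ?v = "\<lambda>u. (s 1 / \<kappa> (\<tau> u)) *\<^sub>R T (\<tau> u)"
    have c\<tau>: "continuous_on {0..1} \<tau>" unfolding continuous_on_eq_continuous_within by (auto intro: DERIV_continuous \<tau>(4))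
    have c\<tau>': "continuous_on {0..1} (\<lambda>u. f (\<tau> u))" if "continuous_on {0..1} f" for f :: "real \<Rightarrow> 'z::topological_space"
      by (rule continuous_on_compose2[OF that c\<tau>]) (use \<tau>(3) in auto)
    have C: "C1_curve ?z ?v" unfolding C1_curve_def
    proof (intro conjI ballI)
      fix u :: real assume u: "u \<in> {0..1}"
      have "(\<tau> has_vector_derivative s 1 / \<kappa> (\<tau> u)) (at u within {0..1})"
        using \<tau>(4)[OF u] by (simp add: has_real_derivative_iff_has_vector_derivative)
      moreover have "(\<gamma> has_vector_derivative T (\<tau> u)) (at (\<tau> u) within \<tau> ` {0..1})"
        by (rule has_vector_derivative_within_subset[OF \<gamma>_deriv[OF \<tau>(3)[OF u]]]) (use \<tau>(3) in auto)
      ultimately show "(?z has_vector_derivative ?v u) (at u within {0..1})"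
        using vector_diff_chain_within[of \<tau> _ u "{0..1}" \<gamma>] by (simp add: o_def)
    next
      show "continuous_on {0..1} ?v"
        by (intro continuous_on_scaleR continuous_on_divide continuous_on_const c\<tau>'[OF c\<kappa>] c\<tau>'[OF cT]) (use \<kappa>pos \<tau>(3) in force)
    qed
    have dens: "quad (\<lambda>x. a x / w x) (\<lambda>x. b x / w x) (\<lambda>x. c x / w x) (?z u) (?v u) = (s 1)\<^sup>2 / 2" if u: "u \<in> {0..1}" for u
    proof -
      let ?t = "\<tau> u"
      have t: "?t \<in> {0..1}" by (rule \<tau>(3)[OF u])
      have sc: "quad (\<lambda>x. a x / w x) (\<lambda>x. b x / w x) (\<lambda>x. c x / w x) x (k *\<^sub>R v) = k\<^sup>2 * quad a b c x v / w x" for x k v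
        by (simp add: quad_def add_divide_distrib power2_eq_square algebra_simps)
      have "(s 1 / \<kappa> ?t)\<^sup>2 = (s 1)\<^sup>2 * w (\<gamma> ?t) / r\<^sup>2"
        unfolding \<kappa>_def by (simp add: power_divide power_mult_distrib Wpos(2)[OF t])
      then show ?thesis unfolding sc quad_T[OF t] using w(2)[OF in_S[OF t]] r by simp
    qed
    have "(40 ^ J)\<^sup>2 / 2 < energy (quad (\<lambda>x. a x / w x) (\<lambda>x. b x / w x) (\<lambda>x. c x / w x)) ?z ?v"
      by (rule far[OF C]) (use \<tau> in auto)
    also have "energy (quad (\<lambda>x. a x / w x) (\<lambda>x. b x / w x) (\<lambda>x. c x / w x)) ?z ?v = integral {0..1} (\<lambda>u::real. (s 1)\<^sup>2 / 2)"
      unfolding energy_def by (intro Henstock_Kurzweil_Integration.integral_cong dens)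
    finally have "(40 ^ J)\<^sup>2 < (s 1)\<^sup>2" by simp
    then have "40 ^ J < s 1" using s1 by (intro power_less_imp_less_base[of "40 ^ J" 2 "s 1"]) auto
    then show ?thesis using grow[of 1 J] by (simp add: k_def)
  qed
qed

end

text \<open>It suffices to treat an h-cheapest way to the frontier of a set \<open>K\<close> that
  confines for h / w. Its conformal length exceeds 40^J, so its h length is at least (11/8)^J times
  a constant determined by a ball about \<open>p\<close>. That constant is independent of
  \<open>K\<close>, which permits choosing \<open>J\<close> before \<open>K\<close>.\<close>

theorem proper_from_conformal:
  assumes S: "open S" and sm: "smooth_on S a" "smooth_on S b" "smooth_on S c" "smooth_on S w"
    and apos: "\<And>x. x \<in> S \<Longrightarrow> a x > 0" and det: "\<And>x. x \<in> S \<Longrightarrow> a x * c x - (b x)\<^sup>2 = 1"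
    and w: "\<And>x. x \<in> S \<Longrightarrow> w x > 0"
    and curv: "\<And>x v. x \<in> S \<Longrightarrow> (grd w x \<bullet> v)\<^sup>2 / (4 * (w x)\<^sup>2) \<le> gcurv a b c x * (2 * quad a b c x v)"
    and proper: "proper_from S (\<lambda>x. a x / w x) (\<lambda>x. b x / w x) (\<lambda>x. c x / w x) p" and p: "p \<in> S"
  shows "proper_from S a b c p"
  unfolding proper_from_def
proof
  fix m :: real
  obtain \<delta> where \<delta>: "\<delta> > 0" "cball p \<delta> \<subseteq> S" using S p open_contains_cball by blast
  have pd: "posdef_on S a b c" using apos det by (simp add: posdef_on_def)
  then have "posdef_on (cball p \<delta>) a b c" using \<delta> by (auto simp: posdef_on_def)
  then obtain l where l: "l > 0" "\<And>x v. x \<in> cball p \<delta> \<Longrightarrow> l * (norm v)\<^sup>2 \<le> quad a b c x v"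
    using quad_lower_compact[OF compact_cball] sm smooth_on_continuous continuous_on_subset[OF _ \<delta>(2)] by metis
  have "cball p \<delta> \<noteq> {}" using \<delta> by simp
  then obtain y where y: "y \<in> cball p \<delta>" "\<And>x. x \<in> cball p \<delta> \<Longrightarrow> w y \<le> w x"
    using continuous_attains_inf[OF compact_cball _ continuous_on_subset[OF smooth_on_continuous[OF sm(4)] \<delta>(2)]] by blast
  have wy: "w y > 0" using w y \<delta> by blast
  define k where "k = min (sqrt (2 * l) * \<delta>) (sqrt (w y))"
  have k: "k > 0" using l \<delta> wy by (simp add: k_def)
  \<comment> \<open>A length above 2 |m| + 1 gives an energy above m, since (2 |m| + 1)^2 >= 2
    |m|.\<close>
  obtain J where J: "(2 * \<bar>m\<bar> + 1) / k < (11 / 8) ^ J" using real_arch_pow[of "11 / 8" "(2 * \<bar>m\<bar> + 1) / k"] by auto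
  then have Jk: "2 * \<bar>m\<bar> + 1 < (11 / 8) ^ J * k" using k by (simp add: field_simps)
  obtain K where K: "compact K" "K \<subseteq> S" "p \<in> interior K"
    "confines K (\<lambda>x. a x / w x) (\<lambda>x. b x / w x) (\<lambda>x. c x / w x) p ((40 ^ J)\<^sup>2 / 2)"
    using proper unfolding proper_from_def by blast
  obtain A B Cc A' B' C' lam M U where ext: "extended_metric A B Cc A' B' C' lam M a b c U" and U: "K \<subseteq> U" "U \<subseteq> S"
    by (rule extended_metric_exists[OF S K(1,2) sm(1-3) pd])
  interpret extended_metric A B Cc A' B' C' lam M a b c U by (rule ext)
  obtain \<gamma> P where \<gamma>: "\<gamma> 0 = p" "\<gamma> 1 \<in> frontier K" "\<And>t. 0 \<le> t \<Longrightarrow> t < 1 \<Longrightarrow> \<gamma> t \<in> interior K"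
    "C1_curve \<gamma> (\<lambda>t. vel A B Cc (\<gamma> t) (P t))" "C1_curve P (\<lambda>t. quad_x A' B' C' (\<gamma> t) (vel A B Cc (\<gamma> t) (P t)))"
    "energy (quad A B Cc) \<gamma> (\<lambda>t. vel A B Cc (\<gamma> t) (P t)) = action p (\<gamma> 1)"
    "\<And>x. x \<in> frontier K \<Longrightarrow> action p (\<gamma> 1) \<le> action p x"
    using frontier_minimizer[OF K(1,3)] by blast
  define E where "E = action p (\<gamma> 1)"
  have "\<gamma> 1 \<noteq> p" using \<gamma>(2) K(3) by (auto simp: frontier_def)
  then have "0 < lam * (norm (\<gamma> 1 - p))\<^sup>2" using lam by simp
  then have E: "E > 0" using action_lower[of "\<gamma> 1" p] by (simp add: E_def)
  have \<gamma>K: "\<gamma> t \<in> K" if "t \<in> {0..1}" for t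
    using \<gamma>(2) \<gamma>(3)[of t] that subsetD[OF interior_subset, of "\<gamma> t" K] subsetD[OF frontier_subset_closed[OF compact_imp_closed[OF K(1)]]]
    by (cases "t = 1") auto
  have \<gamma>U: "\<gamma> t \<in> U" if "t \<in> {0..1}" for t using \<gamma>K[OF that] U by blast
  interpret ug: unimodular_geodesic U a b c \<gamma> P "sqrt (2 * E)"
    by (rule minimizer_unimodular_geodesic[OF open_U order_refl _ _ _ _ \<gamma>U \<gamma>(4,5) \<gamma>(6)[folded E_def] E])
      (use smooth_on_subset[OF _ U(2)] sm det U in auto)
  have "(11 / 8) ^ J * min (sqrt (2 * l) * \<delta>) (sqrt (w y)) \<le> sqrt (2 * E)"
  proof (rule ug.conformal_length_growth)
    show "(sqrt (2 * E))\<^sup>2 / 2 \<le> energy (quad a b c) z v"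
      if z: "C1_curve z v" "z 0 = \<gamma> 0" "z 1 = \<gamma> 1" "\<And>t. t \<in> {0..1} \<Longrightarrow> z t \<in> U" for z v
      using action_le[OF z(1), of p "\<gamma> 1"] energy_agree[where z = z and w = v] z \<gamma>(1) E by (simp add: E_def)
    show "smooth_on U w" by (rule smooth_on_subset[OF sm(4) U(2)])
    show "(40 ^ J)\<^sup>2 / 2 < energy (quad (\<lambda>x. a x / w x) (\<lambda>x. b x / w x) (\<lambda>x. c x / w x)) z v"
      if z: "C1_curve z v" "z 0 = \<gamma> 0" "z 1 = \<gamma> 1" "\<And>t. t \<in> {0..1} \<Longrightarrow> z t \<in> \<gamma> ` {0..1}" for z v
    proof -
      have "\<forall>t\<in>{0..1}. z t \<in> K" using z(4) \<gamma>K by fastforce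
      then show ?thesis using K(4) z \<gamma>(1,2) unfolding confines_def by simp
    qed
  qed (use curv U w l y wy \<delta> \<gamma>(1) in auto)
  then have "2 * \<bar>m\<bar> + 1 < sqrt (2 * E)" using Jk by (simp add: k_def)
  then have "(2 * \<bar>m\<bar> + 1)\<^sup>2 < 2 * E" using real_sqrt_less_iff[of "(2 * \<bar>m\<bar> + 1)\<^sup>2" "2 * E"] by simp
  moreover have "2 * \<bar>m\<bar> \<le> (2 * \<bar>m\<bar> + 1)\<^sup>2" by (simp add: power2_eq_square algebra_simps)
  ultimately have mE: "m < E" by linarith
  have "confines K a b c p m" unfolding confines_def
  proof (intro allI impI)
    fix z v assume z: "C1_curve z v" "z 0 = p" "\<forall>t\<in>{0..1}. z t \<in> K" "z 1 \<in> frontier K"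
    have "E \<le> action p (z 1)" using \<gamma>(7)[OF z(4)] by (simp add: E_def)
    also have "\<dots> \<le> energy (quad A B Cc) z v" by (rule action_le) (use z in auto)
    also have "\<dots> = energy (quad a b c) z v" using z(3) U by (intro energy_agree) auto
    finally show "m < energy (quad a b c) z v" using mE by simp
  qed
  then show "\<exists>K. compact K \<and> K \<subseteq> S \<and> p \<in> interior K \<and> confines K a b c p m" using K by blast
qed

section \<open>Geodesic completeness\<close>

lemma lipschitz_on_mult_compact:
  fixes f g :: "'a::metric_space \<Rightarrow> real"
  assumes X: "compact X" and f: "\<exists>L. L-lipschitz_on X f" and g: "\<exists>L. L-lipschitz_on X g"
  shows "\<exists>L. L-lipschitz_on X (\<lambda>x. f x * g x)"
proof -
  obtain L M where L: "L-lipschitz_on X f" and M: "M-lipschitz_on X g" using f g by blast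
  have "compact (f ` X)" "compact (g ` X)"
    using X lipschitz_on_continuous_on[OF L] lipschitz_on_continuous_on[OF M] by (auto intro: compact_continuous_image)
  then obtain A B where A: "\<And>x. x \<in> X \<Longrightarrow> \<bar>f x\<bar> \<le> A" and B: "\<And>x. x \<in> X \<Longrightarrow> \<bar>g x\<bar> \<le> B"
    by (metis bounded_real compact_imp_bounded image_eqI)
  have L0: "0 \<le> L" "0 \<le> M" using L M lipschitz_on_nonneg by auto
  have "(\<bar>A\<bar> * M + \<bar>B\<bar> * L)-lipschitz_on X (\<lambda>x. f x * g x)"
  proof (rule lipschitz_onI)
    fix x y assume xy: "x \<in> X" "y \<in> X"
    have "\<bar>f x * g x - f y * g y\<bar> = \<bar>f x * (g x - g y) + g y * (f x - f y)\<bar>" by (simp add: algebra_simps)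
    also have "\<dots> \<le> \<bar>f x\<bar> * \<bar>g x - g y\<bar> + \<bar>g y\<bar> * \<bar>f x - f y\<bar>"
      by (rule order_trans[OF abs_triangle_ineq]) (simp add: abs_mult)
    also have "\<dots> \<le> \<bar>A\<bar> * (M * dist x y) + \<bar>B\<bar> * (L * dist x y)"
      using A[OF xy(1)] B[OF xy(2)] lipschitz_onD[OF L xy] lipschitz_onD[OF M xy]
      by (intro add_mono mult_mono) (auto simp: dist_real_def)
    finally show "dist (f x * g x) (f y * g y) \<le> (\<bar>A\<bar> * M + \<bar>B\<bar> * L) * dist x y"
      by (simp add: dist_real_def algebra_simps)
  qed (use L0 in simp)
  then show ?thesis ..
qed

text \<open>A compact set need not be convex, so the gradient bound is applied on balls, and
  compactness turns the local Lipschitz property into a global one on \<open>X\<close>.\<close>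

lemma smooth_on_lipschitz:
  fixes f :: "real^2 \<Rightarrow> real"
  assumes S: "open S" and f: "smooth_on S f" and X: "compact X" "X \<subseteq> S"
  shows "\<exists>L. L-lipschitz_on X f"
proof -
  have "local_lipschitz {0::real} S (\<lambda>_. f)"
  proof (rule local_lipschitzI)
    fix t x :: "_" assume "t \<in> {0::real}" "x \<in> S"
    then obtain u where u: "u > 0" "cball x u \<subseteq> S" using S open_contains_cball by blast
    have "compact (grd f ` cball x u)"
      by (intro compact_continuous_image continuous_on_subset[OF continuous_on_grd[OF f] u(2)] compact_cball)
    then obtain B where B: "\<And>y. y \<in> cball x u \<Longrightarrow> norm (grd f y) \<le> B"
      by (metis bounded_iff compact_imp_bounded image_eqI)
    then have "0 \<le> B" using u by (meson centre_in_cball less_imp_le norm_ge_zero order_trans)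
    have "B-lipschitz_on (cball x u \<inter> S) f"
    proof (rule lipschitz_onI[OF _ \<open>0 \<le> B\<close>])
      fix y z assume yz: "y \<in> cball x u \<inter> S" "z \<in> cball x u \<inter> S"
      have "norm (f y - f z) \<le> B * norm (y - z)"
      proof (rule differentiable_bound[OF convex_cball, where f' = "\<lambda>y v. grd f y \<bullet> v"])
        fix y assume y: "y \<in> cball x u"
        show "(f has_derivative (\<lambda>v. grd f y \<bullet> v)) (at y within cball x u)"
          using smooth_on_grd[OF f] y u has_derivative_at_withinI by blast
        show "onorm (\<lambda>v. grd f y \<bullet> v) \<le> B"
        proof (rule onorm_le)
          fix v
          have "\<bar>grd f y \<bullet> v\<bar> \<le> norm (grd f y) * norm v" by (rule Cauchy_Schwarz_ineq2)
          also have "\<dots> \<le> B * norm v" using B[OF y] by (rule mult_right_mono) simp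
          finally show "norm (grd f y \<bullet> v) \<le> B * norm v" by simp
        qed
      qed (use yz in auto)
      then show "dist (f y) (f z) \<le> B * dist y z" by (simp add: dist_norm)
    qed
    then show "\<exists>u>0. \<exists>L. \<forall>t\<in>cball t u \<inter> {0}. L-lipschitz_on (cball x u \<inter> S) f" using u by blast
  qed
  then have "local_lipschitz {0::real} X (\<lambda>_. f)" by (rule local_lipschitz_subset) (use X in auto)
  from local_lipschitz_compact_implies_lipschitz[OF this X(1) compact_sing continuous_on_const] show ?thesis by (metis insertI1)
qed

text \<open>The explicit Euler scheme and \<open>discrete_limit\<close>. Time is rescaled to the
  unit interval, hence the factor \<tau> in front of the field.\<close>

lemma peano:
  fixes f :: "'a::euclidean_space \<Rightarrow> 'a"
  assumes \<Omega>: "open \<Omega>" and f: "continuous_on \<Omega> f" and z0: "z0 \<in> \<Omega>"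
  obtains \<tau> Y where "\<tau> > 0" "Y 0 = z0" "\<And>t. t \<in> {0..1} \<Longrightarrow> Y t \<in> \<Omega>"
    "\<And>t. t \<in> {0..1} \<Longrightarrow> (Y has_vector_derivative \<tau> *\<^sub>R f (Y t)) (at t within {0..1})"
proof -
  obtain \<delta> where \<delta>: "\<delta> > 0" "cball z0 \<delta> \<subseteq> \<Omega>" using \<Omega> z0 open_contains_cball by blast
  let ?C = "cball z0 \<delta>"
  have C: "closed ?C" "?C \<noteq> {}" "convex ?C" using \<delta> by auto
  \<comment> \<open>Composition with the nearest point projection to the ball yields a bounded field
    that is continuous on the whole space.\<close>
  define h where "h y = f (closest_point ?C y)" for y
  have ch: "continuous_on UNIV h" unfolding h_def
    by (rule continuous_on_compose2[OF f continuous_on_closest_point]) (use C \<delta> closest_point_in_set[OF C(1,2)] in auto)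
  have "compact (f ` ?C)" by (intro compact_continuous_image continuous_on_subset[OF f \<delta>(2)] compact_cball)
  then obtain B where B: "\<And>y. y \<in> ?C \<Longrightarrow> norm (f y) \<le> B" by (metis bounded_iff compact_imp_bounded image_eqI)
  \<comment> \<open>A time so short that solutions cannot leave the ball, on which the projection is
    the identity.\<close>
  define \<tau> where "\<tau> = \<delta> / (\<bar>B\<bar> + 1)"
  have \<tau>: "\<tau> > 0" using \<delta> by (simp add: \<tau>_def)
  have hB: "norm (\<tau> *\<^sub>R h y) \<le> \<delta>" for y
  proof -
    have "norm (h y) \<le> \<bar>B\<bar> + 1" using B[OF closest_point_in_set[OF C(1,2)], of y] by (simp add: h_def)
    then have "\<tau> * norm (h y) \<le> \<tau> * (\<bar>B\<bar> + 1)" using \<tau> by (intro mult_left_mono) auto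
    moreover have "\<tau> * (\<bar>B\<bar> + 1) = \<delta>" by (simp add: \<tau>_def)
    ultimately show ?thesis using \<tau> by (simp only: norm_scaleR abs_of_pos)
  qed
  define y where "y n = rec_nat z0 (\<lambda>k y. y + (1 / real (Suc n)) *\<^sub>R (\<tau> *\<^sub>R h y))" for n
  have y0: "y n 0 = z0" and yS: "y n (Suc k) = y n k + (1 / real (Suc n)) *\<^sub>R (\<tau> *\<^sub>R h (y n k))" for n k by (simp_all add: y_def)
  have yb: "norm (y n k - z0) \<le> real k / real (Suc n) * \<delta>" for n k
  proof (induction k)
    case (Suc k)
    have "norm (y n (Suc k) - z0) = norm ((y n k - z0) + (1 / real (Suc n)) *\<^sub>R (\<tau> *\<^sub>R h (y n k)))" by (simp add: yS algebra_simps)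
    also have "\<dots> \<le> real k / real (Suc n) * \<delta> + norm ((1 / real (Suc n)) *\<^sub>R (\<tau> *\<^sub>R h (y n k)))"
      by (rule order_trans[OF norm_triangle_ineq add_right_mono[OF Suc]])
    also have "norm ((1 / real (Suc n)) *\<^sub>R (\<tau> *\<^sub>R h (y n k))) = (1 / real (Suc n)) * norm (\<tau> *\<^sub>R h (y n k))" by simp
    also have "\<dots> \<le> (1 / real (Suc n)) * \<delta>" by (rule mult_left_mono[OF hB]) simp
    finally show ?case by (simp add: add_divide_distrib[symmetric] distrib_right add.commute)
  qed (simp add: y0)
  have yR: "norm (y n k) \<le> norm z0 + \<delta>" if "k \<le> Suc n" for n k
  proof -
    have "real k / real (Suc n) * \<delta> \<le> 1 * \<delta>" using that \<delta> by (intro mult_right_mono) auto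
    then show ?thesis using yb[of n k] norm_triangle_sub[of "y n k" z0] by simp
  qed
  have F: "continuous_on UNIV (\<lambda>(u, v). \<tau> *\<^sub>R h u :: 'a)" for \<tau> :: real
    unfolding case_prod_beta by (intro continuous_intros continuous_on_compose2[OF ch]) auto
  have yrec: "y n (Suc k) - y n k = (1 / real (Suc n)) *\<^sub>R (\<tau> *\<^sub>R h (y n k))" for n k by (simp add: yS)
  show thesis
  proof (rule discrete_limit[OF F, of y "norm z0 + \<delta>" \<tau>])
    fix Y :: "real \<Rightarrow> 'a" and r :: "nat \<Rightarrow> nat"
    assume Y: "\<And>t. t \<in> {0..1} \<Longrightarrow> (Y has_vector_derivative \<tau> *\<^sub>R h (Y t)) (at t within {0..1})"
      and lim: "\<And>e. e > 0 \<Longrightarrow> \<exists>N. \<forall>n\<ge>N. \<forall>k\<le>Suc (r n). norm (y (r n) k - Y (real k / real (Suc (r n)))) < e"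
    have Y0: "Y 0 = z0"
    proof (rule ccontr)
      assume "Y 0 \<noteq> z0"
      then obtain N where "\<forall>n\<ge>N. \<forall>k\<le>Suc (r n). norm (y (r n) k - Y (real k / real (Suc (r n)))) < norm (z0 - Y 0)"
        using lim[of "norm (z0 - Y 0)"] by auto
      then show False by (force simp: y0)
    qed
    have YC: "Y t \<in> ?C" if t: "t \<in> {0..1}" for t
    proof -
      have "norm (Y t - Y 0) \<le> \<delta> * norm (t - 0)"
      proof (rule differentiable_bound[where S = "{0..1}" and f' = "\<lambda>x d. d *\<^sub>R (\<tau> *\<^sub>R h (Y x))"])
        fix x :: real assume "x \<in> {0..1}"
        then show "(Y has_derivative (\<lambda>d. d *\<^sub>R (\<tau> *\<^sub>R h (Y x)))) (at x within {0..1})" using Y by (simp add: has_vector_derivative_def)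
        show "onorm (\<lambda>d. d *\<^sub>R (\<tau> *\<^sub>R h (Y x))) \<le> \<delta>"
        proof (rule onorm_le)
          fix d :: real
          have "\<bar>d\<bar> * norm (\<tau> *\<^sub>R h (Y x)) \<le> \<bar>d\<bar> * \<delta>" by (rule mult_left_mono[OF hB]) simp
          then show "norm (d *\<^sub>R (\<tau> *\<^sub>R h (Y x))) \<le> \<delta> * norm d" by (simp only: norm_scaleR[of d] real_norm_def mult.commute[of \<delta>])
        qed
      qed (use t in auto)
      also have "\<delta> * norm (t - 0) \<le> \<delta> * 1" using t \<delta> by (intro mult_left_mono) auto
      finally show ?thesis by (simp add: Y0 dist_norm norm_minus_commute)
    qed
    show thesis
    proof (rule that[where Y = Y, OF \<tau> Y0])
      fix t :: real assume t: "t \<in> {0..1}"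
      show "Y t \<in> \<Omega>" using YC[OF t] \<delta> by blast
      show "(Y has_vector_derivative \<tau> *\<^sub>R f (Y t)) (at t within {0..1})"
        using Y[OF t] by (simp add: h_def closest_point_self[OF YC[OF t]])
    qed
  qed (use yR yrec in auto)
qed

text \<open>Gronwall's argument: |y - z|^2 exp(-2 L t) does not increase as long as \<open>y\<close>
  stays in the tube of radius \<epsilon> about \<open>z\<close>, and by the smallness of the initial
  difference \<open>y\<close> never reaches the frontier of the tube.\<close>

lemma ode_dependence:
  fixes f :: "'a::euclidean_space \<Rightarrow> 'a"
  assumes z: "\<And>t. t \<in> {0..1} \<Longrightarrow> (z has_vector_derivative f (z t)) (at t within {0..1})"
    and y: "\<And>t. t \<in> {0..1} \<Longrightarrow> (y has_vector_derivative f (y t)) (at t within {0..1})"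
    and f: "L-lipschitz_on X f" and X: "\<And>t. t \<in> {0..1} \<Longrightarrow> cball (z t) \<epsilon> \<subseteq> X"
    and \<epsilon>: "norm (y 0 - z 0) * exp L < \<epsilon>"
  shows "norm (y 1 - z 1) < \<epsilon>"
proof -
  have L: "0 \<le> L" by (rule lipschitz_on_nonneg[OF f])
  define x where "x t = y t - z t" for t
  have \<epsilon>0: "\<epsilon> > 0" using \<epsilon> by (meson exp_ge_zero less_le_trans mult_nonneg_nonneg norm_ge_zero not_less order.trans)
  have xd: "(x has_vector_derivative f (y t) - f (z t)) (at t within {0..1})" if "t \<in> {0..1}" for t
    unfolding x_def[abs_def] by (intro has_vector_derivative_diff y z that)
  define \<psi> where "\<psi> t = (x t \<bullet> x t) * exp (- 2 * L * t)" for t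
  have \<psi>d: "(\<psi> has_real_derivative (2 * (x t \<bullet> (f (y t) - f (z t))) - 2 * L * (x t \<bullet> x t)) * exp (- 2 * L * t)) (at t within {0..1})"
    if t: "t \<in> {0..1}" for t
  proof -
    have "((\<lambda>t. x t \<bullet> x t) has_real_derivative 2 * (x t \<bullet> (f (y t) - f (z t)))) (at t within {0..1})"
      using bounded_bilinear.has_vector_derivative[OF bounded_bilinear_inner xd[OF t] xd[OF t]]
      by (simp add: has_real_derivative_iff_has_vector_derivative inner_commute)
    moreover have "((\<lambda>t. exp (- 2 * L * t)) has_real_derivative exp (- 2 * L * t) * (- 2 * L)) (at t within {0..1})"
      by (auto intro!: derivative_eq_intros)
    ultimately have "(\<psi> has_real_derivative 2 * (x t \<bullet> (f (y t) - f (z t))) * exp (- 2 * L * t) + exp (- 2 * L * t) * (- 2 * L) * (x t \<bullet> x t)) (at t within {0..1})"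
      unfolding \<psi>_def[abs_def] by (rule DERIV_mult)
    then show ?thesis by (simp add: algebra_simps)
  qed
  have bound: "norm (x t) < \<epsilon>" if t: "0 < t" "t \<le> 1" and tube: "\<And>s. 0 \<le> s \<Longrightarrow> s < t \<Longrightarrow> norm (x s) \<le> \<epsilon>" for t
  proof -
    have "\<psi> t \<le> \<psi> 0"
    proof (rule DERIV_nonpos_imp_decreasing_open[of 0 t \<psi>])
      fix s assume s: "0 < s" "s < t"
      then have s01: "s \<in> {0..1}" using t by auto
      have "z s \<in> cball (z s) \<epsilon>" "y s \<in> cball (z s) \<epsilon>"
        using tube[of s] s \<epsilon>0 by (auto simp: x_def dist_norm norm_minus_commute)
      then have "z s \<in> X" "y s \<in> X" using X[OF s01] by blast+
      then have "norm (f (y s) - f (z s)) \<le> L * norm (x s)"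
        using lipschitz_onD[OF f, of "y s" "z s"] by (simp add: dist_norm x_def)
      then have "norm (x s) * norm (f (y s) - f (z s)) \<le> norm (x s) * (L * norm (x s))" by (intro mult_left_mono) auto
      moreover have "x s \<bullet> (f (y s) - f (z s)) \<le> norm (x s) * norm (f (y s) - f (z s))" by (rule norm_cauchy_schwarz)
      moreover have "norm (x s) * (L * norm (x s)) = L * (x s \<bullet> x s)" by (simp add: power2_norm_eq_inner[symmetric] power2_eq_square)
      ultimately have "2 * (x s \<bullet> (f (y s) - f (z s))) - 2 * L * (x s \<bullet> x s) \<le> 0" by linarith
      then have "(2 * (x s \<bullet> (f (y s) - f (z s))) - 2 * L * (x s \<bullet> x s)) * exp (- 2 * L * s) \<le> 0" by (simp add: mult_nonpos_nonneg)
      moreover have "at s within {0..1} = at s" using s t by (intro at_within_interior) auto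
      ultimately show "\<exists>d. (\<psi> has_real_derivative d) (at s) \<and> d \<le> 0" using \<psi>d[OF s01] by auto
    next
      have "continuous_on {0..1} \<psi>" unfolding continuous_on_eq_continuous_within by (auto intro: DERIV_continuous \<psi>d)
      then show "continuous_on {0..t} \<psi>" by (rule continuous_on_subset) (use t in auto)
    qed (use t in auto)
    then have "(x t \<bullet> x t) * exp (- 2 * L * t) \<le> x 0 \<bullet> x 0" by (simp add: \<psi>_def)
    then have "((x t \<bullet> x t) * exp (- 2 * L * t)) * exp (2 * L * t) \<le> (x 0 \<bullet> x 0) * exp (2 * L * t)" by (intro mult_right_mono) auto
    moreover have "((x t \<bullet> x t) * exp (- 2 * L * t)) * exp (2 * L * t) = x t \<bullet> x t" by (simp add: mult.assoc exp_add[symmetric])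
    moreover have "(x 0 \<bullet> x 0) * exp (2 * L * t) = (norm (x 0) * exp (L * t))\<^sup>2"
      by (simp add: power_mult_distrib power2_norm_eq_inner exp_double[symmetric] mult.assoc)
    ultimately have "(norm (x t))\<^sup>2 \<le> (norm (x 0) * exp (L * t))\<^sup>2" by (simp only: power2_norm_eq_inner)
    then have "norm (x t) \<le> norm (x 0) * exp (L * t)" by (rule power2_le_imp_le) simp
    also have "\<dots> \<le> norm (x 0) * exp L" using L t by (intro mult_left_mono) (auto simp: mult_left_le)
    also have "\<dots> < \<epsilon>" using \<epsilon> by (simp add: x_def)
    finally show ?thesis .
  qed
  have "norm (x 0) \<le> norm (x 0) * exp L" using L by (simp add: mult_le_cancel_left1)
  then have x0: "norm (x 0) < \<epsilon>" using \<epsilon> by (simp add: x_def)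
  show ?thesis
  proof (rule ccontr)
    assume "\<not> norm (y 1 - z 1) < \<epsilon>"
    moreover have "continuous_on {0..1} x" unfolding continuous_on_eq_continuous_within
      by (auto intro: has_vector_derivative_continuous xd)
    ultimately obtain t0 where t0: "0 < t0" "t0 \<le> 1" "x t0 \<in> frontier (cball 0 \<epsilon>)" "\<And>t. 0 \<le> t \<Longrightarrow> t < t0 \<Longrightarrow> x t \<in> interior (cball 0 \<epsilon>)"
      using exit_time[of x "cball 0 \<epsilon>"] x0 by (auto simp: x_def)
    have "norm (x s) \<le> \<epsilon>" if "0 \<le> s" "s < t0" for s using t0(4)[OF that] by simp
    then have "norm (x t0) < \<epsilon>" using bound[OF t0(1,2)] by blast
    moreover have "norm (x t0) = \<epsilon>" using t0(3) \<epsilon>0 by simp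
    ultimately show False by simp
  qed
qed

lemma matrix_inv_2:
  fixes A :: "real^2^2"
  assumes "A $ 1 $ 1 * A $ 2 $ 2 - A $ 1 $ 2 * A $ 2 $ 1 \<noteq> 0" (is "?D \<noteq> 0")
  shows "matrix_inv A $ 1 $ 1 = A $ 2 $ 2 / ?D" "matrix_inv A $ 1 $ 2 = - A $ 1 $ 2 / ?D"
    "matrix_inv A $ 2 $ 1 = - A $ 2 $ 1 / ?D" "matrix_inv A $ 2 $ 2 = A $ 1 $ 1 / ?D"
proof -
  define B :: "real^2^2" where "B = vector [V2 (A $ 2 $ 2 / ?D) (- A $ 1 $ 2 / ?D), V2 (- A $ 2 $ 1 / ?D) (A $ 1 $ 1 / ?D)]"
  have B: "A ** B = mat 1" "B ** A = mat 1"
    using assms unfolding vec_eq_iff forall_2 B_def matrix_matrix_mult_def mat_def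
    by (simp_all add: sum_2 diff_divide_distrib[symmetric] add_divide_distrib[symmetric] mult.commute)
  then have "A ** matrix_inv A = mat 1 \<and> matrix_inv A ** A = mat 1"
    unfolding matrix_inv_def by (intro someI_ex[of "\<lambda>B. A ** B = mat 1 \<and> B ** A = mat 1"] exI[of _ B] conjI)
  then have inv: "matrix_inv A ** A = mat 1" ..
  have "matrix_inv A = matrix_inv A ** (A ** B)" by (simp only: B matrix_mul_rid)
  also have "\<dots> = B" by (simp only: matrix_mul_assoc inv matrix_mul_lid)
  finally have "matrix_inv A = B" .
  then show "matrix_inv A $ 1 $ 1 = A $ 2 $ 2 / ?D" "matrix_inv A $ 1 $ 2 = - A $ 1 $ 2 / ?D"
    "matrix_inv A $ 2 $ 1 = - A $ 2 $ 1 / ?D" "matrix_inv A $ 2 $ 2 = A $ 1 $ 1 / ?D"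
    by (simp_all add: B_def)
qed

section \<open>The geodesic equation in the chart\<close>

locale plane_metric =
  fixes S :: "(real^2) set" and g :: "2 metric"
  assumes open_S: "open S" and riem: "riemannian_metric_on S g"
begin

abbreviation a where "a \<equiv> \<lambda>x. g x $ 1 $ 1"
abbreviation b where "b \<equiv> \<lambda>x. g x $ 1 $ 2"
abbreviation c where "c \<equiv> \<lambda>x. g x $ 2 $ 2"
abbreviation gdet where "gdet \<equiv> \<lambda>x. a x * c x - (b x)\<^sup>2"

lemma smooth_entry: "smooth_on S (\<lambda>x. g x $ i $ j)"
  using riem by (simp add: riemannian_metric_on_def)

lemma g_sym: "x \<in> S \<Longrightarrow> g x $ 2 $ 1 = b x"
  using riem unfolding riemannian_metric_on_def transpose_def vec_eq_iff forall_2 by fastforce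

lemma metric_quad: "x \<in> S \<Longrightarrow> v \<bullet> (g x *v v) = 2 * quad a b c x v"
  using g_sym by (simp add: inner_vec_def matrix_vector_mult_def sum_2 quad_def power2_eq_square algebra_simps)

lemma quad_pos: "x \<in> S \<Longrightarrow> v \<noteq> 0 \<Longrightarrow> quad a b c x v > 0"
  using riem metric_quad by (fastforce simp: riemannian_metric_on_def)

lemma a_pos: "x \<in> S \<Longrightarrow> a x > 0"
  using quad_pos[of x "V2 1 0"] by (simp add: quad_def vec2_eq_iff)

lemma gdet_pos: "x \<in> S \<Longrightarrow> gdet x > 0"
proof -
  assume x: "x \<in> S"
  have "quad a b c x (V2 (- b x) (a x)) > 0" by (rule quad_pos[OF x]) (use a_pos[OF x] in \<open>auto simp: vec2_eq_iff\<close>)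
  moreover have "2 * quad a b c x (V2 (- b x) (a x)) = a x * gdet x" by (simp add: quad_def power2_eq_square field_simps)
  ultimately show ?thesis using a_pos[OF x] by (metis mult_pos_pos zero_less_mult_pos zero_less_numeral)
qed

lemma posdef: "posdef_on S a b c"
  using a_pos gdet_pos by (simp add: posdef_on_def)

lemma matrix_inv_g:
  assumes "x \<in> S"
  shows "matrix_inv (g x) $ 1 $ 1 = c x / gdet x" "matrix_inv (g x) $ 1 $ 2 = - b x / gdet x"
    "matrix_inv (g x) $ 2 $ 1 = - b x / gdet x" "matrix_inv (g x) $ 2 $ 2 = a x / gdet x"
  using matrix_inv_2[of "g x"] gdet_pos[OF assms] g_sym[OF assms] by (simp_all add: power2_eq_square)

lemma smooth_gdet: "smooth_on S gdet"
  by (intro smooth_on_diff smooth_on_mult smooth_on_power smooth_entry open_S)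

lemma smooth_matrix_inv: "smooth_on S (\<lambda>x. matrix_inv (g x) $ k $ l)"
proof -
  have nz: "gdet x \<noteq> 0" if "x \<in> S" for x using gdet_pos[OF that] by simp
  have neg: "smooth_on S (\<lambda>x. - b x)" using smooth_on_diff[OF open_S smooth_on_const[of S "0::real"] smooth_entry] by simp
  have "smooth_on S (\<lambda>x. c x / gdet x)" "smooth_on S (\<lambda>x. - b x / gdet x)" "smooth_on S (\<lambda>x. a x / gdet x)"
    by (intro smooth_on_divide smooth_gdet smooth_entry open_S nz neg; assumption)+
  then have "smooth_on S (\<lambda>x. matrix_inv (g x) $ 1 $ 1)" "smooth_on S (\<lambda>x. matrix_inv (g x) $ 1 $ 2)"
    "smooth_on S (\<lambda>x. matrix_inv (g x) $ 2 $ 1)" "smooth_on S (\<lambda>x. matrix_inv (g x) $ 2 $ 2)"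
    using smooth_on_cong[where f = "\<lambda>x. matrix_inv (g x) $ 1 $ 1" and g = "\<lambda>x. c x / gdet x", OF open_S]
      smooth_on_cong[where f = "\<lambda>x. matrix_inv (g x) $ 1 $ 2" and g = "\<lambda>x. - b x / gdet x", OF open_S]
      smooth_on_cong[where f = "\<lambda>x. matrix_inv (g x) $ 2 $ 1" and g = "\<lambda>x. - b x / gdet x", OF open_S]
      smooth_on_cong[where f = "\<lambda>x. matrix_inv (g x) $ 2 $ 2" and g = "\<lambda>x. a x / gdet x", OF open_S] matrix_inv_g by auto
  then show ?thesis using exhaust_2[of k] exhaust_2[of l] by auto
qed

lemma smooth_christoffel: "smooth_on S (christoffel g k i j)"
  unfolding christoffel_def[abs_def] sum_2
  by (intro smooth_on_mult smooth_on_add smooth_on_diff smooth_on_const smooth_matrix_inv smooth_on_partial_deriv smooth_entry open_S)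

text \<open>The acceleration that the geodesic equation prescribes at position \<open>x\<close> with
  velocity \<open>u\<close>.\<close>

definition G where "G x u = (\<chi> k. - (\<Sum>i\<in>UNIV. \<Sum>j\<in>UNIV. christoffel g k i j x * u $ i * u $ j))"

text \<open>Lowering the index turns the Christoffel acceleration into the Euler-Lagrange
  expression; this connects \<open>geodesic_on\<close> with the Hamiltonian curves obtained by
  minimization.\<close>

lemma mom_G:
  assumes x: "x \<in> S"
  shows "mom a b c x (G x u) = quad_x (grd a) (grd b) (grd c) x u
    - mom (\<lambda>_. grd a x \<bullet> u) (\<lambda>_. grd b x \<bullet> u) (\<lambda>_. grd c x \<bullet> u) x u"
proof -
  have s: "partial_deriv i (\<lambda>y. g y $ 2 $ 1) x = partial_deriv i b x" for i
    by (rule partial_deriv_cong_open[OF open_S x]) (rule g_sym)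
  let ?Y = "quad_x (grd a) (grd b) (grd c) x u - mom (\<lambda>_. grd a x \<bullet> u) (\<lambda>_. grd b x \<bullet> u) (\<lambda>_. grd c x \<bullet> u) x u"
  define i11 i12 i22 where "i11 = c x / gdet x" and "i12 = - b x / gdet x" and "i22 = a x / gdet x"
  note inv = matrix_inv_g[OF x, folded i11_def i12_def i22_def]
  have "G x u $ 1 = i11 * ?Y $ 1 + i12 * ?Y $ 2" "G x u $ 2 = i12 * ?Y $ 1 + i22 * ?Y $ 2"
    by (simp_all add: G_def christoffel_def sum_2 s inv quad_x_def mom_def grd_def power2_eq_square field_simps)
  then have "G x u = vel a b c x ?Y"
    unfolding vec2_eq_iff vel_def i11_def i12_def i22_def by (simp add: diff_divide_distrib)
  then show ?thesis using gdet_pos[OF x] by (simp add: mom_vel)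
qed

lemma G_scaleR: "G x (k *\<^sub>R u) = k\<^sup>2 *\<^sub>R G x u"
  by (simp add: G_def vec2_eq_iff sum_2 power2_eq_square algebra_simps)

text \<open>The velocity T is first seen to be differentiable, with some derivative X.
  Differentiating P = g T then identifies g X, and g is invertible.\<close>

lemma hamilton_geodesic:
  assumes \<gamma>: "C1_curve \<gamma> (\<lambda>t. vel a b c (\<gamma> t) (P t))"
    and P: "C1_curve P (\<lambda>t. quad_x (grd a) (grd b) (grd c) (\<gamma> t) (vel a b c (\<gamma> t) (P t)))"
    and S: "\<And>t. t \<in> {0..1} \<Longrightarrow> \<gamma> t \<in> S" and t: "t \<in> {0..1}"
  shows "((\<lambda>t. vel a b c (\<gamma> t) (P t)) has_vector_derivative G (\<gamma> t) (vel a b c (\<gamma> t) (P t))) (at t within {0..1})"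
proof -
  define T where "T t = vel a b c (\<gamma> t) (P t)" for t
  have nth: "((\<lambda>s. f s $ i :: real) has_real_derivative f' $ i) F" if "(f has_vector_derivative f') F" for f :: "real \<Rightarrow> real^2" and f' i F
    using bounded_linear.has_vector_derivative[OF bounded_linear_vec_nth that] by (simp add: has_real_derivative_iff_has_vector_derivative)
  have \<gamma>d: "(\<gamma> has_vector_derivative T t) (at t within {0..1})" using \<gamma> t by (simp add: C1_curve_def T_def)
  have Pd: "(P has_vector_derivative quad_x (grd a) (grd b) (grd c) (\<gamma> t) (T t)) (at t within {0..1})"
    using P t by (simp add: C1_curve_def T_def)
  note Pn = nth[OF Pd]
  have cd: "((\<lambda>t. f (\<gamma> t)) has_real_derivative grd f (\<gamma> t) \<bullet> T t) (at t within {0..1})" if "smooth_on S f" for f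
    using smooth_on_curve[OF that S[OF t] \<gamma>d] by (simp add: grd_def)
  have nz: "gdet (\<gamma> t) \<noteq> 0" using gdet_pos[OF S[OF t]] by simp
  have "\<exists>X. ((\<lambda>t. (c (\<gamma> t) * P t $ 1 - b (\<gamma> t) * P t $ 2) / gdet (\<gamma> t)) has_real_derivative X) (at t within {0..1})"
    by (rule exI, rule DERIV_divide[OF DERIV_diff[OF DERIV_mult[OF cd[OF smooth_entry] Pn] DERIV_mult[OF cd[OF smooth_entry] Pn]] cd[OF smooth_gdet] nz])
  moreover have "\<exists>X. ((\<lambda>t. (a (\<gamma> t) * P t $ 2 - b (\<gamma> t) * P t $ 1) / gdet (\<gamma> t)) has_real_derivative X) (at t within {0..1})"
    by (rule exI, rule DERIV_divide[OF DERIV_diff[OF DERIV_mult[OF cd[OF smooth_entry] Pn] DERIV_mult[OF cd[OF smooth_entry] Pn]] cd[OF smooth_gdet] nz])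
  ultimately obtain X1 X2 where X: "((\<lambda>t. T t $ 1) has_real_derivative X1) (at t within {0..1})" "((\<lambda>t. T t $ 2) has_real_derivative X2) (at t within {0..1})"
    unfolding T_def vel_def V2_nth by blast
  have eq: "mom a b c (\<gamma> t) (T t) = P t" if "t \<in> {0..1}" for t
    unfolding T_def using gdet_pos[OF S[OF that]] by (intro mom_vel) simp
  have uni: "x = y" if "(f has_real_derivative x) (at t within {0..1})" "(h has_real_derivative y) (at t within {0..1})" "\<And>s. s \<in> {0..1} \<Longrightarrow> f s = h s"
    for f h x y
  proof -
    have "(h has_vector_derivative x) (at t within {0..1})"
      by (rule has_vector_derivative_transform[OF t, of h f]) (use that(1,3) in \<open>simp_all add: has_real_derivative_iff_has_vector_derivative\<close>)
    then show ?thesis using that(2) t vector_derivative_unique_within_closed_interval[of 0 1 t h x y]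
      by (simp add: has_real_derivative_iff_has_vector_derivative)
  qed
  have 1: "(grd a (\<gamma> t) \<bullet> T t) * T t $ 1 + X1 * a (\<gamma> t) + ((grd b (\<gamma> t) \<bullet> T t) * T t $ 2 + X2 * b (\<gamma> t)) = quad_x (grd a) (grd b) (grd c) (\<gamma> t) (T t) $ 1"
    by (rule uni[OF DERIV_add[OF DERIV_mult[OF cd[OF smooth_entry] X(1)] DERIV_mult[OF cd[OF smooth_entry] X(2)]] Pn[of 1]])
      (use eq in \<open>simp add: vec2_eq_iff mom_def\<close>)
  have 2: "(grd b (\<gamma> t) \<bullet> T t) * T t $ 1 + X1 * b (\<gamma> t) + ((grd c (\<gamma> t) \<bullet> T t) * T t $ 2 + X2 * c (\<gamma> t)) = quad_x (grd a) (grd b) (grd c) (\<gamma> t) (T t) $ 2"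
    by (rule uni[OF DERIV_add[OF DERIV_mult[OF cd[OF smooth_entry] X(1)] DERIV_mult[OF cd[OF smooth_entry] X(2)]] Pn[of 2]])
      (use eq in \<open>simp add: vec2_eq_iff mom_def\<close>)
  have "mom a b c (\<gamma> t) (V2 X1 X2) = mom a b c (\<gamma> t) (G (\<gamma> t) (T t))"
    unfolding mom_G[OF S[OF t]] vec2_eq_iff using 1 2 by (simp add: mom_def algebra_simps)
  then have "V2 X1 X2 = G (\<gamma> t) (T t)" using vel_mom[of a "\<gamma> t" c b] nz by metis
  moreover have "((\<lambda>t. V2 (T t $ 1) (T t $ 2)) has_vector_derivative V2 X1 X2) (at t within {0..1})"
    unfolding V2_def using X
    by (intro has_vector_derivative_eq_rhs[OF has_vector_derivative_add[OF has_vector_derivative_scaleR[OF _ has_vector_derivative_const]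
        has_vector_derivative_scaleR[OF _ has_vector_derivative_const]]]) auto
  moreover have "(\<lambda>t. V2 (T t $ 1) (T t $ 2)) = T" by (simp add: fun_eq_iff vec2_eq_iff)
  ultimately show ?thesis by (simp add: T_def[abs_def])
qed

lemma speed_const:
  assumes \<gamma>: "\<And>t. t \<in> {0..1} \<Longrightarrow> (\<gamma> has_vector_derivative T t) (at t within {0..1})"
    and T: "\<And>t. t \<in> {0..1} \<Longrightarrow> (T has_vector_derivative G (\<gamma> t) (T t)) (at t within {0..1})"
    and S: "\<And>t. t \<in> {0..1} \<Longrightarrow> \<gamma> t \<in> S"
  obtains k where "\<And>t. t \<in> {0..1} \<Longrightarrow> quad a b c (\<gamma> t) (T t) = k"
proof -
  have nth: "((\<lambda>s. f s $ i :: real) has_real_derivative f' $ i) F" if "(f has_vector_derivative f') F" for f :: "real \<Rightarrow> real^2" and f' i F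
    using bounded_linear.has_vector_derivative[OF bounded_linear_vec_nth that] by (simp add: has_real_derivative_iff_has_vector_derivative)
  have "\<exists>k. \<forall>t\<in>{0..1}. 2 * quad a b c (\<gamma> t) (T t) = k"
  proof (rule has_field_derivative_zero_constant)
    fix t :: real assume t: "t \<in> {0..1}"
    let ?G = "G (\<gamma> t) (T t)"
    have cd: "((\<lambda>t. f (\<gamma> t)) has_real_derivative grd f (\<gamma> t) \<bullet> T t) (at t within {0..1})" if "smooth_on S f" for f
      using smooth_on_curve[OF that S[OF t] \<gamma>[OF t]] by (simp add: grd_def)
    note Tn = nth[OF T[OF t]]
    have "mom a b c (\<gamma> t) ?G $ i = (quad_x (grd a) (grd b) (grd c) (\<gamma> t) (T t)
        - mom (\<lambda>_. grd a (\<gamma> t) \<bullet> T t) (\<lambda>_. grd b (\<gamma> t) \<bullet> T t) (\<lambda>_. grd c (\<gamma> t) \<bullet> T t) (\<gamma> t) (T t)) $ i" for i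
      by (simp only: mom_G[OF S[OF t]])
    from this[of 1] this[of 2]
    have m: "a (\<gamma> t) * ?G $ 1 + b (\<gamma> t) * ?G $ 2 = quad_x (grd a) (grd b) (grd c) (\<gamma> t) (T t) $ 1 - ((grd a (\<gamma> t) \<bullet> T t) * T t $ 1 + (grd b (\<gamma> t) \<bullet> T t) * T t $ 2)"
      "b (\<gamma> t) * ?G $ 1 + c (\<gamma> t) * ?G $ 2 = quad_x (grd a) (grd b) (grd c) (\<gamma> t) (T t) $ 2 - ((grd b (\<gamma> t) \<bullet> T t) * T t $ 1 + (grd c (\<gamma> t) \<bullet> T t) * T t $ 2)"
      by (simp_all add: mom_def)
    define ga gb gc where "ga = grd a (\<gamma> t) \<bullet> T t" and "gb = grd b (\<gamma> t) \<bullet> T t" and "gc = grd c (\<gamma> t) \<bullet> T t"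
    have q: "2 * (quad_x (grd a) (grd b) (grd c) (\<gamma> t) (T t) $ 1 * T t $ 1 + quad_x (grd a) (grd b) (grd c) (\<gamma> t) (T t) $ 2 * T t $ 2)
        = ga * (T t $ 1)\<^sup>2 + 2 * gb * (T t $ 1 * T t $ 2) + gc * (T t $ 2)\<^sup>2"
      unfolding ga_def gb_def gc_def by (simp add: quad_x_def inner_vec_def sum_2 power2_eq_square algebra_simps)
    have "((\<lambda>t. a (\<gamma> t) * (T t $ 1 * T t $ 1) + 2 * (b (\<gamma> t) * (T t $ 1 * T t $ 2)) + c (\<gamma> t) * (T t $ 2 * T t $ 2)) has_real_derivative
       (ga * (T t $ 1 * T t $ 1) + (?G $ 1 * T t $ 1 + ?G $ 1 * T t $ 1) * a (\<gamma> t)) + 2 * (gb * (T t $ 1 * T t $ 2) + (?G $ 1 * T t $ 2 + ?G $ 2 * T t $ 1) * b (\<gamma> t))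
        + (gc * (T t $ 2 * T t $ 2) + (?G $ 2 * T t $ 2 + ?G $ 2 * T t $ 2) * c (\<gamma> t))) (at t within {0..1})"
      unfolding ga_def gb_def gc_def by (intro DERIV_add DERIV_mult DERIV_cmult cd smooth_entry Tn)
    moreover have "(ga * (T t $ 1 * T t $ 1) + (?G $ 1 * T t $ 1 + ?G $ 1 * T t $ 1) * a (\<gamma> t)) + 2 * (gb * (T t $ 1 * T t $ 2) + (?G $ 1 * T t $ 2 + ?G $ 2 * T t $ 1) * b (\<gamma> t))
        + (gc * (T t $ 2 * T t $ 2) + (?G $ 2 * T t $ 2 + ?G $ 2 * T t $ 2) * c (\<gamma> t))
      = (ga * (T t $ 1)\<^sup>2 + 2 * gb * (T t $ 1 * T t $ 2) + gc * (T t $ 2)\<^sup>2)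
        + 2 * ((a (\<gamma> t) * ?G $ 1 + b (\<gamma> t) * ?G $ 2) * T t $ 1 + (b (\<gamma> t) * ?G $ 1 + c (\<gamma> t) * ?G $ 2) * T t $ 2)"
      by (simp add: power2_eq_square algebra_simps)
    moreover have "\<dots> = 0" unfolding m q[symmetric] using q unfolding ga_def[symmetric] gb_def[symmetric] gc_def[symmetric]
      by (simp add: power2_eq_square algebra_simps)
    moreover have "(\<lambda>t. a (\<gamma> t) * (T t $ 1 * T t $ 1) + 2 * (b (\<gamma> t) * (T t $ 1 * T t $ 2)) + c (\<gamma> t) * (T t $ 2 * T t $ 2)) = (\<lambda>t. 2 * quad a b c (\<gamma> t) (T t))"
      by (simp add: fun_eq_iff quad_def power2_eq_square field_simps)
    ultimately show "((\<lambda>t. 2 * quad a b c (\<gamma> t) (T t)) has_real_derivative 0) (at t within {0..1})"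
      by (simp only:)
  qed simp
  then obtain k where k: "\<And>t. t \<in> {0..1} \<Longrightarrow> 2 * quad a b c (\<gamma> t) (T t) = k" by blast
  show ?thesis by (rule that[of "k / 2"]) (use k in \<open>simp add: mult.commute\<close>)
qed

end

section \<open>Dependence on the initial velocity and the Hopf-Rinow argument\<close>

context plane_metric
begin

definition geod :: "(real \<Rightarrow> real^2) \<Rightarrow> (real \<Rightarrow> real^2) \<Rightarrow> bool" where
  "geod d u \<longleftrightarrow> (\<forall>t. d t \<in> S \<and> (d has_vector_derivative u t) (at t) \<and> (u has_vector_derivative G (d t) (u t)) (at t))"

lemma geodesic_on_UNIV: "geodesic_on S g UNIV d \<longleftrightarrow> (\<exists>u. geod d u)"
  by (auto simp: geodesic_on_def geod_def G_def)

lemma continuous_eq_Icc: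
  fixes f h :: "real \<Rightarrow> 'a::real_normed_vector"
  assumes "continuous_on {0..1} f" "continuous_on {0..1} h" "\<And>t. t \<in> {0<..<1} \<Longrightarrow> f t = h t" "t \<in> {0..1}"
  shows "f t = h t"
proof -
  have "continuous_on (closure {0<..<1}) (\<lambda>t. f t - h t)" using assms(1,2) by (simp add: continuous_on_diff)
  then have "f t - h t = 0" by (rule continuous_constant_on_closure) (use assms(3,4) in auto)
  then show ?thesis by simp
qed

text \<open>Completeness is formulated for geodesics on open intervals with two-sided derivatives.
  So the segment is restricted to the open unit interval, and its data at 0 and 1 are recovered from
  the extension by continuity.\<close>

lemma geod_extension:
  assumes complete: "geodesically_complete S g"
    and \<gamma>: "\<And>t. t \<in> {0..1} \<Longrightarrow> (\<gamma> has_vector_derivative T t) (at t within {0..1})"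
    and T: "\<And>t. t \<in> {0..1} \<Longrightarrow> (T has_vector_derivative G (\<gamma> t) (T t)) (at t within {0..1})"
    and S: "\<And>t. t \<in> {0..1} \<Longrightarrow> \<gamma> t \<in> S"
  obtains d u where "geod d u" "d 0 = \<gamma> 0" "u 0 = T 0" "d 1 = \<gamma> 1"
proof -
  let ?J = "{0<..<1} :: real set"
  have at: "at t within {0..1} = at t" if "t \<in> ?J" for t :: real using that by (intro at_within_interior) auto
  have "geodesic_on S g ?J \<gamma>"
    unfolding geodesic_on_def G_def[symmetric]
  proof (intro conjI ballI exI[of _ T])
    fix t assume t: "t \<in> ?J"
    then have t': "t \<in> {0..1}" by simp
    show "\<gamma> t \<in> S" by (rule S[OF t'])
    show "(\<gamma> has_vector_derivative T t) (at t)" using \<gamma>[OF t'] unfolding at[OF t] .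
    show "(T has_vector_derivative G (\<gamma> t) (T t)) (at t)" using T[OF t'] unfolding at[OF t] .
  qed
  moreover have "is_interval ?J" by (simp add: is_interval_convex)
  ultimately obtain d u where geo: "geod d u" and eq: "\<And>t. t \<in> ?J \<Longrightarrow> d t = \<gamma> t"
    using complete unfolding geodesically_complete_def geodesic_on_UNIV
    by (metis open_greaterThanLessThan greaterThanLessThan_empty_iff not_one_le_zero)
  have cont: "continuous_on {0..1} d" "continuous_on {0..1} u" "continuous_on {0..1} \<gamma>" "continuous_on {0..1} T"
    using geo \<gamma> T has_vector_derivative_continuous continuous_at_imp_continuous_within
    unfolding geod_def continuous_on_eq_continuous_within by blast+
  have "u t = T t" if t: "t \<in> ?J" for t
  proof -
    have "(d has_vector_derivative u t) (at t)" using geo by (simp add: geod_def)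
    then have "(\<gamma> has_vector_derivative u t) (at t)"
      by (rule has_vector_derivative_transform_within_open[of _ _ _ ?J]) (use t eq in auto)
    moreover have "(\<gamma> has_vector_derivative T t) (at t)" using \<gamma>[of t] t at[OF t] by auto
    ultimately show ?thesis by (rule vector_derivative_unique_at)
  qed
  then have uT: "u 0 = T 0" using continuous_eq_Icc[OF cont(2,4)] by simp
  have d\<gamma>: "d 0 = \<gamma> 0" "d 1 = \<gamma> 1" using continuous_eq_Icc[OF cont(1,3) eq] by simp_all
  show ?thesis by (rule that[OF geo d\<gamma>(1) uT d\<gamma>(2)])
qed

text \<open>The geodesic equation as an autonomous first order system for position and
  velocity.\<close>

definition spray :: "(real^2) \<times> (real^2) \<Rightarrow> (real^2) \<times> (real^2)" where
  "spray z = (snd z, G (fst z) (snd z))"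

lemma G_V2: "G x u = V2 (- (christoffel g 1 1 1 x * (u $ 1 * u $ 1) + christoffel g 1 1 2 x * (u $ 1 * u $ 2) + (christoffel g 1 2 1 x * (u $ 2 * u $ 1) + christoffel g 1 2 2 x * (u $ 2 * u $ 2))))
   (- (christoffel g 2 1 1 x * (u $ 1 * u $ 1) + christoffel g 2 1 2 x * (u $ 1 * u $ 2) + (christoffel g 2 2 1 x * (u $ 2 * u $ 1) + christoffel g 2 2 2 x * (u $ 2 * u $ 2))))"
  unfolding vec2_eq_iff by (simp add: G_def sum_2 mult.assoc)

lemma continuous_spray: "continuous_on (S \<times> UNIV) spray"
proof -
  have c: "continuous_on (S \<times> UNIV) (\<lambda>z. christoffel g k i j (fst z))" for k i j
    by (rule continuous_on_compose2[OF smooth_on_continuous[OF smooth_christoffel]]) (auto intro: continuous_intros)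
  show ?thesis unfolding spray_def[abs_def] G_V2 by (intro continuous_intros c)
qed

lemma spray_lipschitz:
  assumes X: "compact X" "X \<subseteq> S \<times> UNIV"
  shows "\<exists>L. L-lipschitz_on X spray"
proof -
  have "compact (fst ` X)" by (intro compact_continuous_image X continuous_intros)
  moreover have "fst ` X \<subseteq> S" using X by auto
  ultimately have "\<exists>L. L-lipschitz_on (fst ` X) (christoffel g k i j)" for k i j
    using smooth_on_lipschitz[OF open_S smooth_christoffel] by blast
  moreover have fst: "1-lipschitz_on X fst" by (rule lipschitz_onI) (auto simp: dist_fst_le)
  ultimately have c: "\<exists>L. L-lipschitz_on X (\<lambda>z. christoffel g k i j (fst z))" for k i j
    using lipschitz_on_compose2 by blast
  have snd: "1-lipschitz_on X snd" by (rule lipschitz_onI) (auto simp: dist_snd_le)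
  have nth: "\<exists>L. L-lipschitz_on X (\<lambda>z. snd z $ i)" for i
    by (rule exI[of _ 1], rule lipschitz_onI) (auto intro: order_trans[OF dist_vec_nth_le dist_snd_le])
  have add: "\<exists>L. L-lipschitz_on X (\<lambda>z. f z + h z)" if "\<exists>L. L-lipschitz_on X f" "\<exists>L. L-lipschitz_on X h" for f h :: "(real^2) \<times> (real^2) \<Rightarrow> real"
    using that lipschitz_on_add by blast
  have neg: "\<exists>L. L-lipschitz_on X (\<lambda>z. - f z)" if "\<exists>L. L-lipschitz_on X f" for f :: "(real^2) \<times> (real^2) \<Rightarrow> real"
    using that lipschitz_on_minus by blast
  have V2: "\<exists>L. L-lipschitz_on X (\<lambda>z. V2 (f z) (h z))" if fh: "\<exists>L. L-lipschitz_on X f" "\<exists>L. L-lipschitz_on X h" for f h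
  proof -
    obtain L M where L: "L-lipschitz_on X f" and M: "M-lipschitz_on X h" using fh by blast
    have "(L + M)-lipschitz_on X (\<lambda>z. V2 (f z) (h z))"
    proof (rule lipschitz_onI)
      fix x y assume xy: "x \<in> X" "y \<in> X"
      have "dist (V2 (f x) (h x)) (V2 (f y) (h y)) = norm (V2 (f x - f y) (h x - h y))"
        unfolding dist_norm by (rule arg_cong[of _ _ norm]) (simp add: vec2_eq_iff)
      also have "\<dots> \<le> \<bar>f x - f y\<bar> + \<bar>h x - h y\<bar>" by (rule norm_V2_le)
      also have "\<dots> \<le> L * dist x y + M * dist x y"
        using lipschitz_onD[OF L xy] lipschitz_onD[OF M xy] by (simp add: dist_real_def)
      finally show "dist (V2 (f x) (h x)) (V2 (f y) (h y)) \<le> (L + M) * dist x y" by (simp add: distrib_right)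
    qed (use lipschitz_on_nonneg[OF L] lipschitz_on_nonneg[OF M] in simp)
    then show ?thesis ..
  qed
  have "\<exists>L. L-lipschitz_on X (\<lambda>z. G (fst z) (snd z))"
    unfolding G_V2 by (intro V2 neg add lipschitz_on_mult_compact[OF X(1)] c nth)
  then show ?thesis unfolding spray_def[abs_def] using snd lipschitz_on_Pair by blast
qed

lemma geod_rescale:
  assumes "geod d u"
  shows "geod (\<lambda>t. d (k * t)) (\<lambda>t. k *\<^sub>R u (k * t))"
  unfolding geod_def
proof (intro allI conjI)
  fix t
  have k: "((\<lambda>t. k * t) has_vector_derivative k) (at t)"
    by (auto intro!: derivative_eq_intros simp: has_real_derivative_iff_has_vector_derivative[symmetric])
  have 1: "d (k * t) \<in> S" "(d has_vector_derivative u (k * t)) (at (k * t))"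
    "(u has_vector_derivative G (d (k * t)) (u (k * t))) (at (k * t))" using assms by (auto simp: geod_def)
  show "d (k * t) \<in> S" by (rule 1)
  show "((\<lambda>t. d (k * t)) has_vector_derivative k *\<^sub>R u (k * t)) (at t)"
    using vector_diff_chain_at[OF k 1(2)] by (simp add: o_def)
  have "((\<lambda>t. u (k * t)) has_vector_derivative k *\<^sub>R G (d (k * t)) (u (k * t))) (at t)"
    using vector_diff_chain_at[OF k 1(3)] by (simp add: o_def)
  then have "((\<lambda>t. k *\<^sub>R u (k * t)) has_vector_derivative k *\<^sub>R (k *\<^sub>R G (d (k * t)) (u (k * t)))) (at t)"
    using bounded_linear.has_vector_derivative[OF bounded_linear_scaleR_right] by blast
  then show "((\<lambda>t. k *\<^sub>R u (k * t)) has_vector_derivative G (d (k * t)) (k *\<^sub>R u (k * t))) (at t)"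
    by (simp add: G_scaleR power2_eq_square)
qed

text \<open>Peano's theorem yields a short geodesic whose velocity is scaled by \<tau>; completeness
  continues it to the whole line, and \<open>geod_rescale\<close> undoes the scaling.\<close>

lemma geod_exists:
  assumes complete: "geodesically_complete S g" and p: "p \<in> S"
  obtains d u where "geod d u" "d 0 = p" "u 0 = v"
proof -
  have "open (S \<times> (UNIV :: (real^2) set))" by (intro open_Times open_S open_UNIV)
  from peano[OF this continuous_spray, of "(p, v)"] p
  obtain \<tau> Y where \<tau>: "\<tau> > 0" and Y0: "Y 0 = (p, v)" and YS: "\<And>t. t \<in> {0..1} \<Longrightarrow> Y t \<in> S \<times> UNIV"
    and Yd: "\<And>t. t \<in> {0..1} \<Longrightarrow> (Y has_vector_derivative \<tau> *\<^sub>R spray (Y t)) (at t within {0..1})" by auto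
  have 1: "((\<lambda>t. fst (Y t)) has_vector_derivative \<tau> *\<^sub>R snd (Y t)) (at t within {0..1})"
    "((\<lambda>t. \<tau> *\<^sub>R snd (Y t)) has_vector_derivative G (fst (Y t)) (\<tau> *\<^sub>R snd (Y t))) (at t within {0..1})" if t: "t \<in> {0..1}" for t
  proof -
    show "((\<lambda>t. fst (Y t)) has_vector_derivative \<tau> *\<^sub>R snd (Y t)) (at t within {0..1})"
      using bounded_linear.has_vector_derivative[OF bounded_linear_fst Yd[OF t]] by (simp add: spray_def)
    have "((\<lambda>t. snd (Y t)) has_vector_derivative \<tau> *\<^sub>R G (fst (Y t)) (snd (Y t))) (at t within {0..1})"
      using bounded_linear.has_vector_derivative[OF bounded_linear_snd Yd[OF t]] by (simp add: spray_def)
    from bounded_linear.has_vector_derivative[OF bounded_linear_scaleR_right this, of \<tau>]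
    show "((\<lambda>t. \<tau> *\<^sub>R snd (Y t)) has_vector_derivative G (fst (Y t)) (\<tau> *\<^sub>R snd (Y t))) (at t within {0..1})"
      by (simp add: G_scaleR power2_eq_square)
  qed
  have YS': "fst (Y t) \<in> S" if "t \<in> {0..1}" for t using YS[OF that] by auto
  obtain d u where d: "geod d u" "d 0 = fst (Y 0)" "u 0 = \<tau> *\<^sub>R snd (Y 0)"
    using geod_extension[where \<gamma> = "\<lambda>t. fst (Y t)" and T = "\<lambda>t. \<tau> *\<^sub>R snd (Y t)", OF complete 1 YS'] by blast
  show ?thesis
    by (rule that[OF geod_rescale[OF d(1), of "1 / \<tau>"]]) (use d Y0 \<tau> in auto)
qed

text \<open>Continuity of the exponential map. The limit geodesic on the unit interval, together
  with its velocity, has a compact tube on which the spray is Lipschitz, so that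
  \<open>ode_dependence\<close> applies.\<close>

lemma geod_limit:
  assumes d: "geod d u" and dn: "\<And>n. geod (dn n) (un n)" "\<And>n. dn n 0 = d 0" and lim: "(\<lambda>n. un n 0) \<longlonglongrightarrow> u 0"
  shows "(\<lambda>n. dn n 1) \<longlonglongrightarrow> d 1"
proof -
  have sp: "((\<lambda>t. (x t, y t)) has_vector_derivative spray (x t, y t)) (at t within {0..1})" if "geod x y" for x y t
  proof -
    have "(x has_vector_derivative y t) (at t)" "(y has_vector_derivative G (x t) (y t)) (at t)" using that by (simp_all add: geod_def)
    from has_vector_derivative_Pair[OF this] have "((\<lambda>t. (x t, y t)) has_vector_derivative spray (x t, y t)) (at t)" by (simp add: spray_def)
    then show ?thesis by (rule has_vector_derivative_at_within)
  qed
  let ?z = "\<lambda>t. (d t, u t)"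
  let ?Z = "?z ` {0..1}"
  have "continuous_on {0..1} ?z" unfolding continuous_on_eq_continuous_within
    using has_vector_derivative_continuous[OF sp[OF d]] by blast
  then have Z: "compact ?Z" by (intro compact_continuous_image) auto
  have ZS: "?Z \<subseteq> S \<times> UNIV" using d by (auto simp: geod_def)
  obtain e where e: "e > 0" "(\<Union>x\<in>?Z. cball x e) \<subseteq> S \<times> UNIV"
    by (rule compact_subset_open_imp_cball_epsilon_subset[OF Z _ ZS]) (intro open_Times open_S open_UNIV)
  \<comment> \<open>The tube is written as a sum of two compact sets, which makes its compactness
    immediate.\<close>
  define X where "X = {x + y |x y. x \<in> ?Z \<and> y \<in> cball 0 e}"
  have Xeq: "X = (\<Union>x\<in>?Z. cball x e)"
  proof -
    have "y \<in> X" if "x \<in> ?Z" "y \<in> cball x e" for x y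
    proof -
      have "y = x + (y - x)" "y - x \<in> cball 0 e" using that(2) by (auto simp: dist_norm norm_minus_commute)
      then show ?thesis unfolding X_def using that(1) by blast
    qed
    moreover have "y \<in> (\<Union>x\<in>?Z. cball x e)" if yX: "y \<in> X" for y
    proof -
      obtain x v where "x \<in> ?Z" "v \<in> cball 0 e" "y = x + v" using yX unfolding X_def by blast
      then have "x \<in> ?Z" "y \<in> cball x e" by (simp_all add: dist_norm)
      then show ?thesis by blast
    qed
    ultimately show ?thesis by blast
  qed
  have "compact X" unfolding X_def by (intro compact_sums Z compact_cball)
  moreover have "X \<subseteq> S \<times> UNIV" using e Xeq by simp
  ultimately obtain L where L: "L-lipschitz_on X spray" using spray_lipschitz by blast
  show ?thesis
  proof (rule LIMSEQ_I)
    fix r :: real assume r: "r > 0"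
    define \<epsilon> where "\<epsilon> = min r e"
    have \<epsilon>: "\<epsilon> > 0" "\<epsilon> \<le> r" "\<epsilon> \<le> e" using r e by (auto simp: \<epsilon>_def)
    have "\<epsilon> / exp L > 0" using \<epsilon> by simp
    then obtain N where N: "\<And>n. n \<ge> N \<Longrightarrow> norm (un n 0 - u 0) < \<epsilon> / exp L" using LIMSEQ_D[OF lim] by blast
    have "norm (dn n 1 - d 1) < r" if n: "n \<ge> N" for n
    proof -
      have "norm ((dn n 0, un n 0) - (d 0, u 0)) = norm (un n 0 - u 0)" using dn by (simp add: norm_Pair)
      then have small: "norm ((dn n 0, un n 0) - (d 0, u 0)) * exp L < \<epsilon>" using N[OF n] by (simp add: pos_less_divide_eq)
      have "norm ((dn n 1, un n 1) - (d 1, u 1)) < \<epsilon>"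
      proof (rule ode_dependence[where z = ?z and y = "\<lambda>t. (dn n t, un n t)", OF sp[OF d] sp[OF dn(1)] L _ small])
        fix t :: real assume "t \<in> {0..1}"
        then have "cball (d t, u t) e \<subseteq> X" unfolding Xeq by blast
        then show "cball (d t, u t) \<epsilon> \<subseteq> X" using \<epsilon> by (meson order_trans subset_cball)
      qed
      moreover have "norm (dn n 1 - d 1) \<le> norm ((dn n 1, un n 1) - (d 1, u 1))" using norm_fst_le[of "dn n 1 - d 1" "un n 1 - u 1"] by simp
      ultimately show ?thesis using \<epsilon> by linarith
    qed
    then show "\<exists>N. \<forall>n\<ge>N. norm (dn n 1 - d 1) < r" by blast
  qed
qed

text \<open>The Hopf-Rinow argument by contradiction. If all sets of an exhaustion can be left at
  cost at most m, then shortest ways to their frontiers are geodesics from \<open>p\<close> with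
  bounded initial velocities. Along a convergent subsequence their end points converge to the point
  that the limit geodesic reaches at time 1, which lies in \<open>S\<close>, although they leave
  every compact subset of \<open>S\<close>.\<close>

theorem complete_imp_proper:
  assumes complete: "geodesically_complete S g" and p: "p \<in> S"
  shows "proper_from S a b c p"
proof (rule ccontr)
  assume "\<not> proper_from S a b c p"
  then obtain m where m: "\<And>K. compact K \<Longrightarrow> K \<subseteq> S \<Longrightarrow> p \<in> interior K \<Longrightarrow> \<not> confines K a b c p m"
    unfolding proper_from_def by blast
  obtain C where C: "\<And>n. compact (C n)" "\<And>n. C n \<subseteq> S" "\<And>n. C n \<subseteq> interior (C (Suc n))" "\<Union>(range C) = S"
    and CK: "\<And>K. compact K \<Longrightarrow> K \<subseteq> S \<Longrightarrow> \<exists>N. \<forall>n\<ge>N. K \<subseteq> C n"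
    using open_Union_compact_subsets[OF open_S] by metis
  obtain N0 where "\<forall>n\<ge>N0. {p} \<subseteq> C n" using CK[of "{p}"] p by auto
  then have pN: "p \<in> C N0" by simp
  define K where "K n = C (Suc (N0 + n))" for n
  have Cmono: "C n \<subseteq> C (n + k)" for n k
    by (induction k) (use C(3) interior_subset in \<open>force+\<close>)
  have K: "compact (K n)" "K n \<subseteq> S" "p \<in> interior (K n)" for n
  proof -
    have "p \<in> C (N0 + n)" using pN Cmono by blast
    then show "p \<in> interior (K n)" unfolding K_def using C(3) by blast
  qed (use C in \<open>auto simp: K_def\<close>)
  have "\<exists>d u. geod d u \<and> d 0 = p \<and> quad a b c p (u 0) \<le> m \<and> d 1 \<notin> interior (K n)" for n
  proof -
    obtain z w where z: "C1_curve z w" "z 0 = p" "\<And>t. t \<in> {0..1} \<Longrightarrow> z t \<in> K n" "z 1 \<in> frontier (K n)" "energy (quad a b c) z w \<le> m"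
      using m[OF K] unfolding confines_def by (meson not_less)
    obtain A B Cc A' B' C' lam M U where ext: "extended_metric A B Cc A' B' C' lam M a b c U" and U: "K n \<subseteq> U" "U \<subseteq> S"
      by (rule extended_metric_exists[OF open_S K(1,2)[of n] smooth_entry smooth_entry smooth_entry posdef])
    interpret extended_metric A B Cc A' B' C' lam M a b c U by (rule ext)
    obtain \<gamma> P where \<gamma>: "\<gamma> 0 = p" "\<gamma> 1 \<in> frontier (K n)" "\<And>t. 0 \<le> t \<Longrightarrow> t < 1 \<Longrightarrow> \<gamma> t \<in> interior (K n)"
      "C1_curve \<gamma> (\<lambda>t. vel A B Cc (\<gamma> t) (P t))" "C1_curve P (\<lambda>t. quad_x A' B' C' (\<gamma> t) (vel A B Cc (\<gamma> t) (P t)))"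
      "energy (quad A B Cc) \<gamma> (\<lambda>t. vel A B Cc (\<gamma> t) (P t)) = action p (\<gamma> 1)"
      "\<And>x. x \<in> frontier (K n) \<Longrightarrow> action p (\<gamma> 1) \<le> action p x"
      using frontier_minimizer[OF K(1,3)] by blast
    have \<gamma>K: "\<gamma> t \<in> K n" if "t \<in> {0..1}" for t
      using \<gamma>(2) \<gamma>(3)[of t] that subsetD[OF interior_subset, of "\<gamma> t" "K n"] subsetD[OF frontier_subset_closed[OF compact_imp_closed[OF K(1)]], of _ n]
      by (cases "t = 1") auto
    have \<gamma>U: "\<gamma> t \<in> U" if "t \<in> {0..1}" for t using \<gamma>K[OF that] U by blast
    have \<gamma>S: "\<gamma> t \<in> S" if "t \<in> {0..1}" for t using \<gamma>U[OF that] U by blast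
    let ?T = "\<lambda>t. vel a b c (\<gamma> t) (P t)"
    note ham = hamilton_agree[OF \<gamma>(4,5) \<gamma>U]
    have Td: "(\<gamma> has_vector_derivative ?T t) (at t within {0..1})" if "t \<in> {0..1}" for t
      using ham(1) that by (simp add: C1_curve_def)
    note TG = hamilton_geodesic[OF ham \<gamma>S]
    obtain k where k: "\<And>t. t \<in> {0..1} \<Longrightarrow> quad a b c (\<gamma> t) (?T t) = k"
      using speed_const[OF Td TG \<gamma>S] by blast
    have "k = energy (quad a b c) \<gamma> ?T"
    proof -
      have "energy (quad a b c) \<gamma> ?T = integral {0..1} (\<lambda>t::real. k)"
        unfolding energy_def by (intro Henstock_Kurzweil_Integration.integral_cong k)
      then show ?thesis by simp
    qed
    also have "\<dots> = energy (quad A B Cc) \<gamma> (\<lambda>t. vel A B Cc (\<gamma> t) (P t))"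
      by (rule energy_cong) (use \<gamma>U agree in \<open>simp add: quad_def vel_def\<close>)
    also have "\<dots> \<le> action p (z 1)" unfolding \<gamma>(6) by (rule \<gamma>(7)[OF z(4)])
    also have "\<dots> \<le> energy (quad A B Cc) z w" by (rule action_le[OF z(1,2) refl])
    also have "\<dots> = energy (quad a b c) z w" using z(3) U by (intro energy_agree) blast
    finally have km: "k \<le> m" using z(5) by linarith
    \<comment> \<open>The minimizer lives on the unit interval, while \<open>geod_limit\<close>
      speaks of geodesics on the whole line.\<close>
    obtain d u where d: "geod d u" "d 0 = \<gamma> 0" "u 0 = ?T 0" "d 1 = \<gamma> 1"
      using geod_extension[OF complete Td TG \<gamma>S] by blast
    have "quad a b c p (u 0) \<le> m" using k[of 0] km \<gamma>(1) d(3) by simp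
    moreover have "d 1 \<notin> interior (K n)" using d(4) \<gamma>(2) by (simp add: frontier_def)
    ultimately show ?thesis using d \<gamma>(1) by metis
  qed
  then obtain dn un where dn: "\<And>n. geod (dn n) (un n)" "\<And>n. dn n 0 = p" "\<And>n. quad a b c p (un n 0) \<le> m" "\<And>n. dn n 1 \<notin> interior (K n)"
    by metis
  \<comment> \<open>At the single point \<open>p\<close> the metric is equivalent to the Euclidean
    one, so bounded energy means bounded initial velocity.\<close>
  obtain l where l: "l > 0" "\<And>v. l * (norm v)\<^sup>2 \<le> quad a b c p v"
    using quad_lower(2)[where x = p and a = a and b = b and c = c, OF a_pos[OF p] gdet_pos[OF p]] a_pos[OF p] gdet_pos[OF p] quad_lower(1)[where x = p and a = a and b = b and c = c, OF a_pos[OF p] gdet_pos[OF p]]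
    by (metis add_pos_pos divide_pos_pos mult_pos_pos zero_less_numeral)
  have "norm (un n 0) \<le> sqrt (m / l)" for n
    using l(1) l(2)[of "un n 0"] dn(3)[of n] by (intro real_le_rsqrt) (simp add: field_simps)
  then have "bounded (range (\<lambda>n. un n 0))" by (auto simp: bounded_iff)
  then obtain v r where r: "strict_mono r" "((\<lambda>n. un n 0) \<circ> r) \<longlonglongrightarrow> v" using bounded_imp_convergent_subsequence by blast
  obtain d u where d: "geod d u" "d 0 = p" "u 0 = v" by (rule geod_exists[OF complete p])
  have lim: "(\<lambda>n. dn (r n) 1) \<longlonglongrightarrow> d 1"
    by (rule geod_limit[OF d(1) dn(1)]) (use dn(2) d r in \<open>simp_all add: o_def\<close>)
  have "d 1 \<in> S" using d by (simp add: geod_def)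
  then obtain N where N: "\<forall>n\<ge>N. {d 1} \<subseteq> C n" using CK[of "{d 1}"] by auto
  then have dN: "d 1 \<in> interior (C (Suc N))" using C(3) by blast
  obtain M where M: "\<And>n. n \<ge> M \<Longrightarrow> dn (r n) 1 \<in> interior (C (Suc N))"
    using topological_tendstoD[OF lim open_interior dN] unfolding eventually_sequentially by blast
  \<comment> \<open>An index at which the end point is already near its limit and the exhaustion has
    already passed that limit.\<close>
  define n where "n = max M (Suc N)"
  have "Suc N \<le> r n" using seq_suble[OF r(1), of n] by (simp add: n_def)
  then have "C (Suc N) \<subseteq> K (r n)" unfolding K_def using Cmono[of "Suc N" "Suc (N0 + r n) - Suc N"] by simp
  then have "dn (r n) 1 \<in> interior (K (r n))" using M[of n] interior_mono by (auto simp: n_def)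
  then show False using dn(4) by blast
qed

end

section \<open>Hessian metrics\<close>

text \<open>The numbers p, q, r, s are the components 111, 112, 122, 222 of the cubic form C of first derivatives
  of a Hessian metric, and l1, l2 the derivatives of \<open>ln w\<close>. In the frame (1, 0), (-b, a) the
  components of C are p, Y, X, Z, and the inequality becomes \<open>|C|\<^sup>2 \<ge> |tr C|\<^sup>2 / 2\<close>.\<close>

lemma hessian_curvature_algebra:
  fixes a b c p q r s l1 l2 D :: real
  assumes a: "a > 0" and D: "D = a * c - b\<^sup>2" "D > 0"
    and l1: "2 * D * l1 = - (p * c + a * r - 2 * b * q)" and l2: "2 * D * l2 = - (q * c + a * s - 2 * b * r)"
  shows "0 \<le> (c * l1\<^sup>2 - 2 * b * (l1 * l2) + a * l2\<^sup>2) / 4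
    + (cofq a b c ((q + l2 * a) / 2) ((r + l1 * c) / 2) ((q + l2 * a) / 2) ((r + l1 * c) / 2)
      - cofq a b c ((p + l1 * a) / 2) (q + l1 * b - (q + l2 * a) / 2) (r + l2 * b - (r + l1 * c) / 2) ((s + l2 * c) / 2)) / D"
proof -
  define L where "L = c * l1\<^sup>2 - 2 * b * (l1 * l2) + a * l2\<^sup>2"
  define Q0 where "Q0 = c * (q\<^sup>2 - p * r) - b * (q * r - p * s) + a * (r\<^sup>2 - q * s)"
  define m1 where "m1 = p * c + a * r - 2 * b * q"
  define m2 where "m2 = q * c + a * s - 2 * b * r"
  let ?Q = "cofq a b c ((q + l2 * a) / 2) ((r + l1 * c) / 2) ((q + l2 * a) / 2) ((r + l1 * c) / 2)
      - cofq a b c ((p + l1 * a) / 2) (q + l1 * b - (q + l2 * a) / 2) (r + l2 * b - (r + l1 * c) / 2) ((s + l2 * c) / 2)"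
  have m: "m1 = - (2 * D * l1)" "m2 = - (2 * D * l2)" using l1 l2 by (simp_all add: m1_def m2_def)
  \<comment> \<open>By the trace relations the terms linear in \<open>l1\<close>, \<open>l2\<close>
    and the cubic form equal -2 D L and cancel the quadratic ones, so only \<open>Q0\<close>, the
    part of the Hessian metric alone, survives.\<close>
  have "4 * ?Q = Q0 + (l1 * (c * m1 - b * m2) + l2 * (a * m2 - b * m1)) + 2 * D * L"
    unfolding cofq_def Q0_def m1_def m2_def L_def D(1) by (simp add: power2_eq_square field_simps)
  also have "l1 * (c * m1 - b * m2) + l2 * (a * m2 - b * m1) = - 2 * D * L"
    unfolding m L_def by (simp add: power2_eq_square algebra_simps)
  finally have Q: "?Q = Q0 / 4" by simp
  define X where "X = a\<^sup>2 * r - 2 * a * b * q + b\<^sup>2 * p"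
  define Y where "Y = a * q - b * p"
  define Z where "Z = a ^ 3 * s - 3 * a\<^sup>2 * b * r + 3 * a * b\<^sup>2 * q - b ^ 3 * p"
  \<comment> \<open>Expressed by the frame components, the left side is a manifest sum of squares,
    since D > 0.\<close>
  have sos: "a ^ 3 * (c * m1\<^sup>2 - 2 * b * (m1 * m2) + a * m2\<^sup>2) + 4 * a ^ 3 * D * Q0
      = D * (D * p - X)\<^sup>2 + 4 * D * X\<^sup>2 + (Z - D * Y)\<^sup>2 + 4 * D\<^sup>2 * Y\<^sup>2"
    unfolding X_def Y_def Z_def Q0_def m1_def m2_def D(1)
    by (simp add: power2_eq_square power3_eq_cube algebra_simps)
  have "c * m1\<^sup>2 - 2 * b * (m1 * m2) + a * m2\<^sup>2 = 4 * D\<^sup>2 * L"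
    unfolding m L_def by (simp add: power2_eq_square algebra_simps)
  with sos have "0 \<le> a ^ 3 * (4 * D\<^sup>2 * L) + 4 * a ^ 3 * D * Q0" using D(2) by (simp only:) simp
  moreover have "a ^ 3 * (4 * D\<^sup>2 * L) + 4 * a ^ 3 * D * Q0 = (L / 4 + Q0 / 4 / D) * (16 * a ^ 3 * D\<^sup>2)"
    using D(2) by (simp add: power2_eq_square field_simps)
  moreover have "16 * a ^ 3 * D\<^sup>2 > 0" using a D(2) by simp
  ultimately have "0 \<le> L / 4 + Q0 / 4 / D" using mult_neg_pos by (metis not_le)
  then show ?thesis unfolding Q L_def by simp
qed

lemma partial_deriv_mult:
  fixes f h :: "real^2 \<Rightarrow> real"
  assumes "smooth_on S f" "smooth_on S h" "x \<in> S"
  shows "partial_deriv i (\<lambda>x. f x * h x) x = partial_deriv i f x * h x + f x * partial_deriv i h x"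
  using partial_deriv_at[OF has_derivative_mult[OF smooth_on_has_frechet[OF assms(1,3)] smooth_on_has_frechet[OF assms(2,3)]]]
  by (simp add: partial_deriv_def add.commute)

lemma partial_deriv_mult2:
  fixes f h :: "real^2 \<Rightarrow> real"
  assumes S: "open S" and f: "smooth_on S f" and h: "smooth_on S h" and x: "x \<in> S"
  shows "partial_deriv i (partial_deriv j (\<lambda>x. f x * h x)) x = partial_deriv i (partial_deriv j f) x * h x
    + partial_deriv j f x * partial_deriv i h x + partial_deriv i f x * partial_deriv j h x + f x * partial_deriv i (partial_deriv j h) x"
proof -
  note pd = smooth_on_partial_deriv
  have "partial_deriv i (partial_deriv j (\<lambda>x. f x * h x)) x = partial_deriv i (\<lambda>x. partial_deriv j f x * h x + f x * partial_deriv j h x) x"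
    by (rule partial_deriv_cong_open[OF S x partial_deriv_mult[OF f h]])
  also have "\<dots> = partial_deriv i (\<lambda>x. partial_deriv j f x * h x) x + partial_deriv i (\<lambda>x. f x * partial_deriv j h x) x"
    using partial_deriv_at[OF has_derivative_add[OF smooth_on_has_frechet smooth_on_has_frechet]]
      smooth_on_mult[OF S pd[OF f] h] smooth_on_mult[OF S f pd[OF h]] x unfolding partial_deriv_def by blast
  finally show ?thesis using partial_deriv_mult[OF pd[OF f] h x] partial_deriv_mult[OF f pd[OF h] x] by simp
qed

lemma partial_deriv_add:
  fixes f h :: "real^2 \<Rightarrow> real"
  assumes "smooth_on S f" "smooth_on S h" "x \<in> S"
  shows "partial_deriv i (\<lambda>x. f x + h x) x = partial_deriv i f x + partial_deriv i h x"
  using partial_deriv_at[OF has_derivative_add[OF smooth_on_has_frechet[OF assms(1,3)] smooth_on_has_frechet[OF assms(2,3)]]]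
  by (simp add: partial_deriv_def)

lemma partial_deriv_diff:
  fixes f h :: "real^2 \<Rightarrow> real"
  assumes "smooth_on S f" "smooth_on S h" "x \<in> S"
  shows "partial_deriv i (\<lambda>x. f x - h x) x = partial_deriv i f x - partial_deriv i h x"
  using partial_deriv_at[OF has_derivative_diff[OF smooth_on_has_frechet[OF assms(1,3)] smooth_on_has_frechet[OF assms(2,3)]]]
  by (simp add: partial_deriv_def)

lemma partial_deriv_const: "partial_deriv i (\<lambda>x. k) x = 0"
  using partial_deriv_at[OF has_derivative_const[of k "at x"]] by simp

lemma partial_deriv_nth: "partial_deriv j (\<lambda>x :: real^2. x $ i) x = (if i = j then 1 else 0)"
  by (simp add: partial_deriv_at[OF bounded_linear_imp_has_derivative[OF bounded_linear_vec_nth]] axis_def)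

lemma proper_from_cong:
  assumes "proper_from S a b c p" and "\<And>x. x \<in> S \<Longrightarrow> a x = a' x \<and> b x = b' x \<and> c x = c' x"
  shows "proper_from S a' b' c' p"
proof -
  have "confines K a' b' c' p m" if "confines K a b c p m" "K \<subseteq> S" for K m
    unfolding confines_def
  proof (intro allI impI)
    fix z w assume z: "C1_curve z w" "z 0 = p" "\<forall>t\<in>{0..1}. z t \<in> K" "z 1 \<in> frontier K"
    have "energy (quad a b c) z w = energy (quad a' b' c') z w"
    proof (rule energy_cong)
      fix t :: real assume "t \<in> {0..1}"
      then have "z t \<in> S" using z(3) that(2) by blast
      then show "quad a b c (z t) (w t) = quad a' b' c' (z t) (w t)" using assms(2) by (simp add: quad_def)
    qed
    then show "m < energy (quad a' b' c') z w" using that(1) z unfolding confines_def by metis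
  qed
  then show ?thesis using assms(1) unfolding proper_from_def by metis
qed

section \<open>Metrics with commuting coordinate gradients\<close>

locale hessian_metric = plane_metric +
  assumes hess: "gradients_span_and_commute S g"
begin

definition w where "w x = 1 / sqrt (gdet x)"

lemma w_pos: "x \<in> S \<Longrightarrow> w x > 0"
  using gdet_pos by (simp add: w_def)

lemma w_sq: "x \<in> S \<Longrightarrow> (w x)\<^sup>2 * gdet x = 1"
  using gdet_pos[of x] by (simp add: w_def power_divide)

lemma smooth_w: "smooth_on S w"
proof -
  have "sqrt (gdet x) \<noteq> 0" if "x \<in> S" for x using gdet_pos[OF that] by simp
  then show ?thesis unfolding w_def[abs_def]
    by (intro smooth_on_divide smooth_on_const smooth_on_sqrt smooth_gdet open_S gdet_pos)
qed

lemma grad_nth: "grad g f x $ i = matrix_inv (g x) $ i $ 1 * partial_deriv 1 f x + matrix_inv (g x) $ i $ 2 * partial_deriv 2 f x"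
  by (simp add: grad_def matrix_vector_mult_def sum_2)

lemma grad_coord_nth: "grad_coord g i x $ j = matrix_inv (g x) $ j $ i"
  using exhaust_2[of i] by (auto simp: grad_nth partial_deriv_nth)

text \<open>The coordinate gradients are the columns of the inverse of g, and their Gram matrix is
  that inverse itself; its determinant is 1 / det g.\<close>

lemma gram_det_eq: "x \<in> S \<Longrightarrow> sqrt (gram_det g x) = w x"
proof -
  assume x: "x \<in> S"
  let ?D = "gdet x"
  have D: "?D > 0" by (rule gdet_pos[OF x])
  note inv = matrix_inv_g[OF x]
  have mi: "metric_inner g x u v = a x * (u $ 1 * v $ 1) + b x * (u $ 1 * v $ 2 + u $ 2 * v $ 1) + c x * (u $ 2 * v $ 2)" for u v
    using g_sym[OF x] by (simp add: metric_inner_def inner_vec_def matrix_vector_mult_def sum_2 algebra_simps)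
  have i11: "metric_inner g x (grad_coord g 1 x) (grad_coord g 1 x) = c x / ?D"
   and i22: "metric_inner g x (grad_coord g 2 x) (grad_coord g 2 x) = a x / ?D"
   and i12: "metric_inner g x (grad_coord g 1 x) (grad_coord g 2 x) = - b x / ?D"
  proof -
    define k where "k = ?D"
    have k: "k \<noteq> 0" "a x * c x - (b x)\<^sup>2 = k" using D by (simp_all add: k_def)
    have "A * (C / k * (C / k)) + B * (C / k * (- B / k) + - B / k * (C / k)) + C * (- B / k * (- B / k)) = C * (A * C - B\<^sup>2) / (k * k)"
      "A * (- B / k * (- B / k)) + B * (- B / k * (A / k) + A / k * (- B / k)) + C * (A / k * (A / k)) = A * (A * C - B\<^sup>2) / (k * k)"
      "A * (C / k * (- B / k)) + B * (C / k * (A / k) + - B / k * (- B / k)) + C * (- B / k * (A / k)) = - B * (A * C - B\<^sup>2) / (k * k)"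
      for A B C :: real
      using k(1) by (simp_all add: power2_eq_square field_simps)
    from this[where A = "a x" and B = "b x" and C = "c x"] show "metric_inner g x (grad_coord g 1 x) (grad_coord g 1 x) = c x / ?D"
      "metric_inner g x (grad_coord g 2 x) (grad_coord g 2 x) = a x / ?D"
      "metric_inner g x (grad_coord g 1 x) (grad_coord g 2 x) = - b x / ?D"
      unfolding mi grad_coord_nth inv k_def[symmetric] unfolding k(2) using k(1) by simp_all
  qed
  have "c x > 0" using quad_lower(1)[where a = a and b = b and c = c, OF a_pos[OF x] D] .
  then have "gram_det g x = (c x / ?D) * (a x / ?D) - (b x / ?D)\<^sup>2"
    unfolding gram_det_def metric_norm_def i11 i22 i12 using D a_pos[OF x] by simp
  also have "\<dots> = ?D / (?D * ?D)" by (simp add: power2_eq_square diff_divide_distrib mult.commute)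
  also have "\<dots> = 1 / ?D" using D by simp
  finally show ?thesis by (simp add: w_def real_sqrt_divide)
qed

lemma gdet_deriv:
  assumes x: "x \<in> S"
  shows "partial_deriv i gdet x = partial_deriv i a x * c x + a x * partial_deriv i c x - 2 * b x * partial_deriv i b x"
proof -
  note se = smooth_entry
  have eq: "gdet = (\<lambda>x. a x * c x - b x * b x)" by (simp add: power2_eq_square)
  show ?thesis unfolding eq partial_deriv_diff[OF smooth_on_mult[OF open_S se se] smooth_on_mult[OF open_S se se] x]
      partial_deriv_mult[OF se se x] by simp
qed

text \<open>The vanishing bracket relates first derivatives of the inverse matrix. Differentiating g
  times its inverse transports these relations to g, where they say that the derivatives of the
  entries are totally symmetric; in the plane these are two equations.\<close>

lemma cubic_symmetric:
  assumes x: "x \<in> S"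
  shows "partial_deriv 2 a x = partial_deriv 1 b x" "partial_deriv 2 b x = partial_deriv 1 c x"
proof -
  let ?A = "\<lambda>x. matrix_inv (g x) $ 1 $ 1" and ?B = "\<lambda>x. matrix_inv (g x) $ 1 $ 2" and ?C = "\<lambda>x. matrix_inv (g x) $ 2 $ 2"
  note si = smooth_matrix_inv and se = smooth_entry
  have sym: "matrix_inv (g y) $ 2 $ 1 = ?B y" if "y \<in> S" for y using matrix_inv_g[OF that] by simp
  have idn: "a y * ?A y + b y * ?B y = 1" "b y * ?A y + c y * ?B y = 0" "a y * ?B y + b y * ?C y = 0" "b y * ?B y + c y * ?C y = 1" if "y \<in> S" for y
  proof -
    define k where "k = gdet y"
    have k: "k \<noteq> 0" "a y * c y - b y * b y = k" using gdet_pos[OF that] by (simp_all add: k_def power2_eq_square)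
    have "a y * ?A y + b y * ?B y = (a y * c y - b y * b y) / k" "b y * ?B y + c y * ?C y = (a y * c y - b y * b y) / k"
      unfolding matrix_inv_g[OF that] k_def[symmetric] by (simp_all add: diff_divide_distrib)
    then show "a y * ?A y + b y * ?B y = 1" "b y * ?B y + c y * ?C y = 1" using k by simp_all
    show "b y * ?A y + c y * ?B y = 0" "a y * ?B y + b y * ?C y = 0" unfolding matrix_inv_g[OF that] by simp_all
  qed
  have der: "(partial_deriv k u1 x * v1 x + u1 x * partial_deriv k v1 x) + (partial_deriv k u2 x * v2 x + u2 x * partial_deriv k v2 x) = 0"
    if u: "smooth_on S u1" "smooth_on S v1" "smooth_on S u2" "smooth_on S v2" "\<And>y. y \<in> S \<Longrightarrow> u1 y * v1 y + u2 y * v2 y = e" for u1 v1 u2 v2 k e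
  proof -
    have "partial_deriv k (\<lambda>y. u1 y * v1 y + u2 y * v2 y) x = 0"
      using partial_deriv_cong_open[OF open_S x u(5), where i = k] partial_deriv_const by simp
    then show ?thesis
      by (simp add: partial_deriv_add[OF smooth_on_mult[OF open_S u(1,2)] smooth_on_mult[OF open_S u(3,4)] x] partial_deriv_mult[OF u(1,2) x] partial_deriv_mult[OF u(3,4) x])
  qed
  have e1: "(partial_deriv k a x * ?A x + a x * partial_deriv k ?A x) + (partial_deriv k b x * ?B x + b x * partial_deriv k ?B x) = 0"
    and e2: "(partial_deriv k b x * ?A x + b x * partial_deriv k ?A x) + (partial_deriv k c x * ?B x + c x * partial_deriv k ?B x) = 0"
    and e3: "(partial_deriv k a x * ?B x + a x * partial_deriv k ?B x) + (partial_deriv k b x * ?C x + b x * partial_deriv k ?C x) = 0"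
    and e4: "(partial_deriv k b x * ?B x + b x * partial_deriv k ?B x) + (partial_deriv k c x * ?C x + c x * partial_deriv k ?C x) = 0" for k
    by (rule der[OF se si se si idn(1)] der[OF se si se si idn(2)] der[OF se si se si idn(3)] der[OF se si se si idn(4)]; assumption)+
  have fd: "frechet_derivative (grad_coord g i) (at x) v = V2 (partial_deriv 1 (\<lambda>x. matrix_inv (g x) $ 1 $ i) x * v $ 1 + partial_deriv 2 (\<lambda>x. matrix_inv (g x) $ 1 $ i) x * v $ 2)
      (partial_deriv 1 (\<lambda>x. matrix_inv (g x) $ 2 $ i) x * v $ 1 + partial_deriv 2 (\<lambda>x. matrix_inv (g x) $ 2 $ i) x * v $ 2)" for i v
  proof -
    have eq: "grad_coord g i = (\<lambda>x. (matrix_inv (g x) $ 1 $ i) *\<^sub>R axis 1 1 + (matrix_inv (g x) $ 2 $ i) *\<^sub>R axis 2 1)"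
      by (rule ext) (simp add: vec2_eq_iff grad_coord_nth axis_def)
    have "(grad_coord g i has_derivative (\<lambda>v. (partial_deriv 1 (\<lambda>x. matrix_inv (g x) $ 1 $ i) x * v $ 1 + partial_deriv 2 (\<lambda>x. matrix_inv (g x) $ 1 $ i) x * v $ 2) *\<^sub>R axis 1 1
       + (partial_deriv 1 (\<lambda>x. matrix_inv (g x) $ 2 $ i) x * v $ 1 + partial_deriv 2 (\<lambda>x. matrix_inv (g x) $ 2 $ i) x * v $ 2) *\<^sub>R axis 2 1)) (at x)"
      unfolding eq by (intro has_derivative_add has_derivative_scaleR_left smooth_on_has_derivative[OF si x])
    from frechet_derivative_at[OF this, symmetric] show ?thesis by (simp add: vec2_eq_iff axis_def)
  qed
  have "lie_bracket (grad_coord g 1) (grad_coord g 2) x = 0" using hess x by (simp add: gradients_span_and_commute_def)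
  moreover have "partial_deriv k (\<lambda>x. matrix_inv (g x) $ 2 $ 1) x = partial_deriv k ?B x" for k
    by (rule partial_deriv_cong_open[OF open_S x sym])
  ultimately have l1: "partial_deriv 1 ?B x * ?A x + partial_deriv 2 ?B x * ?B x - (partial_deriv 1 ?A x * ?B x + partial_deriv 2 ?A x * ?C x) = 0"
    and l2: "partial_deriv 1 ?C x * ?A x + partial_deriv 2 ?C x * ?B x - (partial_deriv 1 ?B x * ?B x + partial_deriv 2 ?B x * ?C x) = 0"
    unfolding lie_bracket_def fd vec2_eq_iff by (simp_all add: grad_coord_nth sym[OF x])
  \<comment> \<open>Linear elimination for one row of g: the row (a, b) gives the first symmetry,
    the row (b, c) the second.\<close>
  have comb: "(A * C - B * B) * (b1 - a2) = 0"
    if "(a1 * B + a' * B1) + (b1 * C + b' * C1) = 0" "(a2 * B + a' * B2) + (b2 * C + b' * C2) = 0"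
      "(a1 * A + a' * A1) + (b1 * B + b' * B1) = 0" "(a2 * A + a' * A2) + (b2 * B + b' * B2) = 0"
      "B1 * A + B2 * B - (A1 * B + A2 * C) = 0" "C1 * A + C2 * B - (B1 * B + B2 * C) = 0"
    for A B C A1 A2 B1 B2 C1 C2 a1 a2 b1 b2 a' b' :: real
    using that by algebra
  have "gdet x \<noteq> 0" using gdet_pos[OF x] by simp
  then have nz: "?A x * ?C x - ?B x * ?B x \<noteq> 0"
  proof -
    have "(?A x * ?C x - ?B x * ?B x) * gdet x = (a x * ?A x + b x * ?B x) * (b x * ?B x + c x * ?C x) - (b x * ?A x + c x * ?B x) * (a x * ?B x + b x * ?C x)"
      by (simp add: power2_eq_square algebra_simps)
    then show ?thesis using idn[OF x] by auto
  qed
  show "partial_deriv 2 a x = partial_deriv 1 b x"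
    using comb[OF e3[of 1] e3[of 2] e1[of 1] e1[of 2] l1 l2] nz by simp
  show "partial_deriv 2 b x = partial_deriv 1 c x"
    using comb[OF e4[of 1] e4[of 2] e2[of 1] e2[of 2] l1 l2] nz by simp
qed

end

section \<open>The unimodular metric h and its curvature bound\<close>

context hessian_metric
begin

abbreviation ha where "ha \<equiv> \<lambda>x. a x * w x"
abbreviation hb where "hb \<equiv> \<lambda>x. b x * w x"
abbreviation hc where "hc \<equiv> \<lambda>x. c x * w x"

lemma smooth_h: "smooth_on S ha" "smooth_on S hb" "smooth_on S hc"
  by (intro smooth_on_mult smooth_entry smooth_w open_S)+

lemma det_h: "x \<in> S \<Longrightarrow> ha x * hc x - (hb x)\<^sup>2 = 1"
  using w_sq[of x] by (simp add: power2_eq_square algebra_simps)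

lemma h_pos: "x \<in> S \<Longrightarrow> ha x > 0"
  using a_pos w_pos by simp

text \<open>In dimension two sqrt (det g) times the inverse of g is conformally invariant, here the
  cofactor matrix of h; only the outer factor 1 / sqrt (det g) = w remains. \<open>F\<close> and
  \<open>f\<close> may differ off \<open>S\<close>, since the root of the Gram determinant is known
  to be \<open>w\<close> only on \<open>S\<close>.\<close>

lemma laplace_beltrami_lap:
  assumes x: "x \<in> S" and f: "smooth_on S f" and F: "\<And>y. y \<in> S \<Longrightarrow> F y = f y"
  shows "laplace_beltrami g F x = w x * lap ha hb hc f x"
proof -
  note sp = smooth_on_partial_deriv[OF f] and sm = smooth_on_mult[OF open_S]
  have det: "det (g y) = gdet y" if "y \<in> S" for y using g_sym[OF that] by (simp add: det_2 power2_eq_square)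
  have r: "sqrt (gdet y) * (k / gdet y) = k * w y" if "y \<in> S" for y k
  proof -
    define s where "s = sqrt (gdet y)"
    have s: "gdet y = s * s" "s \<noteq> 0" using gdet_pos[OF that] by (simp_all add: s_def)
    have "s * (k / (s * s)) = k * (1 / s)" using s(2) by (simp add: field_simps)
    then show ?thesis unfolding w_def s_def[symmetric] s(1)[symmetric] .
  qed
  have g1: "sqrt (det (g y)) * grad g F y $ 1 = hc y * partial_deriv 1 f y - hb y * partial_deriv 2 f y" (is "?l1 = _")
    and g2: "sqrt (det (g y)) * grad g F y $ 2 = ha y * partial_deriv 2 f y - hb y * partial_deriv 1 f y" (is "?l2 = _") if y: "y \<in> S" for y
  proof -
    have F': "partial_deriv i F y = partial_deriv i f y" for i by (rule partial_deriv_cong_open[OF open_S y F])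
    have "?l1 = (sqrt (gdet y) * (c y / gdet y)) * partial_deriv 1 f y + (sqrt (gdet y) * (- b y / gdet y)) * partial_deriv 2 f y"
      unfolding det[OF y] grad_nth F' matrix_inv_g[OF y] by (simp only: distrib_left mult.assoc)
    then show "?l1 = hc y * partial_deriv 1 f y - hb y * partial_deriv 2 f y" unfolding r[OF y] by simp
    have "?l2 = (sqrt (gdet y) * (- b y / gdet y)) * partial_deriv 1 f y + (sqrt (gdet y) * (a y / gdet y)) * partial_deriv 2 f y"
      unfolding det[OF y] grad_nth F' matrix_inv_g[OF y] by (simp only: distrib_left mult.assoc)
    then show "?l2 = ha y * partial_deriv 2 f y - hb y * partial_deriv 1 f y" unfolding r[OF y] by simp
  qed
  have 1: "partial_deriv 1 (\<lambda>y. sqrt (det (g y)) * grad g F y $ 1) x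
      = partial_deriv 1 hc x * partial_deriv 1 f x + hc x * partial_deriv 1 (partial_deriv 1 f) x
        - (partial_deriv 1 hb x * partial_deriv 2 f x + hb x * partial_deriv 1 (partial_deriv 2 f) x)"
    using partial_deriv_cong_open[OF open_S x g1, where i = 1] partial_deriv_diff[OF sm[OF smooth_h(3) sp[of 1]] sm[OF smooth_h(2) sp[of 2]] x, where i = 1]
      partial_deriv_mult[OF smooth_h(3) sp[of 1] x, where i = 1] partial_deriv_mult[OF smooth_h(2) sp[of 2] x, where i = 1] by simp
  have 2: "partial_deriv 2 (\<lambda>y. sqrt (det (g y)) * grad g F y $ 2) x
      = partial_deriv 2 ha x * partial_deriv 2 f x + ha x * partial_deriv 2 (partial_deriv 2 f) x
        - (partial_deriv 2 hb x * partial_deriv 1 f x + hb x * partial_deriv 2 (partial_deriv 1 f) x)"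
    using partial_deriv_cong_open[OF open_S x g2, where i = 2] partial_deriv_diff[OF sm[OF smooth_h(1) sp[of 2]] sm[OF smooth_h(2) sp[of 1]] x, where i = 2]
      partial_deriv_mult[OF smooth_h(1) sp[of 2] x, where i = 2] partial_deriv_mult[OF smooth_h(2) sp[of 1] x, where i = 2] by simp
  have "laplace_beltrami g F x = lap ha hb hc f x / sqrt (gdet x)"
    unfolding laplace_beltrami_def divergence_def sum_2 1 2 det[OF x] lap_def partial_deriv_commute[OF open_S x f, where i = 2 and j = 1]
    by (simp add: algebra_simps)
  then show ?thesis by (simp add: w_def)
qed

lemma w_deriv:
  assumes x: "x \<in> S"
  shows "2 * gdet x * (partial_deriv k w x / w x) = - partial_deriv k gdet x"
proof -
  have ww: "smooth_on S (\<lambda>x. w x * w x)" by (intro smooth_on_mult smooth_w open_S)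
  have "partial_deriv k (\<lambda>y. w y * w y * gdet y) x = 0"
    using partial_deriv_cong_open[OF open_S x, where f = "\<lambda>y. w y * w y * gdet y" and g = "\<lambda>_. 1" and i = k] w_sq partial_deriv_const
    by (simp add: power2_eq_square)
  then have "w x * (2 * partial_deriv k w x * gdet x + w x * partial_deriv k gdet x) = 0"
    unfolding partial_deriv_mult[OF ww smooth_gdet x] partial_deriv_mult[OF smooth_w smooth_w x] by (simp add: algebra_simps)
  then have "2 * partial_deriv k w x * gdet x = - (w x * partial_deriv k gdet x)" using w_pos[OF x] by simp
  then show ?thesis using w_pos[OF x] by (simp add: field_simps)
qed

lemma second_sym:
  assumes x: "x \<in> S"
  shows "partial_deriv 2 (partial_deriv 2 a) x = partial_deriv 1 (partial_deriv 2 b) x"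
    "partial_deriv 1 (partial_deriv 1 c) x = partial_deriv 1 (partial_deriv 2 b) x"
    "partial_deriv 1 (partial_deriv 1 b) x = partial_deriv 1 (partial_deriv 2 a) x"
    "partial_deriv 2 (partial_deriv 2 b) x = partial_deriv 1 (partial_deriv 2 c) x"
proof -
  note pc = partial_deriv_cong_open[OF open_S x] and com = partial_deriv_commute[OF open_S x smooth_entry]
  show "partial_deriv 2 (partial_deriv 2 a) x = partial_deriv 1 (partial_deriv 2 b) x"
    using pc[OF cubic_symmetric(1), where i = 2] com[where i = 2 and j = 1] by simp
  show "partial_deriv 1 (partial_deriv 1 c) x = partial_deriv 1 (partial_deriv 2 b) x"
    using pc[OF cubic_symmetric(2), where i = 1] by simp
  show "partial_deriv 1 (partial_deriv 1 b) x = partial_deriv 1 (partial_deriv 2 a) x"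
    using pc[OF cubic_symmetric(1), where i = 1] by simp
  show "partial_deriv 2 (partial_deriv 2 b) x = partial_deriv 1 (partial_deriv 2 c) x"
    using pc[OF cubic_symmetric(2), where i = 2] com[where i = 2 and j = 1] by simp
qed

text \<open>The curvature splits as W (L / 4 + Q / D) - W (O2 + L) / 2 + W L / 4. The first summand
  is nonnegative by \<open>hessian_curvature_algebra\<close>, the second by superharmonicity, and
  the third is the claimed bound. Derivatives of \<open>w\<close> are divided by \<open>w\<close>,
  which makes every term a power of W times an expression in g.\<close>

lemma gcurv_lower:
  assumes x: "x \<in> S" and lap: "lap ha hb hc w x \<le> 0"
  shows "(hc x * (partial_deriv 1 w x)\<^sup>2 - 2 * hb x * (partial_deriv 1 w x * partial_deriv 2 w x) + ha x * (partial_deriv 2 w x)\<^sup>2) / (4 * (w x)\<^sup>2)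
    \<le> gcurv ha hb hc x"
proof -
  define W where "W = w x"
  have W: "W > 0" using w_pos[OF x] by (simp add: W_def)
  define l where "l k = partial_deriv k w x / W" for k :: 2
  define o2 where "o2 i j = partial_deriv i (partial_deriv j w) x / W" for i j :: 2
  have wk: "partial_deriv k w x = W * l k" for k using W by (simp add: l_def)
  have wkl: "partial_deriv i (partial_deriv j w) x = W * o2 i j" for i j using W by (simp add: o2_def)
  have d1: "partial_deriv k (\<lambda>x. f x * w x) x = W * (partial_deriv k f x + l k * f x)" if "smooth_on S f" for f k
    unfolding partial_deriv_mult[OF that smooth_w x] wk W_def[symmetric] by (simp add: algebra_simps)
  have d2: "partial_deriv i (partial_deriv j (\<lambda>x. f x * w x)) x
      = W * (partial_deriv i (partial_deriv j f) x + partial_deriv j f x * l i + partial_deriv i f x * l j + f x * o2 i j)" if "smooth_on S f" for f i j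
    unfolding partial_deriv_mult2[OF open_S that smooth_w x] wk wkl W_def[symmetric] by (simp add: algebra_simps)
  define A B C D where "A = a x" and "B = b x" and "C = c x" and "D = gdet x"
  define p q r s where "p = partial_deriv 1 a x" and "q = partial_deriv 2 a x" and "r = partial_deriv 2 b x" and "s = partial_deriv 2 c x"
  have qr: "partial_deriv 1 b x = q" "partial_deriv 1 c x = r" using cubic_symmetric[OF x] by (simp_all add: q_def r_def)
  note fold1 = A_def[symmetric] B_def[symmetric] C_def[symmetric] p_def[symmetric] q_def[symmetric] r_def[symmetric] s_def[symmetric] W_def[symmetric]
  have D: "D = A * C - B\<^sup>2" "D > 0" "W\<^sup>2 * D = 1" using gdet_pos[OF x] w_sq[OF x] by (simp_all add: D_def A_def B_def C_def W_def)
  have l12: "2 * D * l 1 = - (p * C + A * r - 2 * B * q)" "2 * D * l 2 = - (q * C + A * s - 2 * B * r)"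
    using w_deriv[OF x, of 1] w_deriv[OF x, of 2] unfolding gdet_deriv[OF x] qr fold1 l_def D_def by (simp_all add: A_def B_def C_def)
  define L where "L = C * (l 1)\<^sup>2 - 2 * B * (l 1 * l 2) + A * (l 2)\<^sup>2"
  define O2 where "O2 = C * o2 1 1 - 2 * B * o2 1 2 + A * o2 2 2"
  define Q where "Q = cofq A B C ((q + l 2 * A) / 2) ((r + l 1 * C) / 2) ((q + l 2 * A) / 2) ((r + l 1 * C) / 2)
      - cofq A B C ((p + l 1 * A) / 2) (q + l 1 * B - (q + l 2 * A) / 2) (r + l 2 * B - (r + l 1 * C) / 2) ((s + l 2 * C) / 2)"
  have key: "0 \<le> L / 4 + Q / D"
    unfolding L_def Q_def by (rule hessian_curvature_algebra[OF _ D(1,2) l12]) (use a_pos[OF x] in \<open>simp add: A_def\<close>)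
  \<comment> \<open>By total symmetry the cofactor matrix of g has divergence zero, so the first
    order terms stem from the conformal factor alone and sum up to \<open>L\<close>.\<close>
  have "lap ha hb hc w x = W\<^sup>2 * (O2 + L)"
    unfolding lap_def d1[OF smooth_entry] wk wkl qr fold1 O2_def L_def by (simp add: power2_eq_square algebra_simps)
  then have OL: "O2 + L \<le> 0" using lap W by (simp add: mult_le_0_iff)
  have cof: "cofq (A * W) (B * W) (C * W) (W * x1 / 2) (W * x2 / 2) (W * x3 / 2) (W * x4 / 2) = W ^ 3 * cofq A B C (x1 / 2) (x2 / 2) (x3 / 2) (x4 / 2)"
    "cofq (A * W) (B * W) (C * W) (W * x1 / 2) (W * y1 - W * x2 / 2) (W * y2 - W * x3 / 2) (W * x4 / 2)
      = W ^ 3 * cofq A B C (x1 / 2) (y1 - x2 / 2) (y2 - x3 / 2) (x4 / 2)" for x1 x2 x3 x4 y1 y2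
    unfolding cofq_def by (simp_all add: power3_eq_cube algebra_simps)
  have "gcurv ha hb hc x = - W * O2 / 2 + W ^ 3 * Q"
    unfolding gcurv_def d1[OF smooth_entry] d2[OF smooth_entry] second_sym(1,2)[OF x] qr fold1 cof
    unfolding Q_def O2_def by (simp add: field_simps)
  also have "W ^ 3 * Q = W * (Q / D)"
  proof -
    have "W ^ 3 * Q * D = W * Q * (W\<^sup>2 * D)" by (simp add: power2_eq_square power3_eq_cube)
    then have "W ^ 3 * Q * D = W * Q" unfolding D(3) by simp
    then show ?thesis using D(2) by (simp add: eq_divide_eq)
  qed
  also have "- W * O2 / 2 + W * (Q / D) = W * (L / 4 + Q / D) - W * (O2 + L) / 2 + W * L / 4"
  proof -
    have "- W * O2 / 2 + W * y = W * (L / 4 + y) - W * (O2 + L) / 2 + W * L / 4" for y by (simp add: field_simps)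
    then show ?thesis .
  qed
  finally have "gcurv ha hb hc x = W * (L / 4 + Q / D) - W * (O2 + L) / 2 + W * L / 4" .
  moreover have "0 \<le> W * (L / 4 + Q / D)" using key W by simp
  moreover have "W * (O2 + L) \<le> 0" using OL W by (simp add: mult_le_0_iff)
  ultimately have "W * L / 4 \<le> gcurv ha hb hc x" by linarith
  moreover have "(hc x * (partial_deriv 1 w x)\<^sup>2 - 2 * hb x * (partial_deriv 1 w x * partial_deriv 2 w x) + ha x * (partial_deriv 2 w x)\<^sup>2) / (4 * (w x)\<^sup>2) = W * L / 4"
    unfolding wk fold1 L_def using W by (simp add: power2_eq_square field_simps)
  ultimately show ?thesis by (simp only:)
qed

text \<open>Cauchy-Schwarz for the covector dw and the vector \<open>v\<close>, from an identity in
  which determinant one leaves the square of their pairing plus another square. This is the form of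
  the bound that is needed along the velocity of a geodesic.\<close>

lemma conformal_curvature_bound:
  assumes x: "x \<in> S" and lap: "lap ha hb hc w x \<le> 0"
  shows "(grd w x \<bullet> v)\<^sup>2 / (4 * (w x)\<^sup>2) \<le> gcurv ha hb hc x * (2 * quad ha hb hc x v)"
proof -
  define A B C u1 u2 where "A = ha x" and "B = hb x" and "C = hc x" and "u1 = partial_deriv 1 w x" and "u2 = partial_deriv 2 w x"
  have det: "A * C - B * B = 1" using det_h[OF x] by (simp add: A_def B_def C_def power2_eq_square)
  have gv: "grd w x \<bullet> v = u1 * v $ 1 + u2 * v $ 2" by (simp add: grd_def u1_def u2_def)
  have id: "(C * u1\<^sup>2 - 2 * B * (u1 * u2) + A * u2\<^sup>2) * (A * (v $ 1)\<^sup>2 + 2 * B * (v $ 1 * v $ 2) + C * (v $ 2)\<^sup>2)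
      = (A * C - B * B) * (u1 * v $ 1 + u2 * v $ 2)\<^sup>2 + (u1 * (B * v $ 1 + C * v $ 2) - u2 * (A * v $ 1 + B * v $ 2))\<^sup>2"
    by (simp add: power2_eq_square algebra_simps)
  have q2: "2 * quad ha hb hc x v = A * (v $ 1)\<^sup>2 + 2 * B * (v $ 1 * v $ 2) + C * (v $ 2)\<^sup>2"
    unfolding A_def B_def C_def quad_def by simp
  have cs: "(u1 * v $ 1 + u2 * v $ 2)\<^sup>2 \<le> (C * u1\<^sup>2 - 2 * B * (u1 * u2) + A * u2\<^sup>2) * (2 * quad ha hb hc x v)"
    unfolding q2 id det by simp
  have "quad ha hb hc x v = w x * quad a b c x v" by (simp add: quad_def field_simps)
  moreover have "0 \<le> quad a b c x v" using quad_pos[OF x, of v] by (cases "v = 0") (auto simp: quad_def)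
  ultimately have "0 \<le> 2 * quad ha hb hc x v" using w_pos[OF x] by simp
  then have "(C * u1\<^sup>2 - 2 * B * (u1 * u2) + A * u2\<^sup>2) / (4 * (w x)\<^sup>2) * (2 * quad ha hb hc x v) \<le> gcurv ha hb hc x * (2 * quad ha hb hc x v)"
    using gcurv_lower[OF x lap] unfolding A_def B_def C_def u1_def u2_def by (intro mult_right_mono)
  moreover have "(u1 * v $ 1 + u2 * v $ 2)\<^sup>2 / (4 * (w x)\<^sup>2) \<le> (C * u1\<^sup>2 - 2 * B * (u1 * u2) + A * u2\<^sup>2) / (4 * (w x)\<^sup>2) * (2 * quad ha hb hc x v)"
    using divide_right_mono[OF cs, of "4 * (w x)\<^sup>2"] by simp
  ultimately show ?thesis unfolding gv by linarith
qed

end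

section \<open>Rigidity\<close>

locale flat_candidate = hessian_metric +
  assumes convex_S: "convex S" and complete: "geodesically_complete S g"
    and superharmonic: "\<And>x. x \<in> S \<Longrightarrow> laplace_beltrami g (\<lambda>y. sqrt (gram_det g y)) x \<le> 0"
begin

lemma lap_w:
  assumes x: "x \<in> S"
  shows "lap ha hb hc w x \<le> 0"
proof -
  have "w x * lap ha hb hc w x \<le> 0"
    using superharmonic[OF x] laplace_beltrami_lap[where F = "\<lambda>y. sqrt (gram_det g y)", OF x smooth_w gram_det_eq] by simp
  moreover have "0 < w x * lap ha hb hc w x" if "0 < lap ha hb hc w x" by (rule mult_pos_pos[OF w_pos[OF x] that])
  ultimately show ?thesis by linarith
qed

lemma proper_h: "p \<in> S \<Longrightarrow> proper_from S ha hb hc p"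
proof (rule proper_from_conformal[OF open_S smooth_h smooth_w h_pos det_h w_pos conformal_curvature_bound[OF _ lap_w]])
  fix p assume p: "p \<in> S"
  show "proper_from S (\<lambda>x. ha x / w x) (\<lambda>x. hb x / w x) (\<lambda>x. hc x / w x) p"
  proof (rule proper_from_cong[OF complete_imp_proper[OF complete p]])
    fix x assume "x \<in> S"
    then have "w x \<noteq> 0" using w_pos[of x] by simp
    then show "a x = ha x / w x \<and> b x = hb x / w x \<and> c x = hc x / w x" by simp
  qed
qed

text \<open>\<open>superharmonic_le\<close> with the two points in both orders; the nonnegative
  curvature it asks for is \<open>conformal_curvature_bound\<close> tested on one vector.\<close>

lemma superharmonic_const:
  assumes f: "smooth_on S f" "\<And>x. x \<in> S \<Longrightarrow> f x > 0" "\<And>x. x \<in> S \<Longrightarrow> lap ha hb hc f x \<le> 0"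
    and "p \<in> S" "q \<in> S"
  shows "f p = f q"
proof -
  have curv: "gcurv ha hb hc x \<ge> 0" if x: "x \<in> S" for x
  proof -
    let ?e = "V2 1 0"
    have "0 \<le> gcurv ha hb hc x * (2 * quad ha hb hc x ?e)"
      using conformal_curvature_bound[OF x lap_w[OF x], of ?e] by (rule order_trans[rotated]) simp
    moreover have "2 * quad ha hb hc x ?e > 0" using h_pos[OF x] by (simp add: quad_def)
    moreover have "gcurv ha hb hc x * (2 * quad ha hb hc x ?e) < 0" if "gcurv ha hb hc x < 0"
      by (rule mult_neg_pos[OF that \<open>2 * quad ha hb hc x ?e > 0\<close>])
    ultimately show ?thesis by linarith
  qed
  note le = superharmonic_le[OF open_S convex_S smooth_h h_pos det_h proper_h curv f]
  show ?thesis by (rule antisym[OF le le]) (use assms in auto)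
qed

lemma deriv_const_0:
  assumes "\<And>p q. p \<in> S \<Longrightarrow> q \<in> S \<Longrightarrow> f p = f q" "x \<in> S"
  shows "partial_deriv i f x = 0"
proof -
  have "partial_deriv i f x = partial_deriv i (\<lambda>_. f x) x"
    by (rule partial_deriv_cong_open[OF open_S assms(2)]) (rule assms(1)[OF _ assms(2)])
  then show ?thesis by (simp only: partial_deriv_const)
qed

lemma deriv2_const_0:
  assumes "\<And>p q. p \<in> S \<Longrightarrow> q \<in> S \<Longrightarrow> f p = f q" "x \<in> S"
  shows "partial_deriv i (partial_deriv j f) x = 0"
proof (rule deriv_const_0[OF _ assms(2)])
  fix p q assume pq: "p \<in> S" "q \<in> S"
  show "partial_deriv j f p = partial_deriv j f q" by (simp only: deriv_const_0[OF assms(1) pq(1)] deriv_const_0[OF assms(1) pq(2)])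
qed

lemma w_const: "p \<in> S \<Longrightarrow> q \<in> S \<Longrightarrow> w p = w q"
  using superharmonic_const[OF smooth_w w_pos lap_w] .

lemma gdet_const:
  assumes "p \<in> S" "q \<in> S"
  shows "gdet p = gdet q"
proof -
  have "(w p)\<^sup>2 * gdet p = (w p)\<^sup>2 * gdet q"
    using w_sq[OF assms(1)] w_sq[OF assms(2)] w_const[OF assms(2,1)] by simp
  then show ?thesis using w_pos[OF assms(1)] by simp
qed

text \<open>The condition \<open>eq\<close> reads u \<Delta>u = 2 |du|^2, which is the harmonicity
  of 1 / u. There are no first order terms, because \<open>w\<close> is constant and the cofactor
  matrix of a Hessian metric has divergence zero. The derivatives of 1 / u are found by
  differentiating u (1 / u) = 1 twice.\<close>

lemma lap_inverse:
  assumes x: "x \<in> S" and u: "smooth_on S u" "\<And>x. x \<in> S \<Longrightarrow> u x > 0"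
    and eq: "u x * (c x * partial_deriv 1 (partial_deriv 1 u) x - 2 * b x * partial_deriv 1 (partial_deriv 2 u) x + a x * partial_deriv 2 (partial_deriv 2 u) x)
      = 2 * (c x * (partial_deriv 1 u x)\<^sup>2 - 2 * b x * (partial_deriv 1 u x * partial_deriv 2 u x) + a x * (partial_deriv 2 u x)\<^sup>2)"
  shows "lap ha hb hc (\<lambda>x. 1 / u x) x = 0"
proof -
  define f where "f x = 1 / u x" for x
  have nz: "u x \<noteq> 0" if "x \<in> S" for x using u(2)[OF that] by simp
  have sf: "smooth_on S f" unfolding f_def[abs_def] by (intro smooth_on_divide smooth_on_const u open_S nz)
  have uf: "u p * f p = 1" if "p \<in> S" for p using nz[OF that] by (simp add: f_def)
  have c1: "u p * f p = u q * f q" if "p \<in> S" "q \<in> S" for p q using uf that by simp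
  have dw: "partial_deriv i w x = 0" for i by (rule deriv_const_0[where f = w, OF w_const x])
  have dh: "partial_deriv i (\<lambda>x. v x * w x) x = partial_deriv i v x * w x" if "smooth_on S v" for i v
    unfolding partial_deriv_mult[OF that smooth_w x] dw by simp
  define U F where "U = u x" and "F = f x"
  have UF: "U * F = 1" using uf[OF x] by (simp add: U_def F_def)
  define u1 u2 f1 f2 where "u1 = partial_deriv 1 u x" and "u2 = partial_deriv 2 u x" and "f1 = partial_deriv 1 f x" and "f2 = partial_deriv 2 f x"
  define u11 u12 u22 where "u11 = partial_deriv 1 (partial_deriv 1 u) x" and "u12 = partial_deriv 1 (partial_deriv 2 u) x" and "u22 = partial_deriv 2 (partial_deriv 2 u) x"
  define f11 f12 f22 where "f11 = partial_deriv 1 (partial_deriv 1 f) x" and "f12 = partial_deriv 1 (partial_deriv 2 f) x" and "f22 = partial_deriv 2 (partial_deriv 2 f) x"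
  note defs = U_def F_def u1_def u2_def f1_def f2_def u11_def u12_def u22_def f11_def f12_def f22_def
  have d1: "u1 * F + U * f1 = 0" "u2 * F + U * f2 = 0"
    using deriv_const_0[where f = "\<lambda>p. u p * f p", OF c1 x] unfolding partial_deriv_mult[OF u(1) sf x] defs by blast+
  have d2: "u11 * F + u1 * f1 + u1 * f1 + U * f11 = 0" "u12 * F + u2 * f1 + u1 * f2 + U * f12 = 0" "u22 * F + u2 * f2 + u2 * f2 + U * f22 = 0"
    using deriv2_const_0[where f = "\<lambda>p. u p * f p", OF c1 x] unfolding partial_deriv_mult2[OF open_S u(1) sf x] defs by blast+
  have alg: "C * f11 - 2 * B * f12 + A * f22 = 0"
    if "U * (C * u11 - 2 * B * u12 + A * u22) = 2 * (C * u1\<^sup>2 - 2 * B * (u1 * u2) + A * u2\<^sup>2)" for A B C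
  proof -
    have e: "f1 = - (u1 * F * F)" "f2 = - (u2 * F * F)" using d1 UF by algebra+
    have "f11 = F * (2 * u1 * u1 * F * F - u11 * F)" "f12 = F * (2 * u1 * u2 * F * F - u12 * F)" "f22 = F * (2 * u2 * u2 * F * F - u22 * F)"
      using d2 UF e by algebra+
    then have "C * f11 - 2 * B * f12 + A * f22 = F ^ 3 * (2 * (C * u1\<^sup>2 - 2 * B * (u1 * u2) + A * u2\<^sup>2) - U * (C * u11 - 2 * B * u12 + A * u22))"
      using UF by algebra
    then show ?thesis using that by simp
  qed
  have "lap ha hb hc f x = w x * (c x * f11 - 2 * b x * f12 + a x * f22)"
    unfolding lap_def dh[OF smooth_entry] cubic_symmetric[OF x] f11_def f12_def f22_def by (simp add: algebra_simps)
  also have "c x * f11 - 2 * b x * f12 + a x * f22 = 0"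
    by (rule alg) (use eq in \<open>simp add: defs\<close>)
  finally show ?thesis by (simp add: f_def[abs_def])
qed

lemma gdet_deriv2:
  assumes x: "x \<in> S"
  shows "partial_deriv i (partial_deriv i a) x * c x + 2 * partial_deriv i a x * partial_deriv i c x + a x * partial_deriv i (partial_deriv i c) x
     - 2 * (partial_deriv i b x)\<^sup>2 - 2 * b x * partial_deriv i (partial_deriv i b) x = 0"
proof -
  note se = smooth_entry and pd = smooth_on_partial_deriv and sm = smooth_on_mult[OF open_S]
  have "partial_deriv i gdet y = partial_deriv i (\<lambda>y. a y * c y) y - partial_deriv i (\<lambda>y. b y * b y) y" if "y \<in> S" for y
    using partial_deriv_diff[OF sm[OF se se] sm[OF se se] that] by (simp add: power2_eq_square)
  then have "partial_deriv i (\<lambda>y. partial_deriv i (\<lambda>y. a y * c y) y - partial_deriv i (\<lambda>y. b y * b y) y) x = 0"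
    using deriv2_const_0[where f = gdet and i = i and j = i, OF gdet_const x] partial_deriv_cong_open[OF open_S x, where f = "partial_deriv i gdet" and i = i] by simp
  then show ?thesis
    unfolding partial_deriv_diff[OF pd[OF sm[OF se se]] pd[OF sm[OF se se]] x] partial_deriv_mult2[OF open_S se se x]
    by (simp add: power2_eq_square algebra_simps)
qed

text \<open>With constant determinant D, the metric g is 1 / a times (a dx1 + b dx2)^2 + D dx2^2,
  and a dx1 + b dx2 is closed by symmetry, locally du. So u and a multiple of x2 are isothermal
  coordinates. The function x1 is harmonic, hence so is its derivative with respect to u, which is 1
  / a. For 1 / c the coordinates are exchanged. The proof verifies the resulting differential
  identities directly.\<close>

lemma entries_deriv_0:
  assumes x: "x \<in> S"
  shows "partial_deriv i (\<lambda>y. g y $ j $ k) x = 0"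
proof -
  have cpos: "c x > 0" if "x \<in> S" for x
    using quad_lower(1)[where a = a and b = b and c = c, OF a_pos[OF that] gdet_pos[OF that]] .
  have D1: "partial_deriv 1 a x * c x + a x * partial_deriv 1 c x - 2 * b x * partial_deriv 1 b x = 0"
    "partial_deriv 2 a x * c x + a x * partial_deriv 2 c x - 2 * b x * partial_deriv 2 b x = 0" if "x \<in> S" for x
    using deriv_const_0[where f = gdet, OF gdet_const that] gdet_deriv[OF that] by simp_all
  have inv: "u p = u q" if u: "smooth_on S u" "\<And>x. x \<in> S \<Longrightarrow> u x > 0" and
    eq: "\<And>x. x \<in> S \<Longrightarrow> u x * (c x * partial_deriv 1 (partial_deriv 1 u) x - 2 * b x * partial_deriv 1 (partial_deriv 2 u) x + a x * partial_deriv 2 (partial_deriv 2 u) x)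
      = 2 * (c x * (partial_deriv 1 u x)\<^sup>2 - 2 * b x * (partial_deriv 1 u x * partial_deriv 2 u x) + a x * (partial_deriv 2 u x)\<^sup>2)"
    and pq: "p \<in> S" "q \<in> S" for u p q
  proof -
    have nz: "u x \<noteq> 0" if "x \<in> S" for x using u(2)[OF that] by simp
    have "1 / u p = 1 / u q"
    proof (rule superharmonic_const[OF _ _ _ pq])
      show "smooth_on S (\<lambda>x. 1 / u x)" by (intro smooth_on_divide smooth_on_const u open_S nz)
      show "lap ha hb hc (\<lambda>x. 1 / u x) x \<le> 0" if "x \<in> S" for x using lap_inverse[OF that u eq[OF that]] by simp
    qed (use u in simp)
    then show ?thesis by simp
  qed
  have ca: "a p = a q" if "p \<in> S" "q \<in> S" for p q
  proof (rule inv[OF smooth_entry a_pos _ that])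
    fix x assume x: "x \<in> S"
    note s = second_sym[OF x] cubic_symmetric[OF x]
    \<comment> \<open>The quadratic terms come from differentiating det g = const twice in direction
      1; the symmetries turn the second derivatives of \<open>b\<close> and \<open>c\<close> into
      those of \<open>a\<close>.\<close>
    show "a x * (c x * partial_deriv 1 (partial_deriv 1 a) x - 2 * b x * partial_deriv 1 (partial_deriv 2 a) x + a x * partial_deriv 2 (partial_deriv 2 a) x)
      = 2 * (c x * (partial_deriv 1 a x)\<^sup>2 - 2 * b x * (partial_deriv 1 a x * partial_deriv 2 a x) + a x * (partial_deriv 2 a x)\<^sup>2)"
      using gdet_deriv2[OF x, of 1] D1[OF x] unfolding s by algebra
  qed
  have cc: "c p = c q" if "p \<in> S" "q \<in> S" for p q
  proof (rule inv[OF smooth_entry cpos _ that])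
    fix x assume x: "x \<in> S"
    note s = second_sym[OF x] cubic_symmetric[OF x]
    show "c x * (c x * partial_deriv 1 (partial_deriv 1 c) x - 2 * b x * partial_deriv 1 (partial_deriv 2 c) x + a x * partial_deriv 2 (partial_deriv 2 c) x)
      = 2 * (c x * (partial_deriv 1 c x)\<^sup>2 - 2 * b x * (partial_deriv 1 c x * partial_deriv 2 c x) + a x * (partial_deriv 2 c x)\<^sup>2)"
      using gdet_deriv2[OF x, of 2] D1[OF x] unfolding s by algebra
  qed
  have ac: "partial_deriv i a x = 0" "partial_deriv i c x = 0" for i
    by (rule deriv_const_0[where f = a, OF ca x], assumption, assumption, rule deriv_const_0[where f = c, OF cc x])
  then have b: "partial_deriv i b x = 0" for i using cubic_symmetric[OF x] exhaust_2[of i] by auto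
  moreover have "partial_deriv i (\<lambda>y. g y $ 2 $ 1) x = 0" for i
    using partial_deriv_cong_open[OF open_S x g_sym, where i = i] b by simp
  ultimately show ?thesis using ac exhaust_2[of j] exhaust_2[of k] by auto
qed

lemma flat: "flat_on S g"
proof -
  have chr: "christoffel g k i j x = 0" if "x \<in> S" for k i j x
    using entries_deriv_0[OF that] by (simp add: christoffel_def)
  then have "partial_deriv m (christoffel g k i j) x = 0" if "x \<in> S" for m k i j x
    using partial_deriv_cong_open[OF open_S that, where f = "christoffel g k i j" and g = "\<lambda>_. 0" and i = m] partial_deriv_const by simp
  then show ?thesis using chr by (simp add: flat_on_def riemann_curvature_def)
qed

end

theorem theorem1p1:
  fixes \<Sigma> :: "(real^2) set" and g :: "real^2 \<Rightarrow> real^2^2"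
  assumes "open \<Sigma>" and "\<Sigma> \<noteq> {}" and "convex \<Sigma>"
    and "riemannian_metric_on \<Sigma> g"
    and "geodesically_complete \<Sigma> g"
    and "boundary_at_most_one_component \<Sigma>"
    and "unit_gradients_smooth \<Sigma> g"
    and "gradients_span_and_commute \<Sigma> g"
    and "\<forall>x\<in>\<Sigma>. laplace_beltrami g (\<lambda>y. sqrt (gram_det g y)) x \<le> 0"
  shows "flat_on \<Sigma> g"
proof -
  interpret flat_candidate \<Sigma> g by unfold_locales (use assms in auto)
  show ?thesis by (rule flat)
qed

end
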